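(* Let $\mathcal C$ be a join restriction category with local glueings. For each object $P\colon\mathcal A\to\mathcal C$ of $\mathrm{rCat}/\!/\mathcal C$, the map $(\eta_P,1)\colon(\mathcal A,P)\to\Phi(\Psi P)$ of $\mathrm{rCat}/\!/\mathcal C$ exhibits $\Psi P$ as the value at $P$ of a left adjoint to the functor $\Phi\colon\mathrm{pCat}_c(\mathcal C)\to\mathrm{rCat}/\!/\mathcal C$; that is, for every partite internal category $\mathbb B$ in $\mathcal C$ and every map $(G,\gamma)\colon(\mathcal A,P)\to\Phi(\mathbb B)$ there is a unique partite cofunctor $F\colon\Psi P\rightsquigarrow\mathbb B$ with $\Phi(F)\circ(\eta_P,1)=(G,\gamma)$. This yields an adjunction $\Psi\dashv\Phi\colon\mathrm{pCat}_c(\mathcal C)\to\mathrm{rCat}/\!/\mathcal C$.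
   Context: RESTRICTION CATEGORIES. A restriction category is a category with an operation assigning to each $f\colon A\to B$ a map $\bar f\colon A\to A$ such that $f\bar f=f$; $\bar f\bar g=\bar g\bar f$ and $\overline{g\bar f}=\bar g\bar f$ for $f\colon A\to B$, $g\colon A\to C$; and $\bar g f=f\,\overline{gf}$ for $f\colon A\to B$, $g\colon B\to C$. $\mathcal O(A)$ is the set of restriction idempotents on $A$ (maps $e\colon A\to A$ with $\bar e=e$). A map $f$ is total if $\bar f=1$. For parallel maps, $f\leqslant g$ iff $f=g\bar f$, and $f\smile g$ (compatible) iff $f\bar g=g\bar f$. A restriction functor satisfies $F\bar f=\overline{Ff}$. A join restriction category is a restriction category in which every pairwise-compatible family of parallel maps has a join for $\leqslant$, and these joins are preserved by precomposition. A partial isomorphism is a map $s\colon A\to B$ with a (necessarily unique) partial inverse $s^*\colon B\to A$: $s^*s=\bar s$, $ss^*=\overline{s^*}$. A local homeomorphism is a total map which is a join of partial isomorphisms. A local atlas on $X$ is a set $I$ and a family $\varphi_{ij}\in\mathcal O(X)$ ($i,j\in I$) with $\varphi_{ij}=\varphi_{ji}$ and $\varphi_{jk}\varphi_{ij}\leqslant\varphi_{ik}$. A glueing of $\varphi$ is a local homeomorphism $p=\bigvee_i p_i\colon A\to X$, with each $p_i$ a partial isomorphism with partial inverse $s_i$, such that $\varphi_{ij}=p_js_i$. $\mathcal C$ has local glueings if every local atlas on every object has a glueing. A partial section of a total map $p\colon A\to X$ is a map $s\colon X\to A$ with $ps=\bar s$. PARTITE INTERNAL CATEGORIES. For a set $I$,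 an $I$-partite internal category $\mathbb A$ in $\mathcal C$ comprises objects $A_i$; objects $A_{ij}$ with total maps $\sigma_{ij}\colon A_{ij}\to A_i$, $\tau_{ij}\colon A_{ij}\to A_j$, where $\sigma_{ij}$ admits pullbacks along all total maps; maps $\eta_i\colon A_i\to A_{ii}$ with $\sigma_{ii}\eta_i=1=\tau_{ii}\eta_i$; and maps $\mu_{ijk}\colon A_{jk}\times_{A_j}A_{ij}\to A_{ik}$ (domain the pullback of $\sigma_{jk}$ along $\tau_{ij}$) with $\sigma_{ik}\mu_{ijk}=\sigma_{ij}\pi_2$, $\tau_{ik}\mu_{ijk}=\tau_{jk}\pi_1$, satisfying $\mu_{iij}(1,\eta_i\sigma_{ij})=1=\mu_{ijj}(\eta_j\tau_{ij},1)$ and $\mu_{ik\ell}(1\times\mu_{ijk})=\mu_{ij\ell}(\mu_{jk\ell}\times 1)$. A partite cofunctor $F\colon\mathbb A\rightsquigarrow\mathbb B$ from an $I$-partite to a $J$-partite internal category comprises a function $I\to J$, $i\mapsto Fi$; total maps $F_i\colon B_{Fi}\to A_i$; and total maps $F_{ij}\colon A_{ij}\times_{A_i}B_{Fi}\to B_{Fi,Fj}$ (domain the pullback of $\sigma_{ij}$ along $F_i$) with $\sigma_{Fi,Fj}F_{ij}=\pi_2$, $F_j\tau_{Fi,Fj}F_{ij}=\tau_{ij}\pi_1$, $F_{ii}(\eta_iF_i,1)=\eta_{Fi}$, and $F_{ik}(\mu_{ijk}\times1)=\mu_{Fi,Fj,Fk}(F_{jk}\times1)(1\times F_{ij})$ on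 $A_{jk}\times_{A_j}A_{ij}\times_{A_i}B_{Fi}$ (using $A_{jk}\times_{A_j}B_{Fi,Fj}\cong(A_{jk}\times_{A_j}B_{Fj})\times_{B_{Fj}}B_{Fi,Fj}$). Composition: $(GF)i=G(Fi)$, $(GF)_i=F_iG_{Fi}$, $(GF)_{ij}=G_{Fi,Fj}(F_{ij}\times1)$ up to the canonical isomorphism of pullbacks. $\mathrm{pCat}_c(\mathcal C)$ is the resulting category of partite internal categories and partite cofunctors. CATEGORIES OVER $\mathcal C$. $\mathrm{rCat}/\!/\mathcal C$ has as objects pairs $(\mathcal A,P)$ of a restriction category and a restriction functor $P\colon\mathcal A\to\mathcal C$; a map $(F,\alpha)\colon(\mathcal A,P)\to(\mathcal B,Q)$ is a restriction functor $F\colon\mathcal A\to\mathcal B$ and a natural transformation $\alpha\colon QF\Rightarrow P$ with total components; $(G,\beta)(F,\alpha)=(GF,\alpha\circ\beta F)$. THE FUNCTOR $\Phi$. $\Phi(\mathbb A)=(\Phi\mathbb A,\pi_{\mathbb A})$: $\Phi\mathbb A$ has object-set $I$; $\Phi\mathbb A(i,j)$ is the set of partial sections of $\sigma_{ij}$; identities are $\eta_i$; the composite of $s\in\Phi\mathbb A(i,j)$, $t\in\Phi\mathbb A(j,k)$ is $\mu_{ijk}\circ\tau_{ij}^*(t)\circ s$ where $\tau_{ij}^*(t)=(t\tau_{ij},\overline{t\tau_{ij}})\colon A_{ij}\to A_{jk}\times_{A_j}A_{ij}$; the restriction of $s$ is $\eta_i\bar s$; $\pi_{\mathbb A}(i)=A_i$,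 $\pi_{\mathbb A}(s)=\tau_{ij}s$. For a cofunctor $F$, $\Phi(F)=(\Phi F,\varpi^F)$ with $\Phi F(i)=Fi$, $\Phi F(s)=F_{ij}\circ(sF_i,\overline{sF_i})$, $\varpi^F_i=F_i$. THE OBJECT $\Psi P$ AND THE MAP $\eta_P$. Given $(\mathcal A,P)$ and $f,g\in\mathcal A(i,j)$ put $[\![f=_Pg]\!]=\bigvee\{Pe: e\in\mathcal O(i),\ e\leqslant\bar f\bar g,\ fe=ge\}\in\mathcal O(Pi)$. $\Psi P$ is the $\mathrm{ob}(\mathcal A)$-partite internal category with objects $Pi$; $\sigma_{ij}\colon\Psi P_{ij}\to Pi$ a glueing of the local atlas $([\![f=_Pg]\!])_{f,g\in\mathcal A(i,j)}$, with associated partial sections $s_f$; $\tau_{ij}$ the unique map with $\tau_{ij}s_f=Pf$ for all $f$; $\eta_i=s_{1_i}$; $\mu_{ijk}$ the unique map with $\mu_{ijk}\tau_{ij}^*(s_g)s_f=s_{gf}$ for all $f\in\mathcal A(i,j)$, $g\in\mathcal A(j,k)$. The restriction functor $\eta_P\colon\mathcal A\to\Phi(\Psi P)$ is the identity on objects and sends $f$ to $s_f$; it satisfies $\pi_{\Psi P}\eta_P=P$. *)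

theory Defs
  imports "HOL-Library.FuncSet" "HOL-Library.Equipollence"
begin

section \<open>Categories, functors, adjunctions\<close>

record ('o, 'm) category =
  Ob :: "'o set"
  Arr :: "'m set"
  Dom :: "'m \<Rightarrow> 'o"
  Cod :: "'m \<Rightarrow> 'o"
  Ide :: "'o \<Rightarrow> 'm"
  Comp :: "'m \<Rightarrow> 'm \<Rightarrow> 'm"  (infixl "\<cdot>\<index>" 70)

definition Hom :: "('o, 'm, 'z) category_scheme \<Rightarrow> 'o \<Rightarrow> 'o \<Rightarrow> 'm set" where
  "Hom C a b = {f \<in> Arr C. Dom C f = a \<and> Cod C f = b}"

text \<open>The order of composition is the applicative one: \<open>g \<cdot> f\<close> is \<open>g\<close> after \<open>f\<close>.\<close>

locale category =
  fixes C (structure)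
  assumes dom_ob: "f \<in> Arr C \<Longrightarrow> Dom C f \<in> Ob C"
    and cod_ob: "f \<in> Arr C \<Longrightarrow> Cod C f \<in> Ob C"
    and ide_hom: "a \<in> Ob C \<Longrightarrow> Ide C a \<in> Hom C a a"
    and comp_hom: "f \<in> Hom C a b \<Longrightarrow> g \<in> Hom C b c \<Longrightarrow> g \<cdot> f \<in> Hom C a c"
    and comp_ide: "f \<in> Hom C a b \<Longrightarrow> f \<cdot> Ide C a = f"
    and ide_comp: "f \<in> Hom C a b \<Longrightarrow> Ide C b \<cdot> f = f"
    and comp_assoc: "f \<in> Hom C a b \<Longrightarrow> g \<in> Hom C b c \<Longrightarrow> h \<in> Hom C c d \<Longrightarrow>
          h \<cdot> (g \<cdot> f) = h \<cdot> g \<cdot> f"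

text \<open>Functors and the other families of maps below are required to be \<open>extensional\<close>, that is,
  \<open>undefined\<close> outside their index sets, so that HOL equality is equality of the mathematical data.\<close>

record ('a, 'b, 'c, 'd) functor_data =
  on_ob :: "'a \<Rightarrow> 'c"
  on_ar :: "'b \<Rightarrow> 'd"

definition is_functor ::
  "('a, 'b, 'x) category_scheme \<Rightarrow> ('c, 'd, 'y) category_scheme \<Rightarrow>
   ('a, 'b, 'c, 'd) functor_data \<Rightarrow> bool" where
  "is_functor A B F \<longleftrightarrow> category A \<and> category B \<and>
     on_ob F \<in> Ob A \<rightarrow>\<^sub>E Ob B \<and> on_ar F \<in> Arr A \<rightarrow>\<^sub>E Arr B \<and>
     (\<forall>a b. \<forall>f\<in>Hom A a b. on_ar F f \<in> Hom B (on_ob F a) (on_ob F b)) \<and>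
     (\<forall>a\<in>Ob A. on_ar F (Ide A a) = Ide B (on_ob F a)) \<and>
     (\<forall>a b c. \<forall>f\<in>Hom A a b. \<forall>g\<in>Hom A b c.
        on_ar F (g \<cdot>\<^bsub>A\<^esub> f) = on_ar F g \<cdot>\<^bsub>B\<^esub> on_ar F f)"

definition functor_id :: "('a, 'b, 'x) category_scheme \<Rightarrow> ('a, 'b, 'a, 'b) functor_data" where
  "functor_id A = \<lparr>on_ob = (\<lambda>a\<in>Ob A. a), on_ar = (\<lambda>f\<in>Arr A. f)\<rparr>"

definition functor_comp ::
  "('a, 'b, 'x) category_scheme \<Rightarrow> ('c, 'd, 'e, 'f) functor_data \<Rightarrow>
   ('a, 'b, 'c, 'd) functor_data \<Rightarrow> ('a, 'b, 'e, 'f) functor_data" where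
  "functor_comp A G F =
     \<lparr>on_ob = (\<lambda>a\<in>Ob A. on_ob G (on_ob F a)), on_ar = (\<lambda>f\<in>Arr A. on_ar G (on_ar F f))\<rparr>"

definition nat_trans ::
  "('a, 'b, 'x) category_scheme \<Rightarrow> ('c, 'd, 'y) category_scheme \<Rightarrow>
   ('a, 'b, 'c, 'd) functor_data \<Rightarrow> ('a, 'b, 'c, 'd) functor_data \<Rightarrow> ('a \<Rightarrow> 'd) \<Rightarrow> bool" where
  "nat_trans A B F G \<eta> \<longleftrightarrow> is_functor A B F \<and> is_functor A B G \<and> \<eta> \<in> extensional (Ob A) \<and>
     (\<forall>a\<in>Ob A. \<eta> a \<in> Hom B (on_ob F a) (on_ob G a)) \<and>
     (\<forall>a b. \<forall>f\<in>Hom A a b. on_ar G f \<cdot>\<^bsub>B\<^esub> \<eta> a = \<eta> b \<cdot>\<^bsub>B\<^esub> on_ar F f)"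

definition adjunction ::
  "('a, 'b, 'x) category_scheme \<Rightarrow> ('c, 'd, 'y) category_scheme \<Rightarrow>
   ('a, 'b, 'c, 'd) functor_data \<Rightarrow> ('c, 'd, 'a, 'b) functor_data \<Rightarrow>
   ('a \<Rightarrow> 'b) \<Rightarrow> ('c \<Rightarrow> 'd) \<Rightarrow> bool" where
  "adjunction D E L R \<eta> \<epsilon> \<longleftrightarrow> is_functor D E L \<and> is_functor E D R \<and>
     nat_trans D D (functor_id D) (functor_comp D R L) \<eta> \<and>
     nat_trans E E (functor_comp E L R) (functor_id E) \<epsilon> \<and>
     (\<forall>d\<in>Ob D. \<epsilon> (on_ob L d) \<cdot>\<^bsub>E\<^esub> on_ar L (\<eta> d) = Ide E (on_ob L d)) \<and>
     (\<forall>e\<in>Ob E. on_ar R (\<epsilon> e) \<cdot>\<^bsub>D\<^esub> \<eta> (on_ob R e) = Ide D (on_ob R e))"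


section \<open>Pullbacks\<close>

definition is_pullback ::
  "('o, 'm, 'z) category_scheme \<Rightarrow> 'm \<Rightarrow> 'm \<Rightarrow> 'm \<Rightarrow> 'm \<Rightarrow> bool" where
  "is_pullback C f g p q \<longleftrightarrow>
     f \<in> Arr C \<and> g \<in> Arr C \<and> Cod C f = Cod C g \<and>
     p \<in> Hom C (Dom C p) (Dom C f) \<and> q \<in> Hom C (Dom C p) (Dom C g) \<and>
     f \<cdot>\<^bsub>C\<^esub> p = g \<cdot>\<^bsub>C\<^esub> q \<and>
     (\<forall>Z. \<forall>u\<in>Hom C Z (Dom C f). \<forall>v\<in>Hom C Z (Dom C g). f \<cdot>\<^bsub>C\<^esub> u = g \<cdot>\<^bsub>C\<^esub> v \<longrightarrow>
        (\<exists>!w. w \<in> Hom C Z (Dom C p) \<and> p \<cdot>\<^bsub>C\<^esub> w = u \<and> q \<cdot>\<^bsub>C\<^esub> w = v))"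

text \<open>A fixed choice of pullback for each cospan that has one; \<open>pairing C f g u v\<close> is the map
  \<open>(u, v)\<close> into the chosen pullback of \<open>f\<close> along \<open>g\<close>.\<close>

definition chosen_pb :: "('o, 'm, 'z) category_scheme \<Rightarrow> 'm \<Rightarrow> 'm \<Rightarrow> 'm \<times> 'm" where
  "chosen_pb C f g = (SOME (p, q). is_pullback C f g p q)"

definition proj1 :: "('o, 'm, 'z) category_scheme \<Rightarrow> 'm \<Rightarrow> 'm \<Rightarrow> 'm" where
  "proj1 C f g = fst (chosen_pb C f g)"

definition proj2 :: "('o, 'm, 'z) category_scheme \<Rightarrow> 'm \<Rightarrow> 'm \<Rightarrow> 'm" where
  "proj2 C f g = snd (chosen_pb C f g)"

definition pb_ob :: "('o, 'm, 'z) category_scheme \<Rightarrow> 'm \<Rightarrow> 'm \<Rightarrow> 'o" where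
  "pb_ob C f g = Dom C (proj1 C f g)"

definition pairing :: "('o, 'm, 'z) category_scheme \<Rightarrow> 'm \<Rightarrow> 'm \<Rightarrow> 'm \<Rightarrow> 'm \<Rightarrow> 'm" where
  "pairing C f g u v = (THE w. w \<in> Hom C (Dom C u) (pb_ob C f g) \<and>
     proj1 C f g \<cdot>\<^bsub>C\<^esub> w = u \<and> proj2 C f g \<cdot>\<^bsub>C\<^esub> w = v)"


section \<open>Restriction categories\<close>

record ('o, 'm) rcategory = "('o, 'm) category" +
  Rst :: "'m \<Rightarrow> 'm"

locale restriction_category = category C for C :: "('o, 'm) rcategory" (structure) +
  assumes rst_hom: "f \<in> Hom C a b \<Longrightarrow> Rst C f \<in> Hom C a a"
    and comp_rst: "f \<in> Arr C \<Longrightarrow> f \<cdot> Rst C f = f"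
    and rst_commute: "f \<in> Hom C a b \<Longrightarrow> g \<in> Hom C a c \<Longrightarrow> Rst C f \<cdot> Rst C g = Rst C g \<cdot> Rst C f"
    and rst_comp_rst: "f \<in> Hom C a b \<Longrightarrow> g \<in> Hom C a c \<Longrightarrow>
          Rst C (g \<cdot> Rst C f) = Rst C g \<cdot> Rst C f"
    and rst_comp: "f \<in> Hom C a b \<Longrightarrow> g \<in> Hom C b c \<Longrightarrow> Rst C g \<cdot> f = f \<cdot> Rst C (g \<cdot> f)"

definition rst_idems :: "('o, 'm) rcategory \<Rightarrow> 'o \<Rightarrow> 'm set" where
  "rst_idems C a = {e \<in> Hom C a a. Rst C e = e}"

definition total :: "('o, 'm) rcategory \<Rightarrow> 'm \<Rightarrow> bool" where
  "total C f \<longleftrightarrow> Rst C f = Ide C (Dom C f)"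

definition rle :: "('o, 'm) rcategory \<Rightarrow> 'm \<Rightarrow> 'm \<Rightarrow> bool" where
  "rle C f g \<longleftrightarrow> f = g \<cdot>\<^bsub>C\<^esub> Rst C f"

definition compatible :: "('o, 'm) rcategory \<Rightarrow> 'm \<Rightarrow> 'm \<Rightarrow> bool" where
  "compatible C f g \<longleftrightarrow> f \<cdot>\<^bsub>C\<^esub> Rst C g = g \<cdot>\<^bsub>C\<^esub> Rst C f"

definition is_join :: "('o, 'm) rcategory \<Rightarrow> 'o \<Rightarrow> 'o \<Rightarrow> 'm set \<Rightarrow> 'm \<Rightarrow> bool" where
  "is_join C a b S f \<longleftrightarrow> f \<in> Hom C a b \<and> (\<forall>h\<in>S. rle C h f) \<and>
     (\<forall>g\<in>Hom C a b. (\<forall>h\<in>S. rle C h g) \<longrightarrow> rle C f g)"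

definition join :: "('o, 'm) rcategory \<Rightarrow> 'o \<Rightarrow> 'o \<Rightarrow> 'm set \<Rightarrow> 'm" where
  "join C a b S = (THE f. is_join C a b S f)"

definition compatible_family :: "('o, 'm) rcategory \<Rightarrow> 'o \<Rightarrow> 'o \<Rightarrow> 'm set \<Rightarrow> bool" where
  "compatible_family C a b S \<longleftrightarrow> S \<subseteq> Hom C a b \<and> (\<forall>f\<in>S. \<forall>g\<in>S. compatible C f g)"

locale join_restriction_category = restriction_category +
  assumes join_exists: "a \<in> Ob C \<Longrightarrow> b \<in> Ob C \<Longrightarrow> compatible_family C a b S \<Longrightarrow>
          \<exists>f. is_join C a b S f"
    and join_comp: "compatible_family C a b S \<Longrightarrow> is_join C a b S f \<Longrightarrow> g \<in> Hom C z a \<Longrightarrow>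
          is_join C z b ((\<lambda>h. h \<cdot> g) ` S) (f \<cdot> g)"

definition restriction_functor ::
  "('a, 'b) rcategory \<Rightarrow> ('c, 'd) rcategory \<Rightarrow> ('a, 'b, 'c, 'd) functor_data \<Rightarrow> bool" where
  "restriction_functor A B F \<longleftrightarrow> restriction_category A \<and> restriction_category B \<and>
     is_functor A B F \<and> (\<forall>f\<in>Arr A. on_ar F (Rst A f) = Rst B (on_ar F f))"

definition partial_inverse :: "('o, 'm) rcategory \<Rightarrow> 'm \<Rightarrow> 'm \<Rightarrow> bool" where
  "partial_inverse C s t \<longleftrightarrow> s \<in> Arr C \<and> t \<in> Hom C (Cod C s) (Dom C s) \<and>
     t \<cdot>\<^bsub>C\<^esub> s = Rst C s \<and> s \<cdot>\<^bsub>C\<^esub> t = Rst C t"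

definition partial_iso :: "('o, 'm) rcategory \<Rightarrow> 'm \<Rightarrow> bool" where
  "partial_iso C s \<longleftrightarrow> (\<exists>t. partial_inverse C s t)"

definition local_homeomorphism :: "('o, 'm) rcategory \<Rightarrow> 'm \<Rightarrow> bool" where
  "local_homeomorphism C p \<longleftrightarrow> p \<in> Arr C \<and> total C p \<and>
     (\<exists>S. S \<subseteq> Hom C (Dom C p) (Cod C p) \<and> (\<forall>s\<in>S. partial_iso C s) \<and>
          is_join C (Dom C p) (Cod C p) S p)"

definition partial_sections :: "('o, 'm) rcategory \<Rightarrow> 'm \<Rightarrow> 'm set" where
  "partial_sections C p = {s \<in> Hom C (Cod C p) (Dom C p). p \<cdot>\<^bsub>C\<^esub> s = Rst C s}"


section \<open>Size and local glueings\<close>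

text \<open>A set is small if its cardinality is strictly below that of the type \<open>'k\<close>, which thus plays
  the role of the universe. Strictness matters: an object of \<open>C\<close> obtained by glueing \<open>\<kappa>\<close> disjoint
  copies of a nonzero object has at least \<open>2\<^sup>\<kappa>\<close> restriction idempotents, so with index sets of
  size up to that of the hom-sets of \<open>C\<close> local glueings would only exist in degenerate cases.\<close>

definition small :: "'k itself \<Rightarrow> 'a set \<Rightarrow> bool" where
  "small K S \<longleftrightarrow> S \<prec> (UNIV :: 'k set)"

definition locally_small :: "'k itself \<Rightarrow> ('o, 'm, 'z) category_scheme \<Rightarrow> bool" where
  "locally_small K C \<longleftrightarrow> (\<forall>a\<in>Ob C. \<forall>b\<in>Ob C. small K (Hom C a b))"

definition local_atlas :: "('o, 'm) rcategory \<Rightarrow> 'o \<Rightarrow> 'i set \<Rightarrow> ('i \<Rightarrow> 'i \<Rightarrow> 'm) \<Rightarrow> bool" where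
  "local_atlas C X I \<phi> \<longleftrightarrow>
     (\<forall>i\<in>I. \<forall>j\<in>I. \<phi> i j \<in> rst_idems C X \<and> \<phi> i j = \<phi> j i) \<and>
     (\<forall>i\<in>I. \<forall>j\<in>I. \<forall>k\<in>I. rle C (\<phi> j k \<cdot>\<^bsub>C\<^esub> \<phi> i j) (\<phi> i k))"

text \<open>In \<open>glueing C X I \<phi> p q s\<close>, the local homeomorphism \<open>p\<close> is the join of the partial
  isomorphisms \<open>q i\<close>, and \<open>s i\<close> is the partial inverse of \<open>q i\<close>.\<close>

definition glueing ::
  "('o, 'm) rcategory \<Rightarrow> 'o \<Rightarrow> 'i set \<Rightarrow> ('i \<Rightarrow> 'i \<Rightarrow> 'm) \<Rightarrow>
   'm \<Rightarrow> ('i \<Rightarrow> 'm) \<Rightarrow> ('i \<Rightarrow> 'm) \<Rightarrow> bool" where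
  "glueing C X I \<phi> p q s \<longleftrightarrow>
     local_homeomorphism C p \<and> Cod C p = X \<and>
     (\<forall>i\<in>I. q i \<in> Hom C (Dom C p) X \<and> partial_inverse C (q i) (s i)) \<and>
     is_join C (Dom C p) X (q ` I) p \<and>
     (\<forall>i\<in>I. \<forall>j\<in>I. \<phi> i j = q j \<cdot>\<^bsub>C\<^esub> s i)"

definition has_local_glueings :: "'k itself \<Rightarrow> ('o, 'm) rcategory \<Rightarrow> bool" where
  "has_local_glueings K C \<longleftrightarrow>
     (\<forall>X\<in>Ob C. \<forall>(I :: 'k set) \<phi>. small K I \<longrightarrow> local_atlas C X I \<phi> \<longrightarrow>
        (\<exists>p q s. glueing C X I \<phi> p q s))"


section \<open>The category of restriction categories over \<open>C\<close>\<close>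

text \<open>The hom-sets of \<open>A\<close> are small because they index local atlases in \<open>C\<close>. No bound on the set
  of objects is needed.\<close>

definition over_ob ::
  "'k itself \<Rightarrow> ('o, 'm) rcategory \<Rightarrow>
   ('a, 'b) rcategory \<times> ('a, 'b, 'o, 'm) functor_data \<Rightarrow> bool" where
  "over_ob K C = (\<lambda>(A, P). restriction_functor A C P \<and> locally_small K A)"

definition over_map ::
  "('o, 'm) rcategory \<Rightarrow>
   ('a, 'b) rcategory \<times> ('a, 'b, 'o, 'm) functor_data \<Rightarrow>
   ('c, 'd) rcategory \<times> ('c, 'd, 'o, 'm) functor_data \<Rightarrow>
   ('a, 'b, 'c, 'd) functor_data \<times> ('a \<Rightarrow> 'm) \<Rightarrow> bool" where
  "over_map C = (\<lambda>(A, P) (B, Q) (F, \<alpha>).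
     restriction_functor A B F \<and> nat_trans A C (functor_comp A Q F) P \<alpha> \<and>
     (\<forall>a\<in>Ob A. total C (\<alpha> a)))"

definition over_id ::
  "('o, 'm) rcategory \<Rightarrow> ('a, 'b) rcategory \<times> ('a, 'b, 'o, 'm) functor_data \<Rightarrow>
   ('a, 'b, 'a, 'b) functor_data \<times> ('a \<Rightarrow> 'm)" where
  "over_id C = (\<lambda>(A, P). (functor_id A, \<lambda>a\<in>Ob A. Ide C (on_ob P a)))"

definition over_comp ::
  "('o, 'm) rcategory \<Rightarrow> ('a, 'b) rcategory \<Rightarrow>
   ('c, 'd, 'e, 'f) functor_data \<times> ('c \<Rightarrow> 'm) \<Rightarrow>
   ('a, 'b, 'c, 'd) functor_data \<times> ('a \<Rightarrow> 'm) \<Rightarrow>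
   ('a, 'b, 'e, 'f) functor_data \<times> ('a \<Rightarrow> 'm)" where
  "over_comp C A = (\<lambda>(G, \<beta>) (F, \<alpha>).
     (functor_comp A G F, \<lambda>a\<in>Ob A. \<alpha> a \<cdot>\<^bsub>C\<^esub> \<beta> (on_ob F a)))"

type_synonym ('a, 'b, 'o, 'm) over = "('a, 'b) rcategory \<times> ('a, 'b, 'o, 'm) functor_data"

type_synonym ('a, 'b, 'o, 'm) over_arrow =
  "('a, 'b, 'o, 'm) over \<times> (('a, 'b, 'a, 'b) functor_data \<times> ('a \<Rightarrow> 'm)) \<times> ('a, 'b, 'o, 'm) over"

definition rCat_over ::
  "'k itself \<Rightarrow> ('o, 'm) rcategory \<Rightarrow>
   (('a, 'b, 'o, 'm) over, ('a, 'b, 'o, 'm) over_arrow) category" where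
  "rCat_over K C =
     \<lparr>Ob = {X. over_ob K C X},
      Arr = {(X, m, Y). over_ob K C X \<and> over_ob K C Y \<and> over_map C X Y m},
      Dom = (\<lambda>(X, m, Y). X),
      Cod = (\<lambda>(X, m, Y). Y),
      Ide = (\<lambda>X. (X, over_id C X, X)),
      Comp = (\<lambda>(Y, n, Z) (X, m, _). (X, over_comp C (fst X) n m, Z))\<rparr>"


section \<open>Partite internal categories and cofunctors\<close>

text \<open>For \<open>i\<close>, \<open>j\<close>, \<open>k\<close> in the index set \<open>Idx A\<close>: the objects \<open>A\<^sub>i\<close> and \<open>A\<^sub>i\<^sub>j\<close> are \<open>Vtx A i\<close> and
  \<open>Edg A i j\<close>, and \<open>Src\<close>, \<open>Tgt\<close>, \<open>Unt\<close>, \<open>Mul\<close> are \<open>\<sigma>\<close>, \<open>\<tau>\<close>, \<open>\<eta>\<close>, \<open>\<mu>\<close>. The pullback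
  \<open>A\<^sub>j\<^sub>k \<times> A\<^sub>i\<^sub>j\<close> over \<open>A\<^sub>j\<close> is the chosen pullback of \<open>Src A j k\<close> along \<open>Tgt A i j\<close>.\<close>

record ('i, 'o, 'm) partite =
  Idx :: "'i set"
  Vtx :: "'i \<Rightarrow> 'o"
  Edg :: "'i \<Rightarrow> 'i \<Rightarrow> 'o"
  Src :: "'i \<Rightarrow> 'i \<Rightarrow> 'm"
  Tgt :: "'i \<Rightarrow> 'i \<Rightarrow> 'm"
  Unt :: "'i \<Rightarrow> 'm"
  Mul :: "'i \<Rightarrow> 'i \<Rightarrow> 'i \<Rightarrow> 'm"

text \<open>Below, \<open>r1\<close> and \<open>r2\<close> are the projections of \<open>A\<^sub>k\<^sub>l \<times> (A\<^sub>j\<^sub>k \<times> A\<^sub>i\<^sub>j)\<close>, and \<open>p1\<close> and \<open>p2\<close> those of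
  \<open>A\<^sub>j\<^sub>k \<times> A\<^sub>i\<^sub>j\<close>.\<close>

definition mul_associative ::
  "('o, 'm) rcategory \<Rightarrow> ('i, 'o, 'm) partite \<Rightarrow> 'i \<Rightarrow> 'i \<Rightarrow> 'i \<Rightarrow> 'i \<Rightarrow> bool" where
  "mul_associative C A i j k l \<longleftrightarrow>
     (let p1 = proj1 C (Src A j k) (Tgt A i j);
          p2 = proj2 C (Src A j k) (Tgt A i j);
          r1 = proj1 C (Src A k l) (Tgt A j k \<cdot>\<^bsub>C\<^esub> p1);
          r2 = proj2 C (Src A k l) (Tgt A j k \<cdot>\<^bsub>C\<^esub> p1);
          one_mul = pairing C (Src A k l) (Tgt A i k) r1 (Mul A i j k \<cdot>\<^bsub>C\<^esub> r2);
          mul_one = pairing C (Src A j l) (Tgt A i j)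
            (Mul A j k l \<cdot>\<^bsub>C\<^esub> pairing C (Src A k l) (Tgt A j k) r1 (p1 \<cdot>\<^bsub>C\<^esub> r2))
            (p2 \<cdot>\<^bsub>C\<^esub> r2)
      in Mul A i k l \<cdot>\<^bsub>C\<^esub> one_mul = Mul A i j l \<cdot>\<^bsub>C\<^esub> mul_one)"

locale partite_internal_category =
  fixes C :: "('o, 'm) rcategory" (structure) and A :: "('i, 'o, 'm) partite"
  assumes vtx_ob: "i \<in> Idx A \<Longrightarrow> Vtx A i \<in> Ob C"
    and edg_ob: "i \<in> Idx A \<Longrightarrow> j \<in> Idx A \<Longrightarrow> Edg A i j \<in> Ob C"
    and src_hom: "i \<in> Idx A \<Longrightarrow> j \<in> Idx A \<Longrightarrow> Src A i j \<in> Hom C (Edg A i j) (Vtx A i)"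
    and src_total: "i \<in> Idx A \<Longrightarrow> j \<in> Idx A \<Longrightarrow> total C (Src A i j)"
    and src_pullback: "i \<in> Idx A \<Longrightarrow> j \<in> Idx A \<Longrightarrow> g \<in> Hom C z (Vtx A i) \<Longrightarrow> total C g \<Longrightarrow>
          \<exists>p q. is_pullback C (Src A i j) g p q"
    and tgt_hom: "i \<in> Idx A \<Longrightarrow> j \<in> Idx A \<Longrightarrow> Tgt A i j \<in> Hom C (Edg A i j) (Vtx A j)"
    and tgt_total: "i \<in> Idx A \<Longrightarrow> j \<in> Idx A \<Longrightarrow> total C (Tgt A i j)"
    and unt_hom: "i \<in> Idx A \<Longrightarrow> Unt A i \<in> Hom C (Vtx A i) (Edg A i i)"
    and src_unt: "i \<in> Idx A \<Longrightarrow> Src A i i \<cdot> Unt A i = Ide C (Vtx A i)"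
    and tgt_unt: "i \<in> Idx A \<Longrightarrow> Tgt A i i \<cdot> Unt A i = Ide C (Vtx A i)"
    and mul_hom: "i \<in> Idx A \<Longrightarrow> j \<in> Idx A \<Longrightarrow> k \<in> Idx A \<Longrightarrow>
          Mul A i j k \<in> Hom C (pb_ob C (Src A j k) (Tgt A i j)) (Edg A i k)"
    and src_mul: "i \<in> Idx A \<Longrightarrow> j \<in> Idx A \<Longrightarrow> k \<in> Idx A \<Longrightarrow>
          Src A i k \<cdot> Mul A i j k = Src A i j \<cdot> proj2 C (Src A j k) (Tgt A i j)"
    and tgt_mul: "i \<in> Idx A \<Longrightarrow> j \<in> Idx A \<Longrightarrow> k \<in> Idx A \<Longrightarrow>
          Tgt A i k \<cdot> Mul A i j k = Tgt A j k \<cdot> proj1 C (Src A j k) (Tgt A i j)"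
    and mul_unt: "i \<in> Idx A \<Longrightarrow> j \<in> Idx A \<Longrightarrow>
          Mul A i i j \<cdot> pairing C (Src A i j) (Tgt A i i) (Ide C (Edg A i j)) (Unt A i \<cdot> Src A i j)
            = Ide C (Edg A i j)"
    and unt_mul: "i \<in> Idx A \<Longrightarrow> j \<in> Idx A \<Longrightarrow>
          Mul A i j j \<cdot> pairing C (Src A j j) (Tgt A i j) (Unt A j \<cdot> Tgt A i j) (Ide C (Edg A i j))
            = Ide C (Edg A i j)"
    and mul_assoc: "i \<in> Idx A \<Longrightarrow> j \<in> Idx A \<Longrightarrow> k \<in> Idx A \<Longrightarrow> l \<in> Idx A \<Longrightarrow>
          mul_associative C A i j k l"

record ('i, 'j, 'm) cofunctor_data =
  cf_idx :: "'i \<Rightarrow> 'j"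
  cf_vtx :: "'i \<Rightarrow> 'm"
  cf_edg :: "'i \<Rightarrow> 'i \<Rightarrow> 'm"

text \<open>The compatibility of a cofunctor with \<open>\<mu>\<close>. Here \<open>p1\<close> and \<open>p2\<close> are the projections of
  \<open>A\<^sub>i\<^sub>j \<times> B\<^sub>F\<^sub>i\<close>, and \<open>r1\<close> and \<open>r2\<close> those of \<open>A\<^sub>j\<^sub>k \<times> (A\<^sub>i\<^sub>j \<times> B\<^sub>F\<^sub>i)\<close>. The map \<open>one_F\<close> goes to
  \<open>A\<^sub>j\<^sub>k \<times> B\<^sub>F\<^sub>i\<^sub>,\<^sub>F\<^sub>j\<close> over \<open>A\<^sub>j\<close>, with projections \<open>t1\<close> and \<open>t2\<close>, and \<open>F_one\<close> from there to
  \<open>B\<^sub>F\<^sub>j\<^sub>,\<^sub>F\<^sub>k \<times> B\<^sub>F\<^sub>i\<^sub>,\<^sub>F\<^sub>j\<close>; the isomorphism of \<open>A\<^sub>j\<^sub>k \<times> B\<^sub>F\<^sub>i\<^sub>,\<^sub>F\<^sub>j\<close> with \<open>(A\<^sub>j\<^sub>k \<times> B\<^sub>F\<^sub>j) \<times> B\<^sub>F\<^sub>i\<^sub>,\<^sub>F\<^sub>j\<close> is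
  absorbed in \<open>F_one\<close>.\<close>

definition cofunctor_mul ::
  "('o, 'm) rcategory \<Rightarrow> ('i, 'o, 'm) partite \<Rightarrow> ('j, 'o, 'm) partite \<Rightarrow>
   ('i, 'j, 'm) cofunctor_data \<Rightarrow> 'i \<Rightarrow> 'i \<Rightarrow> 'i \<Rightarrow> bool" where
  "cofunctor_mul C A B F i j k \<longleftrightarrow>
     (let i' = cf_idx F i; j' = cf_idx F j; k' = cf_idx F k;
          p1 = proj1 C (Src A i j) (cf_vtx F i);
          p2 = proj2 C (Src A i j) (cf_vtx F i);
          r1 = proj1 C (Src A j k) (Tgt A i j \<cdot>\<^bsub>C\<^esub> p1);
          r2 = proj2 C (Src A j k) (Tgt A i j \<cdot>\<^bsub>C\<^esub> p1);
          mul_one = pairing C (Src A i k) (cf_vtx F i)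
            (Mul A i j k \<cdot>\<^bsub>C\<^esub> pairing C (Src A j k) (Tgt A i j) r1 (p1 \<cdot>\<^bsub>C\<^esub> r2))
            (p2 \<cdot>\<^bsub>C\<^esub> r2);
          Ft = cf_vtx F j \<cdot>\<^bsub>C\<^esub> Tgt B i' j';
          one_F = pairing C (Src A j k) Ft r1 (cf_edg F i j \<cdot>\<^bsub>C\<^esub> r2);
          t1 = proj1 C (Src A j k) Ft;
          t2 = proj2 C (Src A j k) Ft;
          F_one = pairing C (Src B j' k') (Tgt B i' j')
            (cf_edg F j k \<cdot>\<^bsub>C\<^esub>
               pairing C (Src A j k) (cf_vtx F j) t1 (Tgt B i' j' \<cdot>\<^bsub>C\<^esub> t2))
            t2
      in cf_edg F i k \<cdot>\<^bsub>C\<^esub> mul_one = Mul B i' j' k' \<cdot>\<^bsub>C\<^esub> (F_one \<cdot>\<^bsub>C\<^esub> one_F))"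

locale partite_cofunctor =
  dom: partite_internal_category C A + cod: partite_internal_category C B
  for C :: "('o, 'm) rcategory" (structure)
    and A :: "('i, 'o, 'm) partite" and B :: "('j, 'o, 'm) partite" +
  fixes F :: "('i, 'j, 'm) cofunctor_data"
  assumes idx_map: "cf_idx F \<in> Idx A \<rightarrow>\<^sub>E Idx B"
    and vtx_ext: "cf_vtx F \<in> extensional (Idx A)"
    and edg_ext: "cf_edg F \<in> Idx A \<rightarrow>\<^sub>E extensional (Idx A)"
    and vtx_hom: "i \<in> Idx A \<Longrightarrow> cf_vtx F i \<in> Hom C (Vtx B (cf_idx F i)) (Vtx A i)"
    and vtx_total: "i \<in> Idx A \<Longrightarrow> total C (cf_vtx F i)"
    and edg_hom: "i \<in> Idx A \<Longrightarrow> j \<in> Idx A \<Longrightarrow>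
          cf_edg F i j \<in> Hom C (pb_ob C (Src A i j) (cf_vtx F i)) (Edg B (cf_idx F i) (cf_idx F j))"
    and edg_total: "i \<in> Idx A \<Longrightarrow> j \<in> Idx A \<Longrightarrow> total C (cf_edg F i j)"
    and src_edg: "i \<in> Idx A \<Longrightarrow> j \<in> Idx A \<Longrightarrow>
          Src B (cf_idx F i) (cf_idx F j) \<cdot> cf_edg F i j = proj2 C (Src A i j) (cf_vtx F i)"
    and tgt_edg: "i \<in> Idx A \<Longrightarrow> j \<in> Idx A \<Longrightarrow>
          cf_vtx F j \<cdot> Tgt B (cf_idx F i) (cf_idx F j) \<cdot> cf_edg F i j
            = Tgt A i j \<cdot> proj1 C (Src A i j) (cf_vtx F i)"
    and edg_unt: "i \<in> Idx A \<Longrightarrow>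
          cf_edg F i i \<cdot>
            pairing C (Src A i i) (cf_vtx F i) (Unt A i \<cdot> cf_vtx F i) (Ide C (Vtx B (cf_idx F i)))
            = Unt B (cf_idx F i)"
    and edg_mul: "i \<in> Idx A \<Longrightarrow> j \<in> Idx A \<Longrightarrow> k \<in> Idx A \<Longrightarrow> cofunctor_mul C A B F i j k"

definition cofunctor_id ::
  "('o, 'm) rcategory \<Rightarrow> ('i, 'o, 'm) partite \<Rightarrow> ('i, 'i, 'm) cofunctor_data" where
  "cofunctor_id C A =
     \<lparr>cf_idx = (\<lambda>i\<in>Idx A. i),
      cf_vtx = (\<lambda>i\<in>Idx A. Ide C (Vtx A i)),
      cf_edg = (\<lambda>i\<in>Idx A. \<lambda>j\<in>Idx A. proj1 C (Src A i j) (Ide C (Vtx A i)))\<rparr>"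

text \<open>In \<open>cofunctor_comp C A B G F\<close>, where \<open>F\<close> goes from \<open>A\<close> to \<open>B\<close>, the map \<open>F_one\<close> is
  \<open>F\<^sub>i\<^sub>j \<times> 1\<close> precomposed with the isomorphism from \<open>A\<^sub>i\<^sub>j \<times> C\<^sub>G\<^sub>F\<^sub>i\<close> to
  \<open>(A\<^sub>i\<^sub>j \<times> B\<^sub>F\<^sub>i) \<times> C\<^sub>G\<^sub>F\<^sub>i\<close>.\<close>

definition cofunctor_comp ::
  "('o, 'm) rcategory \<Rightarrow> ('i, 'o, 'm) partite \<Rightarrow> ('j, 'o, 'm) partite \<Rightarrow>
   ('j, 'k, 'm) cofunctor_data \<Rightarrow> ('i, 'j, 'm) cofunctor_data \<Rightarrow>
   ('i, 'k, 'm) cofunctor_data" where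
  "cofunctor_comp C A B G F =
     \<lparr>cf_idx = (\<lambda>i\<in>Idx A. cf_idx G (cf_idx F i)),
      cf_vtx = (\<lambda>i\<in>Idx A. cf_vtx F i \<cdot>\<^bsub>C\<^esub> cf_vtx G (cf_idx F i)),
      cf_edg = (\<lambda>i\<in>Idx A. \<lambda>j\<in>Idx A.
        let i' = cf_idx F i; j' = cf_idx F j;
            FG = cf_vtx F i \<cdot>\<^bsub>C\<^esub> cf_vtx G i';
            p1 = proj1 C (Src A i j) FG;
            p2 = proj2 C (Src A i j) FG;
            F_one = pairing C (Src B i' j') (cf_vtx G i')
              (cf_edg F i j \<cdot>\<^bsub>C\<^esub>
                 pairing C (Src A i j) (cf_vtx F i) p1 (cf_vtx G i' \<cdot>\<^bsub>C\<^esub> p2))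
              p2
        in cf_edg G i' j' \<cdot>\<^bsub>C\<^esub> F_one)\<rparr>"

type_synonym ('i, 'o, 'm) partite_arrow =
  "('i, 'o, 'm) partite \<times> ('i, 'i, 'm) cofunctor_data \<times> ('i, 'o, 'm) partite"

definition pCat ::
  "('o, 'm) rcategory \<Rightarrow> (('i, 'o, 'm) partite, ('i, 'o, 'm) partite_arrow) category" where
  "pCat C =
     \<lparr>Ob = {A. partite_internal_category C A},
      Arr = {(A, F, B). partite_cofunctor C A B F},
      Dom = (\<lambda>(A, F, B). A),
      Cod = (\<lambda>(A, F, B). B),
      Ide = (\<lambda>A. (A, cofunctor_id C A, A)),
      Comp = (\<lambda>(B, G, D) (A, F, _). (A, cofunctor_comp C A B G F, D))\<rparr>"


section \<open>The functor \<open>\<Phi>\<close>\<close>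

text \<open>\<open>pb_section C p f t\<close> is the pullback \<open>f\<^sup>*(t) = (t f, rst (t f))\<close> along a total map \<open>f\<close> of a
  partial section \<open>t\<close> of \<open>p\<close>.\<close>

definition pb_section :: "('o, 'm) rcategory \<Rightarrow> 'm \<Rightarrow> 'm \<Rightarrow> 'm \<Rightarrow> 'm" where
  "pb_section C p f t = pairing C p f (t \<cdot>\<^bsub>C\<^esub> f) (Rst C (t \<cdot>\<^bsub>C\<^esub> f))"

text \<open>Arrows carry their source and target index, since the objects \<open>A\<^sub>i\<^sub>j\<close> need not be distinct.\<close>

definition Phi_cat ::
  "('o, 'm) rcategory \<Rightarrow> ('i, 'o, 'm) partite \<Rightarrow> ('i, 'i \<times> 'm \<times> 'i) rcategory" where
  "Phi_cat C A =
     \<lparr>Ob = Idx A,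
      Arr = {(i, s, j). i \<in> Idx A \<and> j \<in> Idx A \<and> s \<in> partial_sections C (Src A i j)},
      Dom = (\<lambda>(i, s, j). i),
      Cod = (\<lambda>(i, s, j). j),
      Ide = (\<lambda>i. (i, Unt A i, i)),
      Comp = (\<lambda>(j, t, k) (i, s, _).
        (i, Mul A i j k \<cdot>\<^bsub>C\<^esub> pb_section C (Src A j k) (Tgt A i j) t \<cdot>\<^bsub>C\<^esub> s, k)),
      Rst = (\<lambda>(i, s, j). (i, Unt A i \<cdot>\<^bsub>C\<^esub> Rst C s, i))\<rparr>"

definition Phi_proj ::
  "('o, 'm) rcategory \<Rightarrow> ('i, 'o, 'm) partite \<Rightarrow> ('i, 'i \<times> 'm \<times> 'i, 'o, 'm) functor_data" where
  "Phi_proj C A =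
     \<lparr>on_ob = (\<lambda>i\<in>Idx A. Vtx A i),
      on_ar = (\<lambda>(i, s, j)\<in>Arr (Phi_cat C A). Tgt A i j \<cdot>\<^bsub>C\<^esub> s)\<rparr>"

definition Phi_ob ::
  "('o, 'm) rcategory \<Rightarrow> ('i, 'o, 'm) partite \<Rightarrow> ('i, 'i \<times> 'm \<times> 'i, 'o, 'm) over" where
  "Phi_ob C A = (Phi_cat C A, Phi_proj C A)"

definition Phi_map ::
  "('o, 'm) rcategory \<Rightarrow> ('i, 'o, 'm) partite \<Rightarrow> ('i, 'j, 'm) cofunctor_data \<Rightarrow>
   ('i, 'i \<times> 'm \<times> 'i, 'j, 'j \<times> 'm \<times> 'j) functor_data \<times> ('i \<Rightarrow> 'm)" where
  "Phi_map C A F =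
     (\<lparr>on_ob = (\<lambda>i\<in>Idx A. cf_idx F i),
       on_ar = (\<lambda>(i, s, j)\<in>Arr (Phi_cat C A).
         (cf_idx F i, cf_edg F i j \<cdot>\<^bsub>C\<^esub> pb_section C (Src A i j) (cf_vtx F i) s, cf_idx F j))\<rparr>,
      \<lambda>i\<in>Idx A. cf_vtx F i)"

definition Phi ::
  "('o, 'm) rcategory \<Rightarrow>
   (('i, 'o, 'm) partite, ('i, 'o, 'm) partite_arrow,
    ('i, 'i \<times> 'm \<times> 'i, 'o, 'm) over, ('i, 'i \<times> 'm \<times> 'i, 'o, 'm) over_arrow) functor_data" where
  "Phi C =
     \<lparr>on_ob = (\<lambda>A\<in>Ob (pCat C). Phi_ob C A),
      on_ar = (\<lambda>(A, F, B)\<in>Arr (pCat C). (Phi_ob C A, Phi_map C A F, Phi_ob C B))\<rparr>"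


section \<open>The object \<open>\<Psi> P\<close> and the map \<open>\<eta>\<^sub>P\<close>\<close>

definition agree ::
  "('o, 'm) rcategory \<Rightarrow> ('a, 'b) rcategory \<Rightarrow> ('a, 'b, 'o, 'm) functor_data \<Rightarrow>
   'b \<Rightarrow> 'b \<Rightarrow> 'm" where
  "agree C A P f g =
     (let i = Dom A f
      in join C (on_ob P i) (on_ob P i)
           (on_ar P ` {e \<in> rst_idems A i. rle A e (Rst A f \<cdot>\<^bsub>A\<^esub> Rst A g) \<and> f \<cdot>\<^bsub>A\<^esub> e = g \<cdot>\<^bsub>A\<^esub> e}))"

definition Psi_glueing ::
  "('o, 'm) rcategory \<Rightarrow> ('a, 'b) rcategory \<Rightarrow> ('a, 'b, 'o, 'm) functor_data \<Rightarrow>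
   'a \<Rightarrow> 'a \<Rightarrow> 'm \<times> ('b \<Rightarrow> 'm) \<times> ('b \<Rightarrow> 'm)" where
  "Psi_glueing C A P i j =
     (SOME (p, q, s). glueing C (on_ob P i) (Hom A i j) (agree C A P) p q s)"

definition Psi_src ::
  "('o, 'm) rcategory \<Rightarrow> ('a, 'b) rcategory \<Rightarrow> ('a, 'b, 'o, 'm) functor_data \<Rightarrow>
   'a \<Rightarrow> 'a \<Rightarrow> 'm" where
  "Psi_src C A P i j = fst (Psi_glueing C A P i j)"

text \<open>\<open>Psi_sec C A P f\<close> is the partial section \<open>s\<^sub>f\<close>.\<close>

definition Psi_sec ::
  "('o, 'm) rcategory \<Rightarrow> ('a, 'b) rcategory \<Rightarrow> ('a, 'b, 'o, 'm) functor_data \<Rightarrow> 'b \<Rightarrow> 'm" where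
  "Psi_sec C A P f = snd (snd (Psi_glueing C A P (Dom A f) (Cod A f))) f"

definition Psi_tgt ::
  "('o, 'm) rcategory \<Rightarrow> ('a, 'b) rcategory \<Rightarrow> ('a, 'b, 'o, 'm) functor_data \<Rightarrow>
   'a \<Rightarrow> 'a \<Rightarrow> 'm" where
  "Psi_tgt C A P i j =
     (THE t. t \<in> Hom C (Dom C (Psi_src C A P i j)) (on_ob P j) \<and>
        (\<forall>f\<in>Hom A i j. t \<cdot>\<^bsub>C\<^esub> Psi_sec C A P f = on_ar P f))"

definition Psi_mul ::
  "('o, 'm) rcategory \<Rightarrow> ('a, 'b) rcategory \<Rightarrow> ('a, 'b, 'o, 'm) functor_data \<Rightarrow>
   'a \<Rightarrow> 'a \<Rightarrow> 'a \<Rightarrow> 'm" where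
  "Psi_mul C A P i j k =
     (THE m. m \<in> Hom C (pb_ob C (Psi_src C A P j k) (Psi_tgt C A P i j))
                       (Dom C (Psi_src C A P i k)) \<and>
        (\<forall>f\<in>Hom A i j. \<forall>g\<in>Hom A j k.
           m \<cdot>\<^bsub>C\<^esub> pb_section C (Psi_src C A P j k) (Psi_tgt C A P i j) (Psi_sec C A P g)
             \<cdot>\<^bsub>C\<^esub> Psi_sec C A P f = Psi_sec C A P (g \<cdot>\<^bsub>A\<^esub> f)))"

definition Psi_ob ::
  "('o, 'm) rcategory \<Rightarrow> ('a, 'b, 'o, 'm) over \<Rightarrow> ('a, 'o, 'm) partite" where
  "Psi_ob C = (\<lambda>(A, P).
     \<lparr>Idx = Ob A,
      Vtx = on_ob P,
      Edg = (\<lambda>i j. Dom C (Psi_src C A P i j)),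
      Src = Psi_src C A P,
      Tgt = Psi_tgt C A P,
      Unt = (\<lambda>i. Psi_sec C A P (Ide A i)),
      Mul = Psi_mul C A P\<rparr>)"

definition eta_functor ::
  "('o, 'm) rcategory \<Rightarrow> ('a, 'b, 'o, 'm) over \<Rightarrow> ('a, 'b, 'a, 'a \<times> 'm \<times> 'a) functor_data" where
  "eta_functor C = (\<lambda>(A, P).
     \<lparr>on_ob = (\<lambda>i\<in>Ob A. i),
      on_ar = (\<lambda>f\<in>Arr A. (Dom A f, Psi_sec C A P f, Cod A f))\<rparr>)"

text \<open>The pair \<open>(\<eta>\<^sub>P, 1)\<close>.\<close>

definition eta_map ::
  "('o, 'm) rcategory \<Rightarrow> ('a, 'b, 'o, 'm) over \<Rightarrow>
   ('a, 'b, 'a, 'a \<times> 'm \<times> 'a) functor_data \<times> ('a \<Rightarrow> 'm)" where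
  "eta_map C X = (eta_functor C X, \<lambda>i\<in>Ob (fst X). Ide C (on_ob (snd X) i))"

end

(* Maps into a pullback are compatible pairs of generalized elements, so the axioms of a
   partite internal category and of a partite cofunctor can be written as those of an ordinary
   category and of an ordinary cofunctor, with composition of maps as substitution. A generalized
   element a of a glueing is covered by its restrictions to sheets, that is, to elements of the form
   s_f y; for Psi P one has sigma (s_f y) = y, tau (s_f y) = P f y and mu (s_g (P f y), s_f y) = s_(gf) y.
   Equations in Psi P can thus be checked on elements s_f y, where they reduce to equations in A.
   Given (G, gamma) with G f = t_f, a cofunctor F with the required property must send
   (s_f (gamma x), x) to t_f x, which determines it; conversely these assignments are compatible on
   overlaps of sheets, because t_f and t_g agree wherever f and g are locally equal. *)

theory Submission
  imports Defs
begin

section \<open>Restriction categories and joins\<close>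

text \<open>A is not assumed to have joins, so \<open>agree C A P f g\<close> need not come from an
  idempotent of A: it is a join, formed in C, of images of idempotents on which f and g agree. Every
  statement about it has to be reduced to a single such idempotent, and transitivity and
  compatibility with composition need two nested reductions. The join axiom speaks only of
  precomposition; passing from equality on the members of a cover to equality on its join works by
  recognising w d as the join of the maps w e, through their restrictions. Since maps are partial,
  an element carries a domain, and arguments by covers need side conditions saying that the compared
  maps are defined no further than the covered element. Pullbacks of \<sigma> along total maps are
  not given in advance: they are built as glueings of pulled-back atlases, so glueings are used for
  more than the objects of \<Psi> P. All these atlases are indexed by hom-sets of A, which are
  small. Terms chosen by \<open>SOME\<close> or \<open>THE\<close> are used only through their
  defining property; uniqueness of maps defined sheet by sheet is what makes the \<open>THE\<close>
  terms meaningful.\<close>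

lemma in_Hom_iff: "f \<in> Hom C a b \<longleftrightarrow> f \<in> Arr C \<and> Dom C f = a \<and> Cod C f = b"
  by (simp add: Hom_def)

context category
begin

lemma
  assumes "f \<in> Arr C" "g \<in> Arr C" "Dom C g = Cod C f"
  shows comp_arr [simp]: "g \<cdot> f \<in> Arr C"
    and dom_comp [simp]: "Dom C (g \<cdot> f) = Dom C f"
    and cod_comp [simp]: "Cod C (g \<cdot> f) = Cod C g"
  using comp_hom [of f "Dom C f" "Cod C f" g "Cod C g"] assms by (auto simp: in_Hom_iff)

lemma
  assumes "a \<in> Ob C"
  shows ide_arr [simp]: "Ide C a \<in> Arr C"
    and dom_ide [simp]: "Dom C (Ide C a) = a"
    and cod_ide [simp]: "Cod C (Ide C a) = a"
  using ide_hom [OF assms] by (auto simp: in_Hom_iff)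

lemma comp_ide' [simp]: "f \<in> Arr C \<Longrightarrow> Dom C f = a \<Longrightarrow> f \<cdot> Ide C a = f"
  using comp_ide [of f a "Cod C f"] by (simp add: in_Hom_iff)

lemma ide_comp' [simp]: "f \<in> Arr C \<Longrightarrow> Cod C f = a \<Longrightarrow> Ide C a \<cdot> f = f"
  using ide_comp [of f "Dom C f" a] by (simp add: in_Hom_iff)

lemma assoc [simp]:
  "f \<in> Arr C \<Longrightarrow> g \<in> Arr C \<Longrightarrow> h \<in> Arr C \<Longrightarrow> Dom C g = Cod C f \<Longrightarrow> Dom C h = Cod C g \<Longrightarrow>
    (h \<cdot> g) \<cdot> f = h \<cdot> (g \<cdot> f)"
  using comp_assoc [of f "Dom C f" "Cod C f" g "Cod C g" h "Cod C h"] by (simp add: in_Hom_iff)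

text \<open>Composites are normalised with brackets to the right, so an equation for g f no longer
  matches inside g (f x). This rule and \<open>comp_reduce2\<close> apply such an equation in front
  of a further factor x.\<close>

lemma comp_reduce:
  "g \<cdot> f = k \<Longrightarrow> x \<in> Arr C \<Longrightarrow> f \<in> Arr C \<Longrightarrow> g \<in> Arr C \<Longrightarrow>
    Dom C f = Cod C x \<Longrightarrow> Dom C g = Cod C f \<Longrightarrow> g \<cdot> (f \<cdot> x) = k \<cdot> x"
  by (metis assoc)

lemma comp_reduce2:
  "g \<cdot> f = h \<cdot> k \<Longrightarrow> x \<in> Arr C \<Longrightarrow> f \<in> Arr C \<Longrightarrow> g \<in> Arr C \<Longrightarrow> h \<in> Arr C \<Longrightarrow> k \<in> Arr C \<Longrightarrow>
    Dom C f = Cod C x \<Longrightarrow> Dom C g = Cod C f \<Longrightarrow> Dom C k = Cod C x \<Longrightarrow> Dom C h = Cod C k \<Longrightarrow>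
    g \<cdot> (f \<cdot> x) = h \<cdot> (k \<cdot> x)"
  by (metis assoc)

declare dom_ob [simp] cod_ob [simp]

end

context restriction_category
begin

lemma
  assumes "f \<in> Arr C"
  shows rst_arr [simp]: "Rst C f \<in> Arr C"
    and dom_rst [simp]: "Dom C (Rst C f) = Dom C f"
    and cod_rst [simp]: "Cod C (Rst C f) = Dom C f"
  using rst_hom [of f "Dom C f" "Cod C f"] assms by (auto simp: in_Hom_iff)

lemma comp_rst' [simp]: "f \<in> Arr C \<Longrightarrow> f \<cdot> Rst C f = f"
  by (rule comp_rst)

lemma comp_rst_assoc [simp]:
  "f \<in> Arr C \<Longrightarrow> x \<in> Arr C \<Longrightarrow> Cod C x = Dom C f \<Longrightarrow> f \<cdot> (Rst C f \<cdot> x) = f \<cdot> x"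
  by (metis assoc cod_rst comp_rst' dom_rst rst_arr)

lemma rst_commute': "f \<in> Arr C \<Longrightarrow> g \<in> Arr C \<Longrightarrow> Dom C f = Dom C g \<Longrightarrow>
    Rst C f \<cdot> Rst C g = Rst C g \<cdot> Rst C f"
  using rst_commute [of f "Dom C f" "Cod C f" g "Cod C g"] by (simp add: in_Hom_iff)

lemma rst_comp_rst' [simp]: "f \<in> Arr C \<Longrightarrow> g \<in> Arr C \<Longrightarrow> Dom C g = Dom C f \<Longrightarrow>
    Rst C (g \<cdot> Rst C f) = Rst C g \<cdot> Rst C f"
  using rst_comp_rst [of f "Dom C f" "Cod C f" g "Cod C g"] by (simp add: in_Hom_iff)

lemma rst_comp': "f \<in> Arr C \<Longrightarrow> g \<in> Arr C \<Longrightarrow> Dom C g = Cod C f \<Longrightarrow>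
    Rst C g \<cdot> f = f \<cdot> Rst C (g \<cdot> f)"
  using rst_comp [of f "Dom C f" "Cod C f" g "Cod C g"] by (simp add: in_Hom_iff)

lemma rst_ide [simp]: "a \<in> Ob C \<Longrightarrow> Rst C (Ide C a) = Ide C a"
  by (metis cod_rst comp_rst' dom_ide ide_arr ide_comp' rst_arr)

lemma rst_rst [simp]: "f \<in> Arr C \<Longrightarrow> Rst C (Rst C f) = Rst C f"
  using rst_comp_rst' [of f "Ide C (Dom C f)"] by simp

lemma rst_idem [simp]: "f \<in> Arr C \<Longrightarrow> Rst C f \<cdot> Rst C f = Rst C f"
  by (metis comp_rst' rst_rst rst_arr)

text \<open>Writing f as \<open>f \<cdot> Rst C f\<close> exhibits g f as already restricted to the
  domain of f.\<close>

lemma rst_comp_absorb: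
  assumes "f \<in> Arr C" "g \<in> Arr C" "Dom C g = Cod C f"
  shows "Rst C (g \<cdot> f) \<cdot> Rst C f = Rst C (g \<cdot> f)"
  by (metis assms assoc comp_arr comp_rst' dom_comp rst_comp_rst' rst_arr cod_rst)

lemma rst_comp_absorb' [simp]:
  assumes "f \<in> Arr C" "g \<in> Arr C" "Dom C g = Cod C f"
  shows "Rst C f \<cdot> Rst C (g \<cdot> f) = Rst C (g \<cdot> f)"
  by (metis assms rst_comp_absorb rst_commute' comp_arr dom_comp)

lemma rst_rst_comp [simp]:
  assumes "f \<in> Arr C" "g \<in> Arr C" "Dom C g = Cod C f"
  shows "Rst C (Rst C g \<cdot> f) = Rst C (g \<cdot> f)"
  using assms unfolding rst_comp' [OF assms] by simp

lemma comp_rst_comp [simp]: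
  assumes "f \<in> Arr C" "g \<in> Arr C" "Dom C g = Cod C f"
  shows "g \<cdot> (f \<cdot> Rst C (g \<cdot> f)) = g \<cdot> f"
  using assms comp_rst' [of "g \<cdot> f"] by (metis assoc comp_arr cod_rst dom_comp rst_arr)

lemma total_rst: "total C f \<Longrightarrow> Rst C f = Ide C (Dom C f)"
  by (simp add: total_def)

lemma rst_total_comp [simp]:
  assumes "total C g" "f \<in> Arr C" "g \<in> Arr C" "Dom C g = Cod C f"
  shows "Rst C (g \<cdot> f) = Rst C f"
  using rst_rst_comp [OF assms(2-4)] assms by (simp add: total_rst)

lemma total_ide [simp]: "a \<in> Ob C \<Longrightarrow> total C (Ide C a)"
  by (simp add: total_def)

lemma total_comp [simp]:
  assumes "total C g" "total C f" "f \<in> Arr C" "g \<in> Arr C" "Dom C g = Cod C f"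
  shows "total C (g \<cdot> f)"
  using assms by (simp add: total_def)

lemma total_cancel:
  assumes "total C (g \<cdot> f)" "f \<in> Arr C" "g \<in> Arr C" "Dom C g = Cod C f"
  shows "total C f"
  using assms rst_comp_absorb' [of f g] by (simp add: total_def)

lemma rst_idems_iff: "e \<in> rst_idems C a \<longleftrightarrow> e \<in> Arr C \<and> Dom C e = a \<and> Cod C e = a \<and> Rst C e = e"
  by (auto simp: rst_idems_def in_Hom_iff)

lemma rst_in_idems: "f \<in> Arr C \<Longrightarrow> Dom C f = a \<Longrightarrow> Rst C f \<in> rst_idems C a"
  by (simp add: rst_idems_iff)

lemma idem_idem: "e \<in> rst_idems C a \<Longrightarrow> e \<cdot> e = e"
  by (metis comp_rst' rst_idems_iff)

lemma idem_commute: "e \<in> rst_idems C a \<Longrightarrow> d \<in> rst_idems C a \<Longrightarrow> e \<cdot> d = d \<cdot> e"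
  by (metis rst_commute' rst_idems_iff)

lemma idem_comp: "e \<in> rst_idems C a \<Longrightarrow> d \<in> rst_idems C a \<Longrightarrow> e \<cdot> d \<in> rst_idems C a"
  using rst_comp_rst' [of d e] by (simp add: rst_idems_iff)

lemma rst_comp_idem: "f \<in> Arr C \<Longrightarrow> e \<in> rst_idems C (Dom C f) \<Longrightarrow> Rst C (f \<cdot> e) = Rst C f \<cdot> e"
  using rst_comp_rst' [of e f] by (simp add: rst_idems_iff)

lemma idem_comp_map: "f \<in> Arr C \<Longrightarrow> e \<in> rst_idems C (Cod C f) \<Longrightarrow> e \<cdot> f = f \<cdot> Rst C (e \<cdot> f)"
  using rst_comp' [of f e] by (simp add: rst_idems_iff)

lemma rleD: "rle C f g \<Longrightarrow> g \<cdot> Rst C f = f"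
  by (simp add: rle_def)

text \<open>Each restriction absorbs the other and restrictions commute, so the two domains
  coincide; then f = g \<open>Rst C f\<close> is g itself.\<close>

lemma rle_antisym:
  assumes "rle C f g" "rle C g f" "f \<in> Hom C a b" "g \<in> Hom C a b" shows "f = g"
proof -
  have fg: "f = g \<cdot> Rst C f" "g = f \<cdot> Rst C g" using assms by (auto simp: rle_def)
  then have "Rst C f = Rst C g \<cdot> Rst C f" "Rst C g = Rst C f \<cdot> Rst C g"
    using assms by (auto simp: in_Hom_iff) (metis rst_comp_rst' rle_def)+
  then have "Rst C f = Rst C g"
    using rst_commute' [of f g] assms by (simp add: in_Hom_iff)
  then show ?thesis using fg(1) assms by (simp add: in_Hom_iff)
qed

lemma rle_rst:
  assumes "rle C f g" "f \<in> Arr C" "g \<in> Arr C" "Dom C f = Dom C g"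
  shows "Rst C g \<cdot> Rst C f = Rst C f"
  using assms by (metis rst_comp_rst' rle_def)

lemma rle_idem_iff:
  "e \<in> rst_idems C a \<Longrightarrow> d \<in> rst_idems C a \<Longrightarrow> rle C e d \<longleftrightarrow> d \<cdot> e = e"
  by (auto simp: rle_def rst_idems_iff)

lemma rle_comp_idem: "f \<in> Arr C \<Longrightarrow> e \<in> rst_idems C (Dom C f) \<Longrightarrow> rle C (f \<cdot> e) f"
  unfolding rle_def
  by (subst rst_comp_idem) (auto simp: rst_idems_iff)

lemma compatible_idems:
  "S \<subseteq> rst_idems C a \<Longrightarrow> compatible_family C a a S"
  by (auto simp: compatible_family_def compatible_def rst_idems_def in_Hom_iff subset_iff)
    (metis rst_commute')

text \<open>On the overlap of their domains both maps are restrictions of the common bound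
  h.\<close>

lemma rle_compatible:
  assumes "rle C f h" "rle C g h" "f \<in> Hom C a b" "g \<in> Hom C a b" "h \<in> Hom C a b"
  shows "compatible C f g"
proof -
  have "f \<cdot> Rst C g = h \<cdot> (Rst C f \<cdot> Rst C g)" "g \<cdot> Rst C f = h \<cdot> (Rst C g \<cdot> Rst C f)"
    using assms comp_reduce [OF rleD [OF assms(1)]] comp_reduce [OF rleD [OF assms(2)]]
    by (auto simp: in_Hom_iff)
  then show ?thesis using assms rst_commute' [of f g] by (simp add: compatible_def in_Hom_iff)
qed

lemma is_joinD:
  assumes "is_join C a b S f"
  shows "f \<in> Hom C a b" "h \<in> S \<Longrightarrow> rle C h f"
    "g \<in> Hom C a b \<Longrightarrow> (\<And>h. h \<in> S \<Longrightarrow> rle C h g) \<Longrightarrow> rle C f g"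
  using assms by (auto simp: is_join_def)

lemma is_join_unique: "is_join C a b S f \<Longrightarrow> is_join C a b S g \<Longrightarrow> f = g"
  by (rule rle_antisym) (auto simp: is_join_def)

lemma join_eq: "is_join C a b S f \<Longrightarrow> join C a b S = f"
  unfolding join_def by (blast intro: is_join_unique)

lemma is_join_compatible:
  "S \<subseteq> Hom C a b \<Longrightarrow> is_join C a b S f \<Longrightarrow> compatible_family C a b S"
  by (auto simp: compatible_family_def is_join_def subset_iff intro: rle_compatible)

text \<open>The join e of the restrictions lies below the identity, hence is an idempotent, and
  below \<open>Rst C f\<close>. Conversely f e is already an upper bound of S, so f lies below f e,
  which forces \<open>Rst C f\<close> below e.\<close>

lemma is_join_rst:
  assumes "S \<subseteq> Hom C a b" "is_join C a b S f" "is_join C a a (Rst C ` S) e"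
  shows "e = Rst C f"
proof -
  note f = is_joinD [OF assms(2)] and e = is_joinD [OF assms(3)]
  have ob: "a \<in> Ob C" and ty: "e \<in> Arr C" "Dom C e = a" "Cod C e = a"
      "f \<in> Arr C" "Dom C f = a" "Cod C f = b"
    using f(1) e(1) by (auto simp: in_Hom_iff)
  have S: "h \<in> Arr C \<and> Dom C h = a \<and> Cod C h = b" if "h \<in> S" for h
    using assms(1) that by (auto simp: in_Hom_iff)
  have "rle C e (Ide C a)"
  proof (rule e(3))
    show "rle C h (Ide C a)" if "h \<in> Rst C ` S" for h
      using that S ob by (auto simp: rle_def)
  qed (use ob in \<open>auto simp: in_Hom_iff\<close>)
  then have idem: "Rst C e = e" using ty ob by (simp add: rle_def)
  have lef: "rle C e (Rst C f)"
  proof (rule e(3))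
    show "rle C h (Rst C f)" if "h \<in> Rst C ` S" for h
      using that S ty f(2) rle_rst by (auto simp: rle_def)
  qed (use ty in \<open>auto simp: in_Hom_iff\<close>)
  have "rle C f (f \<cdot> e)"
  proof (rule f(3))
    show "rle C h (f \<cdot> e)" if h: "h \<in> S" for h
    proof -
      have "rle C (Rst C h) e" using e(2) h by blast
      then have "e \<cdot> Rst C h = Rst C h" using S [OF h] by (simp add: rle_def)
      then show ?thesis using S [OF h] ty rleD [OF f(2) [OF h]] by (simp add: rle_def)
    qed
  qed (use ty in \<open>auto simp: in_Hom_iff\<close>)
  then have "f \<cdot> e \<cdot> Rst C f = f" by (simp add: rle_def)
  then have "Rst C f = Rst C (f \<cdot> (e \<cdot> Rst C f))" using ty by simp
  also have "\<dots> = Rst C f \<cdot> e"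
    using ty idem rst_comp_rst' [of f e] rst_commute' [of f e] rst_comp_rst' [of e f]
    by (metis assoc cod_rst comp_rst_assoc dom_rst rst_arr)
  also have "\<dots> = e" using lef idem by (simp add: rle_def)
  finally show ?thesis by simp
qed

end

section \<open>Joins of idempotents, equality on covers and glueing of compatible maps\<close>

context join_restriction_category
begin

text \<open>Every member of S is its own restriction, so \<open>is_join_rst\<close> with the join of
  S in both roles shows that this join is an idempotent.\<close>

lemma idems_join:
  assumes "S \<subseteq> rst_idems C a" "a \<in> Ob C"
  obtains e where "is_join C a a S e" "e \<in> rst_idems C a"
proof -
  obtain e where e: "is_join C a a S e"
    using join_exists compatible_idems assms by blast
  have "Rst C ` S = S" using assms(1) by (force simp: rst_idems_iff image_iff)
  then have "e = Rst C e"
    using is_join_rst [of S a a e e] e assms(1) by (auto simp: rst_idems_def)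
  then show thesis using that e by (metis (no_types, lifting) in_Hom_iff is_join_def rst_idems_iff)
qed

lemma join_rst:
  assumes "S \<subseteq> Hom C a b" "is_join C a b S f"
  shows "is_join C a a (Rst C ` S) (Rst C f)"
proof -
  have "a \<in> Ob C" using assms by (auto simp: is_join_def in_Hom_iff)
  moreover have "Rst C ` S \<subseteq> rst_idems C a" using assms(1) by (auto simp: in_Hom_iff rst_in_idems)
  ultimately obtain e where "is_join C a a (Rst C ` S) e" using idems_join by blast
  then show ?thesis using is_join_rst assms by metis
qed

text \<open>Joins are assumed stable under precomposition, whereas here u and v are applied after
  the join d. Both u d and v d turn out to be the join of the common maps u e = v e.\<close>

lemma join_local_eq:
  assumes "E \<subseteq> rst_idems C a" "is_join C a a E d"
    and "u \<in> Hom C a b" "v \<in> Hom C a b" "\<And>e. e \<in> E \<Longrightarrow> u \<cdot> e = v \<cdot> e"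
  shows "u \<cdot> d = v \<cdot> d"
proof -
  have ty: "d \<in> Arr C" "Dom C d = a" "Cod C d = a" "a \<in> Ob C" "b \<in> Ob C"
      "u \<in> Arr C" "Dom C u = a" "Cod C u = b" "v \<in> Arr C" "Dom C v = a" "Cod C v = b"
    using assms(2-4) by (auto simp: in_Hom_iff is_join_def)
  obtain d' where "is_join C a a E d'" "d' \<in> rst_idems C a"
    using idems_join assms ty by blast
  then have d: "d \<in> rst_idems C a" using assms is_join_unique by blast
  have E: "e \<in> rst_idems C a" "d \<cdot> e = e" if "e \<in> E" for e
    using assms that is_joinD(2) [OF assms(2) that] d rle_idem_iff [of e a d] by auto
  define S where "S = (\<lambda>e. u \<cdot> e) ` E"
  \<comment> \<open>For any w agreeing with u on each e: precomposing the join d with the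
    restriction of w shows that f has domain d \<open>Rst C w\<close>, and f lies below w, so f = w
    d. This is used for w = u and for w = v.\<close>
  have *: "w \<cdot> d = f" if w: "w \<in> Hom C a b" "\<And>e. e \<in> E \<Longrightarrow> w \<cdot> e = u \<cdot> e" and f: "is_join C a b S f" for w f
  proof -
    have wt: "w \<in> Arr C" "Dom C w = a" "Cod C w = b" using w by (auto simp: in_Hom_iff)
    have "(\<lambda>e. e \<cdot> Rst C w) ` E = Rst C ` S"
      unfolding S_def image_image
    proof (rule image_cong [OF refl])
      fix e assume e: "e \<in> E"
      have "Rst C (u \<cdot> e) = Rst C w \<cdot> e" using E(1) [OF e] wt w(2) [OF e] rst_comp_idem [of w e] by simp
      then show "e \<cdot> Rst C w = Rst C (u \<cdot> e)"
        using E(1) [OF e] idem_commute [OF _ rst_in_idems] wt by metis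
    qed
    then have "is_join C a a (Rst C ` S) (d \<cdot> Rst C w)"
      using join_comp [OF compatible_idems [OF assms(1)] assms(2), of "Rst C w" a] wt
      by (simp add: in_Hom_iff)
    moreover have S: "S \<subseteq> Hom C a b" unfolding S_def using E(1) ty
      by (auto simp: in_Hom_iff rst_idems_iff)
    ultimately have r: "Rst C f = d \<cdot> Rst C w" using is_join_rst [OF S f] by simp
    have "rle C f w"
    proof (rule is_joinD(3) [OF f w(1)])
      fix h assume "h \<in> S"
      then obtain e where e: "e \<in> E" "h = w \<cdot> e" using w(2) by (auto simp: S_def)
      then show "rle C h w" using rle_comp_idem wt E by auto
    qed
    then have "f = w \<cdot> (d \<cdot> Rst C w)" using r by (simp add: rle_def)
    also have "\<dots> = w \<cdot> (Rst C w \<cdot> d)" using idem_commute [OF d rst_in_idems] wt by simp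
    also have "\<dots> = w \<cdot> d" using wt ty by simp
    finally show ?thesis by simp
  qed
  have "rle C (u \<cdot> e) u" if "e \<in> E" for e using rle_comp_idem E(1) [OF that] ty by auto
  then have "compatible_family C a b S"
    unfolding compatible_family_def S_def using assms(3) E(1) ty
    by (auto simp: in_Hom_iff rst_idems_iff intro!: rle_compatible [of _ u _ a b])
  then obtain f where "is_join C a b S f" using join_exists ty by blast
  then show ?thesis using * [OF assms(3)] * [OF assms(4)] assms(5) by metis
qed

text \<open>The maps \<open>h i\<close> restricted to \<open>e i\<close> are pairwise compatible by
  the third hypothesis, and u is their join. The proviso in the conclusion says that
  \<open>h i\<close> is defined on all of \<open>e i\<close>; it identifies the restriction of
  \<open>h i \<cdot> e i\<close> with \<open>e i\<close>.\<close>

lemma join_glue: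
  assumes "\<And>i. i \<in> I \<Longrightarrow> h i \<in> Hom C a b" "\<And>i. i \<in> I \<Longrightarrow> e i \<in> rst_idems C a"
    and "\<And>i j. i \<in> I \<Longrightarrow> j \<in> I \<Longrightarrow> h i \<cdot> (e i \<cdot> e j) = h j \<cdot> (e i \<cdot> e j)"
    and "a \<in> Ob C" "b \<in> Ob C"
  obtains u where "u \<in> Hom C a b" "\<And>i. i \<in> I \<Longrightarrow> Rst C (h i) \<cdot> e i = e i \<Longrightarrow> u \<cdot> e i = h i \<cdot> e i"
proof -
  have ty: "h i \<in> Arr C" "Dom C (h i) = a" "Cod C (h i) = b"
      "e i \<in> Arr C" "Dom C (e i) = a" "Cod C (e i) = a" "Rst C (e i) = e i" if "i \<in> I" for i
    using assms(1,2) that by (auto simp: in_Hom_iff rst_idems_iff)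
  have r: "Rst C (h i \<cdot> e i) = Rst C (h i) \<cdot> e i" if "i \<in> I" for i
    using rst_comp_idem [of "h i" "e i"] assms(2) ty that by simp
  have "compatible_family C a b ((\<lambda>i. h i \<cdot> e i) ` I)"
    unfolding compatible_family_def
  proof (intro conjI ballI)
    fix f g assume "f \<in> (\<lambda>i. h i \<cdot> e i) ` I" "g \<in> (\<lambda>i. h i \<cdot> e i) ` I"
    then obtain i j where ij: "i \<in> I" "j \<in> I" "f = h i \<cdot> e i" "g = h j \<cdot> e j" by auto
    \<comment> \<open>All idempotents are moved to the right, where they form a product symmetric in
      i and j. Compatibility of the two restricted maps then comes from the agreement of
      \<open>h i\<close> and \<open>h j\<close> on \<open>e i \<cdot> e j\<close>.\<close>
    have 1: "h i \<cdot> e i \<cdot> (Rst C (h j) \<cdot> e j) = h i \<cdot> (e i \<cdot> e j) \<cdot> (Rst C (h i) \<cdot> Rst C (h j))"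
      if "i \<in> I" "j \<in> I" for i j
    proof -
      have c: "e j \<cdot> Rst C (h j) = Rst C (h j) \<cdot> e j"
          "e i \<cdot> (e j \<cdot> Rst C (h i)) = Rst C (h i) \<cdot> (e i \<cdot> e j)"
        using idem_commute [OF assms(2) rst_in_idems] idem_comp [OF assms(2) assms(2)]
          idem_commute [OF idem_comp [OF assms(2) assms(2)] rst_in_idems] ty that
        by (metis, metis assoc cod_rst rst_arr)
      have "h i \<cdot> (e i \<cdot> e j) \<cdot> (Rst C (h i) \<cdot> Rst C (h j))
          = h i \<cdot> ((e i \<cdot> (e j \<cdot> Rst C (h i))) \<cdot> Rst C (h j))"
        using that by (simp add: ty)
      also have "\<dots> = h i \<cdot> (e i \<cdot> (e j \<cdot> Rst C (h j)))"
        unfolding c(2) using that by (simp add: ty)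
      finally show ?thesis unfolding c(1) using that by (simp add: ty)
    qed
    have "e i \<cdot> e j = e j \<cdot> e i" using idem_commute assms(2) ij by blast
    then show "compatible C f g"
      unfolding compatible_def ij(3,4) r [OF ij(1)] r [OF ij(2)] 1 [OF ij(1,2)] 1 [OF ij(2,1)]
      using assms(3) [OF ij(1,2)] rst_commute' [of "h i" "h j"] ij by (simp add: ty del: assoc)
  qed (auto simp: in_Hom_iff ty)
  then obtain u where u: "is_join C a b ((\<lambda>i. h i \<cdot> e i) ` I) u"
    using join_exists assms(4,5) by blast
  have "u \<cdot> e i = h i \<cdot> e i" if "i \<in> I" "Rst C (h i) \<cdot> e i = e i" for i
    using is_joinD(2) [OF u, of "h i \<cdot> e i"] that r [of i] by (simp add: rle_def)
  then show thesis using that u is_joinD(1) [OF u] by blast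
qed

end

section \<open>Pullbacks\<close>

text \<open>\<open>proj1\<close>, \<open>proj2\<close> and \<open>pairing\<close> are chosen for
  every cospan; this is the hypothesis under which the choices have their universal property, in a
  form that can guard simplification rules.\<close>

definition has_pb :: "('o, 'm, 'z) category_scheme \<Rightarrow> 'm \<Rightarrow> 'm \<Rightarrow> bool" where
  "has_pb C f g \<longleftrightarrow> (\<exists>p q. is_pullback C f g p q)"

context category
begin

lemma chosen_pullback:
  assumes "has_pb C f g"
  shows "is_pullback C f g (proj1 C f g) (proj2 C f g)"
proof -
  have "case chosen_pb C f g of (p, q) \<Rightarrow> is_pullback C f g p q"
    unfolding chosen_pb_def using assms by (intro someI_ex [of "\<lambda>(p, q). is_pullback C f g p q"])
      (auto simp: has_pb_def)
  then show ?thesis by (simp add: proj1_def proj2_def case_prod_beta)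
qed

lemma
  assumes "has_pb C f g"
  shows proj1_arr [simp]: "proj1 C f g \<in> Arr C"
    and dom_proj1 [simp]: "Dom C (proj1 C f g) = pb_ob C f g"
    and cod_proj1 [simp]: "Cod C (proj1 C f g) = Dom C f"
    and proj2_arr [simp]: "proj2 C f g \<in> Arr C"
    and dom_proj2 [simp]: "Dom C (proj2 C f g) = pb_ob C f g"
    and cod_proj2 [simp]: "Cod C (proj2 C f g) = Dom C g"
    and pb_square: "f \<cdot> proj1 C f g = g \<cdot> proj2 C f g"
    and pb_arr1: "f \<in> Arr C" and pb_arr2: "g \<in> Arr C" and pb_cod: "Cod C f = Cod C g"
  using chosen_pullback [OF assms] by (auto simp: is_pullback_def in_Hom_iff pb_ob_def)

lemma pb_ob_ob [simp]: "has_pb C f g \<Longrightarrow> pb_ob C f g \<in> Ob C"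
  using dom_ob [of "proj1 C f g"] by simp

lemma pb_ex1:
  assumes "has_pb C f g" "u \<in> Hom C Z (Dom C f)" "v \<in> Hom C Z (Dom C g)" "f \<cdot> u = g \<cdot> v"
  shows "\<exists>!w. w \<in> Hom C Z (pb_ob C f g) \<and> proj1 C f g \<cdot> w = u \<and> proj2 C f g \<cdot> w = v"
  using chosen_pullback [OF assms(1)] assms unfolding is_pullback_def pb_ob_def by blast

lemma
  assumes "has_pb C f g" "u \<in> Arr C" "v \<in> Arr C" "Cod C u = Dom C f" "Cod C v = Dom C g"
    "Dom C u = Dom C v" "f \<cdot> u = g \<cdot> v"
  shows pairing_arr [simp]: "pairing C f g u v \<in> Arr C"
    and dom_pairing [simp]: "Dom C (pairing C f g u v) = Dom C v"
    and cod_pairing [simp]: "Cod C (pairing C f g u v) = pb_ob C f g"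
    and proj1_pairing [simp]: "proj1 C f g \<cdot> pairing C f g u v = u"
    and proj2_pairing [simp]: "proj2 C f g \<cdot> pairing C f g u v = v"
proof -
  have "pairing C f g u v \<in> Hom C (Dom C u) (pb_ob C f g) \<and>
      proj1 C f g \<cdot> pairing C f g u v = u \<and> proj2 C f g \<cdot> pairing C f g u v = v"
    unfolding pairing_def
    by (rule theI') (use pb_ex1 [of f g u "Dom C u" v] assms in \<open>simp add: in_Hom_iff\<close>)
  then show "pairing C f g u v \<in> Arr C" "Dom C (pairing C f g u v) = Dom C v"
    "Cod C (pairing C f g u v) = pb_ob C f g" "proj1 C f g \<cdot> pairing C f g u v = u"
    "proj2 C f g \<cdot> pairing C f g u v = v"
    using assms(6) by (auto simp: in_Hom_iff)
qed

lemma pb_eqI: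
  assumes "has_pb C f g" "w \<in> Arr C" "w' \<in> Arr C" "Dom C w = Dom C w'"
    "Cod C w = pb_ob C f g" "Cod C w' = pb_ob C f g"
    "proj1 C f g \<cdot> w = proj1 C f g \<cdot> w'" "proj2 C f g \<cdot> w = proj2 C f g \<cdot> w'"
  shows "w = w'"
proof -
  have "f \<cdot> (proj1 C f g \<cdot> w) = g \<cdot> (proj2 C f g \<cdot> w)"
    using assms(1,2,5) pb_square [OF assms(1)] pb_arr1 [OF assms(1)] pb_arr2 [OF assms(1)]
      pb_cod [OF assms(1)] by (intro comp_reduce2) auto
  then have "\<exists>!z. z \<in> Hom C (Dom C w) (pb_ob C f g) \<and>
      proj1 C f g \<cdot> z = proj1 C f g \<cdot> w \<and> proj2 C f g \<cdot> z = proj2 C f g \<cdot> w"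
    using assms by (intro pb_ex1) (auto simp: in_Hom_iff)
  then show ?thesis using assms by (metis in_Hom_iff)
qed

text \<open>Naturality of the universal property in the apex of the cone: composing with k
  substitutes into both components, so composition acts as substitution into elements of a
  pullback.\<close>

lemma pairing_comp:
  assumes "has_pb C f g" "u \<in> Arr C" "v \<in> Arr C" "Cod C u = Dom C f" "Cod C v = Dom C g"
    "Dom C u = Dom C v" "f \<cdot> u = g \<cdot> v" "k \<in> Arr C" "Cod C k = Dom C v"
  shows "pairing C f g u v \<cdot> k = pairing C f g (u \<cdot> k) (v \<cdot> k)"
proof -
  have sq: "f \<cdot> (u \<cdot> k) = g \<cdot> (v \<cdot> k)"
    using assms pb_arr1 [OF assms(1)] pb_arr2 [OF assms(1)] pb_cod [OF assms(1)]
    by (intro comp_reduce2) auto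
  show ?thesis
    by (rule pb_eqI [OF assms(1)])
      (use assms sq comp_reduce [OF proj1_pairing [OF assms(1-7)]]
      comp_reduce [OF proj2_pairing [OF assms(1-7)]] in auto)
qed

lemma pairing_proj:
  assumes "has_pb C f g"
  shows "pairing C f g (proj1 C f g) (proj2 C f g) = Ide C (pb_ob C f g)"
  by (rule pb_eqI [OF assms]) (use assms pb_square [OF assms] in auto)

end

context restriction_category
begin

text \<open>From f p = g q with f and g total, both projections p and q have the same restriction.
  Precomposing with it changes neither projection, so by the uniqueness clause of the pullback it is
  the identity.\<close>

lemma
  assumes "has_pb C f g" "total C f" "total C g"
  shows total_proj1 [simp]: "total C (proj1 C f g)" and total_proj2 [simp]: "total C (proj2 C f g)"
proof -
  let ?p = "proj1 C f g" and ?q = "proj2 C f g"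
  note fg = pb_arr1 [OF assms(1)] pb_arr2 [OF assms(1)]
  have eq: "Rst C ?p = Rst C ?q"
    using pb_square [OF assms(1)] rst_total_comp [of f ?p] rst_total_comp [of g ?q] assms fg by simp
  have q: "?q \<cdot> Rst C ?p = ?q" using assms(1) unfolding eq by simp
  have "Rst C ?p = Ide C (pb_ob C f g)" by (rule pb_eqI [OF assms(1)]) (use assms(1) q in auto)
  then show "total C ?p" "total C ?q" using eq assms(1) by (auto simp: total_def)
qed

lemma rst_cone:
  assumes "f \<in> Arr C" "g \<in> Arr C" "u \<in> Arr C" "v \<in> Arr C" "Cod C u = Dom C f" "Cod C v = Dom C g"
    "f \<cdot> u = g \<cdot> v" "total C f" "total C g"
  shows "Rst C u = Rst C v"
  using rst_total_comp [of f u] rst_total_comp [of g v] assms by simp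

end

section \<open>Partite internal categories in terms of generalized elements\<close>

text \<open>\<open>mult C A i j k b a\<close> is the composite of generalized elements \<open>a\<close> of \<open>A\<^sub>i\<^sub>j\<close> and \<open>b\<close> of
  \<open>A\<^sub>j\<^sub>k\<close>. In these terms the axioms on nested pullbacks become the equations of a category.\<close>

definition mult ::
  "('o, 'm) rcategory \<Rightarrow> ('i, 'o, 'm) partite \<Rightarrow> 'i \<Rightarrow> 'i \<Rightarrow> 'i \<Rightarrow> 'm \<Rightarrow> 'm \<Rightarrow> 'm" where
  "mult C A i j k b a = Mul A i j k \<cdot>\<^bsub>C\<^esub> pairing C (Src A j k) (Tgt A i j) b a"

locale partite = restriction_category C + partite_internal_category C A
  for C :: "('o, 'm) rcategory" (structure) and A :: "('i, 'o, 'm) partite"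
begin

declare vtx_ob [simp] edg_ob [simp] src_total [simp] tgt_total [simp] src_unt [simp] tgt_unt [simp]

lemma
  assumes "i \<in> Idx A" "j \<in> Idx A"
  shows src_arr [simp]: "Src A i j \<in> Arr C" and dom_src [simp]: "Dom C (Src A i j) = Edg A i j"
    and cod_src [simp]: "Cod C (Src A i j) = Vtx A i"
    and tgt_arr [simp]: "Tgt A i j \<in> Arr C" and dom_tgt [simp]: "Dom C (Tgt A i j) = Edg A i j"
    and cod_tgt [simp]: "Cod C (Tgt A i j) = Vtx A j"
  using src_hom [OF assms] tgt_hom [OF assms] by (auto simp: in_Hom_iff)

lemma
  assumes "i \<in> Idx A"
  shows unt_arr [simp]: "Unt A i \<in> Arr C" and dom_unt [simp]: "Dom C (Unt A i) = Vtx A i"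
    and cod_unt [simp]: "Cod C (Unt A i) = Edg A i i"
  using unt_hom [OF assms] by (auto simp: in_Hom_iff)

lemma
  assumes "i \<in> Idx A" "j \<in> Idx A" "k \<in> Idx A"
  shows mul_arr [simp]: "Mul A i j k \<in> Arr C"
    and dom_mul [simp]: "Dom C (Mul A i j k) = pb_ob C (Src A j k) (Tgt A i j)"
    and cod_mul [simp]: "Cod C (Mul A i j k) = Edg A i k"
  using mul_hom [OF assms] by (auto simp: in_Hom_iff)

lemma has_pb_src: "i \<in> Idx A \<Longrightarrow> j \<in> Idx A \<Longrightarrow> g \<in> Arr C \<Longrightarrow> Cod C g = Vtx A i \<Longrightarrow> total C g \<Longrightarrow>
    has_pb C (Src A i j) g"
  using src_pullback [of i j g "Dom C g"] by (auto simp: has_pb_def in_Hom_iff)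

lemma has_pb_tgt [simp]: "i \<in> Idx A \<Longrightarrow> j \<in> Idx A \<Longrightarrow> k \<in> Idx A \<Longrightarrow> has_pb C (Src A j k) (Tgt A i j)"
  by (rule has_pb_src) auto

lemma total_unt [simp]: "i \<in> Idx A \<Longrightarrow> total C (Unt A i)"
  by (rule total_cancel [of "Src A i i"]) auto

lemma src_unt_comp [simp]: "i \<in> Idx A \<Longrightarrow> x \<in> Arr C \<Longrightarrow> Cod C x = Vtx A i \<Longrightarrow> Src A i i \<cdot> (Unt A i \<cdot> x) = x"
  by (subst comp_reduce [OF src_unt]) auto

lemma tgt_unt_comp [simp]: "i \<in> Idx A \<Longrightarrow> x \<in> Arr C \<Longrightarrow> Cod C x = Vtx A i \<Longrightarrow> Tgt A i i \<cdot> (Unt A i \<cdot> x) = x"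
  by (subst comp_reduce [OF tgt_unt]) auto

text \<open>The domain of a product can be read off from its source: the source maps are total and
  the source of the product is that of a, which gives \<open>rst_mult\<close>.\<close>

lemma
  assumes "i \<in> Idx A" "j \<in> Idx A" "k \<in> Idx A" "a \<in> Arr C" "b \<in> Arr C"
    "Cod C a = Edg A i j" "Cod C b = Edg A j k" "Dom C b = Dom C a" "Src A j k \<cdot> b = Tgt A i j \<cdot> a"
  shows mult_arr [simp]: "mult C A i j k b a \<in> Arr C"
    and dom_mult [simp]: "Dom C (mult C A i j k b a) = Dom C a"
    and cod_mult [simp]: "Cod C (mult C A i j k b a) = Edg A i k"
    and src_mult: "Src A i k \<cdot> mult C A i j k b a = Src A i j \<cdot> a"
    and tgt_mult: "Tgt A i k \<cdot> mult C A i j k b a = Tgt A j k \<cdot> b"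
    and rst_mult: "Rst C (mult C A i j k b a) = Rst C a"
    and mult_comp: "x \<in> Arr C \<Longrightarrow> Cod C x = Dom C a \<Longrightarrow>
      mult C A i j k b a \<cdot> x = mult C A i j k (b \<cdot> x) (a \<cdot> x)"
proof -
  let ?p = "pairing C (Src A j k) (Tgt A i j) b a"
  have p: "?p \<in> Arr C" "Dom C ?p = Dom C a" "Cod C ?p = pb_ob C (Src A j k) (Tgt A i j)"
    "proj1 C (Src A j k) (Tgt A i j) \<cdot> ?p = b" "proj2 C (Src A j k) (Tgt A i j) \<cdot> ?p = a"
    using assms by auto
  show 1: "mult C A i j k b a \<in> Arr C" "Dom C (mult C A i j k b a) = Dom C a"
    "Cod C (mult C A i j k b a) = Edg A i k"
    using assms p by (auto simp: mult_def)
  show s: "Src A i k \<cdot> mult C A i j k b a = Src A i j \<cdot> a"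
    unfolding mult_def using assms p comp_reduce2 [OF src_mul [OF assms(1-3)], of ?p] by simp
  show "Tgt A i k \<cdot> mult C A i j k b a = Tgt A j k \<cdot> b"
    unfolding mult_def using assms p comp_reduce2 [OF tgt_mul [OF assms(1-3)], of ?p] by simp
  show "Rst C (mult C A i j k b a) = Rst C a"
    using rst_total_comp [of "Src A i k" "mult C A i j k b a"]
      rst_total_comp [of "Src A i j" a] s 1 assms by simp
  show "mult C A i j k b a \<cdot> x = mult C A i j k (b \<cdot> x) (a \<cdot> x)"
    if "x \<in> Arr C" "Cod C x = Dom C a"
    unfolding mult_def
    using that p assms pairing_comp [of "Src A j k" "Tgt A i j" b a x] by simp
qed

text \<open>The axiom is this law at the generic element, the identity of \<open>Edg A i j\<close>;
  precomposition with a gives it for all elements.\<close>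

lemma mult_unt:
  assumes "i \<in> Idx A" "j \<in> Idx A" "a \<in> Arr C" "Cod C a = Edg A i j"
  shows "mult C A i i j a (Unt A i \<cdot> (Src A i j \<cdot> a)) = a"
proof -
  have "mult C A i i j (Ide C (Edg A i j)) (Unt A i \<cdot> Src A i j) \<cdot> a = Ide C (Edg A i j) \<cdot> a"
    unfolding mult_def using mul_unt assms by simp
  then show ?thesis using assms by (subst (asm) mult_comp) auto
qed

lemma unt_mult:
  assumes "i \<in> Idx A" "j \<in> Idx A" "a \<in> Arr C" "Cod C a = Edg A i j"
  shows "mult C A i j j (Unt A j \<cdot> (Tgt A i j \<cdot> a)) a = a"
proof -
  have "mult C A i j j (Unt A j \<cdot> Tgt A i j) (Ide C (Edg A i j)) \<cdot> a = Ide C (Edg A i j) \<cdot> a"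
    unfolding mult_def using unt_mul assms by simp
  then show ?thesis using assms by (subst (asm) mult_comp) auto
qed

text \<open>The axiom is the law at the generic composable triple, given by the projections of the
  iterated pullback. Any triple (c, b, a) factors through it by the map \<open>?r\<close> that it
  induces.\<close>

lemma mult_assoc:
  assumes "i \<in> Idx A" "j \<in> Idx A" "k \<in> Idx A" "l \<in> Idx A" "a \<in> Arr C" "b \<in> Arr C" "c \<in> Arr C"
    "Cod C a = Edg A i j" "Cod C b = Edg A j k" "Cod C c = Edg A k l"
    "Dom C b = Dom C a" "Dom C c = Dom C a"
    "Src A j k \<cdot> b = Tgt A i j \<cdot> a" "Src A k l \<cdot> c = Tgt A j k \<cdot> b"
  shows "mult C A i k l c (mult C A i j k b a) = mult C A i j l (mult C A j k l c b) a"
proof -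
  let ?p1 = "proj1 C (Src A j k) (Tgt A i j)" and ?p2 = "proj2 C (Src A j k) (Tgt A i j)"
  let ?t = "Tgt A j k \<cdot> ?p1"
  let ?r1 = "proj1 C (Src A k l) ?t" and ?r2 = "proj2 C (Src A k l) ?t"
  let ?w = "pairing C (Src A j k) (Tgt A i j) b a"
  let ?r = "pairing C (Src A k l) ?t c ?w"
  note idx = assms(1-4)
  have pb: "has_pb C (Src A k l) ?t" using idx by (intro has_pb_src) auto
  have w: "?w \<in> Arr C" "Dom C ?w = Dom C a" "Cod C ?w = pb_ob C (Src A j k) (Tgt A i j)"
    "?p1 \<cdot> ?w = b" "?p2 \<cdot> ?w = a"
    using assms by auto
  have r: "?r \<in> Arr C" "Dom C ?r = Dom C a" "Cod C ?r = pb_ob C (Src A k l) ?t"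
    "?r1 \<cdot> ?r = c" "?r2 \<cdot> ?r = ?w"
    using assms pb w by auto
  have sq1: "Src A j k \<cdot> (?p1 \<cdot> ?r2) = Tgt A i j \<cdot> (?p2 \<cdot> ?r2)"
    using idx pb by (intro comp_reduce2 pb_square) auto
  have sq2: "Src A k l \<cdot> ?r1 = Tgt A j k \<cdot> (?p1 \<cdot> ?r2)"
    using idx pb pb_square [OF pb] by simp
  have r2: "Mul A i j k \<cdot> ?r2 = mult C A i j k (?p1 \<cdot> ?r2) (?p2 \<cdot> ?r2)"
    unfolding mult_def
    using pairing_comp [of "Src A j k" "Tgt A i j" ?p1 ?p2 ?r2] idx pb pairing_proj pb_square
    by simp
  have gen: "mult C A i k l ?r1 (mult C A i j k (?p1 \<cdot> ?r2) (?p2 \<cdot> ?r2))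
      = mult C A i j l (mult C A j k l ?r1 (?p1 \<cdot> ?r2)) (?p2 \<cdot> ?r2)"
    using mul_assoc [OF idx] by (simp only: mul_associative_def Let_def r2) (simp add: mult_def)
  \<comment> \<open>Both bracketings commute with substitution, so precomposing \<open>gen\<close>
    with \<open>?r\<close> replaces the generic triple by (c, b, a).\<close>
  have subst: "mult C A i k l (c' \<cdot> r) (mult C A i j k (b' \<cdot> r) (a' \<cdot> r))
      = mult C A i k l c' (mult C A i j k b' a') \<cdot> r"
    "mult C A i j l (mult C A j k l (c' \<cdot> r) (b' \<cdot> r)) (a' \<cdot> r)
      = mult C A i j l (mult C A j k l c' b') a' \<cdot> r"
    if "a' \<in> Arr C" "b' \<in> Arr C" "c' \<in> Arr C" "Cod C a' = Edg A i j" "Cod C b' = Edg A j k"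
      "Cod C c' = Edg A k l" "Dom C b' = Dom C a'" "Dom C c' = Dom C a'" "r \<in> Arr C" "Cod C r = Dom C a'"
      "Src A j k \<cdot> b' = Tgt A i j \<cdot> a'" "Src A k l \<cdot> c' = Tgt A j k \<cdot> b'" for a' b' c' r
    using idx that by (simp_all add: mult_comp src_mult tgt_mult)
  have ty: "?p1 \<cdot> ?r2 \<in> Arr C" "?p2 \<cdot> ?r2 \<in> Arr C" "?r1 \<in> Arr C" "Cod C (?p2 \<cdot> ?r2) = Edg A i j"
      "Cod C (?p1 \<cdot> ?r2) = Edg A j k" "Cod C ?r1 = Edg A k l" "Dom C (?p1 \<cdot> ?r2) = Dom C (?p2 \<cdot> ?r2)"
      "Dom C ?r1 = Dom C (?p2 \<cdot> ?r2)" "Cod C ?r = Dom C (?p2 \<cdot> ?r2)"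
    using idx pb r(3) by auto
  have cr: "(?p1 \<cdot> ?r2) \<cdot> ?r = b" "(?p2 \<cdot> ?r2) \<cdot> ?r = a" using idx pb w r by auto
  note subst [OF ty(2,1,3-8) r(1) ty(9) sq1 sq2, unfolded cr r(4)]
  then show ?thesis using gen by simp
qed

end

text \<open>The element laws are instantiated at identities for the unit axioms and at the
  projections of the iterated pullback for associativity. Candidates can thus be verified without
  handling nested pullbacks.\<close>

lemma (in restriction_category) partite_internal_categoryI:
  assumes "\<And>i. i \<in> Idx A \<Longrightarrow> Vtx A i \<in> Ob C"
    and src: "\<And>i j. i \<in> Idx A \<Longrightarrow> j \<in> Idx A \<Longrightarrow> Src A i j \<in> Hom C (Edg A i j) (Vtx A i)"
    and "\<And>i j. i \<in> Idx A \<Longrightarrow> j \<in> Idx A \<Longrightarrow> total C (Src A i j)"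
    and pb: "\<And>i j g. i \<in> Idx A \<Longrightarrow> j \<in> Idx A \<Longrightarrow> g \<in> Arr C \<Longrightarrow> Cod C g = Vtx A i \<Longrightarrow> total C g \<Longrightarrow>
          has_pb C (Src A i j) g"
    and tgt: "\<And>i j. i \<in> Idx A \<Longrightarrow> j \<in> Idx A \<Longrightarrow> Tgt A i j \<in> Hom C (Edg A i j) (Vtx A j)"
    and tot: "\<And>i j. i \<in> Idx A \<Longrightarrow> j \<in> Idx A \<Longrightarrow> total C (Tgt A i j)"
    and unt: "\<And>i. i \<in> Idx A \<Longrightarrow> Unt A i \<in> Hom C (Vtx A i) (Edg A i i)"
    and "\<And>i. i \<in> Idx A \<Longrightarrow> Src A i i \<cdot> Unt A i = Ide C (Vtx A i)"
    and "\<And>i. i \<in> Idx A \<Longrightarrow> Tgt A i i \<cdot> Unt A i = Ide C (Vtx A i)"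
    and mul: "\<And>i j k. i \<in> Idx A \<Longrightarrow> j \<in> Idx A \<Longrightarrow> k \<in> Idx A \<Longrightarrow>
          Mul A i j k \<in> Hom C (pb_ob C (Src A j k) (Tgt A i j)) (Edg A i k)"
    and "\<And>i j k. i \<in> Idx A \<Longrightarrow> j \<in> Idx A \<Longrightarrow> k \<in> Idx A \<Longrightarrow>
          Src A i k \<cdot> Mul A i j k = Src A i j \<cdot> proj2 C (Src A j k) (Tgt A i j)"
    and "\<And>i j k. i \<in> Idx A \<Longrightarrow> j \<in> Idx A \<Longrightarrow> k \<in> Idx A \<Longrightarrow>
          Tgt A i k \<cdot> Mul A i j k = Tgt A j k \<cdot> proj1 C (Src A j k) (Tgt A i j)"
    and mu: "\<And>i j a. i \<in> Idx A \<Longrightarrow> j \<in> Idx A \<Longrightarrow> a \<in> Arr C \<Longrightarrow> Cod C a = Edg A i j \<Longrightarrow>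
          mult C A i i j a (Unt A i \<cdot> (Src A i j \<cdot> a)) = a"
    and um: "\<And>i j a. i \<in> Idx A \<Longrightarrow> j \<in> Idx A \<Longrightarrow> a \<in> Arr C \<Longrightarrow> Cod C a = Edg A i j \<Longrightarrow>
          mult C A i j j (Unt A j \<cdot> (Tgt A i j \<cdot> a)) a = a"
    and as: "\<And>i j k l a b c. i \<in> Idx A \<Longrightarrow> j \<in> Idx A \<Longrightarrow> k \<in> Idx A \<Longrightarrow> l \<in> Idx A \<Longrightarrow>
          a \<in> Arr C \<Longrightarrow> b \<in> Arr C \<Longrightarrow> c \<in> Arr C \<Longrightarrow>
          Cod C a = Edg A i j \<Longrightarrow> Cod C b = Edg A j k \<Longrightarrow> Cod C c = Edg A k l \<Longrightarrow>
          Dom C b = Dom C a \<Longrightarrow> Dom C c = Dom C a \<Longrightarrow>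
          Src A j k \<cdot> b = Tgt A i j \<cdot> a \<Longrightarrow> Src A k l \<cdot> c = Tgt A j k \<cdot> b \<Longrightarrow>
          mult C A i k l c (mult C A i j k b a) = mult C A i j l (mult C A j k l c b) a"
  shows "partite_internal_category C A"
proof
  show edg: "Edg A i j \<in> Ob C" if "i \<in> Idx A" "j \<in> Idx A" for i j
    using src [OF that] by (metis in_Hom_iff dom_ob)
  note ty = src [simplified in_Hom_iff] tgt [simplified in_Hom_iff] unt [simplified in_Hom_iff]
    mul [simplified in_Hom_iff]
  show "\<exists>p q. is_pullback C (Src A i j) g p q"
    if "i \<in> Idx A" "j \<in> Idx A" "g \<in> Hom C z (Vtx A i)" "total C g" for i j g z
    using pb [of i j g] that by (auto simp: has_pb_def in_Hom_iff)
  show "Mul A i i j \<cdot> pairing C (Src A i j) (Tgt A i i) (Ide C (Edg A i j)) (Unt A i \<cdot> Src A i j)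
            = Ide C (Edg A i j)" if "i \<in> Idx A" "j \<in> Idx A" for i j
    using mu [of i j "Ide C (Edg A i j)"] that ty edg by (simp add: mult_def)
  show "Mul A i j j \<cdot> pairing C (Src A j j) (Tgt A i j) (Unt A j \<cdot> Tgt A i j) (Ide C (Edg A i j))
            = Ide C (Edg A i j)" if "i \<in> Idx A" "j \<in> Idx A" for i j
    using um [of i j "Ide C (Edg A i j)"] that ty edg by (simp add: mult_def)
  show "mul_associative C A i j k l" if idx: "i \<in> Idx A" "j \<in> Idx A" "k \<in> Idx A" "l \<in> Idx A" for i j k l
  proof -
    let ?p1 = "proj1 C (Src A j k) (Tgt A i j)" and ?p2 = "proj2 C (Src A j k) (Tgt A i j)"
    let ?t = "Tgt A j k \<cdot> ?p1"
    let ?r1 = "proj1 C (Src A k l) ?t" and ?r2 = "proj2 C (Src A k l) ?t"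
    have pb1: "has_pb C (Src A j k) (Tgt A i j)" using idx ty tot by (intro pb) auto
    have pb2: "has_pb C (Src A k l) ?t" using idx ty tot pb1 assms(3) by (intro pb) auto
    have sq1: "Src A j k \<cdot> (?p1 \<cdot> ?r2) = Tgt A i j \<cdot> (?p2 \<cdot> ?r2)"
      using idx pb1 pb2 ty by (intro comp_reduce2 pb_square) auto
    have sq2: "Src A k l \<cdot> ?r1 = Tgt A j k \<cdot> (?p1 \<cdot> ?r2)"
      using idx pb1 pb2 ty pb_square [OF pb2] by simp
    have r2: "Mul A i j k \<cdot> ?r2 = mult C A i j k (?p1 \<cdot> ?r2) (?p2 \<cdot> ?r2)"
      unfolding mult_def
      using pairing_comp [of "Src A j k" "Tgt A i j" ?p1 ?p2 ?r2] idx pb1 pb2 pairing_proj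
        pb_square [OF pb1] ty by simp
    show ?thesis
      unfolding mul_associative_def Let_def r2
      using as [OF idx, of "?p2 \<cdot> ?r2" "?p1 \<cdot> ?r2" ?r1] idx pb1 pb2 ty sq1 sq2
      by (simp add: mult_def)
  qed
qed (use assms in auto)

section \<open>The restriction category of partial sections\<close>

lemma in_partial_sections:
  "s \<in> partial_sections C p \<longleftrightarrow>
    s \<in> Arr C \<and> Dom C s = Cod C p \<and> Cod C s = Dom C p \<and> p \<cdot>\<^bsub>C\<^esub> s = Rst C s"
  by (auto simp: partial_sections_def in_Hom_iff)

text \<open>Composition in \<open>Phi_cat\<close> in terms of elements. The section s is cut down to
  the part where t after the target of s is defined, since the two arguments of \<open>mult\<close>
  must have the same domain.\<close>

definition sec_comp ::
  "('o, 'm) rcategory \<Rightarrow> ('i, 'o, 'm) partite \<Rightarrow> 'i \<Rightarrow> 'i \<Rightarrow> 'i \<Rightarrow> 'm \<Rightarrow> 'm \<Rightarrow> 'm" where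
  "sec_comp C A i j k t s =
    mult C A i j k (t \<cdot>\<^bsub>C\<^esub> (Tgt A i j \<cdot>\<^bsub>C\<^esub> s)) (s \<cdot>\<^bsub>C\<^esub> Rst C (t \<cdot>\<^bsub>C\<^esub> (Tgt A i j \<cdot>\<^bsub>C\<^esub> s)))"

context restriction_category
begin

text \<open>The second component arises by moving \<open>Rst C (t \<cdot> f)\<close> past s with the
  axiom \<open>rst_comp\<close>.\<close>

lemma pb_section_comp:
  assumes "has_pb C p f" "t \<in> partial_sections C p" "s \<in> Arr C" "Cod C s = Dom C f"
  shows "pb_section C p f t \<in> Arr C" "Dom C (pb_section C p f t) = Dom C f"
    "Cod C (pb_section C p f t) = pb_ob C p f"
    "pb_section C p f t \<cdot> s = pairing C p f (t \<cdot> (f \<cdot> s)) (s \<cdot> Rst C (t \<cdot> (f \<cdot> s)))"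
proof -
  note ty = pb_arr1 [OF assms(1)] pb_arr2 [OF assms(1)] pb_cod [OF assms(1)]
  have t: "t \<in> Arr C" "Dom C t = Cod C p" "Cod C t = Dom C p" "p \<cdot> t = Rst C t"
    using assms(2) by (auto simp: in_partial_sections)
  have sq: "p \<cdot> (t \<cdot> f) = f \<cdot> Rst C (t \<cdot> f)"
    using comp_reduce [OF t(4), of f] t ty rst_comp' [of f t] by simp
  show "pb_section C p f t \<in> Arr C" "Dom C (pb_section C p f t) = Dom C f"
    "Cod C (pb_section C p f t) = pb_ob C p f"
    unfolding pb_section_def using assms t ty sq by auto
  show "pb_section C p f t \<cdot> s = pairing C p f (t \<cdot> (f \<cdot> s)) (s \<cdot> Rst C (t \<cdot> (f \<cdot> s)))"
    unfolding pb_section_def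
    using assms t ty sq rst_comp' [of s "t \<cdot> f"] by (subst pairing_comp) auto
qed

end

context partite
begin

lemma
  assumes "i \<in> Idx A" "j \<in> Idx A" "s \<in> partial_sections C (Src A i j)"
  shows sec_arr: "s \<in> Arr C" and dom_sec: "Dom C s = Vtx A i" and cod_sec: "Cod C s = Edg A i j"
    and src_sec: "Src A i j \<cdot> s = Rst C s"
  using assms by (auto simp: in_partial_sections)

lemmas sec = sec_arr dom_sec cod_sec src_sec

lemma
  assumes "i \<in> Idx A" "j \<in> Idx A" "k \<in> Idx A"
    "s \<in> partial_sections C (Src A i j)" "t \<in> partial_sections C (Src A j k)"
  shows sec_comp_eq:
      "Mul A i j k \<cdot> pb_section C (Src A j k) (Tgt A i j) t \<cdot> s = sec_comp C A i j k t s"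
    and sec_comp_square:
      "Src A j k \<cdot> (t \<cdot> (Tgt A i j \<cdot> s)) = Tgt A i j \<cdot> (s \<cdot> Rst C (t \<cdot> (Tgt A i j \<cdot> s)))"
    and sec_comp_section: "sec_comp C A i j k t s \<in> partial_sections C (Src A i k)"
    and rst_sec_comp: "Rst C (sec_comp C A i j k t s) = Rst C (t \<cdot> (Tgt A i j \<cdot> s))"
    and tgt_sec_comp: "Tgt A i k \<cdot> sec_comp C A i j k t s = Tgt A j k \<cdot> (t \<cdot> (Tgt A i j \<cdot> s))"
proof -
  note s = sec [OF assms(1,2,4)] and t = sec [OF assms(2,3,5)]
  show "Mul A i j k \<cdot> pb_section C (Src A j k) (Tgt A i j) t \<cdot> s = sec_comp C A i j k t s"
    unfolding sec_comp_def mult_def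
    using assms s t pb_section_comp [of "Src A j k" "Tgt A i j" t s] by simp
  show sq: "Src A j k \<cdot> (t \<cdot> (Tgt A i j \<cdot> s)) = Tgt A i j \<cdot> (s \<cdot> Rst C (t \<cdot> (Tgt A i j \<cdot> s)))"
    using comp_reduce [OF t(4), of "Tgt A i j \<cdot> s"] rst_comp' [of "Tgt A i j \<cdot> s" t] s t assms by simp
  have r: "Rst C s \<cdot> Rst C (t \<cdot> (Tgt A i j \<cdot> s)) = Rst C (t \<cdot> (Tgt A i j \<cdot> s))"
    using rst_comp_absorb' [of s "t \<cdot> Tgt A i j"] s t assms by simp
  show R: "Rst C (sec_comp C A i j k t s) = Rst C (t \<cdot> (Tgt A i j \<cdot> s))"
    unfolding sec_comp_def using assms s t sq r by (simp add: rst_mult)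
  show "sec_comp C A i j k t s \<in> partial_sections C (Src A i k)"
    unfolding in_partial_sections R
    unfolding sec_comp_def using assms s t sq r
      comp_reduce [OF s(4), of "Rst C (t \<cdot> (Tgt A i j \<cdot> s))"]
    by (simp add: src_mult)
  show "Tgt A i k \<cdot> sec_comp C A i j k t s = Tgt A j k \<cdot> (t \<cdot> (Tgt A i j \<cdot> s))"
    unfolding sec_comp_def using assms s t sq r by (simp add: tgt_mult)
qed

lemma unt_section: "i \<in> Idx A \<Longrightarrow> e \<in> rst_idems C (Vtx A i) \<Longrightarrow> Unt A i \<cdot> e \<in> partial_sections C (Src A i i)"
  by (simp add: in_partial_sections rst_idems_iff)

lemma unt_section1: "i \<in> Idx A \<Longrightarrow> Unt A i \<in> partial_sections C (Src A i i)"
  by (simp add: in_partial_sections total_rst)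

text \<open>The target of the unit over e is e, so t becomes an element restricted to e, and the
  unit law of \<open>mult\<close> applies to it: precomposing with such a unit is just
  restriction.\<close>

lemma sec_comp_unt:
  assumes "i \<in> Idx A" "j \<in> Idx A" "s \<in> partial_sections C (Src A i j)" "e \<in> rst_idems C (Vtx A i)"
  shows "sec_comp C A i i j s (Unt A i \<cdot> e) = s \<cdot> e"
proof -
  note s = sec [OF assms(1-3)]
  have e: "e \<in> Arr C" "Dom C e = Vtx A i" "Cod C e = Vtx A i" "Rst C e = e"
    using assms by (auto simp: rst_idems_iff)
  have r: "Rst C (s \<cdot> e) = Rst C s \<cdot> e" using rst_comp_idem s assms by simp
  have "e \<cdot> (Rst C s \<cdot> e) = Rst C s \<cdot> e"
    using rst_comp_absorb' [of e s] s e r by simp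
  then show ?thesis
    unfolding sec_comp_def
    using mult_unt [of i j "s \<cdot> e"] assms s e r comp_reduce [OF s(4), of e] by simp
qed

lemma sec_comp_ide:
  assumes "i \<in> Idx A" "j \<in> Idx A" "s \<in> partial_sections C (Src A i j)"
  shows "sec_comp C A i i j s (Unt A i) = s"
  using sec_comp_unt [OF assms, of "Ide C (Vtx A i)"] sec [OF assms] assms by (simp add: rst_idems_iff)

text \<open>An idempotent after the target of s equals that target precomposed with the preimage of
  the idempotent; over this preimage the other unit law applies.\<close>

lemma unt_sec_comp:
  assumes "i \<in> Idx A" "j \<in> Idx A" "s \<in> partial_sections C (Src A i j)" "e \<in> rst_idems C (Vtx A j)"
  shows "sec_comp C A i j j (Unt A j \<cdot> e) s = s \<cdot> Rst C (e \<cdot> (Tgt A i j \<cdot> s))"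
proof -
  note s = sec [OF assms(1-3)]
  have e: "e \<in> Arr C" "Dom C e = Vtx A j" "Cod C e = Vtx A j" "Rst C e = e"
    using assms by (auto simp: rst_idems_iff)
  let ?r = "Rst C (e \<cdot> (Tgt A i j \<cdot> s))"
  have "e \<cdot> (Tgt A i j \<cdot> s) = Tgt A i j \<cdot> (s \<cdot> ?r)"
    using idem_comp_map [of "Tgt A i j \<cdot> s" e] assms s e by simp
  then show ?thesis
    unfolding sec_comp_def
    using unt_mult [of i j "s \<cdot> ?r"] assms s e by simp
qed

lemma ide_sec_comp:
  assumes "i \<in> Idx A" "j \<in> Idx A" "s \<in> partial_sections C (Src A i j)"
  shows "sec_comp C A i j j (Unt A j) s = s"
  using unt_sec_comp [OF assms, of "Ide C (Vtx A j)"] sec [OF assms] assms by (simp add: rst_idems_iff)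

text \<open>Both bracketings are products of the same three elements, obtained by following s, then
  t, then u, once all are cut down to the domain of the last; \<open>mult_assoc\<close> then
  applies.\<close>

lemma sec_comp_assoc:
  assumes "i \<in> Idx A" "j \<in> Idx A" "k \<in> Idx A" "l \<in> Idx A"
    "s \<in> partial_sections C (Src A i j)" "t \<in> partial_sections C (Src A j k)"
    "u \<in> partial_sections C (Src A k l)"
  shows "sec_comp C A i k l u (sec_comp C A i j k t s) = sec_comp C A i j l (sec_comp C A j k l u t) s"
proof -
  note s = sec [OF assms(1,2,5)] and t = sec [OF assms(2,3,6)] and u = sec [OF assms(3,4,7)]
  note sq = sec_comp_square [OF assms(1-3,5,6)] and sq' = sec_comp_square [OF assms(2-4,6,7)]
  let ?x = "t \<cdot> (Tgt A i j \<cdot> s)"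
  let ?y = "u \<cdot> (Tgt A j k \<cdot> ?x)"
  \<comment> \<open>The domain of the threefold composite, on which all three elements are
    defined.\<close>
  let ?r = "Rst C ?y"
  have ty: "?x \<in> Arr C" "Dom C ?x = Vtx A i" "Cod C ?x = Edg A j k"
    "?y \<in> Arr C" "Dom C ?y = Vtx A i" "Cod C ?y = Edg A k l" using s t u assms by auto
  have r: "Rst C ?x \<cdot> ?r = ?r" using rst_comp_absorb' [of ?x "u \<cdot> Tgt A j k"] ty u assms by simp
  have sqx: "Src A j k \<cdot> (?x \<cdot> ?r) = Tgt A i j \<cdot> (s \<cdot> ?r)"
  proof -
    have "Rst C t \<cdot> (Tgt A i j \<cdot> s) \<cdot> ?r = Tgt A i j \<cdot> s \<cdot> Rst C ?x \<cdot> ?r"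
      using rst_comp' [of "Tgt A i j \<cdot> s" t] s t assms by simp
    then have "Rst C t \<cdot> (Tgt A i j \<cdot> (s \<cdot> ?r)) = Tgt A i j \<cdot> (s \<cdot> ?r)"
      using s t u assms ty r by simp
    then show ?thesis
      using comp_reduce [OF t(4), of "Tgt A i j \<cdot> (s \<cdot> ?r)"] s t assms ty by simp
  qed
  have sqy: "Src A k l \<cdot> ?y = Tgt A j k \<cdot> (?x \<cdot> ?r)"
    using comp_reduce [OF u(4), of "Tgt A j k \<cdot> ?x"] s t u assms ty
      rst_comp' [of "Tgt A j k \<cdot> ?x" u] by simp
  have 1: "sec_comp C A i j k t s \<cdot> ?r = mult C A i j k (?x \<cdot> ?r) (s \<cdot> ?r)"
    unfolding sec_comp_def using s t u assms ty sq r by (subst mult_comp) auto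
  have "sec_comp C A i k l u (sec_comp C A i j k t s) = mult C A i k l ?y (mult C A i j k (?x \<cdot> ?r) (s \<cdot> ?r))"
    unfolding sec_comp_def [of C A i k l] tgt_sec_comp [OF assms(1-3,5,6)] 1 by simp
  also have "\<dots> = mult C A i j l (mult C A j k l ?y (?x \<cdot> ?r)) (s \<cdot> ?r)"
    using s t u assms ty sqx sqy by (intro mult_assoc) auto
  also have "\<dots> = sec_comp C A i j l (sec_comp C A j k l u t) s"
  proof -
    let ?ut = "sec_comp C A j k l u t"
    note ut = sec [OF assms(2,4) sec_comp_section [OF assms(2-4,6,7)]]
    \<comment> \<open>The cut-off inside the composite of u and t stands in front of the target of
      s; moved behind it, it becomes \<open>?r\<close>.\<close>
    have "?ut \<cdot> (Tgt A i j \<cdot> s) = mult C A j k l ?y (t \<cdot> (Rst C (u \<cdot> (Tgt A j k \<cdot> t)) \<cdot> (Tgt A i j \<cdot> s)))"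
      unfolding sec_comp_def using s t u assms ty sq' by (subst mult_comp) auto
    also have "Rst C (u \<cdot> (Tgt A j k \<cdot> t)) \<cdot> (Tgt A i j \<cdot> s) = Tgt A i j \<cdot> s \<cdot> ?r"
      using rst_comp' [of "Tgt A i j \<cdot> s" "u \<cdot> (Tgt A j k \<cdot> t)"] s t u assms by simp
    finally have e: "?ut \<cdot> (Tgt A i j \<cdot> s) = mult C A j k l ?y (?x \<cdot> ?r)"
      using s t u assms by simp
    have "Rst C (?x \<cdot> ?r) = ?r" using ty r by simp
    then have "Rst C (?ut \<cdot> (Tgt A i j \<cdot> s)) = ?r"
      unfolding e using sqy ty assms by (simp add: rst_mult)
    then show ?thesis unfolding sec_comp_def [of C A i j l] e by simp
  qed
  finally show ?thesis .
qed

lemma Phi_cat_simps [simp]: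
  "Ob (Phi_cat C A) = Idx A"
  "(i, s, j) \<in> Arr (Phi_cat C A) \<longleftrightarrow> i \<in> Idx A \<and> j \<in> Idx A \<and> s \<in> partial_sections C (Src A i j)"
  "Dom (Phi_cat C A) (i, s, j) = i"
  "Cod (Phi_cat C A) (i, s, j) = j"
  "Ide (Phi_cat C A) i = (i, Unt A i, i)"
  "Rst (Phi_cat C A) (i, s, j) = (i, Unt A i \<cdot> Rst C s, i)"
  by (auto simp: Phi_cat_def)

lemma Phi_cat_comp [simp]:
  assumes "i \<in> Idx A" "j \<in> Idx A" "k \<in> Idx A"
    "s \<in> partial_sections C (Src A i j)" "t \<in> partial_sections C (Src A j k)"
  shows "(j, t, k) \<cdot>\<^bsub>Phi_cat C A\<^esub> (i, s, j) = (i, sec_comp C A i j k t s, k)"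
  using sec_comp_eq [OF assms] by (simp add: Phi_cat_def)

lemma in_Hom_Phi_cat:
  "f \<in> Hom (Phi_cat C A) i j \<longleftrightarrow> i \<in> Idx A \<and> j \<in> Idx A \<and> (\<exists>s\<in>partial_sections C (Src A i j). f = (i, s, j))"
  by (cases f) (auto simp: in_Hom_iff)

lemma Phi_category: "category (Phi_cat C A)"
proof
  show "Dom (Phi_cat C A) f \<in> Ob (Phi_cat C A)" "Cod (Phi_cat C A) f \<in> Ob (Phi_cat C A)"
    if "f \<in> Arr (Phi_cat C A)" for f
    using that by (cases f; simp)+
qed (auto simp: in_Hom_Phi_cat unt_section1 sec_comp_section sec_comp_ide ide_sec_comp sec_comp_assoc)

text \<open>The restriction of s is the unit over the idempotent \<open>Rst C s\<close> of C.
  Composing with such units restricts sections, by \<open>sec_comp_unt\<close> and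
  \<open>unt_sec_comp\<close>, so each axiom reduces to restriction identities in C.\<close>

lemma Phi_restriction_category: "restriction_category (Phi_cat C A)"
proof -
  interpret Phi: category "Phi_cat C A" by (rule Phi_category)
  have rst_sec: "Rst C s \<in> rst_idems C (Vtx A i)"
    if "i \<in> Idx A" "j \<in> Idx A" "s \<in> partial_sections C (Src A i j)" for i j s
    using sec [OF that] by (simp add: rst_in_idems)
  note rst_sec' = unt_section [OF _ rst_sec]
  show ?thesis
  proof
    fix f g a b c
    show "f \<in> Hom (Phi_cat C A) a b \<Longrightarrow> Rst (Phi_cat C A) f \<in> Hom (Phi_cat C A) a a"
      by (auto simp: in_Hom_Phi_cat intro!: rst_sec')
    show "f \<in> Arr (Phi_cat C A) \<Longrightarrow> f \<cdot>\<^bsub>Phi_cat C A\<^esub> Rst (Phi_cat C A) f = f"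
      by (cases f) (auto simp: rst_sec' sec_comp_unt rst_sec sec)
    show "Rst (Phi_cat C A) f \<cdot>\<^bsub>Phi_cat C A\<^esub> Rst (Phi_cat C A) g
        = Rst (Phi_cat C A) g \<cdot>\<^bsub>Phi_cat C A\<^esub> Rst (Phi_cat C A) f"
      if "f \<in> Hom (Phi_cat C A) a b" "g \<in> Hom (Phi_cat C A) a c"
      using that rst_commute' by (auto simp: in_Hom_Phi_cat rst_sec' sec_comp_unt rst_sec sec)
    show "Rst (Phi_cat C A) (g \<cdot>\<^bsub>Phi_cat C A\<^esub> Rst (Phi_cat C A) f)
        = Rst (Phi_cat C A) g \<cdot>\<^bsub>Phi_cat C A\<^esub> Rst (Phi_cat C A) f"
      if "f \<in> Hom (Phi_cat C A) a b" "g \<in> Hom (Phi_cat C A) a c"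
      using that by (auto simp: in_Hom_Phi_cat rst_sec' sec_comp_unt rst_sec sec)
    show "Rst (Phi_cat C A) g \<cdot>\<^bsub>Phi_cat C A\<^esub> f
        = f \<cdot>\<^bsub>Phi_cat C A\<^esub> Rst (Phi_cat C A) (g \<cdot>\<^bsub>Phi_cat C A\<^esub> f)"
      if f: "f \<in> Hom (Phi_cat C A) a b" and g: "g \<in> Hom (Phi_cat C A) b c"
    proof -
      obtain s t where st: "a \<in> Idx A" "b \<in> Idx A" "c \<in> Idx A"
          "s \<in> partial_sections C (Src A a b)" "t \<in> partial_sections C (Src A b c)"
          "f = (a, s, b)" "g = (b, t, c)"
        using f g by (auto simp: in_Hom_Phi_cat)
      have 1: "Rst C (Rst C t \<cdot> (Tgt A a b \<cdot> s)) = Rst C (t \<cdot> (Tgt A a b \<cdot> s))"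
        using st sec [OF st(1,2,4)] sec [OF st(2,3,5)] by simp
      show ?thesis using st sec_comp_section [OF st(1-5)]
        by (simp add: rst_sec' sec_comp_unt rst_sec unt_sec_comp 1 rst_sec_comp
            rst_sec [OF st(1,3), of "sec_comp C A a b c t s", simplified rst_sec_comp [OF st(1-5)]]
            unt_section)
    qed
  qed
qed

lemma Phi_proj_simps [simp]:
  "i \<in> Idx A \<Longrightarrow> on_ob (Phi_proj C A) i = Vtx A i"
  "i \<in> Idx A \<Longrightarrow> j \<in> Idx A \<Longrightarrow> s \<in> partial_sections C (Src A i j) \<Longrightarrow>
    on_ar (Phi_proj C A) (i, s, j) = Tgt A i j \<cdot> s"
  by (auto simp: Phi_proj_def)

lemma Phi_proj_restriction_functor: "restriction_functor (Phi_cat C A) C (Phi_proj C A)"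
  unfolding restriction_functor_def is_functor_def
proof (intro conjI ballI allI)
  show "on_ob (Phi_proj C A) \<in> Ob (Phi_cat C A) \<rightarrow>\<^sub>E Ob C" by (auto simp: Phi_proj_def)
  show "on_ar (Phi_proj C A) \<in> Arr (Phi_cat C A) \<rightarrow>\<^sub>E Arr C" by (auto simp: Phi_proj_def sec)
  show "on_ar (Phi_proj C A) (Rst (Phi_cat C A) f) = Rst C (on_ar (Phi_proj C A) f)"
    if "f \<in> Arr (Phi_cat C A)" for f
  proof (cases f)
    case (fields i s j)
    then have f: "i \<in> Idx A" "j \<in> Idx A" "s \<in> partial_sections C (Src A i j)" using that by auto
    show ?thesis using f sec [OF f] unt_section [of i "Rst C s"] by (simp add: fields rst_in_idems)
  qed
  show "on_ar (Phi_proj C A) (g \<cdot>\<^bsub>Phi_cat C A\<^esub> f) = on_ar (Phi_proj C A) g \<cdot> on_ar (Phi_proj C A) f"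
    if f: "f \<in> Hom (Phi_cat C A) a b" and g: "g \<in> Hom (Phi_cat C A) b c" for f g a b c
    using that by (auto simp: in_Hom_Phi_cat sec_comp_section tgt_sec_comp sec)
qed (auto simp: Phi_restriction_category Phi_category restriction_category_axioms category_axioms
    in_Hom_Phi_cat in_Hom_iff sec unt_section1)

end

section \<open>Partite cofunctors in terms of generalized elements\<close>

text \<open>\<open>act C A F i j a x\<close> lifts the generalized element \<open>a\<close> of \<open>A\<^sub>i\<^sub>j\<close> to one of \<open>B\<^sub>F\<^sub>i\<^sub>,\<^sub>F\<^sub>j\<close> with
  source \<open>x\<close>.\<close>

definition act ::
  "('o, 'm) rcategory \<Rightarrow> ('i, 'o, 'm) partite \<Rightarrow> ('i, 'j, 'm) cofunctor_data \<Rightarrow>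
   'i \<Rightarrow> 'i \<Rightarrow> 'm \<Rightarrow> 'm \<Rightarrow> 'm" where
  "act C A F i j a x = cf_edg F i j \<cdot>\<^bsub>C\<^esub> pairing C (Src A i j) (cf_vtx F i) a x"

text \<open>The typing of a cofunctor with its source and target equations, enough for lifts by
  \<open>act\<close> to behave well. A candidate is introduced at this level, so that its unit and
  multiplication laws can then be checked in terms of \<open>act\<close>.\<close>

locale precofunctor = restriction_category C + A: partite C A + B: partite C B
  for C :: "('o, 'm) rcategory" (structure)
    and A :: "('i, 'o, 'm) partite" and B :: "('j, 'o, 'm) partite" +
  fixes F :: "('i, 'j, 'm) cofunctor_data"
  assumes idx [simp]: "i \<in> Idx A \<Longrightarrow> cf_idx F i \<in> Idx B"
    and vtx: "i \<in> Idx A \<Longrightarrow> cf_vtx F i \<in> Hom C (Vtx B (cf_idx F i)) (Vtx A i)"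
    and total_vtx [simp]: "i \<in> Idx A \<Longrightarrow> total C (cf_vtx F i)"
    and edg: "i \<in> Idx A \<Longrightarrow> j \<in> Idx A \<Longrightarrow>
          cf_edg F i j \<in> Hom C (pb_ob C (Src A i j) (cf_vtx F i)) (Edg B (cf_idx F i) (cf_idx F j))"
    and src: "i \<in> Idx A \<Longrightarrow> j \<in> Idx A \<Longrightarrow>
          Src B (cf_idx F i) (cf_idx F j) \<cdot> cf_edg F i j = proj2 C (Src A i j) (cf_vtx F i)"
    and tgt: "i \<in> Idx A \<Longrightarrow> j \<in> Idx A \<Longrightarrow>
          cf_vtx F j \<cdot> Tgt B (cf_idx F i) (cf_idx F j) \<cdot> cf_edg F i j
            = Tgt A i j \<cdot> proj1 C (Src A i j) (cf_vtx F i)"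
begin

lemma
  assumes "i \<in> Idx A"
  shows vtx_arr [simp]: "cf_vtx F i \<in> Arr C"
    and dom_vtx [simp]: "Dom C (cf_vtx F i) = Vtx B (cf_idx F i)"
    and cod_vtx [simp]: "Cod C (cf_vtx F i) = Vtx A i"
  using vtx [OF assms] by (auto simp: in_Hom_iff)

lemma
  assumes "i \<in> Idx A" "j \<in> Idx A"
  shows edg_arr [simp]: "cf_edg F i j \<in> Arr C"
    and dom_edg [simp]: "Dom C (cf_edg F i j) = pb_ob C (Src A i j) (cf_vtx F i)"
    and cod_edg [simp]: "Cod C (cf_edg F i j) = Edg B (cf_idx F i) (cf_idx F j)"
  using edg [OF assms] by (auto simp: in_Hom_iff)

lemma has_pb_vtx [simp]: "i \<in> Idx A \<Longrightarrow> j \<in> Idx A \<Longrightarrow> has_pb C (Src A i j) (cf_vtx F i)"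
  by (rule A.has_pb_src) auto

lemma edg_tot: "i \<in> Idx A \<Longrightarrow> j \<in> Idx A \<Longrightarrow> total C (cf_edg F i j)"
  by (rule total_cancel [of "Src B (cf_idx F i) (cf_idx F j)"]) (auto simp: src)

lemma
  assumes "i \<in> Idx A" "j \<in> Idx A" "a \<in> Arr C" "x \<in> Arr C" "Cod C a = Edg A i j"
    "Cod C x = Vtx B (cf_idx F i)" "Dom C a = Dom C x" "Src A i j \<cdot> a = cf_vtx F i \<cdot> x"
  shows act_arr [simp]: "act C A F i j a x \<in> Arr C"
    and dom_act [simp]: "Dom C (act C A F i j a x) = Dom C x"
    and cod_act [simp]: "Cod C (act C A F i j a x) = Edg B (cf_idx F i) (cf_idx F j)"
    and src_act: "Src B (cf_idx F i) (cf_idx F j) \<cdot> act C A F i j a x = x"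
    and tgt_act: "cf_vtx F j \<cdot> (Tgt B (cf_idx F i) (cf_idx F j) \<cdot> act C A F i j a x) = Tgt A i j \<cdot> a"
    and rst_act: "Rst C (act C A F i j a x) = Rst C x"
    and act_comp: "y \<in> Arr C \<Longrightarrow> Cod C y = Dom C x \<Longrightarrow>
      act C A F i j a x \<cdot> y = act C A F i j (a \<cdot> y) (x \<cdot> y)"
proof -
  let ?p = "pairing C (Src A i j) (cf_vtx F i) a x"
  have p: "?p \<in> Arr C" "Dom C ?p = Dom C x" "Cod C ?p = pb_ob C (Src A i j) (cf_vtx F i)"
    "proj1 C (Src A i j) (cf_vtx F i) \<cdot> ?p = a" "proj2 C (Src A i j) (cf_vtx F i) \<cdot> ?p = x"
    using assms by auto
  show 1: "act C A F i j a x \<in> Arr C" "Dom C (act C A F i j a x) = Dom C x"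
    "Cod C (act C A F i j a x) = Edg B (cf_idx F i) (cf_idx F j)"
    using assms p by (auto simp: act_def)
  show s: "Src B (cf_idx F i) (cf_idx F j) \<cdot> act C A F i j a x = x"
    unfolding act_def using assms p comp_reduce [OF src [OF assms(1,2)], of ?p] by simp
  show "cf_vtx F j \<cdot> (Tgt B (cf_idx F i) (cf_idx F j) \<cdot> act C A F i j a x) = Tgt A i j \<cdot> a"
    unfolding act_def using assms p comp_reduce2 [OF tgt [OF assms(1,2)], of ?p] by simp
  show "Rst C (act C A F i j a x) = Rst C x"
    using rst_total_comp [of "Src B (cf_idx F i) (cf_idx F j)" "act C A F i j a x"] s 1 assms by simp
  show "act C A F i j a x \<cdot> y = act C A F i j (a \<cdot> y) (x \<cdot> y)"
    if "y \<in> Arr C" "Cod C y = Dom C x"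
    unfolding act_def
    using that p assms pairing_comp [of "Src A i j" "cf_vtx F i" a x y] by simp
qed

lemma act_proj:
  "i \<in> Idx A \<Longrightarrow> j \<in> Idx A \<Longrightarrow>
    act C A F i j (proj1 C (Src A i j) (cf_vtx F i)) (proj2 C (Src A i j) (cf_vtx F i)) = cf_edg F i j"
  by (simp add: act_def pairing_proj)

text \<open>\<open>cofunctor_mul\<close> is the element law at the universal configuration formed by
  the projections \<open>?r1\<close>, \<open>?a\<close> and \<open>?x\<close>. Every (b, a, x) is
  obtained from it by precomposition, and both sides commute with precomposition.\<close>

lemma
  assumes idx3: "i \<in> Idx A" "j \<in> Idx A" "k \<in> Idx A"
  shows cofunctor_mulI:
      "(\<And>a b x. a \<in> Arr C \<Longrightarrow> b \<in> Arr C \<Longrightarrow> x \<in> Arr C \<Longrightarrow> Cod C a = Edg A i j \<Longrightarrow> Cod C b = Edg A j k \<Longrightarrow>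
        Cod C x = Vtx B (cf_idx F i) \<Longrightarrow> Dom C a = Dom C x \<Longrightarrow> Dom C b = Dom C x \<Longrightarrow>
        Src A i j \<cdot> a = cf_vtx F i \<cdot> x \<Longrightarrow> Src A j k \<cdot> b = Tgt A i j \<cdot> a \<Longrightarrow>
        act C A F i k (mult C A i j k b a) x =
          mult C B (cf_idx F i) (cf_idx F j) (cf_idx F k)
            (act C A F j k b (Tgt B (cf_idx F i) (cf_idx F j) \<cdot> act C A F i j a x)) (act C A F i j a x)) \<Longrightarrow>
        cofunctor_mul C A B F i j k"
    and cofunctor_mulD: "cofunctor_mul C A B F i j k \<Longrightarrow>
        a \<in> Arr C \<Longrightarrow> b \<in> Arr C \<Longrightarrow> x \<in> Arr C \<Longrightarrow> Cod C a = Edg A i j \<Longrightarrow> Cod C b = Edg A j k \<Longrightarrow>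
        Cod C x = Vtx B (cf_idx F i) \<Longrightarrow> Dom C a = Dom C x \<Longrightarrow> Dom C b = Dom C x \<Longrightarrow>
        Src A i j \<cdot> a = cf_vtx F i \<cdot> x \<Longrightarrow> Src A j k \<cdot> b = Tgt A i j \<cdot> a \<Longrightarrow>
        act C A F i k (mult C A i j k b a) x =
          mult C B (cf_idx F i) (cf_idx F j) (cf_idx F k)
            (act C A F j k b (Tgt B (cf_idx F i) (cf_idx F j) \<cdot> act C A F i j a x)) (act C A F i j a x)"
proof -
  let ?i = "cf_idx F i" and ?j = "cf_idx F j" and ?k = "cf_idx F k"
  let ?p1 = "proj1 C (Src A i j) (cf_vtx F i)" and ?p2 = "proj2 C (Src A i j) (cf_vtx F i)"
  let ?t = "Tgt A i j \<cdot> ?p1"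
  let ?r1 = "proj1 C (Src A j k) ?t" and ?r2 = "proj2 C (Src A j k) ?t"
  let ?Ft = "cf_vtx F j \<cdot> Tgt B ?i ?j"
  let ?t1 = "proj1 C (Src A j k) ?Ft" and ?t2 = "proj2 C (Src A j k) ?Ft"
  let ?FF = "\<lambda>a x. act C A F i j a x"
  let ?L = "\<lambda>b a x. act C A F i k (mult C A i j k b a) x"
  let ?R = "\<lambda>b a x. mult C B ?i ?j ?k (act C A F j k b (Tgt B ?i ?j \<cdot> ?FF a x)) (?FF a x)"
  let ?a = "?p1 \<cdot> ?r2" and ?x = "?p2 \<cdot> ?r2"
  have pb: "has_pb C (Src A j k) ?t" "has_pb C (Src A j k) ?Ft"
    using idx3 by (auto intro!: A.has_pb_src)
  have sq: "Src A i j \<cdot> ?a = cf_vtx F i \<cdot> ?x"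
    using idx3 pb by (intro comp_reduce2 pb_square) auto
  have sq2: "Src A j k \<cdot> ?r1 = Tgt A i j \<cdot> ?a"
    using idx3 pb pb_square [OF pb(1)] by simp
  have sq3: "Src A j k \<cdot> ?t1 = cf_vtx F j \<cdot> (Tgt B ?i ?j \<cdot> ?t2)"
    using idx3 pb pb_square [OF pb(2)] by simp
  have e: "cf_edg F i j \<cdot> ?r2 = ?FF ?a ?x"
    unfolding act_def
    using pairing_comp [of "Src A i j" "cf_vtx F i" ?p1 ?p2 ?r2] idx3 pb pairing_proj
      pb_square [of "Src A i j" "cf_vtx F i"] by simp
  have ty: "?a \<in> Arr C" "?x \<in> Arr C" "?r1 \<in> Arr C" "Cod C ?a = Edg A i j" "Cod C ?x = Vtx B ?i"
    "Cod C ?r1 = Edg A j k" "Dom C ?a = Dom C ?x" "Dom C ?r1 = Dom C ?x"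
    using idx3 pb by auto
  let ?F1 = "pairing C (Src A j k) ?Ft ?r1 (?FF ?a ?x)"
  have F1: "?F1 \<in> Arr C" "Dom C ?F1 = Dom C ?x" "Cod C ?F1 = pb_ob C (Src A j k) ?Ft"
    "?t1 \<cdot> ?F1 = ?r1" "?t2 \<cdot> ?F1 = ?FF ?a ?x"
    using pb(2) ty idx3 sq sq2 tgt_act [OF idx3(1,2) ty(1,2,4,5,7) sq] by auto
  have sqF: "Src B ?j ?k \<cdot> act C A F j k ?t1 (Tgt B ?i ?j \<cdot> ?t2) = Tgt B ?i ?j \<cdot> ?t2"
    using pb idx3 sq3 by (intro src_act) auto
  let ?P = "pairing C (Src B ?j ?k) (Tgt B ?i ?j) (act C A F j k ?t1 (Tgt B ?i ?j \<cdot> ?t2)) ?t2"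
  have P: "?P \<in> Arr C" "Dom C ?P = pb_ob C (Src A j k) ?Ft" "Cod C ?P = pb_ob C (Src B ?j ?k) (Tgt B ?i ?j)"
    using pb idx3 sq3 sqF by auto
  \<comment> \<open>The maps \<open>one_F\<close> and \<open>F_one\<close> of the axiom collapse to
    the pair of lifts of the universal configuration.\<close>
  have PF: "?P \<cdot> ?F1 = pairing C (Src B ?j ?k) (Tgt B ?i ?j)
      (act C A F j k ?r1 (Tgt B ?i ?j \<cdot> ?FF ?a ?x)) (?FF ?a ?x)"
    using pb idx3 sq3 sqF F1 by (simp add: pairing_comp act_comp)
  have iff: "cofunctor_mul C A B F i j k \<longleftrightarrow> ?L ?r1 ?a ?x = ?R ?r1 ?a ?x"
    unfolding cofunctor_mul_def Let_def e PF [unfolded act_def [of C A F j k]]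
    by (simp add: mult_def act_def)
  show "cofunctor_mul C A B F i j k"
    if *: "\<And>a b x. a \<in> Arr C \<Longrightarrow> b \<in> Arr C \<Longrightarrow> x \<in> Arr C \<Longrightarrow> Cod C a = Edg A i j \<Longrightarrow> Cod C b = Edg A j k \<Longrightarrow>
        Cod C x = Vtx B (cf_idx F i) \<Longrightarrow> Dom C a = Dom C x \<Longrightarrow> Dom C b = Dom C x \<Longrightarrow>
        Src A i j \<cdot> a = cf_vtx F i \<cdot> x \<Longrightarrow> Src A j k \<cdot> b = Tgt A i j \<cdot> a \<Longrightarrow> ?L b a x = ?R b a x"
    unfolding iff using ty sq sq2 by (intro *) auto
  show "?L b a x = ?R b a x"
    if *: "cofunctor_mul C A B F i j k" "a \<in> Arr C" "b \<in> Arr C" "x \<in> Arr C"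
        "Cod C a = Edg A i j" "Cod C b = Edg A j k"
        "Cod C x = Vtx B (cf_idx F i)" "Dom C a = Dom C x" "Dom C b = Dom C x"
        "Src A i j \<cdot> a = cf_vtx F i \<cdot> x" "Src A j k \<cdot> b = Tgt A i j \<cdot> a"
  proof -
    let ?w = "pairing C (Src A i j) (cf_vtx F i) a x"
    have w: "?w \<in> Arr C" "Dom C ?w = Dom C x" "Cod C ?w = pb_ob C (Src A i j) (cf_vtx F i)"
      "?p1 \<cdot> ?w = a" "?p2 \<cdot> ?w = x"
      using idx3 * by auto
    let ?r = "pairing C (Src A j k) ?t b ?w"
    have r: "?r \<in> Arr C" "Dom C ?r = Dom C x" "Cod C ?r = pb_ob C (Src A j k) ?t"
      "?r1 \<cdot> ?r = b" "?r2 \<cdot> ?r = ?w"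
      using idx3 * pb w by auto
    have cr: "?a \<cdot> ?r = a" "?x \<cdot> ?r = x" using idx3 pb w r by auto
    have dr: "Cod C ?r = Dom C ?x" using r pb idx3 by simp
    have subst: "?L (b \<cdot> r) (a \<cdot> r) (x \<cdot> r) = ?L b a x \<cdot> r" "?R (b \<cdot> r) (a \<cdot> r) (x \<cdot> r) = ?R b a x \<cdot> r"
      if "a \<in> Arr C" "b \<in> Arr C" "x \<in> Arr C" "Cod C a = Edg A i j" "Cod C b = Edg A j k"
        "Cod C x = Vtx B ?i" "Dom C a = Dom C x" "Dom C b = Dom C x" "r \<in> Arr C" "Cod C r = Dom C x"
        "Src A i j \<cdot> a = cf_vtx F i \<cdot> x" "Src A j k \<cdot> b = Tgt A i j \<cdot> a" for a b x r
      using that idx3 by (simp_all add: B.mult_comp A.mult_comp act_comp src_act tgt_act A.src_mult)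
    have "?L ?r1 ?a ?x = ?R ?r1 ?a ?x" using * iff by blast
    then show ?thesis
      using subst [of ?a ?r1 ?x ?r, unfolded cr r(4)] ty r(1) sq sq2 dr by auto
  qed
qed

lemma partite_cofunctorI:
  assumes "cf_idx F \<in> extensional (Idx A)" "cf_vtx F \<in> extensional (Idx A)"
    "cf_edg F \<in> Idx A \<rightarrow>\<^sub>E extensional (Idx A)"
    and unt: "\<And>i. i \<in> Idx A \<Longrightarrow>
          act C A F i i (Unt A i \<cdot> cf_vtx F i) (Ide C (Vtx B (cf_idx F i))) = Unt B (cf_idx F i)"
    and mult: "\<And>i j k a b x. i \<in> Idx A \<Longrightarrow> j \<in> Idx A \<Longrightarrow> k \<in> Idx A \<Longrightarrow>
        a \<in> Arr C \<Longrightarrow> b \<in> Arr C \<Longrightarrow> x \<in> Arr C \<Longrightarrow> Cod C a = Edg A i j \<Longrightarrow> Cod C b = Edg A j k \<Longrightarrow>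
        Cod C x = Vtx B (cf_idx F i) \<Longrightarrow> Dom C a = Dom C x \<Longrightarrow> Dom C b = Dom C x \<Longrightarrow>
        Src A i j \<cdot> a = cf_vtx F i \<cdot> x \<Longrightarrow> Src A j k \<cdot> b = Tgt A i j \<cdot> a \<Longrightarrow>
        act C A F i k (mult C A i j k b a) x =
          mult C B (cf_idx F i) (cf_idx F j) (cf_idx F k)
            (act C A F j k b (Tgt B (cf_idx F i) (cf_idx F j) \<cdot> act C A F i j a x)) (act C A F i j a x)"
  shows "partite_cofunctor C A B F"
proof
  show "cf_idx F \<in> Idx A \<rightarrow>\<^sub>E Idx B" using assms(1) by (auto simp: PiE_def)
  show "cofunctor_mul C A B F i j k" if "i \<in> Idx A" "j \<in> Idx A" "k \<in> Idx A" for i j k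
    by (rule cofunctor_mulI) (use that mult in auto)
qed (use assms vtx edg src tgt edg_tot unt in \<open>auto simp: act_def\<close>)

end

locale cofunctor = restriction_category C + partite_cofunctor C A B F
  for C :: "('o, 'm) rcategory" (structure)
    and A :: "('i, 'o, 'm) partite" and B :: "('j, 'o, 'm) partite"
    and F :: "('i, 'j, 'm) cofunctor_data"
begin

sublocale precofunctor C A B F
proof (intro precofunctor.intro precofunctor_axioms.intro)
  show "cf_idx F i \<in> Idx B" if "i \<in> Idx A" for i using idx_map that by auto
qed (auto simp: partite_def restriction_category_axioms dom.partite_internal_category_axioms
    cod.partite_internal_category_axioms vtx_hom vtx_total edg_hom src_edg tgt_edg)

lemma act_unt:
  assumes "i \<in> Idx A" "x \<in> Arr C" "Cod C x = Vtx B (cf_idx F i)"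
  shows "act C A F i i (Unt A i \<cdot> (cf_vtx F i \<cdot> x)) x = Unt B (cf_idx F i) \<cdot> x"
proof -
  have "act C A F i i (Unt A i \<cdot> cf_vtx F i) (Ide C (Vtx B (cf_idx F i))) \<cdot> x = Unt B (cf_idx F i) \<cdot> x"
    unfolding act_def using edg_unt [OF assms(1)] by simp
  then show ?thesis using assms by (subst (asm) act_comp) auto
qed

lemmas act_mult = cofunctor_mulD [OF _ _ _ edg_mul]

end

text \<open>The edge maps are recovered from lifts: by \<open>act_proj\<close>,
  \<open>cf_edg\<close> is the lift of the two projections. Outside the index set the data is fixed
  by extensionality.\<close>

lemma cofunctor_eqI:
  assumes "cofunctor C A B F" "cofunctor C A B G"
    and idx: "\<And>i. i \<in> Idx A \<Longrightarrow> cf_idx F i = cf_idx G i" and vtx: "\<And>i. i \<in> Idx A \<Longrightarrow> cf_vtx F i = cf_vtx G i"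
    and act: "\<And>i j a x. i \<in> Idx A \<Longrightarrow> j \<in> Idx A \<Longrightarrow> a \<in> Arr C \<Longrightarrow> x \<in> Arr C \<Longrightarrow> Cod C a = Edg A i j \<Longrightarrow>
      Cod C x = Vtx B (cf_idx F i) \<Longrightarrow> Dom C a = Dom C x \<Longrightarrow> Src A i j \<cdot>\<^bsub>C\<^esub> a = cf_vtx F i \<cdot>\<^bsub>C\<^esub> x \<Longrightarrow>
      act C A F i j a x = act C A G i j a x"
  shows "F = G"
proof -
  interpret F: cofunctor C A B F by fact
  interpret G: cofunctor C A B G by fact
  have "cf_idx F = cf_idx G"
    using F.idx_map G.idx_map idx by (intro extensionalityI [of _ "Idx A"]) (auto simp: PiE_def)
  moreover have "cf_vtx F = cf_vtx G"
    using F.vtx_ext G.vtx_ext vtx by (intro extensionalityI [of _ "Idx A"]) auto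
  moreover have "cf_edg F = cf_edg G"
  proof (rule extensionalityI [of _ "Idx A"])
    fix i assume i: "i \<in> Idx A"
    show "cf_edg F i = cf_edg G i"
    proof (rule extensionalityI [of _ "Idx A"])
      fix j assume j: "j \<in> Idx A"
      have "act C A F i j (proj1 C (Src A i j) (cf_vtx F i)) (proj2 C (Src A i j) (cf_vtx F i))
          = act C A G i j (proj1 C (Src A i j) (cf_vtx F i)) (proj2 C (Src A i j) (cf_vtx F i))"
        using i j F.pb_square [OF F.has_pb_vtx] by (intro act) auto
      then show "cf_edg F i j = cf_edg G i j"
        using F.act_proj [OF i j] G.act_proj [OF i j] vtx [OF i] by simp
    qed (use F.edg_ext G.edg_ext i in \<open>auto simp: PiE_def Pi_def\<close>)
  qed (use F.edg_ext G.edg_ext in \<open>auto simp: PiE_def\<close>)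
  ultimately show ?thesis by simp
qed

section \<open>The category of partite internal categories\<close>

lemma (in partite) act_id:
  assumes "i \<in> Idx A" "j \<in> Idx A" "a \<in> Arr C" "Cod C a = Edg A i j" "x = Src A i j \<cdot> a"
  shows "act C A (cofunctor_id C A) i j a x = a"
proof -
  have "has_pb C (Src A i j) (Ide C (Vtx A i))" using assms by (intro has_pb_src) auto
  then show ?thesis using assms by (simp add: act_def cofunctor_id_def)
qed

lemma (in partite) cofunctor_id: "cofunctor C A A (cofunctor_id C A)"
proof -
  have pb: "has_pb C (Src A i j) (Ide C (Vtx A i))" if "i \<in> Idx A" "j \<in> Idx A" for i j
    using that by (intro has_pb_src) auto
  have sq: "Src A i j \<cdot> proj1 C (Src A i j) (Ide C (Vtx A i)) = proj2 C (Src A i j) (Ide C (Vtx A i))"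
    if "i \<in> Idx A" "j \<in> Idx A" for i j
    using that pb_square [OF pb [OF that]] pb [OF that] by simp
  interpret precofunctor C A A "cofunctor_id C A"
    by unfold_locales (auto simp: cofunctor_id_def in_Hom_iff pb sq)
  have "partite_cofunctor C A A (cofunctor_id C A)"
  proof (rule partite_cofunctorI)
    show "act C A (cofunctor_id C A) i i (Unt A i \<cdot> cf_vtx (cofunctor_id C A) i)
        (Ide C (Vtx A (cf_idx (cofunctor_id C A) i))) = Unt A (cf_idx (cofunctor_id C A) i)"
      if "i \<in> Idx A" for i
      using that by (subst act_id) (auto simp: cofunctor_id_def)
    fix i j k a b x
    assume a: "i \<in> Idx A" "j \<in> Idx A" "k \<in> Idx A" "a \<in> Arr C" "b \<in> Arr C" "x \<in> Arr C"
      "Cod C a = Edg A i j" "Cod C b = Edg A j k" "Cod C x = Vtx A (cf_idx (cofunctor_id C A) i)"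
      "Dom C a = Dom C x" "Dom C b = Dom C x"
      "Src A i j \<cdot> a = cf_vtx (cofunctor_id C A) i \<cdot> x" "Src A j k \<cdot> b = Tgt A i j \<cdot> a"
    have x: "x = Src A i j \<cdot> a" using a by (simp add: cofunctor_id_def)
    have [simp]: "cf_idx (cofunctor_id C A) i = i" if "i \<in> Idx A" for i
      using that by (simp add: cofunctor_id_def)
    show "act C A (cofunctor_id C A) i k (mult C A i j k b a) x =
      mult C A (cf_idx (cofunctor_id C A) i) (cf_idx (cofunctor_id C A) j) (cf_idx (cofunctor_id C A) k)
        (act C A (cofunctor_id C A) j k b
          (Tgt A (cf_idx (cofunctor_id C A) i) (cf_idx (cofunctor_id C A) j) \<cdot> act C A (cofunctor_id C A) i j a x))
        (act C A (cofunctor_id C A) i j a x)"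
      unfolding x using a(1-8,13) a(10,11) [unfolded x] by (simp add: act_id src_mult)
  qed (auto simp: cofunctor_id_def)
  then show ?thesis by (simp add: cofunctor_def restriction_category_axioms)
qed

text \<open>Composition of cofunctors iterates lifting: a is lifted along F over the image of x, and
  the result is lifted along G over x. This holds by definition at the projections and extends by
  substitution; the laws of the composite then follow from those of F and G in turn.\<close>

lemma
  assumes "cofunctor C A B F" "cofunctor C B D G"
  shows cofunctor_comp: "cofunctor C A D (cofunctor_comp C A B G F)"
    and act_cofunctor_comp: "i \<in> Idx A \<Longrightarrow> j \<in> Idx A \<Longrightarrow> a \<in> Arr C \<Longrightarrow> x \<in> Arr C \<Longrightarrow> Cod C a = Edg A i j \<Longrightarrow>
      Cod C x = Vtx D (cf_idx G (cf_idx F i)) \<Longrightarrow> Dom C a = Dom C x \<Longrightarrow>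
      Src A i j \<cdot>\<^bsub>C\<^esub> a = cf_vtx F i \<cdot>\<^bsub>C\<^esub> (cf_vtx G (cf_idx F i) \<cdot>\<^bsub>C\<^esub> x) \<Longrightarrow>
      act C A (cofunctor_comp C A B G F) i j a x =
        act C B G (cf_idx F i) (cf_idx F j) (act C A F i j a (cf_vtx G (cf_idx F i) \<cdot>\<^bsub>C\<^esub> x)) x"
proof -
  interpret F: cofunctor C A B F by fact
  interpret G: cofunctor C B D G by fact
  let ?H = "cofunctor_comp C A B G F"
  have [simp]: "cf_idx ?H i = cf_idx G (cf_idx F i)"
    "cf_vtx ?H i = cf_vtx F i \<cdot>\<^bsub>C\<^esub> cf_vtx G (cf_idx F i)" if "i \<in> Idx A" for i
    using that by (auto simp: cofunctor_comp_def)
  have pb: "has_pb C (Src A i j) (cf_vtx F i \<cdot>\<^bsub>C\<^esub> cf_vtx G (cf_idx F i))" if "i \<in> Idx A" "j \<in> Idx A" for i j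
    using that by (intro F.A.has_pb_src) auto
  let ?p1 = "\<lambda>i j. proj1 C (Src A i j) (cf_vtx F i \<cdot>\<^bsub>C\<^esub> cf_vtx G (cf_idx F i))"
  let ?p2 = "\<lambda>i j. proj2 C (Src A i j) (cf_vtx F i \<cdot>\<^bsub>C\<^esub> cf_vtx G (cf_idx F i))"
  have sq: "Src A i j \<cdot>\<^bsub>C\<^esub> ?p1 i j = cf_vtx F i \<cdot>\<^bsub>C\<^esub> (cf_vtx G (cf_idx F i) \<cdot>\<^bsub>C\<^esub> ?p2 i j)"
    if "i \<in> Idx A" "j \<in> Idx A" for i j
    using that F.pb_square [OF pb [OF that]] pb [OF that] by simp
  have edg: "cf_edg ?H i j =
      act C B G (cf_idx F i) (cf_idx F j) (act C A F i j (?p1 i j) (cf_vtx G (cf_idx F i) \<cdot>\<^bsub>C\<^esub> ?p2 i j)) (?p2 i j)"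
    if "i \<in> Idx A" "j \<in> Idx A" for i j
    using that by (simp add: cofunctor_comp_def Let_def act_def)
  interpret H: precofunctor C A D ?H
  proof
    fix i j assume ij: "i \<in> Idx A" "j \<in> Idx A"
    note s = sq [OF ij] pb [OF ij] ij
    show "cf_edg ?H i j \<in> Hom C (pb_ob C (Src A i j) (cf_vtx ?H i)) (Edg D (cf_idx ?H i) (cf_idx ?H j))"
      unfolding edg [OF ij] using s by (auto simp: in_Hom_iff F.src_act)
    show "Src D (cf_idx ?H i) (cf_idx ?H j) \<cdot>\<^bsub>C\<^esub> cf_edg ?H i j = proj2 C (Src A i j) (cf_vtx ?H i)"
      unfolding edg [OF ij] using s by (simp add: F.src_act G.src_act)
    show "cf_vtx ?H j \<cdot>\<^bsub>C\<^esub> Tgt D (cf_idx ?H i) (cf_idx ?H j) \<cdot>\<^bsub>C\<^esub> cf_edg ?H i j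
        = Tgt A i j \<cdot>\<^bsub>C\<^esub> proj1 C (Src A i j) (cf_vtx ?H i)"
      unfolding edg [OF ij] using s by (simp add: F.src_act G.src_act F.tgt_act G.tgt_act)
  qed (auto simp: in_Hom_iff)
  show act: "act C A ?H i j a x =
        act C B G (cf_idx F i) (cf_idx F j) (act C A F i j a (cf_vtx G (cf_idx F i) \<cdot>\<^bsub>C\<^esub> x)) x"
    if "i \<in> Idx A" "j \<in> Idx A" "a \<in> Arr C" "x \<in> Arr C" "Cod C a = Edg A i j"
      "Cod C x = Vtx D (cf_idx G (cf_idx F i))" "Dom C a = Dom C x"
      "Src A i j \<cdot>\<^bsub>C\<^esub> a = cf_vtx F i \<cdot>\<^bsub>C\<^esub> (cf_vtx G (cf_idx F i) \<cdot>\<^bsub>C\<^esub> x)" for i j a x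
  proof -
    let ?w = "pairing C (Src A i j) (cf_vtx F i \<cdot>\<^bsub>C\<^esub> cf_vtx G (cf_idx F i)) a x"
    have w: "?w \<in> Arr C" "Dom C ?w = Dom C x"
      "Cod C ?w = pb_ob C (Src A i j) (cf_vtx F i \<cdot>\<^bsub>C\<^esub> cf_vtx G (cf_idx F i))"
      "?p1 i j \<cdot>\<^bsub>C\<^esub> ?w = a" "?p2 i j \<cdot>\<^bsub>C\<^esub> ?w = x"
      using that pb by auto
    show ?thesis
      unfolding act_def [of C A ?H] edg [OF that(1,2)]
      using that w sq pb by (simp add: G.act_comp F.act_comp F.src_act)
  qed
  have "partite_cofunctor C A D ?H"
  proof (rule H.partite_cofunctorI)
    fix i assume i: "i \<in> Idx A"
    have "act C A F i i (Unt A i \<cdot>\<^bsub>C\<^esub> (cf_vtx F i \<cdot>\<^bsub>C\<^esub> cf_vtx G (cf_idx F i))) (cf_vtx G (cf_idx F i))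
        = Unt B (cf_idx F i) \<cdot>\<^bsub>C\<^esub> cf_vtx G (cf_idx F i)"
      using F.act_unt [of i "cf_vtx G (cf_idx F i)"] i by simp
    then show "act C A ?H i i (Unt A i \<cdot>\<^bsub>C\<^esub> cf_vtx ?H i) (Ide C (Vtx D (cf_idx ?H i))) = Unt D (cf_idx ?H i)"
      using i G.act_unt [of "cf_idx F i" "Ide C (Vtx D (cf_idx G (cf_idx F i)))"]
      by (subst act) auto
  next
    fix i j k a b x
    assume a: "i \<in> Idx A" "j \<in> Idx A" "k \<in> Idx A" "a \<in> Arr C" "b \<in> Arr C" "x \<in> Arr C"
      "Cod C a = Edg A i j" "Cod C b = Edg A j k" "Cod C x = Vtx D (cf_idx ?H i)"
      "Dom C a = Dom C x" "Dom C b = Dom C x"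
      "Src A i j \<cdot>\<^bsub>C\<^esub> a = cf_vtx ?H i \<cdot>\<^bsub>C\<^esub> x" "Src A j k \<cdot>\<^bsub>C\<^esub> b = Tgt A i j \<cdot>\<^bsub>C\<^esub> a"
    then show "act C A ?H i k (mult C A i j k b a) x = mult C D (cf_idx ?H i) (cf_idx ?H j) (cf_idx ?H k)
        (act C A ?H j k b (Tgt D (cf_idx ?H i) (cf_idx ?H j) \<cdot>\<^bsub>C\<^esub> act C A ?H i j a x)) (act C A ?H i j a x)"
      by (simp add: act F.A.src_mult F.act_mult G.act_mult F.src_act F.tgt_act G.src_act G.tgt_act)
  qed (auto simp: cofunctor_comp_def)
  then show "cofunctor C A D ?H" by (simp add: cofunctor_def F.restriction_category_axioms)
qed

context restriction_category
begin

lemma partite_iff: "partite C A \<longleftrightarrow> partite_internal_category C A"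
  by (simp add: partite_def restriction_category_axioms)

lemma cofunctor_iff: "cofunctor C A B F \<longleftrightarrow> partite_cofunctor C A B F"
  by (simp add: cofunctor_def restriction_category_axioms)

lemma pCat_simps [simp]:
  "A \<in> Ob (pCat C) \<longleftrightarrow> partite C A"
  "(A, F, B) \<in> Arr (pCat C) \<longleftrightarrow> cofunctor C A B F"
  "Dom (pCat C) (A, F, B) = A"
  "Cod (pCat C) (A, F, B) = B"
  "Ide (pCat C) A = (A, cofunctor_id C A, A)"
  "(B, G, D) \<cdot>\<^bsub>pCat C\<^esub> (A, F, B') = (A, cofunctor_comp C A B G F, D)"
  by (auto simp: pCat_def partite_iff cofunctor_iff)

lemma in_Hom_pCat: "f \<in> Hom (pCat C) A B \<longleftrightarrow> (\<exists>F. f = (A, F, B) \<and> cofunctor C A B F)"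
  by (cases f) (auto simp: in_Hom_iff)

lemma cofunctor_partite: "cofunctor C A B F \<Longrightarrow> partite C A" "cofunctor C A B F \<Longrightarrow> partite C B"
  by (auto simp: cofunctor_def partite_def partite_cofunctor_def)

text \<open>Equations between cofunctors are compared on lifts by \<open>cofunctor_eqI\<close>,
  where composites become iterated lifts and associativity is immediate.\<close>

lemma pCat_category:
  "category (pCat C :: (('i, 'o, 'm) partite, ('i, 'o, 'm) partite_arrow) category)"
proof
  fix f :: "('i, 'o, 'm) partite_arrow" assume "f \<in> Arr (pCat C)"
  then obtain A F B where F: "f = (A, F, B)" "cofunctor C A B F" by (cases f) auto
  show "Dom (pCat C) f \<in> Ob (pCat C)" "Cod (pCat C) f \<in> Ob (pCat C)"
    using cofunctor_partite [OF F(2)] by (simp_all add: F(1))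
next
  fix A :: "('i, 'o, 'm) partite"
  show "A \<in> Ob (pCat C) \<Longrightarrow> Ide (pCat C) A \<in> Hom (pCat C) A A"
    by (auto simp: in_Hom_pCat partite.cofunctor_id)
next
  fix f g :: "('i, 'o, 'm) partite_arrow" and A B D
  show "f \<in> Hom (pCat C) A B \<Longrightarrow> g \<in> Hom (pCat C) B D \<Longrightarrow> g \<cdot>\<^bsub>pCat C\<^esub> f \<in> Hom (pCat C) A D"
    by (auto simp: in_Hom_pCat cofunctor_comp)
next
  fix f :: "('i, 'o, 'm) partite_arrow" and A B assume "f \<in> Hom (pCat C) A B"
  then obtain F where F: "f = (A, F, B)" "cofunctor C A B F" by (auto simp: in_Hom_pCat)
  interpret F: cofunctor C A B F by fact
  note comp = cofunctor_comp [OF F.A.cofunctor_id F(2)] cofunctor_comp [OF F(2) F.B.cofunctor_id]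
  have "cofunctor_comp C A A F (cofunctor_id C A) = F"
  proof (rule cofunctor_eqI [OF comp(1) F(2)])
    show 1: "cf_idx (cofunctor_comp C A A F (cofunctor_id C A)) i = cf_idx F i" if "i \<in> Idx A" for i
      using that by (auto simp: cofunctor_comp_def cofunctor_id_def)
    show 2: "cf_vtx (cofunctor_comp C A A F (cofunctor_id C A)) i = cf_vtx F i" if "i \<in> Idx A" for i
      using that by (auto simp: cofunctor_comp_def cofunctor_id_def)
    have [simp]: "cf_idx (cofunctor_id C A) i = i" "cf_vtx (cofunctor_id C A) i = Ide C (Vtx A i)"
      if "i \<in> Idx A" for i using that by (auto simp: cofunctor_id_def)
    show "act C A (cofunctor_comp C A A F (cofunctor_id C A)) i j a x = act C A F i j a x"
      if "i \<in> Idx A" "j \<in> Idx A" "a \<in> Arr C" "x \<in> Arr C" "Cod C a = Edg A i j"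
        "Cod C x = Vtx B (cf_idx (cofunctor_comp C A A F (cofunctor_id C A)) i)" "Dom C a = Dom C x"
        "Src A i j \<cdot> a = cf_vtx (cofunctor_comp C A A F (cofunctor_id C A)) i \<cdot> x" for i j a x
      using that unfolding 1 [OF that(1)] 2 [OF that(1)]
      by (subst act_cofunctor_comp [OF F.A.cofunctor_id F(2)]) (auto simp: F.A.act_id)
  qed
  moreover have "cofunctor_comp C A B (cofunctor_id C B) F = F"
  proof (rule cofunctor_eqI [OF comp(2) F(2)])
    have [simp]: "cf_idx (cofunctor_id C B) i = i" "cf_vtx (cofunctor_id C B) i = Ide C (Vtx B i)"
      if "i \<in> Idx B" for i using that by (auto simp: cofunctor_id_def)
    show 1: "cf_idx (cofunctor_comp C A B (cofunctor_id C B) F) i = cf_idx F i" if "i \<in> Idx A" for i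
      using that by (auto simp: cofunctor_comp_def)
    show 2: "cf_vtx (cofunctor_comp C A B (cofunctor_id C B) F) i = cf_vtx F i" if "i \<in> Idx A" for i
      using that by (auto simp: cofunctor_comp_def)
    show "act C A (cofunctor_comp C A B (cofunctor_id C B) F) i j a x = act C A F i j a x"
      if "i \<in> Idx A" "j \<in> Idx A" "a \<in> Arr C" "x \<in> Arr C" "Cod C a = Edg A i j"
        "Cod C x = Vtx B (cf_idx (cofunctor_comp C A B (cofunctor_id C B) F) i)" "Dom C a = Dom C x"
        "Src A i j \<cdot> a = cf_vtx (cofunctor_comp C A B (cofunctor_id C B) F) i \<cdot> x" for i j a x
      using that unfolding 1 [OF that(1)] 2 [OF that(1)]
      by (subst act_cofunctor_comp [OF F(2) F.B.cofunctor_id]) (auto simp: F.B.act_id F.src_act)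
  qed
  ultimately show "f \<cdot>\<^bsub>pCat C\<^esub> Ide (pCat C) A = f" "Ide (pCat C) B \<cdot>\<^bsub>pCat C\<^esub> f = f"
    by (auto simp: F(1))
next
  fix f g h :: "('i, 'o, 'm) partite_arrow" and A B D E
  assume "f \<in> Hom (pCat C) A B" "g \<in> Hom (pCat C) B D" "h \<in> Hom (pCat C) D E"
  then obtain F G H where FGH: "f = (A, F, B)" "g = (B, G, D)" "h = (D, H, E)"
    and F: "cofunctor C A B F" and G: "cofunctor C B D G" and H: "cofunctor C D E H"
    by (auto simp: in_Hom_pCat)
  interpret F: cofunctor C A B F by fact
  interpret G: cofunctor C B D G by fact
  interpret H: cofunctor C D E H by fact
  note GF = cofunctor_comp [OF F G] and HG = cofunctor_comp [OF G H]
  have [simp]: "cf_idx (cofunctor_comp C A B K F) i = cf_idx K (cf_idx F i)"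
    "cf_vtx (cofunctor_comp C A B K F) i = cf_vtx F i \<cdot> cf_vtx K (cf_idx F i)" if "i \<in> Idx A" for i K
    using that by (auto simp: cofunctor_comp_def)
  have [simp]: "cf_idx (cofunctor_comp C B D H G) i = cf_idx H (cf_idx G i)"
    "cf_vtx (cofunctor_comp C B D H G) i = cf_vtx G i \<cdot> cf_vtx H (cf_idx G i)" if "i \<in> Idx B" for i
    using that by (auto simp: cofunctor_comp_def)
  have [simp]: "cf_idx (cofunctor_comp C A D H (cofunctor_comp C A B G F)) i = cf_idx H (cf_idx G (cf_idx F i))"
    "cf_vtx (cofunctor_comp C A D H (cofunctor_comp C A B G F)) i =
      cf_vtx F i \<cdot> (cf_vtx G (cf_idx F i) \<cdot> cf_vtx H (cf_idx G (cf_idx F i)))" if "i \<in> Idx A" for i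
    using that by (auto simp: cofunctor_comp_def)
  have "cofunctor_comp C A D H (cofunctor_comp C A B G F) = cofunctor_comp C A B (cofunctor_comp C B D H G) F"
  proof (rule cofunctor_eqI [OF cofunctor_comp [OF GF H] cofunctor_comp [OF F HG]])
    fix i j a x
    assume a: "i \<in> Idx A" "j \<in> Idx A" "a \<in> Arr C" "x \<in> Arr C" "Cod C a = Edg A i j"
        "Cod C x = Vtx E (cf_idx (cofunctor_comp C A D H (cofunctor_comp C A B G F)) i)" "Dom C a = Dom C x"
        "Src A i j \<cdot> a = cf_vtx (cofunctor_comp C A D H (cofunctor_comp C A B G F)) i \<cdot> x"
    then show "act C A (cofunctor_comp C A D H (cofunctor_comp C A B G F)) i j a x =
        act C A (cofunctor_comp C A B (cofunctor_comp C B D H G) F) i j a x"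
      by (simp add: act_cofunctor_comp [OF GF H] act_cofunctor_comp [OF F G] act_cofunctor_comp [OF F HG]
          act_cofunctor_comp [OF G H] F.src_act)
  qed auto
  then show "h \<cdot>\<^bsub>pCat C\<^esub> (g \<cdot>\<^bsub>pCat C\<^esub> f) = h \<cdot>\<^bsub>pCat C\<^esub> g \<cdot>\<^bsub>pCat C\<^esub> f"
    by (simp add: FGH)
qed

end

section \<open>The category of restriction categories over \<open>C\<close>\<close>

lemma is_functorD:
  assumes "is_functor A B F"
  shows "category A" "category B" "on_ob F \<in> extensional (Ob A)" "on_ar F \<in> extensional (Arr A)"
    "a \<in> Ob A \<Longrightarrow> on_ob F a \<in> Ob B" "f \<in> Arr A \<Longrightarrow> on_ar F f \<in> Arr B"
    "f \<in> Arr A \<Longrightarrow> Dom B (on_ar F f) = on_ob F (Dom A f)"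
    "f \<in> Arr A \<Longrightarrow> Cod B (on_ar F f) = on_ob F (Cod A f)"
    "a \<in> Ob A \<Longrightarrow> on_ar F (Ide A a) = Ide B (on_ob F a)"
    "f \<in> Arr A \<Longrightarrow> g \<in> Arr A \<Longrightarrow> Dom A g = Cod A f \<Longrightarrow>
      on_ar F (g \<cdot>\<^bsub>A\<^esub> f) = on_ar F g \<cdot>\<^bsub>B\<^esub> on_ar F f"
  using assms unfolding is_functor_def by (auto simp: in_Hom_iff PiE_def)

lemma is_functorI:
  assumes "category A" "category B" "on_ob F \<in> extensional (Ob A)" "on_ar F \<in> extensional (Arr A)"
    "\<And>a. a \<in> Ob A \<Longrightarrow> on_ob F a \<in> Ob B" "\<And>f. f \<in> Arr A \<Longrightarrow> on_ar F f \<in> Arr B"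
    "\<And>f. f \<in> Arr A \<Longrightarrow> Dom B (on_ar F f) = on_ob F (Dom A f)"
    "\<And>f. f \<in> Arr A \<Longrightarrow> Cod B (on_ar F f) = on_ob F (Cod A f)"
    "\<And>a. a \<in> Ob A \<Longrightarrow> on_ar F (Ide A a) = Ide B (on_ob F a)"
    "\<And>f g. f \<in> Arr A \<Longrightarrow> g \<in> Arr A \<Longrightarrow> Dom A g = Cod A f \<Longrightarrow>
      on_ar F (g \<cdot>\<^bsub>A\<^esub> f) = on_ar F g \<cdot>\<^bsub>B\<^esub> on_ar F f"
  shows "is_functor A B F"
  using assms unfolding is_functor_def by (auto simp: in_Hom_iff PiE_def)

lemma functor_comp_simps [simp]:
  "a \<in> Ob A \<Longrightarrow> on_ob (functor_comp A G F) a = on_ob G (on_ob F a)"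
  "f \<in> Arr A \<Longrightarrow> on_ar (functor_comp A G F) f = on_ar G (on_ar F f)"
  by (auto simp: functor_comp_def)

lemma functor_comp_functor:
  assumes "is_functor A B F" "is_functor B D G"
  shows "is_functor A D (functor_comp A G F)"
proof -
  interpret category A by (rule is_functorD [OF assms(1)])
  show ?thesis
    by (rule is_functorI)
      (auto simp: is_functorD [OF assms(1)] is_functorD [OF assms(2)],
        auto simp: functor_comp_def)
qed

lemma functor_id_functor:
  assumes "category A"
  shows "is_functor A A (functor_id A)"
proof -
  interpret category A by fact
  show ?thesis by (rule is_functorI) (auto simp: functor_id_def category_axioms)
qed

lemma functor_data_eqI:
  "on_ob F \<in> extensional S \<Longrightarrow> on_ob G \<in> extensional S \<Longrightarrow>
    on_ar F \<in> extensional T \<Longrightarrow> on_ar G \<in> extensional T \<Longrightarrow>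
    (\<And>a. a \<in> S \<Longrightarrow> on_ob F a = on_ob G a) \<Longrightarrow> (\<And>f. f \<in> T \<Longrightarrow> on_ar F f = on_ar G f) \<Longrightarrow> F = G"
  for F G :: "('a, 'b, 'c, 'd) functor_data"
  by (rule functor_data.equality) (auto intro: extensionalityI)

lemma is_functor_eqI:
  "is_functor A B F \<Longrightarrow> is_functor A B G \<Longrightarrow>
    (\<And>a. a \<in> Ob A \<Longrightarrow> on_ob F a = on_ob G a) \<Longrightarrow> (\<And>f. f \<in> Arr A \<Longrightarrow> on_ar F f = on_ar G f) \<Longrightarrow> F = G"
  using functor_data_eqI [of F "Ob A" G "Arr A"] is_functorD(3,4) [of A B F] is_functorD(3,4) [of A B G]
  by blast

lemma restriction_functorD:
  assumes "restriction_functor A B F"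
  shows "restriction_category A" "restriction_category B" "is_functor A B F"
    "f \<in> Arr A \<Longrightarrow> on_ar F (Rst A f) = Rst B (on_ar F f)"
  using assms by (auto simp: restriction_functor_def)

lemma restriction_functor_comp:
  assumes "restriction_functor A B F" "restriction_functor B D G"
  shows "restriction_functor A D (functor_comp A G F)"
proof -
  note F = restriction_functorD [OF assms(1)] and G = restriction_functorD [OF assms(2)]
  interpret restriction_category A by (rule F)
  show ?thesis
    unfolding restriction_functor_def
    using F G is_functorD [OF F(3)] by (auto simp: functor_comp_functor)
qed

lemma nat_transD:
  assumes "nat_trans A B F G \<alpha>"
  shows "is_functor A B F" "is_functor A B G" "\<alpha> \<in> extensional (Ob A)"
    "a \<in> Ob A \<Longrightarrow> \<alpha> a \<in> Arr B" "a \<in> Ob A \<Longrightarrow> Dom B (\<alpha> a) = on_ob F a"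
    "a \<in> Ob A \<Longrightarrow> Cod B (\<alpha> a) = on_ob G a"
    "f \<in> Arr A \<Longrightarrow> on_ar G f \<cdot>\<^bsub>B\<^esub> \<alpha> (Dom A f) = \<alpha> (Cod A f) \<cdot>\<^bsub>B\<^esub> on_ar F f"
  using assms unfolding nat_trans_def by (auto simp: in_Hom_iff)

lemma nat_transI:
  assumes "is_functor A B F" "is_functor A B G" "\<alpha> \<in> extensional (Ob A)"
    "\<And>a. a \<in> Ob A \<Longrightarrow> \<alpha> a \<in> Arr B" "\<And>a. a \<in> Ob A \<Longrightarrow> Dom B (\<alpha> a) = on_ob F a"
    "\<And>a. a \<in> Ob A \<Longrightarrow> Cod B (\<alpha> a) = on_ob G a"
    "\<And>f. f \<in> Arr A \<Longrightarrow> on_ar G f \<cdot>\<^bsub>B\<^esub> \<alpha> (Dom A f) = \<alpha> (Cod A f) \<cdot>\<^bsub>B\<^esub> on_ar F f"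
  shows "nat_trans A B F G \<alpha>"
  using assms unfolding nat_trans_def by (auto simp: in_Hom_iff)

lemma over_map_iff:
  "over_map C (A, P) (B, Q) (F, \<alpha>) \<longleftrightarrow>
     restriction_functor A B F \<and> nat_trans A C (functor_comp A Q F) P \<alpha> \<and> (\<forall>a\<in>Ob A. total C (\<alpha> a))"
  by (simp add: over_map_def)

lemma over_comp_simp:
  "over_comp C A (G, \<beta>) (F, \<alpha>) = (functor_comp A G F, \<lambda>a\<in>Ob A. \<alpha> a \<cdot>\<^bsub>C\<^esub> \<beta> (on_ob F a))"
  by (simp add: over_comp_def)

context restriction_category
begin

lemma over_comp_map:
  assumes "restriction_functor A C P" "restriction_functor B C Q" "restriction_functor D C R"
    "over_map C (A, P) (B, Q) (F, \<alpha>)" "over_map C (B, Q) (D, R) (G, \<beta>)"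
  shows "over_map C (A, P) (D, R) (over_comp C A (G, \<beta>) (F, \<alpha>))"
proof -
  have F: "restriction_functor A B F" "nat_trans A C (functor_comp A Q F) P \<alpha>" "\<And>a. a\<in>Ob A \<Longrightarrow> total C (\<alpha> a)"
    and G: "restriction_functor B D G" "nat_trans B C (functor_comp B R G) Q \<beta>" "\<And>a. a\<in>Ob B \<Longrightarrow> total C (\<beta> a)"
    using assms(4,5) by (auto simp: over_map_iff)
  note Ff = is_functorD [OF restriction_functorD(3) [OF F(1)]]
    and Gf = is_functorD [OF restriction_functorD(3) [OF G(1)]]
    and Rf = is_functorD [OF restriction_functorD(3) [OF assms(3)]]
    and Pf = is_functorD [OF restriction_functorD(3) [OF assms(1)]]
    and Qf = is_functorD [OF restriction_functorD(3) [OF assms(2)]]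
  note \<alpha> = nat_transD [OF F(2)] and \<beta> = nat_transD [OF G(2)]
  interpret A: category A by (rule Ff)
  interpret B: category B by (rule Ff)
  interpret D: category D by (rule Gf)
  note ty = Ff(5-10) Gf(5-10) Rf(5-10) Pf(5-10) Qf(5-10)
  have "nat_trans A C (functor_comp A R (functor_comp A G F)) P (\<lambda>a\<in>Ob A. \<alpha> a \<cdot> \<beta> (on_ob F a))"
  proof (rule nat_transI)
    show "is_functor A C (functor_comp A R (functor_comp A G F))"
      using assms(3) F(1) G(1) by (auto intro!: functor_comp_functor dest: restriction_functorD(3))
    show "is_functor A C P" using assms(1) by (rule restriction_functorD)
    fix f assume f: "f \<in> Arr A"
    have 1: "on_ar P f \<cdot> \<alpha> (Dom A f) = \<alpha> (Cod A f) \<cdot> on_ar Q (on_ar F f)"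
      using \<alpha>(7) [OF f] f by simp
    have 2: "on_ar Q (on_ar F f) \<cdot> \<beta> (on_ob F (Dom A f)) = \<beta> (on_ob F (Cod A f)) \<cdot> on_ar R (on_ar G (on_ar F f))"
      using \<beta>(7) [of "on_ar F f"] f ty by simp
    show "on_ar P f \<cdot> (\<lambda>a\<in>Ob A. \<alpha> a \<cdot> \<beta> (on_ob F a)) (Dom A f)
        = (\<lambda>a\<in>Ob A. \<alpha> a \<cdot> \<beta> (on_ob F a)) (Cod A f) \<cdot> on_ar (functor_comp A R (functor_comp A G F)) f"
      using f ty \<alpha>(4-6) \<beta>(4-6) comp_reduce2 [OF 1, of "\<beta> (on_ob F (Dom A f))"] 2 by simp
  qed (use \<alpha>(4-6) \<beta>(4-6) ty in auto)
  moreover have "total C (\<alpha> a \<cdot> \<beta> (on_ob F a))" if "a \<in> Ob A" for a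
    using that F(3) G(3) \<alpha>(4-6) \<beta>(4-6) ty by auto
  ultimately show ?thesis
    using restriction_functor_comp [OF F(1) G(1)] by (auto simp: over_map_iff over_comp_simp)
qed

lemma over_id_map:
  assumes "restriction_functor A C P"
  shows "over_map C (A, P) (A, P) (over_id C (A, P))"
proof -
  note P = is_functorD [OF restriction_functorD(3) [OF assms]]
  interpret A: restriction_category A by (rule restriction_functorD [OF assms])
  have "restriction_functor A A (functor_id A)"
    unfolding restriction_functor_def
    using functor_id_functor [of A] A.category_axioms A.restriction_category_axioms
    by (auto simp: functor_id_def)
  moreover have "functor_comp A P (functor_id A) = P"
    by (rule is_functor_eqI [of A C])
      (use functor_comp_functor [OF functor_id_functor restriction_functorD(3) [OF assms]]
        restriction_functorD(3) [OF assms] A.category_axioms in \<open>auto simp: functor_id_def\<close>)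
  ultimately show ?thesis
    unfolding over_id_def prod.case over_map_iff
    using restriction_functorD(3) [OF assms] P by (auto intro!: nat_transI)
qed

lemma rCat_over_simps [simp]:
  "X \<in> Ob (rCat_over K C) \<longleftrightarrow> over_ob K C X"
  "(X, m, Y) \<in> Arr (rCat_over K C) \<longleftrightarrow> over_ob K C X \<and> over_ob K C Y \<and> over_map C X Y m"
  "Dom (rCat_over K C) (X, m, Y) = X"
  "Cod (rCat_over K C) (X, m, Y) = Y"
  "Ide (rCat_over K C) X = (X, over_id C X, X)"
  "(Y, n, Z) \<cdot>\<^bsub>rCat_over K C\<^esub> (X, m, Y') = (X, over_comp C (fst X) n m, Z)"
  by (auto simp: rCat_over_def)

lemma in_Hom_rCat_over:
  "f \<in> Hom (rCat_over K C) X Y \<longleftrightarrow>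
    (\<exists>F \<alpha>. f = (X, (F, \<alpha>), Y) \<and> over_ob K C X \<and> over_ob K C Y \<and> over_map C X Y (F, \<alpha>))"
  by (cases f) (auto simp: in_Hom_iff)

text \<open>Composite functors and their natural transformations are restricted to their index sets,
  so the unit and associativity laws hold as equations once both sides are compared there.\<close>

lemma rCat_over_category:
  "category (rCat_over K C :: (('c, 'd, 'o, 'm) over, ('c, 'd, 'o, 'm) over_arrow) category)"
proof
  fix f :: "('c, 'd, 'o, 'm) over_arrow" assume "f \<in> Arr (rCat_over K C)"
  then show "Dom (rCat_over K C) f \<in> Ob (rCat_over K C)" "Cod (rCat_over K C) f \<in> Ob (rCat_over K C)"
    by (cases f; auto)+
next
  fix X :: "('c, 'd, 'o, 'm) over" assume "X \<in> Ob (rCat_over K C)"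
  then show "Ide (rCat_over K C) X \<in> Hom (rCat_over K C) X X"
    using over_id_map by (cases X) (auto simp: in_Hom_iff over_ob_def)
next
  fix f g :: "('c, 'd, 'o, 'm) over_arrow" and X Y Z
  assume "f \<in> Hom (rCat_over K C) X Y" "g \<in> Hom (rCat_over K C) Y Z"
  then obtain F \<alpha> G \<beta> where "f = (X, (F, \<alpha>), Y)" "g = (Y, (G, \<beta>), Z)" "over_ob K C X" "over_ob K C Y"
      "over_ob K C Z" "over_map C X Y (F, \<alpha>)" "over_map C Y Z (G, \<beta>)"
    by (auto simp: in_Hom_rCat_over)
  then show "g \<cdot>\<^bsub>rCat_over K C\<^esub> f \<in> Hom (rCat_over K C) X Z"
    using over_comp_map [of "fst X" "snd X" "fst Y" "snd Y" "fst Z" "snd Z" F \<alpha> G \<beta>]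
    by (auto simp: in_Hom_iff over_ob_def case_prod_beta)
next
  fix f :: "('c, 'd, 'o, 'm) over_arrow" and X Y assume "f \<in> Hom (rCat_over K C) X Y"
  then obtain A P B Q F \<alpha> where f: "X = (A, P)" "Y = (B, Q)" "f = (X, (F, \<alpha>), Y)"
      and P: "restriction_functor A C P" "restriction_functor B C Q"
      and F: "restriction_functor A B F" "nat_trans A C (functor_comp A Q F) P \<alpha>"
    by (cases X; cases Y) (auto simp: in_Hom_rCat_over over_ob_def over_map_iff)
  note Ff = is_functorD [OF restriction_functorD(3) [OF F(1)]] and \<alpha> = nat_transD [OF F(2)]
  interpret A: category A by (rule Ff)
  interpret B: category B by (rule Ff)
  note F' = restriction_functorD(3) [OF F(1)]
  have 1: "functor_comp A F (functor_id A) = F"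
    by (rule is_functor_eqI [OF functor_comp_functor [OF functor_id_functor [OF Ff(1)] F'] F'])
      (auto simp: functor_id_def)
  have 3: "functor_comp A (functor_id B) F = F"
    by (rule is_functor_eqI [OF functor_comp_functor [OF F' functor_id_functor [OF Ff(2)]] F'])
      (auto simp: functor_id_def Ff)
  have 2: "(\<lambda>a\<in>Ob A. (\<lambda>a\<in>Ob A. Ide C (on_ob P a)) a \<cdot> \<alpha> (on_ob (functor_id A) a)) = \<alpha>"
    "(\<lambda>a\<in>Ob A. \<alpha> a \<cdot> (\<lambda>a\<in>Ob B. Ide C (on_ob Q a)) (on_ob F a)) = \<alpha>"
    by (rule extensionalityI [of _ "Ob A"]; use \<alpha> Ff in \<open>auto simp: functor_id_def\<close>)+
  show "f \<cdot>\<^bsub>rCat_over K C\<^esub> Ide (rCat_over K C) X = f" "Ide (rCat_over K C) Y \<cdot>\<^bsub>rCat_over K C\<^esub> f = f"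
    unfolding f using 1 3 2 by (simp_all add: over_id_def over_comp_simp)
next
  fix f g h :: "('c, 'd, 'o, 'm) over_arrow" and X Y Z W
  assume "f \<in> Hom (rCat_over K C) X Y" "g \<in> Hom (rCat_over K C) Y Z" "h \<in> Hom (rCat_over K C) Z W"
  then obtain A P B Q F \<alpha> D R G \<beta> E S H \<gamma> where f: "X = (A, P)" "Y = (B, Q)" "f = (X, (F, \<alpha>), Y)"
      and P: "restriction_functor A C P" "restriction_functor B C Q" "restriction_functor D C R"
      and F: "restriction_functor A B F" "nat_trans A C (functor_comp A Q F) P \<alpha>"
      and g: "Z = (D, R)" "g = (Y, (G, \<beta>), Z)"
      and G: "restriction_functor B D G" "nat_trans B C (functor_comp B R G) Q \<beta>"
      and h: "W = (E, S)" "h = (Z, (H, \<gamma>), W)"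
      and H: "restriction_functor D E H" "nat_trans D C (functor_comp D S H) R \<gamma>"
    by (cases X; cases Y; cases Z; cases W) (auto simp: in_Hom_rCat_over over_ob_def over_map_iff)
  note F' = restriction_functorD(3) [OF F(1)] and G' = restriction_functorD(3) [OF G(1)]
    and H' = restriction_functorD(3) [OF H(1)]
  note Ff = is_functorD [OF F'] and Gf = is_functorD [OF G']
  note \<alpha> = nat_transD [OF F(2)] and \<beta> = nat_transD [OF G(2)] and \<gamma> = nat_transD [OF H(2)]
  have 1: "functor_comp A H (functor_comp A G F) = functor_comp A (functor_comp B H G) F"
    by (rule is_functor_eqI [of A E])
      (use functor_comp_functor [OF functor_comp_functor [OF F' G'] H']
        functor_comp_functor [OF F' functor_comp_functor [OF G' H']] Ff in auto)
  have 2: "(\<lambda>a\<in>Ob A. (\<lambda>a\<in>Ob A. \<alpha> a \<cdot> \<beta> (on_ob F a)) a \<cdot> \<gamma> (on_ob (functor_comp A G F) a))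
      = (\<lambda>a\<in>Ob A. \<alpha> a \<cdot> (\<lambda>a\<in>Ob B. \<beta> a \<cdot> \<gamma> (on_ob G a)) (on_ob F a))"
    by (rule extensionalityI [of _ "Ob A"]) (use \<alpha>(4-6) \<beta>(4-6) \<gamma>(4-6) Ff Gf in auto)
  show "h \<cdot>\<^bsub>rCat_over K C\<^esub> (g \<cdot>\<^bsub>rCat_over K C\<^esub> f) = h \<cdot>\<^bsub>rCat_over K C\<^esub> g \<cdot>\<^bsub>rCat_over K C\<^esub> f"
    unfolding f g h using 1 2 by (simp add: over_comp_simp)
qed

end

section \<open>The functor \<open>\<Phi>\<close>\<close>

text \<open>The arrow part of \<Phi> F in terms of elements: \<open>s \<cdot> cf_vtx F i\<close> is
  lifted over its own restriction, the idempotent that marks where it is defined.\<close>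

definition sec_map ::
  "('o, 'm) rcategory \<Rightarrow> ('i, 'o, 'm) partite \<Rightarrow> ('i, 'j, 'm) cofunctor_data \<Rightarrow> 'i \<Rightarrow> 'i \<Rightarrow> 'm \<Rightarrow> 'm" where
  "sec_map C A F i j s = act C A F i j (s \<cdot>\<^bsub>C\<^esub> cf_vtx F i) (Rst C (s \<cdot>\<^bsub>C\<^esub> cf_vtx F i))"

context cofunctor
begin

lemma
  assumes "i \<in> Idx A" "j \<in> Idx A" "s \<in> partial_sections C (Src A i j)"
  shows sec_map_eq: "cf_edg F i j \<cdot> pb_section C (Src A i j) (cf_vtx F i) s = sec_map C A F i j s"
    and sec_map_square: "Src A i j \<cdot> (s \<cdot> cf_vtx F i) = cf_vtx F i \<cdot> Rst C (s \<cdot> cf_vtx F i)"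
    and rst_sec_map: "Rst C (sec_map C A F i j s) = Rst C (s \<cdot> cf_vtx F i)"
    and sec_map_section: "sec_map C A F i j s \<in> partial_sections C (Src B (cf_idx F i) (cf_idx F j))"
    and tgt_sec_map:
      "cf_vtx F j \<cdot> (Tgt B (cf_idx F i) (cf_idx F j) \<cdot> sec_map C A F i j s) = Tgt A i j \<cdot> (s \<cdot> cf_vtx F i)"
    and sec_map_comp: "x \<in> Arr C \<Longrightarrow> Cod C x = Vtx B (cf_idx F i) \<Longrightarrow> sec_map C A F i j s \<cdot> x
      = act C A F i j (s \<cdot> (cf_vtx F i \<cdot> x)) (x \<cdot> Rst C (s \<cdot> (cf_vtx F i \<cdot> x)))"
proof -
  note s = A.sec [OF assms]
  show "cf_edg F i j \<cdot> pb_section C (Src A i j) (cf_vtx F i) s = sec_map C A F i j s"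
    by (simp add: sec_map_def act_def pb_section_def)
  show sq: "Src A i j \<cdot> (s \<cdot> cf_vtx F i) = cf_vtx F i \<cdot> Rst C (s \<cdot> cf_vtx F i)"
    using comp_reduce [OF s(4), of "cf_vtx F i"] rst_comp' [of "cf_vtx F i" s] s assms by simp
  show R: "Rst C (sec_map C A F i j s) = Rst C (s \<cdot> cf_vtx F i)"
    unfolding sec_map_def using assms s sq by (simp add: rst_act)
  show "sec_map C A F i j s \<in> partial_sections C (Src B (cf_idx F i) (cf_idx F j))"
    unfolding in_partial_sections R unfolding sec_map_def using assms s sq by (simp add: src_act)
  show "cf_vtx F j \<cdot> (Tgt B (cf_idx F i) (cf_idx F j) \<cdot> sec_map C A F i j s) = Tgt A i j \<cdot> (s \<cdot> cf_vtx F i)"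
    unfolding sec_map_def using assms s sq by (simp add: tgt_act)
  show "sec_map C A F i j s \<cdot> x
      = act C A F i j (s \<cdot> (cf_vtx F i \<cdot> x)) (x \<cdot> Rst C (s \<cdot> (cf_vtx F i \<cdot> x)))"
    if "x \<in> Arr C" "Cod C x = Vtx B (cf_idx F i)"
    unfolding sec_map_def
    using that assms s sq rst_comp' [of x "s \<cdot> cf_vtx F i"] by (simp add: act_comp)
qed

text \<open>The idempotent e pulls back along \<open>cf_vtx F i\<close> to
  \<open>Rst C (e \<cdot> cf_vtx F i)\<close>, and over this idempotent the unit law of F
  applies.\<close>

lemma sec_map_unt:
  assumes "i \<in> Idx A" "e \<in> rst_idems C (Vtx A i)"
  shows "sec_map C A F i i (Unt A i \<cdot> e) = Unt B (cf_idx F i) \<cdot> Rst C (e \<cdot> cf_vtx F i)"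
proof -
  have "e \<cdot> cf_vtx F i = cf_vtx F i \<cdot> Rst C (e \<cdot> cf_vtx F i)"
    using idem_comp_map [of "cf_vtx F i" e] assms by simp
  moreover have "Rst C ((Unt A i \<cdot> e) \<cdot> cf_vtx F i) = Rst C (e \<cdot> cf_vtx F i)"
    using assms by (simp add: rst_idems_iff)
  ultimately show ?thesis
    unfolding sec_map_def using act_unt [of i "Rst C (e \<cdot> cf_vtx F i)"] assms
    by (simp add: rst_idems_iff)
qed

lemma sec_map_ide: "i \<in> Idx A \<Longrightarrow> sec_map C A F i i (Unt A i) = Unt B (cf_idx F i)"
  using sec_map_unt [of i "Ide C (Vtx A i)"] total_rst [OF total_vtx] by (simp add: rst_idems_iff)

text \<open>Both sides live on the domain \<open>?r\<close> of the composite section precomposed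
  with \<open>cf_vtx F i\<close>. Over it s and t become a composable pair of elements to which
  \<open>act_mult\<close> applies.\<close>

lemma sec_map_sec_comp:
  assumes "i \<in> Idx A" "j \<in> Idx A" "k \<in> Idx A"
    "s \<in> partial_sections C (Src A i j)" "t \<in> partial_sections C (Src A j k)"
  shows "sec_map C A F i k (sec_comp C A i j k t s) =
    sec_comp C B (cf_idx F i) (cf_idx F j) (cf_idx F k) (sec_map C A F j k t) (sec_map C A F i j s)"
proof -
  note s = A.sec [OF assms(1,2,4)] and t = A.sec [OF assms(2,3,5)]
  let ?x = "Tgt A i j \<cdot> (s \<cdot> cf_vtx F i)"
  let ?r = "Rst C (t \<cdot> ?x)"
  let ?s = "sec_map C A F i j s" and ?t = "sec_map C A F j k t"
  note s' = B.sec [OF idx [OF assms(1)] idx [OF assms(2)] sec_map_section [OF assms(1,2,4)]]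
  note sq = sec_map_square [OF assms(1,2,4)]
  have x: "?x \<in> Arr C" "Dom C ?x = Vtx B (cf_idx F i)" "Cod C ?x = Vtx A j" using assms s by auto
  have r: "Rst C (s \<cdot> cf_vtx F i) \<cdot> ?r = ?r"
    using rst_comp_absorb' [of "s \<cdot> cf_vtx F i" "t \<cdot> Tgt A i j"] s t assms by simp
  have rr: "?r \<in> Arr C" "Dom C ?r = Vtx B (cf_idx F i)" "Cod C ?r = Vtx B (cf_idx F i)"
    using assms x t by auto
  have sqr: "Src A i j \<cdot> (s \<cdot> (cf_vtx F i \<cdot> ?r)) = cf_vtx F i \<cdot> ?r"
  proof -
    have "(Src A i j \<cdot> (s \<cdot> cf_vtx F i)) \<cdot> ?r = (cf_vtx F i \<cdot> Rst C (s \<cdot> cf_vtx F i)) \<cdot> ?r"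
      by (simp only: sq)
    then show ?thesis using r rr s assms x t by simp
  qed
  have s1: "?s \<cdot> ?r = act C A F i j (s \<cdot> (cf_vtx F i \<cdot> ?r)) ?r"
    unfolding sec_map_def using sq r rr s assms x t by (simp add: act_comp)
  have c1: "sec_comp C A i j k t s \<cdot> cf_vtx F i = mult C A i j k (t \<cdot> ?x) (s \<cdot> (cf_vtx F i \<cdot> ?r))"
    unfolding sec_comp_def
    using rst_comp' [of "cf_vtx F i" "t \<cdot> (Tgt A i j \<cdot> s)"] A.sec_comp_square [OF assms] s t assms
    by (simp add: A.mult_comp)
  have sqt: "Src A j k \<cdot> (t \<cdot> ?x) = Tgt A i j \<cdot> (s \<cdot> (cf_vtx F i \<cdot> ?r))"
    using comp_reduce [OF t(4), of ?x] rst_comp' [of ?x t] x s t assms by simp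
  have r1: "Rst C (sec_comp C A i j k t s \<cdot> cf_vtx F i) = ?r"
    unfolding c1 using sqt s t assms x rr r rst_comp_rst' [of "t \<cdot> ?x" "s \<cdot> cf_vtx F i"]
    by (simp add: A.rst_mult)
  have L: "sec_map C A F i k (sec_comp C A i j k t s) =
      mult C B (cf_idx F i) (cf_idx F j) (cf_idx F k)
        (act C A F j k (t \<cdot> ?x) (Tgt B (cf_idx F i) (cf_idx F j) \<cdot> (?s \<cdot> ?r))) (?s \<cdot> ?r)"
    unfolding sec_map_def [of C A F i k] r1 unfolding c1 s1
    using sqt sqr s t assms x rr by (subst act_mult) auto
  \<comment> \<open>By \<open>tgt_sec_map\<close>, \<open>cf_vtx F j\<close> carries the target of
    the lifted section to the target of s, so t is lifted from the same element as in
    \<open>L\<close>.\<close>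
  have t1: "?t \<cdot> (Tgt B (cf_idx F i) (cf_idx F j) \<cdot> ?s) =
      act C A F j k (t \<cdot> ?x) (Tgt B (cf_idx F i) (cf_idx F j) \<cdot> (?s \<cdot> ?r))"
    using sec_map_comp [OF assms(2,3,5), of "Tgt B (cf_idx F i) (cf_idx F j) \<cdot> ?s"]
      tgt_sec_map [OF assms(1,2,4)] s' assms rr by simp
  have "Rst C (act C A F j k (t \<cdot> ?x) (Tgt B (cf_idx F i) (cf_idx F j) \<cdot> (?s \<cdot> ?r))) = ?r"
  proof -
    have "cf_vtx F j \<cdot> (Tgt B (cf_idx F i) (cf_idx F j) \<cdot> (?s \<cdot> ?r)) = Src A j k \<cdot> (t \<cdot> ?x)"
      unfolding sqt using comp_reduce2 [of "cf_vtx F j \<cdot> Tgt B (cf_idx F i) (cf_idx F j)" ?s "Tgt A i j" "s \<cdot> cf_vtx F i" ?r]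
        tgt_sec_map [OF assms(1,2,4)] s s' assms rr by simp
    then have "Rst C (act C A F j k (t \<cdot> ?x) (Tgt B (cf_idx F i) (cf_idx F j) \<cdot> (?s \<cdot> ?r)))
        = Rst C (Tgt B (cf_idx F i) (cf_idx F j) \<cdot> (?s \<cdot> ?r))"
      using s' t x rr assms by (intro rst_act) auto
    also have "\<dots> = ?r"
      using s' rr r assms s t by (simp add: rst_sec_map)
    finally show ?thesis .
  qed
  then show ?thesis unfolding L unfolding sec_comp_def [of C B] t1 by simp
qed

text \<open>Naturality of the vertex maps is \<open>tgt_sec_map\<close>; preservation of
  restrictions is \<open>sec_map_unt\<close> at the idempotent \<open>Rst C s\<close>.\<close>

lemma Phi_map_over: "over_map C (Phi_ob C A) (Phi_ob C B) (Phi_map C A F)"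
proof -
  let ?F = "fst (Phi_map C A F)"
  have ob [simp]: "on_ob ?F i = cf_idx F i" if "i \<in> Idx A" for i
    using that by (simp add: Phi_map_def)
  have ar [simp]: "on_ar ?F (i, s, j) = (cf_idx F i, sec_map C A F i j s, cf_idx F j)"
    if "i \<in> Idx A" "j \<in> Idx A" "s \<in> partial_sections C (Src A i j)" for i s j
    using that by (simp add: Phi_map_def sec_map_eq)
  interpret PA: restriction_category "Phi_cat C A" by (rule A.Phi_restriction_category)
  interpret PB: restriction_category "Phi_cat C B" by (rule B.Phi_restriction_category)
  note PAf = restriction_functorD(3) [OF A.Phi_proj_restriction_functor]
    and PBf = restriction_functorD(3) [OF B.Phi_proj_restriction_functor]
  have f: "is_functor (Phi_cat C A) (Phi_cat C B) ?F"
  proof (rule is_functorI)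
    show "on_ob ?F \<in> extensional (Ob (Phi_cat C A))" "on_ar ?F \<in> extensional (Arr (Phi_cat C A))"
      by (simp_all add: Phi_map_def)
  qed (auto simp: PA.category_axioms PB.category_axioms sec_map_section A.unt_section1 sec_map_ide
      A.sec_comp_section sec_map_sec_comp)
  have "restriction_functor (Phi_cat C A) (Phi_cat C B) ?F"
    unfolding restriction_functor_def
  proof (intro conjI ballI f)
    fix f assume "f \<in> Arr (Phi_cat C A)"
    then obtain i s j where s: "f = (i, s, j)" "i \<in> Idx A" "j \<in> Idx A" "s \<in> partial_sections C (Src A i j)"
      by (cases f) auto
    note t = A.sec [OF s(2-4)]
    show "on_ar ?F (Rst (Phi_cat C A) f) = Rst (Phi_cat C B) (on_ar ?F f)"
      using s t A.unt_section [of i "Rst C s"] sec_map_unt [of i "Rst C s"] by (simp add: rst_in_idems rst_sec_map)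
  qed (auto simp: PA.restriction_category_axioms PB.restriction_category_axioms)
  moreover have "nat_trans (Phi_cat C A) C (functor_comp (Phi_cat C A) (Phi_proj C B) ?F) (Phi_proj C A)
      (\<lambda>i\<in>Idx A. cf_vtx F i)"
  proof (rule nat_transI)
    fix f assume "f \<in> Arr (Phi_cat C A)"
    then obtain i s j where s: "f = (i, s, j)" "i \<in> Idx A" "j \<in> Idx A" "s \<in> partial_sections C (Src A i j)"
      by (cases f) auto
    note t = A.sec [OF s(2-4)]
    show "on_ar (Phi_proj C A) f \<cdot> (\<lambda>i\<in>Idx A. cf_vtx F i) (Dom (Phi_cat C A) f)
        = (\<lambda>i\<in>Idx A. cf_vtx F i) (Cod (Phi_cat C A) f) \<cdot> on_ar (functor_comp (Phi_cat C A) (Phi_proj C B) ?F) f"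
      using s t by (simp add: sec_map_section tgt_sec_map)
  qed (use functor_comp_functor [OF f PBf] PAf in auto)
  ultimately show ?thesis
    unfolding Phi_ob_def Phi_map_def by (simp add: over_map_iff)
qed

end

context restriction_category
begin

text \<open>An arrow of \<open>Phi_cat C A\<close> from i to j is a map of C tagged with i and j, so
  local smallness of C bounds the hom-sets.\<close>

lemma Phi_ob_over:
  assumes "partite C A" "locally_small K C"
  shows "over_ob K C (Phi_ob C A)"
proof -
  interpret A: partite C A by fact
  have "small K (Hom (Phi_cat C A) i j)" if "i \<in> Idx A" "j \<in> Idx A" for i j
  proof -
    have "Hom (Phi_cat C A) i j \<subseteq> (\<lambda>s. (i, s, j)) ` Hom C (Vtx A i) (Edg A i j)"
      using that by (auto simp: A.in_Hom_Phi_cat in_Hom_iff A.sec)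
    then have "Hom (Phi_cat C A) i j \<lesssim> Hom C (Vtx A i) (Edg A i j)"
      by (meson image_lepoll lepoll_trans subset_imp_lepoll)
    moreover have "small K (Hom C (Vtx A i) (Edg A i j))"
      using assms(2) that by (auto simp: locally_small_def)
    ultimately show ?thesis by (auto simp: small_def intro: lesspoll_trans1)
  qed
  then show ?thesis
    by (simp add: over_ob_def Phi_ob_def A.Phi_proj_restriction_functor locally_small_def)
qed

lemma Phi_map_id:
  assumes "partite C A"
  shows "Phi_map C A (cofunctor_id C A) = over_id C (Phi_ob C A)"
proof -
  interpret A: partite C A by fact
  interpret I: cofunctor C A A "cofunctor_id C A" by (rule A.cofunctor_id)
  have "fst (Phi_map C A (cofunctor_id C A)) = functor_id (Phi_cat C A)"
  proof (rule functor_data_eqI [of _ "Idx A" _ "Arr (Phi_cat C A)"])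
    fix f assume "f \<in> Arr (Phi_cat C A)"
    then obtain i s j where s: "f = (i, s, j)" "i \<in> Idx A" "j \<in> Idx A" "s \<in> partial_sections C (Src A i j)"
      by (cases f) auto
    note t = A.sec [OF s(2-4)]
    have "sec_map C A (cofunctor_id C A) i j s = s"
      using s t by (simp add: sec_map_def cofunctor_id_def A.act_id [unfolded cofunctor_id_def])
    then show "on_ar (fst (Phi_map C A (cofunctor_id C A))) f = on_ar (functor_id (Phi_cat C A)) f"
      using s by (simp add: Phi_map_def functor_id_def I.sec_map_eq) (simp add: cofunctor_id_def)
  qed (auto simp: Phi_map_def functor_id_def cofunctor_id_def)
  then show ?thesis
    by (simp add: Phi_map_def Phi_ob_def over_id_def cofunctor_id_def cong: restrict_cong)
qed

text \<open>Sections are transported by lifting and lifts along a composite are iterated lifts; what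
  remains is to compare the domains of the sections precomposed with the vertex maps.\<close>

lemma Phi_map_comp:
  assumes "cofunctor C A B F" "cofunctor C B D G"
  shows "Phi_map C A (cofunctor_comp C A B G F) = over_comp C (Phi_cat C A) (Phi_map C B G) (Phi_map C A F)"
proof -
  interpret F: cofunctor C A B F by fact
  interpret G: cofunctor C B D G by fact
  let ?H = "cofunctor_comp C A B G F"
  interpret H: cofunctor C A D ?H using assms by (rule cofunctor_comp)
  have [simp]: "cf_idx ?H i = cf_idx G (cf_idx F i)"
    "cf_vtx ?H i = cf_vtx F i \<cdot> cf_vtx G (cf_idx F i)" if "i \<in> Idx A" for i
    using that by (auto simp: cofunctor_comp_def)
  have "fst (Phi_map C A ?H) = functor_comp (Phi_cat C A) (fst (Phi_map C B G)) (fst (Phi_map C A F))"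
  proof (rule functor_data_eqI [of _ "Idx A" _ "Arr (Phi_cat C A)"])
    fix f assume "f \<in> Arr (Phi_cat C A)"
    then obtain i s j where s: "f = (i, s, j)" "i \<in> Idx A" "j \<in> Idx A" "s \<in> partial_sections C (Src A i j)"
      by (cases f) auto
    note t = F.A.sec [OF s(2-4)] and t' = F.B.sec [OF F.idx [OF s(2)] F.idx [OF s(3)] F.sec_map_section [OF s(2-4)]]
    let ?x = "cf_vtx G (cf_idx F i)"
    have "sec_map C A F i j s \<cdot> ?x =
        act C A F i j (s \<cdot> (cf_vtx F i \<cdot> ?x)) (?x \<cdot> Rst C (s \<cdot> (cf_vtx F i \<cdot> ?x)))"
      using F.sec_map_comp [OF s(2-4), of ?x] s by simp
    moreover have "Src A i j \<cdot> (s \<cdot> (cf_vtx F i \<cdot> ?x)) = cf_vtx F i \<cdot> (?x \<cdot> Rst C (s \<cdot> (cf_vtx F i \<cdot> ?x)))"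
      using H.sec_map_square [OF s(2-4)] s t by simp
    moreover have "Rst C (sec_map C A F i j s \<cdot> ?x) = Rst C (s \<cdot> (cf_vtx F i \<cdot> ?x))"
      using rst_rst_comp [of ?x "sec_map C A F i j s"] rst_rst_comp [of ?x "s \<cdot> cf_vtx F i"] s t t'
      by (simp add: F.rst_sec_map)
    ultimately have "sec_map C A ?H i j s = sec_map C B G (cf_idx F i) (cf_idx F j) (sec_map C A F i j s)"
      using s t by (simp add: sec_map_def [of C A ?H] sec_map_def [of C B G]
          act_cofunctor_comp [OF assms])
    then show "on_ar (fst (Phi_map C A ?H)) f
        = on_ar (functor_comp (Phi_cat C A) (fst (Phi_map C B G)) (fst (Phi_map C A F))) f"
      using s F.sec_map_section [OF s(2-4)] H.sec_map_eq [OF s(2-4)]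
      by (simp add: Phi_map_def F.sec_map_eq G.sec_map_eq)
  qed (auto simp: Phi_map_def functor_comp_def)
  then show ?thesis
    by (simp add: Phi_map_def over_comp_simp cong: restrict_cong)
qed

lemma Phi_functor:
  assumes "locally_small K C"
  shows "is_functor (pCat C :: (('i, 'o, 'm) partite, ('i, 'o, 'm) partite_arrow) category)
    (rCat_over K C) (Phi C)"
proof -
  have ar: "on_ar (Phi C) (A, F, B) = (Phi_ob C A, Phi_map C A F, Phi_ob C B)" if "cofunctor C A B F"
    for A B and F :: "('i, 'i, 'm) cofunctor_data"
    using that by (simp add: Phi_def)
  have ob: "on_ob (Phi C) A = Phi_ob C A" if "partite C A" for A :: "('i, 'o, 'm) partite"
    using that by (simp add: Phi_def)
  show ?thesis
  proof (rule is_functorI)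
    fix f :: "('i, 'o, 'm) partite_arrow" assume "f \<in> Arr (pCat C)"
    then obtain A F B where f: "f = (A, F, B)" and F: "cofunctor C A B F" by (cases f) auto
    interpret F: cofunctor C A B F by (rule F)
    show "on_ar (Phi C) f \<in> Arr (rCat_over K C)"
      "Dom (rCat_over K C) (on_ar (Phi C) f) = on_ob (Phi C) (Dom (pCat C) f)"
      "Cod (rCat_over K C) (on_ar (Phi C) f) = on_ob (Phi C) (Cod (pCat C) f)"
      using F F.A.partite_axioms F.B.partite_axioms assms F.Phi_map_over
      by (auto simp: f ar ob Phi_ob_over)
    fix g :: "('i, 'o, 'm) partite_arrow" assume g: "g \<in> Arr (pCat C)" "Dom (pCat C) g = Cod (pCat C) f"
    then obtain G D where gg: "g = (B, G, D)" and G: "cofunctor C B D G" by (cases g) (auto simp: f)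
    show "on_ar (Phi C) (g \<cdot>\<^bsub>pCat C\<^esub> f) = on_ar (Phi C) g \<cdot>\<^bsub>rCat_over K C\<^esub> on_ar (Phi C) f"
      using F G by (simp add: f gg ar cofunctor_comp Phi_map_comp) (simp add: Phi_ob_def)
  qed (use assms in \<open>auto simp: pCat_category rCat_over_category ob ar Phi_ob_over partite.cofunctor_id Phi_map_id Phi_def\<close>)
qed

end

section \<open>Glueings\<close>

text \<open>A generalized element \<open>a\<close> of a glueing lies on the sheet of index \<open>i\<close> if \<open>s i \<cdot> (p \<cdot> a) = a\<close>.
  Every element is covered by its restrictions to sheets, which reduces equations between maps out of
  a glueing to elements of the form \<open>s i \<cdot> x\<close>.\<close>

locale glued = join_restriction_category C for C :: "('o, 'm) rcategory" (structure) +
  fixes X :: 'o and I :: "'i set" and \<phi> :: "'i \<Rightarrow> 'i \<Rightarrow> 'm" and p :: 'm and q s :: "'i \<Rightarrow> 'm"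
  assumes glueing: "glueing C X I \<phi> p q s"
begin

lemma p_arr [simp]: "p \<in> Arr C" and p_total [simp]: "total C p" and cod_p [simp]: "Cod C p = X"
  using glueing by (auto simp: glueing_def local_homeomorphism_def)

lemma X_ob [simp]: "X \<in> Ob C"
  using cod_ob [OF p_arr] by simp

lemma
  assumes "i \<in> I"
  shows q_arr [simp]: "q i \<in> Arr C" and dom_q [simp]: "Dom C (q i) = Dom C p"
    and cod_q [simp]: "Cod C (q i) = X" and s_arr [simp]: "s i \<in> Arr C"
    and dom_s [simp]: "Dom C (s i) = X" and cod_s [simp]: "Cod C (s i) = Dom C p"
    and s_q: "s i \<cdot> q i = Rst C (q i)" and q_s: "q i \<cdot> s i = Rst C (s i)"
    and p_q: "p \<cdot> Rst C (q i) = q i"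
  using glueing assms is_joinD(2) [of "Dom C p" X "q ` I" p "q i"]
  by (auto simp: glueing_def partial_inverse_def in_Hom_iff rle_def)

lemma phi: "i \<in> I \<Longrightarrow> j \<in> I \<Longrightarrow> \<phi> i j = q j \<cdot> s i"
  using glueing by (auto simp: glueing_def)

lemma phi_diag: "i \<in> I \<Longrightarrow> \<phi> i i = Rst C (s i)"
  by (simp add: phi q_s)

text \<open>The image of \<open>s i\<close> lies in the domain of \<open>q i\<close>, where p
  coincides with \<open>q i\<close>.\<close>

lemma p_s: assumes "i \<in> I" shows "p \<cdot> s i = Rst C (s i)"
proof -
  have "q i \<cdot> s i = p \<cdot> (Rst C (q i) \<cdot> s i)"
    using assms by (subst p_q [symmetric]) simp_all
  also have "Rst C (q i) \<cdot> s i = s i \<cdot> Rst C (Rst C (s i))"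
    using rst_comp' [of "s i" "q i"] assms by (simp add: q_s)
  finally show ?thesis using assms by (simp add: q_s)
qed

lemma p_s_comp: "i \<in> I \<Longrightarrow> x \<in> Arr C \<Longrightarrow> Cod C x = X \<Longrightarrow> p \<cdot> (s i \<cdot> x) = Rst C (s i) \<cdot> x"
  by (intro comp_reduce [OF p_s]) auto

lemma sheet_q:
  assumes "i \<in> I" "a \<in> Arr C" "Cod C a = Dom C p" "s i \<cdot> (p \<cdot> a) = a"
  shows "q i \<cdot> a = p \<cdot> a"
proof -
  have "q i \<cdot> a = q i \<cdot> (s i \<cdot> (p \<cdot> a))" "p \<cdot> a = p \<cdot> (s i \<cdot> (p \<cdot> a))" using assms(4) by simp_all
  moreover have "q i \<cdot> (s i \<cdot> (p \<cdot> a)) = Rst C (s i) \<cdot> (p \<cdot> a)"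
    using assms by (intro comp_reduce [OF q_s]) auto
  moreover have "p \<cdot> (s i \<cdot> (p \<cdot> a)) = Rst C (s i) \<cdot> (p \<cdot> a)"
    using assms by (intro p_s_comp) auto
  ultimately show ?thesis by simp
qed

text \<open>On its sheet j the element a is sent by \<open>q j\<close> to its base point, and
  \<open>\<phi> i j\<close> is \<open>q j\<close> after \<open>s i\<close>. With the converse
  \<open>phi_sheets\<close> this is the glueing relation: over an x in the domain of both, the
  sections \<open>s i\<close> and \<open>s j\<close> agree exactly when \<open>\<phi> i j\<close>
  fixes x.\<close>

lemma sheets_phi:
  assumes "i \<in> I" "j \<in> I" "a \<in> Arr C" "Cod C a = Dom C p" "s i \<cdot> (p \<cdot> a) = a" "s j \<cdot> (p \<cdot> a) = a"
  shows "\<phi> i j \<cdot> (p \<cdot> a) = p \<cdot> a"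
  using sheet_q [of j a] assms by (simp add: phi)

text \<open>If \<open>\<phi> i j\<close> fixes x, then x is \<open>q j\<close> applied to
  \<open>s i \<cdot> x\<close>; applying \<open>s j\<close> returns \<open>s i \<cdot> x\<close>,
  because \<open>s j\<close> is the partial inverse of \<open>q j\<close>.\<close>

lemma phi_sheets:
  assumes "i \<in> I" "j \<in> I" "x \<in> Arr C" "Cod C x = X" "\<phi> i j \<cdot> x = x"
  shows "s i \<cdot> x = s j \<cdot> x"
proof -
  have x: "q j \<cdot> (s i \<cdot> x) = x" using assms by (simp add: phi)
  have "s j \<cdot> x = s j \<cdot> (q j \<cdot> (s i \<cdot> x))" by (simp add: x)
  also have "\<dots> = Rst C (q j) \<cdot> (s i \<cdot> x)" using assms by (intro comp_reduce [OF s_q]) auto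
  also have "\<dots> = s i \<cdot> x \<cdot> Rst C (q j \<cdot> (s i \<cdot> x))" using assms by (intro rst_comp') auto
  also have "\<dots> = s i \<cdot> x" unfolding x using assms by simp
  finally show ?thesis by simp
qed

text \<open>As \<open>q i\<close> is the part of p that \<open>s i\<close> inverts, a lies on sheet
  i exactly where \<open>q i \<cdot> a\<close> is defined; e is the largest part of the domain of a
  with this property.\<close>

lemma sheet_domain:
  assumes "i \<in> I" "a \<in> Arr C" "Cod C a = Dom C p"
  defines "e \<equiv> Rst C (q i \<cdot> a)"
  shows "s i \<cdot> (p \<cdot> (a \<cdot> e)) = a \<cdot> e" "Rst C a \<cdot> e = e"
    "\<And>c. c \<in> Arr C \<Longrightarrow> Cod C c = Dom C a \<Longrightarrow> Rst C a \<cdot> c = c \<Longrightarrow> s i \<cdot> (p \<cdot> (a \<cdot> c)) = a \<cdot> c \<Longrightarrow> e \<cdot> c = c"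
proof -
  have "p \<cdot> (a \<cdot> e) = p \<cdot> (Rst C (q i) \<cdot> a)" unfolding e_def using rst_comp' [of a "q i"] assms by simp
  also have "\<dots> = q i \<cdot> a" using assms by (intro comp_reduce [OF p_q]) auto
  finally have "s i \<cdot> (p \<cdot> (a \<cdot> e)) = s i \<cdot> (q i \<cdot> a)" by simp
  also have "\<dots> = Rst C (q i) \<cdot> a" using assms by (intro comp_reduce [OF s_q]) auto
  finally show "s i \<cdot> (p \<cdot> (a \<cdot> e)) = a \<cdot> e" unfolding e_def using rst_comp' [of a "q i"] assms by simp
  show "Rst C a \<cdot> e = e" unfolding e_def using assms by simp
  fix c assume c: "c \<in> Arr C" "Cod C c = Dom C a" "Rst C a \<cdot> c = c" "s i \<cdot> (p \<cdot> (a \<cdot> c)) = a \<cdot> c"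
  have qa: "q i \<cdot> (a \<cdot> c) = p \<cdot> (a \<cdot> c)" using c assms by (intro sheet_q) auto
  have "e \<cdot> c = c \<cdot> Rst C (q i \<cdot> (a \<cdot> c))" unfolding e_def using rst_comp' [of c "q i \<cdot> a"] c assms by simp
  also have "\<dots> = c \<cdot> Rst C (a \<cdot> c)" unfolding qa using c assms by simp
  also have "\<dots> = c" using rst_comp' [of c a] c assms by simp
  finally show "e \<cdot> c = c" .
qed

lemma sheet_domain_iff:
  assumes "i \<in> I" "a \<in> Arr C" "Cod C a = Dom C p" "c \<in> Arr C" "Cod C c = Dom C a" "Rst C a \<cdot> c = c"
  shows "Rst C (q i \<cdot> a) \<cdot> c = c \<longleftrightarrow> s i \<cdot> (p \<cdot> (a \<cdot> c)) = a \<cdot> c"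
proof
  let ?e = "Rst C (q i \<cdot> a)"
  assume c: "?e \<cdot> c = c"
  have "s i \<cdot> (p \<cdot> (a \<cdot> ?e)) \<cdot> c = a \<cdot> ?e \<cdot> c" using sheet_domain(1) [OF assms(1-3)] by simp
  then show "s i \<cdot> (p \<cdot> (a \<cdot> c)) = a \<cdot> c" using assms c by simp
qed (rule sheet_domain(3) [OF assms(1-3,4-6)])

text \<open>The join p of the \<open>q i\<close> is preserved by precomposition with a and by
  passage to restrictions; totality of p turns \<open>Rst C (p \<cdot> a)\<close> into
  \<open>Rst C a\<close>.\<close>

lemma sheets_join:
  assumes "a \<in> Arr C" "Cod C a = Dom C p"
  shows "is_join C (Dom C a) (Dom C a) ((\<lambda>i. Rst C (q i \<cdot> a)) ` I) (Rst C a)"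
proof -
  have 1: "is_join C (Dom C p) X (q ` I) p" and S: "q ` I \<subseteq> Hom C (Dom C p) X"
    using glueing by (auto simp: glueing_def)
  have "is_join C (Dom C a) X ((\<lambda>h. h \<cdot> a) ` q ` I) (p \<cdot> a)"
    using join_comp [OF is_join_compatible [OF S 1] 1, of a] assms by (simp add: in_Hom_iff)
  then have "is_join C (Dom C a) (Dom C a) (Rst C ` (\<lambda>h. h \<cdot> a) ` q ` I) (Rst C (p \<cdot> a))"
    using assms by (intro join_rst) (auto simp: in_Hom_iff)
  then show ?thesis using assms by (simp add: image_image)
qed

text \<open>The parts of a on the individual sheets cover its domain by \<open>sheets_join\<close>.
  The conditions \<open>u \<cdot> Rst C a = u\<close> and \<open>v \<cdot> Rst C a = v\<close> keep
  u and v inside that domain.\<close>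

lemma local_eq:
  assumes "a \<in> Arr C" "Cod C a = Dom C p"
    "u \<in> Arr C" "v \<in> Arr C" "Dom C u = Dom C a" "Dom C v = Dom C a" "Cod C u = Cod C v"
    "u \<cdot> Rst C a = u" "v \<cdot> Rst C a = v"
    and loc: "\<And>i e. i \<in> I \<Longrightarrow> e \<in> Arr C \<Longrightarrow> Dom C e = Dom C a \<Longrightarrow> Cod C e = Dom C a \<Longrightarrow> Rst C e = e \<Longrightarrow>
      Rst C a \<cdot> e = e \<Longrightarrow> s i \<cdot> (p \<cdot> (a \<cdot> e)) = a \<cdot> e \<Longrightarrow> u \<cdot> e = v \<cdot> e"
  shows "u = v"
proof -
  have "u \<cdot> Rst C a = v \<cdot> Rst C a"
  proof (rule join_local_eq [OF _ sheets_join [OF assms(1,2)]])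
    show "(\<lambda>i. Rst C (q i \<cdot> a)) ` I \<subseteq> rst_idems C (Dom C a)"
      using assms by (auto simp: rst_idems_iff)
    show "u \<cdot> e = v \<cdot> e" if "e \<in> (\<lambda>i. Rst C (q i \<cdot> a)) ` I" for e
      using that assms(1,2) sheet_domain by (auto intro!: loc)
  qed (use assms in \<open>auto simp: in_Hom_iff\<close>)
  then show ?thesis using assms by simp
qed

text \<open>The candidates \<open>h i\<close> agree where sheets overlap and are defined on the
  whole of their sheets, so they glue to a map with the domain of a. Its values are recorded at
  every element c and not only at idempotents, since later uses substitute into u.\<close>

lemma glue_ex:
  assumes a: "a \<in> Arr C" "Cod C a = Dom C p" and Y: "Y \<in> Ob C"
    and h: "\<And>i. i \<in> I \<Longrightarrow> h i \<in> Arr C \<and> Dom C (h i) = Dom C a \<and> Cod C (h i) = Y"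
    and compat: "\<And>i j e. i \<in> I \<Longrightarrow> j \<in> I \<Longrightarrow> e \<in> Arr C \<Longrightarrow> Dom C e = Dom C a \<Longrightarrow> Cod C e = Dom C a \<Longrightarrow>
      Rst C e = e \<Longrightarrow> Rst C a \<cdot> e = e \<Longrightarrow> s i \<cdot> (p \<cdot> (a \<cdot> e)) = a \<cdot> e \<Longrightarrow> s j \<cdot> (p \<cdot> (a \<cdot> e)) = a \<cdot> e \<Longrightarrow>
      h i \<cdot> e = h j \<cdot> e"
    and defd: "\<And>i e. i \<in> I \<Longrightarrow> e \<in> Arr C \<Longrightarrow> Dom C e = Dom C a \<Longrightarrow> Cod C e = Dom C a \<Longrightarrow>
      Rst C e = e \<Longrightarrow> Rst C a \<cdot> e = e \<Longrightarrow> s i \<cdot> (p \<cdot> (a \<cdot> e)) = a \<cdot> e \<Longrightarrow> Rst C (h i \<cdot> e) = e"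
  obtains u where "u \<in> Arr C" "Dom C u = Dom C a" "Cod C u = Y" "Rst C u = Rst C a"
    "\<And>i c. i \<in> I \<Longrightarrow> c \<in> Arr C \<Longrightarrow> Cod C c = Dom C a \<Longrightarrow> Rst C a \<cdot> c = c \<Longrightarrow>
      s i \<cdot> (p \<cdot> (a \<cdot> c)) = a \<cdot> c \<Longrightarrow> u \<cdot> c = h i \<cdot> c"
proof -
  let ?e = "\<lambda>i. Rst C (q i \<cdot> a)"
  have e: "?e i \<in> rst_idems C (Dom C a)" if "i \<in> I" for i using a that by (simp add: rst_in_idems)
  have ty: "?e i \<in> Arr C" "Dom C (?e i) = Dom C a" "Cod C (?e i) = Dom C a" "Rst C (?e i) = ?e i" if "i \<in> I" for i
    using a that by auto
  have dom: "Rst C (h i) \<cdot> ?e i = ?e i" if "i \<in> I" for i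
    using defd [OF that ty [OF that] sheet_domain(2,1) [OF that a]] rst_comp_idem [of "h i" "?e i"]
      h that e by auto
  have "h i \<cdot> (?e i \<cdot> ?e j) = h j \<cdot> (?e i \<cdot> ?e j)" if ij: "i \<in> I" "j \<in> I" for i j
  proof (rule compat [OF ij])
    have c: "?e i \<cdot> ?e j = ?e j \<cdot> ?e i" using idem_commute e ij by blast
    have "s i \<cdot> (p \<cdot> (a \<cdot> ?e i)) \<cdot> ?e j = a \<cdot> ?e i \<cdot> ?e j"
      using sheet_domain(1) [OF ij(1) a] by simp
    then show "s i \<cdot> (p \<cdot> (a \<cdot> (?e i \<cdot> ?e j))) = a \<cdot> (?e i \<cdot> ?e j)" using a ij ty by simp
    have "s j \<cdot> (p \<cdot> (a \<cdot> ?e j)) \<cdot> ?e i = a \<cdot> ?e j \<cdot> ?e i"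
      using sheet_domain(1) [OF ij(2) a] by simp
    then show "s j \<cdot> (p \<cdot> (a \<cdot> (?e i \<cdot> ?e j))) = a \<cdot> (?e i \<cdot> ?e j)" unfolding c using a ij ty by simp
    show "Rst C (?e i \<cdot> ?e j) = ?e i \<cdot> ?e j" using idem_comp [OF e [OF ij(1)] e [OF ij(2)]] by (simp add: rst_idems_iff)
    show "Rst C a \<cdot> (?e i \<cdot> ?e j) = ?e i \<cdot> ?e j"
      using comp_reduce [OF sheet_domain(2) [OF ij(1) a], of "?e j"] a ij ty by simp
  qed (use a ij in auto)
  from join_glue [of I h "Dom C a" Y ?e, OF _ e this]
  obtain u where u: "u \<in> Hom C (Dom C a) Y" "\<And>i. i \<in> I \<Longrightarrow> u \<cdot> ?e i = h i \<cdot> ?e i"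
    using h Y a dom by (auto simp: in_Hom_iff)
  then have uty: "u \<in> Arr C" "Dom C u = Dom C a" "Cod C u = Y" by (auto simp: in_Hom_iff)
  have uc: "u \<cdot> c = h i \<cdot> c"
    if c: "i \<in> I" "c \<in> Arr C" "Cod C c = Dom C a" "Rst C a \<cdot> c = c" "s i \<cdot> (p \<cdot> (a \<cdot> c)) = a \<cdot> c" for i c
  proof -
    have ec: "?e i \<cdot> c = c" using sheet_domain(3) [OF c(1) a c(2-5)] .
    have "u \<cdot> (?e i \<cdot> c) = h i \<cdot> (?e i \<cdot> c)"
      using u(2) [OF c(1)] c a h uty by (intro comp_reduce2) auto
    then show ?thesis unfolding ec .
  qed
  show thesis
  \<comment> \<open>The glued map is known only on the cover; cutting it down to the domain of a
    makes its domain exact.\<close>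
  proof (rule that [of "u \<cdot> Rst C a"])
    show uc': "u \<cdot> Rst C a \<cdot> c = h i \<cdot> c"
      if "i \<in> I" "c \<in> Arr C" "Cod C c = Dom C a" "Rst C a \<cdot> c = c" "s i \<cdot> (p \<cdot> (a \<cdot> c)) = a \<cdot> c" for i c
      using uc [OF that] that uty a by simp
    show "Rst C (u \<cdot> Rst C a) = Rst C a"
    proof (rule local_eq [OF a])
      fix i e assume e': "i \<in> I" "e \<in> Arr C" "Dom C e = Dom C a" "Cod C e = Dom C a" "Rst C e = e"
        "Rst C a \<cdot> e = e" "s i \<cdot> (p \<cdot> (a \<cdot> e)) = a \<cdot> e"
      have "Rst C (u \<cdot> Rst C a) \<cdot> e = Rst C (u \<cdot> Rst C a \<cdot> e)"
        using rst_comp_idem [of "u \<cdot> Rst C a" e] e' uty a by (simp add: rst_idems_iff)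
      also have "\<dots> = e" using uc' [OF e'(1,2,4,6,7)] defd [OF e'] by simp
      finally show "Rst C (u \<cdot> Rst C a) \<cdot> e = Rst C a \<cdot> e" using e' by simp
    qed (use uty a in auto)
  qed (use uty a in auto)
qed

text \<open>The axiom \<open>rst_comp\<close> moves the idempotent past g for one direction and past
  x for the other; totality of g makes the domain of g x equal to that of x.\<close>

lemma pulled_back_phi:
  assumes "i \<in> I" "j \<in> I" "g \<in> Arr C" "Cod C g = X" "total C g" "x \<in> Arr C" "Cod C x = Dom C g"
    "\<phi> i j \<in> rst_idems C X"
  shows "Rst C (\<phi> i j \<cdot> g) \<cdot> x = x \<longleftrightarrow> \<phi> i j \<cdot> (g \<cdot> x) = g \<cdot> x"
proof
  have ty: "\<phi> i j \<in> Arr C" "Dom C (\<phi> i j) = X" "Cod C (\<phi> i j) = X" "Rst C (\<phi> i j) = \<phi> i j"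
    using assms by (auto simp: rst_idems_iff)
  assume "Rst C (\<phi> i j \<cdot> g) \<cdot> x = x"
  moreover have "\<phi> i j \<cdot> (g \<cdot> x) = g \<cdot> (Rst C (\<phi> i j \<cdot> g) \<cdot> x)"
    using idem_comp_map [of g "\<phi> i j"] assms ty by (intro comp_reduce2) auto
  ultimately show "\<phi> i j \<cdot> (g \<cdot> x) = g \<cdot> x" by simp
next
  have ty: "\<phi> i j \<in> Arr C" "Dom C (\<phi> i j) = X" "Cod C (\<phi> i j) = X" "Rst C (\<phi> i j) = \<phi> i j"
    using assms by (auto simp: rst_idems_iff)
  assume "\<phi> i j \<cdot> (g \<cdot> x) = g \<cdot> x"
  then show "Rst C (\<phi> i j \<cdot> g) \<cdot> x = x"
    using rst_comp' [of x "\<phi> i j \<cdot> g"] assms ty by simp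
qed

text \<open>The pullback of a glueing along a total g is the glueing of the pulled-back atlas: the
  point of its sheet i over y lies over the point of the original sheet i over g y.\<close>

lemma pullback:
  assumes g: "g \<in> Arr C" "Cod C g = X" "total C g"
    and idem: "\<And>i j. i \<in> I \<Longrightarrow> j \<in> I \<Longrightarrow> \<phi> i j \<in> rst_idems C X"
    and glued': "glued C (Dom C g) I (\<lambda>i j. Rst C (\<phi> i j \<cdot> g)) p' q' s'"
  shows "has_pb C p g"
proof -
  interpret G: glued C "Dom C g" I "\<lambda>i j. Rst C (\<phi> i j \<cdot> g)" p' q' s' by (rule glued')
  note pb_phi = pulled_back_phi [OF _ _ g _ _ idem]
  let ?A' = "Dom C p'"
  have A': "?A' \<in> Ob C" by simp
  \<comment> \<open>On sheet i the comparison map sends \<open>s' i\<close> y to \<open>s i\<close>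
    (g y). Sheets that meet over y in the pulled-back atlas meet over g y, by
    \<open>pulled_back_phi\<close>.\<close>
  obtain g' where g': "g' \<in> Arr C" "Dom C g' = ?A'" "Cod C g' = Dom C p" "Rst C g' = Ide C ?A'"
    and g'c: "\<And>i c. i \<in> I \<Longrightarrow> c \<in> Arr C \<Longrightarrow> Cod C c = ?A' \<Longrightarrow> s' i \<cdot> (p' \<cdot> c) = c \<Longrightarrow>
      g' \<cdot> c = s i \<cdot> (g \<cdot> (p' \<cdot> c))"
  proof (rule G.glue_ex [of "Ide C ?A'" "Dom C p" "\<lambda>i. s i \<cdot> (g \<cdot> p')"])
    fix i j e assume e: "i \<in> I" "j \<in> I" "e \<in> Arr C" "Dom C e = Dom C (Ide C ?A')" "Cod C e = Dom C (Ide C ?A')"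
      "s' i \<cdot> (p' \<cdot> (Ide C ?A' \<cdot> e)) = Ide C ?A' \<cdot> e" "s' j \<cdot> (p' \<cdot> (Ide C ?A' \<cdot> e)) = Ide C ?A' \<cdot> e"
    have "Rst C (\<phi> i j \<cdot> g) \<cdot> (p' \<cdot> e) = p' \<cdot> e" using e by (intro G.sheets_phi) auto
    then have "\<phi> i j \<cdot> (g \<cdot> (p' \<cdot> e)) = g \<cdot> (p' \<cdot> e)" using e g by (subst (asm) pb_phi) auto
    then have "s i \<cdot> (g \<cdot> (p' \<cdot> e)) = s j \<cdot> (g \<cdot> (p' \<cdot> e))" using e g by (intro phi_sheets) auto
    then show "s i \<cdot> (g \<cdot> p') \<cdot> e = s j \<cdot> (g \<cdot> p') \<cdot> e" using e g by simp
  next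
    fix i e assume e: "i \<in> I" "e \<in> Arr C" "Dom C e = Dom C (Ide C ?A')" "Cod C e = Dom C (Ide C ?A')"
      "Rst C e = e" "s' i \<cdot> (p' \<cdot> (Ide C ?A' \<cdot> e)) = Ide C ?A' \<cdot> e"
    have "Rst C (\<phi> i i \<cdot> g) \<cdot> (p' \<cdot> e) = p' \<cdot> e" using e by (intro G.sheets_phi) auto
    then have "\<phi> i i \<cdot> (g \<cdot> (p' \<cdot> e)) = g \<cdot> (p' \<cdot> e)" using e g by (subst (asm) pb_phi) auto
    then have "Rst C (s i) \<cdot> (g \<cdot> (p' \<cdot> e)) = g \<cdot> (p' \<cdot> e)" using e by (simp add: phi_diag)
    then have "Rst C (s i \<cdot> (g \<cdot> (p' \<cdot> e))) = Rst C (g \<cdot> (p' \<cdot> e))"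
      using rst_rst_comp [of "g \<cdot> (p' \<cdot> e)" "s i"] e g by simp
    then show "Rst C (s i \<cdot> (g \<cdot> p') \<cdot> e) = e" using e g by simp
  next
    fix u assume u: "u \<in> Arr C" "Dom C u = Dom C (Ide C ?A')" "Cod C u = Dom C p" "Rst C u = Rst C (Ide C ?A')"
      "\<And>i c. i \<in> I \<Longrightarrow> c \<in> Arr C \<Longrightarrow> Cod C c = Dom C (Ide C ?A') \<Longrightarrow> Rst C (Ide C ?A') \<cdot> c = c \<Longrightarrow>
        s' i \<cdot> (p' \<cdot> (Ide C ?A' \<cdot> c)) = Ide C ?A' \<cdot> c \<Longrightarrow> u \<cdot> c = (s i \<cdot> (g \<cdot> p')) \<cdot> c"
    show thesis by (rule that [of u]) (use u g in auto)
  qed (use g in auto)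
  have g't: "total C g'" using g' by (simp add: total_def)
  have sq: "p \<cdot> g' = g \<cdot> p'"
  proof (rule G.local_eq [of "Ide C ?A'"])
    fix i e assume e: "i \<in> I" "e \<in> Arr C" "Dom C e = Dom C (Ide C ?A')" "Cod C e = Dom C (Ide C ?A')"
      "s' i \<cdot> (p' \<cdot> (Ide C ?A' \<cdot> e)) = Ide C ?A' \<cdot> e"
    have "Rst C (\<phi> i i \<cdot> g) \<cdot> (p' \<cdot> e) = p' \<cdot> e" using e by (intro G.sheets_phi) auto
    then have "\<phi> i i \<cdot> (g \<cdot> (p' \<cdot> e)) = g \<cdot> (p' \<cdot> e)" using e g by (subst (asm) pb_phi) auto
    then have "p \<cdot> (s i \<cdot> (g \<cdot> (p' \<cdot> e))) = g \<cdot> (p' \<cdot> e)" using e g by (simp add: phi_diag p_s_comp)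
    then show "p \<cdot> g' \<cdot> e = g \<cdot> p' \<cdot> e" using e g g' g'c [of i e] by simp
  qed (use g g' in auto)
  have "is_pullback C p g g' p'"
    unfolding is_pullback_def
  proof (intro conjI allI ballI impI)
    fix W u v assume u: "u \<in> Hom C W (Dom C p)" and v: "v \<in> Hom C W (Dom C g)" and uv: "p \<cdot> u = g \<cdot> v"
    then have uty: "u \<in> Arr C" "Dom C u = W" "Cod C u = Dom C p" and vty: "v \<in> Arr C" "Dom C v = W" "Cod C v = Dom C g"
      by (auto simp: in_Hom_iff)
    have r: "Rst C u = Rst C v" using rst_cone [of p g u v] uty vty uv g by simp
    have puc: "p \<cdot> (u \<cdot> c) = g \<cdot> (v \<cdot> c)" if "c \<in> Arr C" "Cod C c = W" for c
      using uv that uty vty g by (intro comp_reduce2) auto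
    have sh: "Rst C (\<phi> i j \<cdot> g) \<cdot> (v \<cdot> c) = v \<cdot> c"
      if "i \<in> I" "j \<in> I" "c \<in> Arr C" "Cod C c = W" "s i \<cdot> (p \<cdot> (u \<cdot> c)) = u \<cdot> c" "s j \<cdot> (p \<cdot> (u \<cdot> c)) = u \<cdot> c" for i j c
    proof -
      have "\<phi> i j \<cdot> (p \<cdot> (u \<cdot> c)) = p \<cdot> (u \<cdot> c)" using that uty by (intro sheets_phi) auto
      then show ?thesis using that uty vty g puc by (subst pb_phi) auto
    qed
    \<comment> \<open>The mediating map has to be \<open>s' i\<close> after v on the part where u
      lies on sheet i.\<close>
    obtain w where w: "w \<in> Arr C" "Dom C w = W" "Cod C w = ?A'" "Rst C w = Rst C u"
      and wc: "\<And>i c. i \<in> I \<Longrightarrow> c \<in> Arr C \<Longrightarrow> Cod C c = W \<Longrightarrow> Rst C u \<cdot> c = c \<Longrightarrow>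
        s i \<cdot> (p \<cdot> (u \<cdot> c)) = u \<cdot> c \<Longrightarrow> w \<cdot> c = s' i \<cdot> v \<cdot> c"
    proof (rule glue_ex [OF uty(1,3) A', of "\<lambda>i. s' i \<cdot> v"])
      fix i j e assume e: "i \<in> I" "j \<in> I" "e \<in> Arr C" "Dom C e = Dom C u" "Cod C e = Dom C u"
        "s i \<cdot> (p \<cdot> (u \<cdot> e)) = u \<cdot> e" "s j \<cdot> (p \<cdot> (u \<cdot> e)) = u \<cdot> e"
      have "s' i \<cdot> (v \<cdot> e) = s' j \<cdot> (v \<cdot> e)" using e uty vty sh [of i j e] by (intro G.phi_sheets) auto
      then show "s' i \<cdot> v \<cdot> e = s' j \<cdot> v \<cdot> e" using e uty vty by simp
    next
      fix i e assume e: "i \<in> I" "e \<in> Arr C" "Dom C e = Dom C u" "Cod C e = Dom C u" "Rst C e = e" "Rst C u \<cdot> e = e"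
        "s i \<cdot> (p \<cdot> (u \<cdot> e)) = u \<cdot> e"
      have "Rst C (s' i) \<cdot> (v \<cdot> e) = v \<cdot> e" using e uty sh [of i i e] by (simp add: G.phi_diag)
      then have "Rst C (s' i \<cdot> (v \<cdot> e)) = Rst C (v \<cdot> e)"
        using rst_rst_comp [of "v \<cdot> e" "s' i"] e uty vty by simp
      also have "\<dots> = e" using rst_comp_idem [of v e] r e uty vty by (simp add: rst_idems_iff)
      finally show "Rst C (s' i \<cdot> v \<cdot> e) = e" using e uty vty by simp
    qed (use uty vty that in auto)
    have wr: "w \<cdot> Rst C u = w" "v \<cdot> Rst C u = v" using comp_rst' [of w] comp_rst' [of v] w vty r by auto
    have pw: "p' \<cdot> w = v"
    proof (rule local_eq [OF uty(1,3)])
      fix i e assume e: "i \<in> I" "e \<in> Arr C" "Dom C e = Dom C u" "Cod C e = Dom C u" "Rst C u \<cdot> e = e"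
        "s i \<cdot> (p \<cdot> (u \<cdot> e)) = u \<cdot> e"
      have "p' \<cdot> (w \<cdot> e) = v \<cdot> e"
        using wc [of i e] e uty vty sh [of i i e] by (simp add: G.phi_diag G.p_s_comp)
      then show "p' \<cdot> w \<cdot> e = v \<cdot> e" using w e uty by simp
    qed (use w uty vty wr in auto)
    have gw: "g' \<cdot> w = u"
    proof (rule local_eq [OF uty(1,3)])
      fix i e assume e: "i \<in> I" "e \<in> Arr C" "Dom C e = Dom C u" "Cod C e = Dom C u" "Rst C u \<cdot> e = e"
        "s i \<cdot> (p \<cdot> (u \<cdot> e)) = u \<cdot> e"
      have 1: "p' \<cdot> (s' i \<cdot> (v \<cdot> e)) = v \<cdot> e"
        using e uty vty sh [of i i e] by (simp add: G.phi_diag G.p_s_comp)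
      have "w \<cdot> e = s' i \<cdot> (v \<cdot> e)" using wc [of i e] e uty vty by simp
      moreover have "g' \<cdot> (s' i \<cdot> (v \<cdot> e)) = s i \<cdot> (g \<cdot> (v \<cdot> e))"
        using g'c [of i "s' i \<cdot> (v \<cdot> e)"] 1 e uty vty by simp
      ultimately show "g' \<cdot> w \<cdot> e = u \<cdot> e" using w e uty g' puc [of e] by simp
    qed (use w uty vty g' wr in auto)
    \<comment> \<open>For uniqueness, z may sit on another sheet j of the pullback; but then u lies
      on the sheets i and j at once, so the pulled-back atlas identifies these sheets over
      v.\<close>
    have lift: "z \<cdot> e = s' i \<cdot> (v \<cdot> e)"
      if z: "z \<in> Arr C" "Dom C z = W" "Cod C z = ?A'" "g' \<cdot> z = u" "p' \<cdot> z = v"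
        and e: "i \<in> I" "e \<in> Arr C" "Dom C e = W" "Cod C e = W" "s i \<cdot> (p \<cdot> (u \<cdot> e)) = u \<cdot> e"
      for z i e
    proof (rule G.local_eq [of "z \<cdot> e"])
      have ve: "p' \<cdot> (z \<cdot> e) = v \<cdot> e" using comp_reduce [OF z(5)] z e by simp
      show "s' i \<cdot> (v \<cdot> e) \<cdot> Rst C (z \<cdot> e) = s' i \<cdot> (v \<cdot> e)"
      proof -
        have "Rst C (v \<cdot> e) = Rst C (z \<cdot> e)" unfolding ve [symmetric] using z e by simp
        then have "v \<cdot> e \<cdot> Rst C (z \<cdot> e) = v \<cdot> e" using comp_rst' [of "v \<cdot> e"] e vty by simp
        then show ?thesis using e vty z by simp
      qed
      fix j d assume d: "j \<in> I" "d \<in> Arr C" "Dom C d = Dom C (z \<cdot> e)" "Cod C d = Dom C (z \<cdot> e)"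
        "s' j \<cdot> (p' \<cdot> (z \<cdot> e \<cdot> d)) = z \<cdot> e \<cdot> d"
      have ed: "e \<cdot> d \<in> Arr C" "Cod C (e \<cdot> d) = W" using z e d by auto
      have ved: "p' \<cdot> (z \<cdot> (e \<cdot> d)) = v \<cdot> (e \<cdot> d)" using comp_reduce [OF z(5), of "e \<cdot> d"] z ed by simp
      have ued: "g' \<cdot> (z \<cdot> (e \<cdot> d)) = u \<cdot> (e \<cdot> d)" using comp_reduce [OF z(4), of "e \<cdot> d"] z ed g' by simp
      have zed: "z \<cdot> (e \<cdot> d) = s' j \<cdot> (v \<cdot> (e \<cdot> d))" using d e z ved by simp
      have "u \<cdot> (e \<cdot> d) = s j \<cdot> (g \<cdot> (v \<cdot> (e \<cdot> d)))"
        using g'c [of j "z \<cdot> (e \<cdot> d)"] ued ved zed z ed d e vty by simp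
      then have sj: "s j \<cdot> (p \<cdot> (u \<cdot> (e \<cdot> d))) = u \<cdot> (e \<cdot> d)" using puc [OF ed] by simp
      have "s i \<cdot> (p \<cdot> (u \<cdot> e)) \<cdot> d = u \<cdot> e \<cdot> d" using e by simp
      then have si: "s i \<cdot> (p \<cdot> (u \<cdot> (e \<cdot> d))) = u \<cdot> (e \<cdot> d)"
        using e(1-4) d(2-4) z(1-3) uty by simp
      have "s' i \<cdot> (v \<cdot> (e \<cdot> d)) = s' j \<cdot> (v \<cdot> (e \<cdot> d))"
        using sh [OF e(1) d(1) ed si sj] e d ed vty by (intro G.phi_sheets) auto
      then show "z \<cdot> e \<cdot> d = s' i \<cdot> (v \<cdot> e) \<cdot> d" using zed z e d vty by simp
    qed (use z e vty in auto)
    show "\<exists>!w. w \<in> Hom C W (Dom C g') \<and> g' \<cdot> w = u \<and> p' \<cdot> w = v"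
    proof (rule ex1I [of _ w])
      show "w \<in> Hom C W (Dom C g') \<and> g' \<cdot> w = u \<and> p' \<cdot> w = v" using w gw pw g' by (simp add: in_Hom_iff)
      fix z assume "z \<in> Hom C W (Dom C g') \<and> g' \<cdot> z = u \<and> p' \<cdot> z = v"
      then have z: "z \<in> Arr C" "Dom C z = W" "Cod C z = ?A'" "g' \<cdot> z = u" "p' \<cdot> z = v"
        using g' by (auto simp: in_Hom_iff)
      have rz: "Rst C z = Rst C u" using z(4) rst_total_comp [of g' z] z g't g' by simp
      show "z = w"
      proof (rule local_eq [OF uty(1,3)])
        show "z \<cdot> Rst C u = z" unfolding rz [symmetric] using z by simp
        show "w \<cdot> Rst C u = w" by (rule wr)
        show "z \<cdot> e = w \<cdot> e" if "i \<in> I" "e \<in> Arr C" "Dom C e = Dom C u" "Cod C e = Dom C u"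
          "s i \<cdot> (p \<cdot> (u \<cdot> e)) = u \<cdot> e" for i e
          using lift [OF z] lift [OF w(1-3) gw pw] that uty by simp
      qed (use z w uty in auto)
    qed
  qed (use g g' sq in \<open>auto simp: in_Hom_iff\<close>)
  then show ?thesis by (auto simp: has_pb_def)
qed

end

section \<open>Pulled-back atlases and change of index set\<close>

context join_restriction_category
begin

text \<open>Transitivity is tested after g: the product \<open>?x\<close> of two pulled-back
  idempotents satisfies \<open>g \<cdot> ?x = \<phi> j k \<cdot> \<phi> i j \<cdot> g\<close>, which
  \<open>\<phi> i k\<close> fixes by the atlas condition.\<close>

lemma local_atlas_pullback:
  assumes "local_atlas C X I \<phi>" "g \<in> Arr C" "Cod C g = X"
  shows "local_atlas C (Dom C g) I (\<lambda>i j. Rst C (\<phi> i j \<cdot> g))"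
  unfolding local_atlas_def
proof (intro conjI ballI)
  have ty: "\<phi> i j \<in> Arr C" "Dom C (\<phi> i j) = X" "Cod C (\<phi> i j) = X" "Rst C (\<phi> i j) = \<phi> i j"
    "\<phi> i j = \<phi> j i" if "i \<in> I" "j \<in> I" for i j
    using assms(1) that by (auto simp: local_atlas_def rst_idems_iff)
  fix i j assume ij: "i \<in> I" "j \<in> I"
  show "Rst C (\<phi> i j \<cdot> g) \<in> rst_idems C (Dom C g)" "Rst C (\<phi> i j \<cdot> g) = Rst C (\<phi> j i \<cdot> g)"
    using ty [OF ij] assms by (auto simp: rst_idems_iff)
  fix k assume k: "k \<in> I"
  have "rle C (\<phi> j k \<cdot> \<phi> i j) (\<phi> i k)" using assms(1) ij k by (auto simp: local_atlas_def)
  moreover have "Rst C (\<phi> j k \<cdot> \<phi> i j) = \<phi> j k \<cdot> \<phi> i j"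
    using idem_comp [of "\<phi> j k" X "\<phi> i j"] ty ij k by (simp add: rst_idems_iff)
  ultimately have le: "\<phi> i k \<cdot> (\<phi> j k \<cdot> \<phi> i j) = \<phi> j k \<cdot> \<phi> i j" by (simp add: rle_def)
  let ?x = "Rst C (\<phi> j k \<cdot> g) \<cdot> Rst C (\<phi> i j \<cdot> g)"
  have g1: "\<phi> i j \<cdot> g = g \<cdot> Rst C (\<phi> i j \<cdot> g)" if "i \<in> I" "j \<in> I" for i j
    using idem_comp_map [of g "\<phi> i j"] ty that assms by (simp add: rst_idems_iff)
  have "\<phi> j k \<cdot> (\<phi> i j \<cdot> g) = (\<phi> j k \<cdot> g) \<cdot> Rst C (\<phi> i j \<cdot> g)"
    using g1 [OF ij] ty ij k assms by simp
  also have "\<dots> = \<phi> j k \<cdot> (g \<cdot> Rst C (\<phi> i j \<cdot> g))" using ty ij k assms by simp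
  also have "\<dots> = g \<cdot> ?x"
    by (intro comp_reduce2 [OF g1 [OF ij(2) k]]) (use ty ij k assms in auto)
  finally have gx: "g \<cdot> ?x = \<phi> j k \<cdot> \<phi> i j \<cdot> g" using ty ij k assms by simp
  have x: "Rst C ?x = ?x" "?x \<in> Arr C" "Dom C ?x = Dom C g" "Cod C ?x = Dom C g"
    using ty ij k assms idem_comp [OF rst_in_idems rst_in_idems, of "\<phi> j k \<cdot> g" "Dom C g" "\<phi> i j \<cdot> g"]
    by (auto simp: rst_idems_iff)
  have "\<phi> i k \<cdot> (g \<cdot> ?x) = (\<phi> i k \<cdot> (\<phi> j k \<cdot> \<phi> i j)) \<cdot> g"
    unfolding gx using ty ij k assms by simp
  also have "\<dots> = g \<cdot> ?x" unfolding le gx ..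
  finally have 1: "\<phi> i k \<cdot> (g \<cdot> ?x) = g \<cdot> ?x" .
  have "Rst C (\<phi> i k \<cdot> g) \<cdot> ?x = ?x \<cdot> Rst C (\<phi> i k \<cdot> (g \<cdot> ?x))"
    using rst_comp' [of ?x "\<phi> i k \<cdot> g"] ty ij k x assms by simp
  also have "\<dots> = ?x"
  proof -
    have "Rst C g \<cdot> ?x = ?x"
      using comp_reduce [OF rst_comp_absorb' [of g "\<phi> j k"], of "Rst C (\<phi> i j \<cdot> g)"] ty ij k x assms by simp
    then have "Rst C (g \<cdot> ?x) = ?x"
      using rst_comp_idem [of g ?x] x assms by (simp add: rst_idems_iff)
    then show ?thesis unfolding 1 using x comp_rst' [of ?x] by simp
  qed
  finally show "rle C (Rst C (\<phi> j k \<cdot> g) \<cdot> Rst C (\<phi> i j \<cdot> g)) (Rst C (\<phi> i k \<cdot> g))"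
    unfolding rle_def x(1) by simp
qed

text \<open>Local glueings are provided for index sets inside the universe type. A small I injects
  there; the atlas is transported along the inverse of the injection and the resulting sheets are
  reindexed.\<close>

lemma small_glueing:
  fixes I :: "'i set" and K :: "'k itself"
  assumes "has_local_glueings K C" "X \<in> Ob C" "small K I" "local_atlas C X I \<phi>"
  obtains p q s where "glueing C X I \<phi> p q s"
proof -
  have "I \<lesssim> (UNIV :: 'k set)" using assms(3) by (auto simp: small_def lesspoll_def)
  then obtain h :: "'i \<Rightarrow> 'k" where h: "inj_on h I" by (auto simp: lepoll_def)
  let ?k = "inv_into I h"
  have k [simp]: "?k (h i) = i" if "i \<in> I" for i using h that by simp
  have "h ` I \<approx> I" using h by (metis inj_on_image_eqpoll_self)
  then have "small K (h ` I)"
    using assms(3) unfolding small_def by (meson eqpoll_imp_lepoll lesspoll_trans1)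
  moreover have "local_atlas C X (h ` I) (\<lambda>i j. \<phi> (?k i) (?k j))"
    using assms(4) unfolding local_atlas_def by simp
  ultimately obtain p q s where "glueing C X (h ` I) (\<lambda>i j. \<phi> (?k i) (?k j)) p q s"
    using assms(1,2) unfolding has_local_glueings_def by blast
  then have "glueing C X I \<phi> p (q \<circ> h) (s \<circ> h)"
    unfolding glueing_def by (simp add: image_comp)
  then show thesis by (rule that)
qed

end

section \<open>The object \<open>\<Psi> P\<close>\<close>

locale over_join = join_restriction_category C + A: restriction_category A
  for C :: "('o, 'm) rcategory" (structure) and A :: "('a, 'b) rcategory" +
  fixes P :: "('a, 'b, 'o, 'm) functor_data" and K :: "'k itself"
  assumes P_functor: "restriction_functor A C P"
    and small_A: "locally_small K A"
    and local_glueings: "has_local_glueings K C"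
begin

abbreviation comp_A (infixl "\<bullet>" 70) where
  "g \<bullet> f \<equiv> g \<cdot>\<^bsub>A\<^esub> f"

abbreviation "\<phi> \<equiv> agree C A P"
abbreviation "\<sigma> \<equiv> Psi_src C A P"
abbreviation "\<tau> \<equiv> Psi_tgt C A P"
abbreviation "sec \<equiv> Psi_sec C A P"

lemmas P = is_functorD [OF restriction_functorD(3) [OF P_functor]]

lemma P_rst: "f \<in> Arr A \<Longrightarrow> on_ar P (Rst A f) = Rst C (on_ar P f)"
  by (rule restriction_functorD [OF P_functor])

declare P(5-8) [simp]

lemma P_comp: "f \<in> Arr A \<Longrightarrow> g \<in> Arr A \<Longrightarrow> Dom A g = Cod A f \<Longrightarrow>
      on_ar P (g \<bullet> f) = on_ar P g \<cdot> on_ar P f"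
  by (rule P)

section \<open>Local equality of parallel maps of A, measured in C\<close>

definition agrees_on :: "'b \<Rightarrow> 'b \<Rightarrow> 'b \<Rightarrow> bool" where
  "agrees_on f g e \<longleftrightarrow> e \<in> Arr A \<and> Dom A e = Dom A f \<and> Cod A e = Dom A f \<and> Rst A e = e \<and>
    Rst A f \<bullet> e = e \<and> Rst A g \<bullet> e = e \<and> f \<bullet> e = g \<bullet> e"

lemma agrees_on_sym: "agrees_on f g e \<Longrightarrow> Dom A g = Dom A f \<Longrightarrow> agrees_on g f e"
  by (auto simp: agrees_on_def)

lemma agrees_on_idem: "agrees_on f g e \<Longrightarrow> on_ar P e \<in> rst_idems C (on_ob P (Dom A f))"
  using P_rst [of e] by (auto simp: agrees_on_def rst_idems_iff)

text \<open>An idempotent is below the product of two commuting restrictions exactly when each of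
  them fixes it. In this second form every use of a witness is a rewriting step.\<close>

lemma agrees_on_iff:
  assumes "f \<in> Arr A" "g \<in> Arr A" "Dom A g = Dom A f"
  shows "{e \<in> rst_idems A (Dom A f). rle A e (Rst A f \<bullet> Rst A g) \<and> f \<bullet> e = g \<bullet> e}
    = {e. agrees_on f g e}"
proof -
  have "rle A e (Rst A f \<bullet> Rst A g) \<longleftrightarrow> Rst A f \<bullet> e = e \<and> Rst A g \<bullet> e = e"
    if e: "e \<in> Arr A" "Dom A e = Dom A f" "Cod A e = Dom A f" "Rst A e = e" for e
  proof
    have c: "Rst A f \<bullet> Rst A g = Rst A g \<bullet> Rst A f" using assms by (intro A.rst_commute') auto
    assume "rle A e (Rst A f \<bullet> Rst A g)"
    then have 1: "Rst A f \<bullet> Rst A g \<bullet> e = e" using e by (simp add: rle_def)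
    then have 2: "Rst A g \<bullet> Rst A f \<bullet> e = e" unfolding c .
    have "Rst A f \<bullet> e = Rst A f \<bullet> (Rst A f \<bullet> Rst A g \<bullet> e)" using 1 by simp
    also have "\<dots> = (Rst A f \<bullet> Rst A f) \<bullet> Rst A g \<bullet> e" using assms e by (simp del: A.rst_idem)
    finally have f: "Rst A f \<bullet> e = e" using 1 assms by simp
    have "Rst A g \<bullet> e = Rst A g \<bullet> (Rst A g \<bullet> Rst A f \<bullet> e)" using 2 by simp
    also have "\<dots> = (Rst A g \<bullet> Rst A g) \<bullet> Rst A f \<bullet> e" using assms e by (simp del: A.rst_idem)
    finally have "Rst A g \<bullet> e = e" using 2 assms by simp
    with f show "Rst A f \<bullet> e = e \<and> Rst A g \<bullet> e = e" by simp
  next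
    assume "Rst A f \<bullet> e = e \<and> Rst A g \<bullet> e = e"
    then show "rle A e (Rst A f \<bullet> Rst A g)" using e assms by (simp add: rle_def)
  qed
  then show ?thesis by (auto simp: A.rst_idems_iff agrees_on_def)
qed

lemma
  assumes "f \<in> Arr A" "g \<in> Arr A" "Dom A g = Dom A f"
  shows agree_join: "is_join C (on_ob P (Dom A f)) (on_ob P (Dom A f)) (on_ar P ` {e. agrees_on f g e}) (\<phi> f g)"
    and agree_idem: "\<phi> f g \<in> rst_idems C (on_ob P (Dom A f))"
proof -
  have "on_ar P ` {e. agrees_on f g e} \<subseteq> rst_idems C (on_ob P (Dom A f))" using agrees_on_idem by auto
  then obtain d where d: "is_join C (on_ob P (Dom A f)) (on_ob P (Dom A f)) (on_ar P ` {e. agrees_on f g e}) d"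
      "d \<in> rst_idems C (on_ob P (Dom A f))"
    using idems_join assms by (metis A.dom_ob P(5))
  moreover have "\<phi> f g = d"
    unfolding agree_def Let_def agrees_on_iff [OF assms] using d(1) by (rule join_eq)
  ultimately show "is_join C (on_ob P (Dom A f)) (on_ob P (Dom A f)) (on_ar P ` {e. agrees_on f g e}) (\<phi> f g)"
    "\<phi> f g \<in> rst_idems C (on_ob P (Dom A f))" by auto
qed

lemma
  assumes "f \<in> Arr A" "g \<in> Arr A" "Dom A g = Dom A f"
  shows agree_arr [simp]: "\<phi> f g \<in> Arr C" and dom_agree [simp]: "Dom C (\<phi> f g) = on_ob P (Dom A f)"
    and cod_agree [simp]: "Cod C (\<phi> f g) = on_ob P (Dom A f)"
    and rst_agree [simp]: "Rst C (\<phi> f g) = \<phi> f g"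
  using agree_idem [OF assms] by (auto simp: rst_idems_iff)

lemma agreeI:
  assumes "f \<in> Arr A" "g \<in> Arr A" "Dom A g = Dom A f" "agrees_on f g e"
    "x \<in> Arr C" "Cod C x = on_ob P (Dom A f)" "on_ar P e \<cdot> x = x"
  shows "\<phi> f g \<cdot> x = x"
proof -
  have "rle C (on_ar P e) (\<phi> f g)"
    using is_joinD(2) [OF agree_join [OF assms(1-3)]] assms(4) by blast
  then have "\<phi> f g \<cdot> on_ar P e = on_ar P e"
    using agrees_on_idem [OF assms(4)] by (simp add: rle_def rst_idems_iff)
  then have "\<phi> f g \<cdot> (on_ar P e \<cdot> x) = on_ar P e \<cdot> x"
    using agrees_on_idem [OF assms(4)] assms by (intro comp_reduce) (auto simp: rst_idems_iff)
  then show ?thesis using assms by simp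
qed

text \<open>Precomposing the join with x and passing to restrictions covers the domain of x by parts
  that each lie under one witness e. Together with \<open>agreeI\<close> this replaces arguments
  about the join by arguments about single idempotents of A.\<close>

lemma agreeE:
  assumes fg: "f \<in> Arr A" "g \<in> Arr A" "Dom A g = Dom A f"
    and x: "x \<in> Arr C" "Cod C x = on_ob P (Dom A f)" "\<phi> f g \<cdot> x = x"
    and uv: "u \<in> Arr C" "v \<in> Arr C" "Dom C u = Dom C x" "Dom C v = Dom C x" "Cod C u = Cod C v"
      "u \<cdot> Rst C x = u" "v \<cdot> Rst C x = v"
    and loc: "\<And>e d. agrees_on f g e \<Longrightarrow> d \<in> Arr C \<Longrightarrow> Dom C d = Dom C x \<Longrightarrow> Cod C d = Dom C x \<Longrightarrow> Rst C d = d \<Longrightarrow>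
      Rst C x \<cdot> d = d \<Longrightarrow> on_ar P e \<cdot> (x \<cdot> d) = x \<cdot> d \<Longrightarrow> u \<cdot> d = v \<cdot> d"
  shows "u = v"
proof -
  let ?E = "on_ar P ` {e. agrees_on f g e}"
  let ?a = "on_ob P (Dom A f)"
  have E: "?E \<subseteq> rst_idems C ?a" using agrees_on_idem by auto
  have "is_join C (Dom C x) ?a ((\<lambda>h. h \<cdot> x) ` ?E) (\<phi> f g \<cdot> x)"
    using join_comp [OF compatible_idems [OF E] agree_join [OF fg], of x] x by (simp add: in_Hom_iff)
  then have J: "is_join C (Dom C x) (Dom C x) (Rst C ` (\<lambda>h. h \<cdot> x) ` ?E) (Rst C x)"
    unfolding x(3) using E x by (intro join_rst) (auto simp: in_Hom_iff rst_idems_iff subset_iff)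
  have S: "Rst C ` (\<lambda>h. h \<cdot> x) ` ?E \<subseteq> rst_idems C (Dom C x)"
    using E x by (auto simp: rst_idems_iff subset_iff)
  have "u \<cdot> Rst C x = v \<cdot> Rst C x"
  proof (rule join_local_eq [OF S J])
    fix d assume "d \<in> Rst C ` (\<lambda>h. h \<cdot> x) ` ?E"
    then obtain e where e: "agrees_on f g e" and d: "d = Rst C (on_ar P e \<cdot> x)" by auto
    have et: "on_ar P e \<in> Arr C" "Dom C (on_ar P e) = ?a" "Cod C (on_ar P e) = ?a"
      "Rst C (on_ar P e) = on_ar P e" using agrees_on_idem [OF e] by (auto simp: rst_idems_iff)
    have "on_ar P e \<cdot> x = x \<cdot> d" unfolding d using idem_comp_map [of x "on_ar P e"] agrees_on_idem [OF e] x by simp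
    moreover have "on_ar P e \<cdot> (on_ar P e \<cdot> x) = on_ar P e \<cdot> x"
      using et x comp_rst_assoc [of "on_ar P e" x] by simp
    ultimately have pe: "on_ar P e \<cdot> (x \<cdot> d) = x \<cdot> d" by simp
    show "u \<cdot> d = v \<cdot> d"
      by (rule loc [OF e _ _ _ _ _ pe]) (use d et x in auto)
  qed (use uv in \<open>auto simp: in_Hom_iff\<close>)
  then show ?thesis using uv by simp
qed

lemma agree_sym:
  assumes "f \<in> Arr A" "g \<in> Arr A" "Dom A g = Dom A f"
  shows "\<phi> f g = \<phi> g f"
proof -
  have "{e. agrees_on f g e} = {e. agrees_on g f e}" using agrees_on_sym assms by (metis (full_types))
  then show ?thesis using agree_join [OF assms] agree_join [of g f] assms is_join_unique by fastforce
qed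

lemma agree_eq:
  assumes "f \<in> Arr A" "g \<in> Arr A" "Dom A g = Dom A f" "Cod A g = Cod A f"
    "x \<in> Arr C" "Cod C x = on_ob P (Dom A f)" "\<phi> f g \<cdot> x = x"
  shows "on_ar P f \<cdot> x = on_ar P g \<cdot> x"
proof (rule agreeE [OF assms(1-3,5-7)])
  fix e d assume e: "agrees_on f g e" and d: "d \<in> Arr C" "Dom C d = Dom C x" "Cod C d = Dom C x"
    "on_ar P e \<cdot> (x \<cdot> d) = x \<cdot> d"
  have et: "e \<in> Arr A" "Dom A e = Dom A f" "Cod A e = Dom A f" "f \<bullet> e = g \<bullet> e"
    using e by (auto simp: agrees_on_def)
  have "on_ar P f \<cdot> on_ar P e = on_ar P g \<cdot> on_ar P e"
    using P_comp [of e f] P_comp [of e g] et assms by simp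
  then have "on_ar P f \<cdot> (on_ar P e \<cdot> (x \<cdot> d)) = on_ar P g \<cdot> (on_ar P e \<cdot> (x \<cdot> d))"
    using assms et d by (intro comp_reduce2) auto
  then show "on_ar P f \<cdot> x \<cdot> d = on_ar P g \<cdot> x \<cdot> d" using d assms by simp
qed (use assms in auto)

lemma agree_dom:
  assumes "f \<in> Arr A" "g \<in> Arr A" "Dom A g = Dom A f"
    "x \<in> Arr C" "Cod C x = on_ob P (Dom A f)" "\<phi> f g \<cdot> x = x"
  shows "Rst C (on_ar P f) \<cdot> x = x"
proof (rule agreeE [OF assms])
  fix e d assume e: "agrees_on f g e" and d: "d \<in> Arr C" "Dom C d = Dom C x" "Cod C d = Dom C x"
    "on_ar P e \<cdot> (x \<cdot> d) = x \<cdot> d"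
  have et: "e \<in> Arr A" "Dom A e = Dom A f" "Cod A e = Dom A f" "Rst A f \<bullet> e = e"
    using e by (auto simp: agrees_on_def)
  have "Rst C (on_ar P f) \<cdot> on_ar P e = on_ar P e"
    using P_comp [of e "Rst A f"] et assms P_rst [of f] by simp
  then have "Rst C (on_ar P f) \<cdot> (on_ar P e \<cdot> (x \<cdot> d)) = on_ar P e \<cdot> (x \<cdot> d)"
    using assms et d by (intro comp_reduce) auto
  then show "Rst C (on_ar P f) \<cdot> x \<cdot> d = x \<cdot> d" using d assms by simp
qed (use assms in auto)

text \<open>The restriction of f is itself a witness, which gives one inequality;
  \<open>agree_dom\<close> gives the other.\<close>

lemma agree_refl:
  assumes "f \<in> Arr A"
  shows "\<phi> f f = Rst C (on_ar P f)"
proof -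
  have "agrees_on f f (Rst A f)" using assms by (auto simp: agrees_on_def)
  then have "\<phi> f f \<cdot> Rst C (on_ar P f) = Rst C (on_ar P f)"
    using assms P_rst [of f] by (intro agreeI [of f f "Rst A f"]) auto
  moreover have "Rst C (on_ar P f) \<cdot> \<phi> f f = \<phi> f f"
    using assms comp_rst' [of "\<phi> f f"] by (intro agree_dom [of f f]) auto
  moreover have "\<phi> f f \<cdot> Rst C (on_ar P f) = Rst C (on_ar P f) \<cdot> \<phi> f f"
    using rst_commute' [of "\<phi> f f" "on_ar P f"] assms by simp
  ultimately show ?thesis by simp
qed

text \<open>A witness e for f and g and a witness e' for g and h multiply to a witness for f and h.
  Both depend on the part of x considered, so the domain is refined twice.\<close>

lemma agree_trans:
  assumes fgh: "f \<in> Arr A" "g \<in> Arr A" "h \<in> Arr A" "Dom A g = Dom A f" "Dom A h = Dom A f"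
    and x: "x \<in> Arr C" "Cod C x = on_ob P (Dom A f)" "\<phi> f g \<cdot> x = x" "\<phi> g h \<cdot> x = x"
  shows "\<phi> f h \<cdot> x = x"
proof (rule agreeE [OF fgh(1,2,4) x(1-3)])
  fix e d assume e: "agrees_on f g e" and d: "d \<in> Arr C" "Dom C d = Dom C x" "Cod C d = Dom C x" "Rst C x \<cdot> d = d"
    "on_ar P e \<cdot> (x \<cdot> d) = x \<cdot> d"
  have xd: "\<phi> g h \<cdot> (x \<cdot> d) = x \<cdot> d" using comp_reduce [OF x(4)] x fgh d by simp
  have "\<phi> f h \<cdot> (x \<cdot> d) = x \<cdot> d"
  proof (rule agreeE [of g h "x \<cdot> d"])
    fix e' d' assume e': "agrees_on g h e'" and d': "d' \<in> Arr C" "Dom C d' = Dom C (x \<cdot> d)" "Cod C d' = Dom C (x \<cdot> d)"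
      "on_ar P e' \<cdot> (x \<cdot> d \<cdot> d') = x \<cdot> d \<cdot> d'"
    have et: "e \<in> Arr A" "Dom A e = Dom A f" "Cod A e = Dom A f" "Rst A e = e" "Rst A f \<bullet> e = e" "f \<bullet> e = g \<bullet> e"
      and et': "e' \<in> Arr A" "Dom A e' = Dom A f" "Cod A e' = Dom A f" "Rst A e' = e'" "Rst A h \<bullet> e' = e'" "g \<bullet> e' = h \<bullet> e'"
      using e e' fgh by (auto simp: agrees_on_def)
    let ?y = "x \<cdot> (d \<cdot> d')"
    have y: "?y \<in> Arr C" "Cod C ?y = on_ob P (Dom A f)" using d d' x by auto
    have y': "on_ar P e' \<cdot> ?y = ?y" using d d' x by simp
    have "on_ar P e \<cdot> (x \<cdot> d) \<cdot> d' = x \<cdot> d \<cdot> d'" using d by simp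
    then have y2: "on_ar P e \<cdot> ?y = ?y" using d(1-3) d'(1-3) x(1,2) et by simp
    have c: "e \<bullet> e' = e' \<bullet> e"
      using A.idem_commute [of e "Dom A f" e'] et et' by (auto simp: A.rst_idems_iff)
    have "agrees_on f h (e \<bullet> e')"
      unfolding agrees_on_def
    proof (intro conjI)
      show "Rst A (e \<bullet> e') = e \<bullet> e'"
        using A.idem_comp [of e "Dom A f" e'] et et' by (auto simp: A.rst_idems_iff)
      show "Rst A f \<bullet> (e \<bullet> e') = e \<bullet> e'"
        using A.comp_reduce [OF et(5), of e'] et et' fgh by simp
      show "Rst A h \<bullet> (e \<bullet> e') = e \<bullet> e'"
        unfolding c using A.comp_reduce [OF et'(5), of e] et et' fgh by simp
      have "f \<bullet> (e \<bullet> e') = g \<bullet> (e \<bullet> e')"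
        using et et' fgh by (intro A.comp_reduce2) auto
      also have "\<dots> = h \<bullet> (e \<bullet> e')"
        unfolding c using et et' fgh by (intro A.comp_reduce2) auto
      finally show "f \<bullet> (e \<bullet> e') = h \<bullet> (e \<bullet> e')" .
    qed (use et et' in auto)
    then have "\<phi> f h \<cdot> ?y = ?y"
      using y y' y2 et et' fgh P_comp [of e' e] by (intro agreeI [of f h "e \<bullet> e'"]) auto
    then show "\<phi> f h \<cdot> (x \<cdot> d) \<cdot> d' = x \<cdot> d \<cdot> d'" using d(1-3) d'(1-3) x(1,2) fgh by simp
  qed (use xd fgh x d in auto)
  then show "\<phi> f h \<cdot> x \<cdot> d = x \<cdot> d" using fgh x d by simp
qed (use fgh x in auto)

text \<open>Given a witness e for f and f' and a witness e' for g and g', the part of e that f sends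
  into e' is a witness for the composites. The domain is refined first at x and then at its image
  under P f.\<close>

lemma agree_comp:
  assumes f: "f \<in> Arr A" "f' \<in> Arr A" "Dom A f' = Dom A f" "Cod A f' = Cod A f"
    and g: "g \<in> Arr A" "g' \<in> Arr A" "Dom A g = Cod A f" "Dom A g' = Cod A f" "Cod A g' = Cod A g"
    and x: "x \<in> Arr C" "Cod C x = on_ob P (Dom A f)" "\<phi> f f' \<cdot> x = x"
      "\<phi> g g' \<cdot> (on_ar P f \<cdot> x) = on_ar P f \<cdot> x"
  shows "\<phi> (g \<bullet> f) (g' \<bullet> f') \<cdot> x = x"
proof (rule agreeE [OF f(1-3) x(1-3)])
  let ?a = "\<phi> (g \<bullet> f) (g' \<bullet> f')"
  have a: "?a \<in> Arr C" "Dom C ?a = on_ob P (Dom A f)" "Cod C ?a = on_ob P (Dom A f)" using f g by auto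
  fix e d assume e: "agrees_on f f' e" and d: "d \<in> Arr C" "Dom C d = Dom C x" "Cod C d = Dom C x" "Rst C d = d" "Rst C x \<cdot> d = d"
    "on_ar P e \<cdot> (x \<cdot> d) = x \<cdot> d"
  let ?z = "on_ar P f \<cdot> (x \<cdot> d)"
  \<comment> \<open>Applying P f to x d loses nothing of the domain, since x lies in the domain of P
    f; the second refinement, made at \<open>?z\<close>, can therefore be carried back to x
    d.\<close>
  have dz: "Rst C ?z = d"
  proof -
    have "Rst C ?z = Rst C (Rst C (on_ar P f) \<cdot> (x \<cdot> d))" using f x d by simp
    also have "Rst C (on_ar P f) \<cdot> (x \<cdot> d) = x \<cdot> d"
      using comp_reduce [OF agree_dom [OF f(1-3) x(1-3)], of d] f x d by simp
    also have "Rst C (x \<cdot> d) = d" using rst_comp_idem [of x d] x d by (simp add: rst_idems_iff)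
    finally show ?thesis .
  qed
  have "?a \<cdot> (x \<cdot> d) = x \<cdot> d"
  proof (rule agreeE [of g g' ?z])
    show "\<phi> g g' \<cdot> ?z = ?z"
    proof -
      have "\<phi> g g' \<cdot> (on_ar P f \<cdot> x) \<cdot> d = on_ar P f \<cdot> x \<cdot> d" using x by simp
      then show ?thesis using f g x(1,2) d(1-3) by simp
    qed
    fix e' d' assume e': "agrees_on g g' e'" and d': "d' \<in> Arr C" "Dom C d' = Dom C ?z" "Cod C d' = Dom C ?z"
      "Rst C ?z \<cdot> d' = d'" "Rst C d' = d'" "on_ar P e' \<cdot> (?z \<cdot> d') = ?z \<cdot> d'"
    have et: "e \<in> Arr A" "Dom A e = Dom A f" "Cod A e = Dom A f" "Rst A e = e" "Rst A f \<bullet> e = e"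
        "f \<bullet> e = f' \<bullet> e"
      and et': "e' \<in> Arr A" "Dom A e' = Cod A f" "Cod A e' = Cod A f" "Rst A e' = e'" "Rst A g \<bullet> e' = e'"
        "Rst A g' \<bullet> e' = e'" "g \<bullet> e' = g' \<bullet> e'"
      using e e' f g by (auto simp: agrees_on_def)
    let ?y = "x \<cdot> (d \<cdot> d')"
    have y: "?y \<in> Arr C" "Cod C ?y = on_ob P (Dom A f)" using d d' x f by auto
    have "on_ar P e \<cdot> (x \<cdot> d) \<cdot> d' = x \<cdot> d \<cdot> d'" using d by simp
    then have y1: "on_ar P e \<cdot> ?y = ?y" using d(1-3) d'(1-3) x(1,2) f et by simp
    have y2: "on_ar P e' \<cdot> (on_ar P f \<cdot> ?y) = on_ar P f \<cdot> ?y"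
      using d'(6) d(1-3) d'(1-3) x(1,2) f et' by simp
    let ?r = "Rst A (e' \<bullet> f)"
    \<comment> \<open>The part of e that f sends into e', formed as an idempotent of A.\<close>
    let ?w = "?r \<bullet> e"
    have r: "?r \<in> Arr A" "Dom A ?r = Dom A f" "Cod A ?r = Dom A f" using et' f by auto
    have w: "?w \<in> Arr A" "Dom A ?w = Dom A f" "Cod A ?w = Dom A f" "Rst A ?w = ?w"
      using et et' f A.idem_comp [of ?r "Dom A f" e] by (auto simp: A.rst_idems_iff)
    \<comment> \<open>The witness is symmetric in f and f': since f e = f' e, both have the same
      preimage of e' within e.\<close>
    have r': "?w = Rst A (e' \<bullet> f') \<bullet> e"
    proof -
      have "e \<in> rst_idems A (Dom A f)" using et by (simp add: A.rst_idems_iff)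
      then have "?w = Rst A (e' \<bullet> f \<bullet> e)" "Rst A (e' \<bullet> f') \<bullet> e = Rst A (e' \<bullet> f' \<bullet> e)"
        using A.rst_comp_idem [of "e' \<bullet> f" e] A.rst_comp_idem [of "e' \<bullet> f'" e] et' f by simp_all
      then show ?thesis using et et' f by simp
    qed
    have fw: "h \<bullet> (Rst A (e' \<bullet> h) \<bullet> e) = e' \<bullet> (h \<bullet> e)"
      if "h \<in> Arr A" "Dom A h = Dom A f" "Cod A h = Cod A f" for h
    proof -
      have "h \<bullet> Rst A (e' \<bullet> h) = e' \<bullet> h"
        using A.idem_comp_map [of h e'] et' that by (simp add: A.rst_idems_iff)
      then have "h \<bullet> (Rst A (e' \<bullet> h) \<bullet> e) = e' \<bullet> h \<bullet> e"
        using that et et' by (intro A.comp_reduce) auto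
      then show ?thesis using that et et' by simp
    qed
    \<comment> \<open>As e' lies in the domain of k, its preimage under h lies in the domain of k
      h.\<close>
    have abs: "Rst A (k \<bullet> h) \<bullet> Rst A (e' \<bullet> h) = Rst A (e' \<bullet> h)"
      if "h \<in> Arr A" "Dom A h = Dom A f" "Cod A h = Cod A f" "k \<in> Arr A" "Dom A k = Cod A f" "Rst A k \<bullet> e' = e'" for h k
    proof -
      have e1: "h \<bullet> Rst A (e' \<bullet> h) = e' \<bullet> h"
        using A.idem_comp_map [of h e'] et' that by (simp add: A.rst_idems_iff)
      have "Rst A (k \<bullet> h) \<bullet> Rst A (e' \<bullet> h) = Rst A (k \<bullet> (h \<bullet> Rst A (e' \<bullet> h)))"
        using A.rst_comp_rst' [of "e' \<bullet> h" "k \<bullet> h"] that et' by simp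
      also have "\<dots> = Rst A (Rst A k \<bullet> (e' \<bullet> h))" unfolding e1 using that et' by simp
      also have "Rst A k \<bullet> (e' \<bullet> h) = e' \<bullet> h" using A.comp_reduce [OF that(6), of h] that et' by simp
      finally show ?thesis .
    qed
    have "agrees_on (g \<bullet> f) (g' \<bullet> f') ?w"
      unfolding agrees_on_def
    proof (intro conjI)
      show "Rst A (g \<bullet> f) \<bullet> ?w = ?w"
        by (rule A.comp_reduce [OF abs]) (use f g et et' in auto)
      show "Rst A (g' \<bullet> f') \<bullet> ?w = ?w"
        unfolding r' by (rule A.comp_reduce [OF abs]) (use f g et et' in auto)
      have 1: "g \<bullet> f \<bullet> ?w = g \<bullet> (e' \<bullet> (f \<bullet> e))"
        using fw [of f] f g w by simp
      have 2: "g' \<bullet> f' \<bullet> ?w = g' \<bullet> (e' \<bullet> (f' \<bullet> e))"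
        unfolding r' using fw [of f'] f g et et' by simp
      have 3: "g \<bullet> (e' \<bullet> (f' \<bullet> e)) = g' \<bullet> (e' \<bullet> (f' \<bullet> e))"
        using et et' f g by (intro A.comp_reduce2) auto
      show "g \<bullet> f \<bullet> ?w = g' \<bullet> f' \<bullet> ?w" unfolding 1 2 et(6) 3 ..
    qed (use w f g in auto)
    moreover have "on_ar P ?w \<cdot> ?y = ?y"
    proof -
      have "on_ar P ?w = Rst C (on_ar P e' \<cdot> on_ar P f) \<cdot> on_ar P e"
        using P_comp [of e ?r] P_comp [of f e'] P_rst [of "e' \<bullet> f"] et et' f by simp
      then have "on_ar P ?w \<cdot> ?y = Rst C (on_ar P e' \<cdot> on_ar P f) \<cdot> ?y"
        using y y1 et et' f by simp
      also have "\<dots> = ?y \<cdot> Rst C (on_ar P e' \<cdot> (on_ar P f \<cdot> ?y))"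
        using rst_comp' [of ?y "on_ar P e' \<cdot> on_ar P f"] y et' f by simp
      also have "\<dots> = ?y"
      proof -
        have zd: "on_ar P f \<cdot> ?y = ?z \<cdot> d'" using f x(1,2) d(1-3) d'(1-3) by simp
        have "Rst C (?z \<cdot> d') = d'" using rst_comp_idem [of ?z d'] f x(1,2) d(1-3) d' by (simp add: rst_idems_iff)
        then have "Rst C (on_ar P e' \<cdot> (on_ar P f \<cdot> ?y)) = d'" unfolding y2 unfolding zd .
        then show ?thesis using x(1,2) d(1-3) d'(1-3,5) f comp_rst' [of d'] by simp
      qed
      finally show ?thesis .
    qed
    ultimately have "?a \<cdot> ?y = ?y"
      using y f g by (intro agreeI [of "g \<bullet> f" "g' \<bullet> f'" ?w]) auto
    then show "?a \<cdot> (x \<cdot> d) \<cdot> d' = x \<cdot> d \<cdot> d'" using d(1-3) d'(1-3) x(1,2) f a by simp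
  next
    show "?a \<cdot> (x \<cdot> d) \<cdot> Rst C ?z = ?a \<cdot> (x \<cdot> d)" "x \<cdot> d \<cdot> Rst C ?z = x \<cdot> d"
      unfolding dz using d a x f comp_rst' [of d] by simp_all
  qed (use f g x d a in auto)
  then show "?a \<cdot> x \<cdot> d = x \<cdot> d" using f g x d a by simp
qed (use f g x in auto)

text \<open>For the transitivity condition \<open>agree_trans\<close> is applied to the element
  \<open>\<phi> g h \<cdot> \<phi> f g\<close> itself, which both factors fix because they
  commute.\<close>

lemma agree_atlas:
  assumes "i \<in> Ob A" "j \<in> Ob A"
  shows "local_atlas C (on_ob P i) (Hom A i j) (\<phi>)"
  unfolding local_atlas_def
proof (intro conjI ballI)
  fix f g assume fg: "f \<in> Hom A i j" "g \<in> Hom A i j"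
  then show "\<phi> f g \<in> rst_idems C (on_ob P i)" "\<phi> f g = \<phi> g f"
    using agree_idem [of f g] agree_sym [of f g] by (auto simp: in_Hom_iff)
  fix h assume h: "h \<in> Hom A i j"
  let ?x = "\<phi> g h \<cdot> \<phi> f g"
  have ty: "f \<in> Arr A" "g \<in> Arr A" "h \<in> Arr A" "Dom A f = i" "Dom A g = i" "Dom A h = i"
    using fg h by (auto simp: in_Hom_iff)
  have x: "?x \<in> rst_idems C (on_ob P i)" using ty agree_idem [of g h] agree_idem [of f g] by (intro idem_comp) auto
  have id: "\<phi> f g \<cdot> \<phi> f g = \<phi> f g" if "f \<in> Arr A" "g \<in> Arr A" "Dom A g = Dom A f" for f g
    using agree_idem [OF that] by (rule idem_idem)
  have c: "?x = \<phi> f g \<cdot> \<phi> g h"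
    using idem_commute [of "\<phi> g h" "on_ob P i"] agree_idem [of f g] agree_idem [of g h] ty by simp
  have 1: "\<phi> g h \<cdot> ?x = ?x" using comp_reduce [OF id [of g h]] ty by simp
  have 2: "\<phi> f g \<cdot> ?x = ?x" unfolding c using comp_reduce [OF id [of f g]] ty by simp
  have "\<phi> f h \<cdot> ?x = ?x" using 1 2 ty by (intro agree_trans [of f g h]) auto
  then show "rle C ?x (\<phi> f h)" using x by (simp add: rle_def rst_idems_iff)
qed

section \<open>The glued objects of \<Psi> P and their structure maps\<close>

abbreviation E :: "'a \<Rightarrow> 'a \<Rightarrow> 'o" where
  "E i j \<equiv> Dom C (\<sigma> i j)"

text \<open>The glueing exists because the hom-sets of A are small. \<open>Psi_sec\<close> looks up
  its glueing from the domain and codomain of its argument, so on \<open>Hom A i j\<close> it is the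
  family of sections chosen for (i, j).\<close>

lemma Psi_glued:
  assumes "i \<in> Ob A" "j \<in> Ob A"
  shows "glued C (on_ob P i) (Hom A i j) (\<phi>) (\<sigma> i j)
    (fst (snd (Psi_glueing C A P i j))) (sec)"
proof -
  have "small K (Hom A i j)" using small_A assms by (simp add: locally_small_def)
  then obtain p q s where "glueing C (on_ob P i) (Hom A i j) (\<phi>) p q s"
    using small_glueing [OF local_glueings P(5) [OF assms(1)] _ agree_atlas [OF assms]] by blast
  then have "case Psi_glueing C A P i j of (p, q, s) \<Rightarrow> glueing C (on_ob P i) (Hom A i j) (\<phi>) p q s"
    unfolding Psi_glueing_def
    by (intro someI_ex [of "\<lambda>(p, q, s). glueing C (on_ob P i) (Hom A i j) (\<phi>) p q s"]) auto
  then have "glueing C (on_ob P i) (Hom A i j) (\<phi>) (\<sigma> i j)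
      (fst (snd (Psi_glueing C A P i j))) (snd (snd (Psi_glueing C A P i j)))"
    by (simp add: Psi_src_def case_prod_beta)
  then have "glueing C (on_ob P i) (Hom A i j) (\<phi>) (\<sigma> i j)
      (fst (snd (Psi_glueing C A P i j))) (sec)"
    unfolding glueing_def by (simp add: Psi_sec_def in_Hom_iff)
  then show ?thesis by unfold_locales
qed

lemma
  assumes "i \<in> Ob A" "j \<in> Ob A"
  shows src_arr [simp]: "\<sigma> i j \<in> Arr C" and cod_src [simp]: "Cod C (\<sigma> i j) = on_ob P i"
    and src_total [simp]: "total C (\<sigma> i j)"
    and E_ob [simp]: "E i j \<in> Ob C"
proof -
  interpret G: glued C "on_ob P i" "Hom A i j" \<phi> "\<sigma> i j"
    "fst (snd (Psi_glueing C A P i j))" sec by (rule Psi_glued [OF assms])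
  show "\<sigma> i j \<in> Arr C" "Cod C (\<sigma> i j) = on_ob P i"
    "total C (\<sigma> i j)" by auto
  then show "E i j \<in> Ob C" by simp
qed

lemma
  assumes "f \<in> Arr A"
  shows sec_arr [simp]: "sec f \<in> Arr C" and dom_sec [simp]: "Dom C (sec f) = on_ob P (Dom A f)"
    and cod_sec [simp]: "Cod C (sec f) = E (Dom A f) (Cod A f)"
    and rst_sec: "Rst C (sec f) = Rst C (on_ar P f)"
    and src_sec: "\<sigma> (Dom A f) (Cod A f) \<cdot> sec f = Rst C (on_ar P f)"
proof -
  interpret G: glued C "on_ob P (Dom A f)" "Hom A (Dom A f) (Cod A f)" \<phi> "\<sigma> (Dom A f) (Cod A f)"
    "fst (snd (Psi_glueing C A P (Dom A f) (Cod A f)))" sec using assms by (intro Psi_glued) auto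
  have f: "f \<in> Hom A (Dom A f) (Cod A f)" using assms by (simp add: in_Hom_iff)
  show "sec f \<in> Arr C" "Dom C (sec f) = on_ob P (Dom A f)"
    "Cod C (sec f) = E (Dom A f) (Cod A f)" using f by auto
  show "Rst C (sec f) = Rst C (on_ar P f)"
    using G.phi_diag [OF f] agree_refl [OF assms] by simp
  then show "\<sigma> (Dom A f) (Cod A f) \<cdot> sec f = Rst C (on_ar P f)"
    using G.p_s [OF f] by simp
qed

lemma src_sec_comp:
  assumes "f \<in> Arr A" "Dom A f = i" "Cod A f = j" "y \<in> Arr C" "Cod C y = on_ob P i" "Rst C (on_ar P f) \<cdot> y = y"
  shows "\<sigma> i j \<cdot> (sec f \<cdot> y) = y"
  using comp_reduce [OF src_sec [OF assms(1)], of y] assms by auto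

lemma rst_sec_comp:
  assumes "f \<in> Arr A" "y \<in> Arr C" "Cod C y = on_ob P (Dom A f)" "Rst C (on_ar P f) \<cdot> y = y"
  shows "Rst C (sec f \<cdot> y) = Rst C y"
  using rst_rst_comp [of y "sec f"] assms by (simp add: rst_sec)

lemma sec_eq:
  assumes "f \<in> Arr A" "g \<in> Arr A" "Dom A g = Dom A f" "Cod A g = Cod A f"
    "y \<in> Arr C" "Cod C y = on_ob P (Dom A f)" "\<phi> f g \<cdot> y = y"
  shows "sec f \<cdot> y = sec g \<cdot> y"
proof -
  interpret G: glued C "on_ob P (Dom A f)" "Hom A (Dom A f) (Cod A f)" \<phi> "\<sigma> (Dom A f) (Cod A f)"
    "fst (snd (Psi_glueing C A P (Dom A f) (Cod A f)))" sec using assms by (intro Psi_glued) auto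
  show ?thesis using assms by (intro G.phi_sheets) (auto simp: in_Hom_iff)
qed

text \<open>The sheet condition of \<open>local_eq\<close> is rephrased with y as the base point of
  \<open>a \<cdot> e\<close>: on each part a is literally \<open>sec f \<cdot> y\<close>, with y in
  the domain of P f.\<close>

lemma Psi_local_eq:
  assumes "i \<in> Ob A" "j \<in> Ob A" "a \<in> Arr C" "Cod C a = E i j"
    "u \<in> Arr C" "v \<in> Arr C" "Dom C u = Dom C a" "Dom C v = Dom C a" "Cod C u = Cod C v"
    "u \<cdot> Rst C a = u" "v \<cdot> Rst C a = v"
    and loc: "\<And>f e y. f \<in> Arr A \<Longrightarrow> Dom A f = i \<Longrightarrow> Cod A f = j \<Longrightarrow>
      e \<in> Arr C \<Longrightarrow> Dom C e = Dom C a \<Longrightarrow> Cod C e = Dom C a \<Longrightarrow> Rst C e = e \<Longrightarrow> Rst C a \<cdot> e = e \<Longrightarrow>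
      y \<in> Arr C \<Longrightarrow> Dom C y = Dom C a \<Longrightarrow> Cod C y = on_ob P i \<Longrightarrow> Rst C (on_ar P f) \<cdot> y = y \<Longrightarrow>
      Rst C y = e \<Longrightarrow> a \<cdot> e = sec f \<cdot> y \<Longrightarrow> u \<cdot> e = v \<cdot> e"
  shows "u = v"
proof -
  interpret G: glued C "on_ob P i" "Hom A i j" \<phi> "\<sigma> i j"
    "fst (snd (Psi_glueing C A P i j))" sec by (rule Psi_glued [OF assms(1,2)])
  show ?thesis
  proof (rule G.local_eq [OF assms(3-11)])
    fix f e assume f: "f \<in> Hom A i j" and e: "e \<in> Arr C" "Dom C e = Dom C a" "Cod C e = Dom C a" "Rst C e = e"
      "Rst C a \<cdot> e = e" "sec f \<cdot> (\<sigma> i j \<cdot> (a \<cdot> e)) = a \<cdot> e"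
    let ?y = "\<sigma> i j \<cdot> (a \<cdot> e)"
    have ft: "f \<in> Arr A" "Dom A f = i" "Cod A f = j" using f by (auto simp: in_Hom_iff)
    have "\<phi> f f \<cdot> ?y = ?y" using f e assms by (intro G.sheets_phi) auto
    then have "Rst C (on_ar P f) \<cdot> ?y = ?y" using agree_refl [OF ft(1)] by simp
    moreover have "Rst C (a \<cdot> e) = e" using rst_comp_idem [of a e] e assms by (simp add: rst_idems_iff)
    ultimately show "u \<cdot> e = v \<cdot> e"
      using ft e assms(1-4) by (intro loc [of f e ?y]) auto
  qed
qed

text \<open>The maps \<open>on_ar P f \<cdot> \<sigma> i j\<close>, one per sheet, agree on overlaps
  by \<open>agree_eq\<close> and are defined on their sheets, so they glue to a total map.
  \<open>Psi_local_eq\<close> supplies the uniqueness by which the description in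
  \<open>Psi_tgt\<close> denotes it.\<close>

lemma
  assumes ij: "i \<in> Ob A" "j \<in> Ob A"
  shows tgt_arr [simp]: "\<tau> i j \<in> Arr C" and dom_tgt [simp]: "Dom C (\<tau> i j) = E i j"
    and cod_tgt [simp]: "Cod C (\<tau> i j) = on_ob P j"
    and tgt_total [simp]: "total C (\<tau> i j)"
    and tgt_sec: "f \<in> Arr A \<Longrightarrow> Dom A f = i \<Longrightarrow> Cod A f = j \<Longrightarrow> \<tau> i j \<cdot> sec f = on_ar P f"
proof -
  interpret G: glued C "on_ob P i" "Hom A i j" \<phi> "\<sigma> i j"
    "fst (snd (Psi_glueing C A P i j))" sec by (rule Psi_glued [OF ij])
  let ?s = "\<sigma> i j"
  obtain t where t: "t \<in> Arr C" "Dom C t = E i j" "Cod C t = on_ob P j" "Rst C t = Ide C (E i j)"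
    and tc: "\<And>f c. f \<in> Hom A i j \<Longrightarrow> c \<in> Arr C \<Longrightarrow> Cod C c = E i j \<Longrightarrow>
      sec f \<cdot> (?s \<cdot> c) = c \<Longrightarrow> t \<cdot> c = on_ar P f \<cdot> (?s \<cdot> c)"
  proof (rule G.glue_ex [of "Ide C (E i j)" "on_ob P j" "\<lambda>f. on_ar P f \<cdot> ?s"])
    fix f g e assume fg: "f \<in> Hom A i j" "g \<in> Hom A i j" and e: "e \<in> Arr C" "Dom C e = Dom C (Ide C (E i j))"
      "Cod C e = Dom C (Ide C (E i j))" "sec f \<cdot> (?s \<cdot> (Ide C (E i j) \<cdot> e)) = Ide C (E i j) \<cdot> e"
      "sec g \<cdot> (?s \<cdot> (Ide C (E i j) \<cdot> e)) = Ide C (E i j) \<cdot> e"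
    have ft: "f \<in> Arr A" "Dom A f = i" "Cod A f = j" "g \<in> Arr A" "Dom A g = i" "Cod A g = j"
      using fg by (auto simp: in_Hom_iff)
    have "\<phi> f g \<cdot> (?s \<cdot> e) = ?s \<cdot> e" using fg e ij by (intro G.sheets_phi) auto
    then have "on_ar P f \<cdot> (?s \<cdot> e) = on_ar P g \<cdot> (?s \<cdot> e)" using ft e ij by (intro agree_eq) auto
    then show "on_ar P f \<cdot> ?s \<cdot> e = on_ar P g \<cdot> ?s \<cdot> e" using ft e ij by simp
  next
    fix f e assume f: "f \<in> Hom A i j" and e: "e \<in> Arr C" "Dom C e = Dom C (Ide C (E i j))"
      "Cod C e = Dom C (Ide C (E i j))" "Rst C e = e" "sec f \<cdot> (?s \<cdot> (Ide C (E i j) \<cdot> e)) = Ide C (E i j) \<cdot> e"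
    have ft: "f \<in> Arr A" "Dom A f = i" "Cod A f = j" using f by (auto simp: in_Hom_iff)
    have "\<phi> f f \<cdot> (?s \<cdot> e) = ?s \<cdot> e" using f e ij by (intro G.sheets_phi) auto
    then have "Rst C (on_ar P f) \<cdot> (?s \<cdot> e) = ?s \<cdot> e" using agree_refl [OF ft(1)] by simp
    then have "Rst C (on_ar P f \<cdot> (?s \<cdot> e)) = Rst C (?s \<cdot> e)"
      using rst_rst_comp [of "?s \<cdot> e" "on_ar P f"] ft e ij by simp
    then show "Rst C (on_ar P f \<cdot> ?s \<cdot> e) = e" using ft e ij by simp
  next
    fix u assume u: "u \<in> Arr C" "Dom C u = Dom C (Ide C (E i j))" "Cod C u = on_ob P j" "Rst C u = Rst C (Ide C (E i j))"
      "\<And>f c. f \<in> Hom A i j \<Longrightarrow> c \<in> Arr C \<Longrightarrow> Cod C c = Dom C (Ide C (E i j)) \<Longrightarrow> Rst C (Ide C (E i j)) \<cdot> c = c \<Longrightarrow>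
        sec f \<cdot> (?s \<cdot> (Ide C (E i j) \<cdot> c)) = Ide C (E i j) \<cdot> c \<Longrightarrow> u \<cdot> c = on_ar P f \<cdot> ?s \<cdot> c"
    show thesis by (rule that [of u]) (use u ij in \<open>auto simp: in_Hom_iff\<close>)
  qed (use ij in \<open>auto simp: in_Hom_iff\<close>)
  have ts: "t \<cdot> sec f = on_ar P f" if f: "f \<in> Hom A i j" for f
  proof -
    have ft: "f \<in> Arr A" "Dom A f = i" "Cod A f = j" using f by (auto simp: in_Hom_iff)
    have "sec f \<cdot> (?s \<cdot> sec f) = sec f"
      using src_sec [OF ft(1)] rst_sec [OF ft(1)] ft comp_rst' [of "sec f"] by simp
    then show ?thesis using tc [OF f, of "sec f"] src_sec [OF ft(1)] ft by simp
  qed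
  have "\<tau> i j = t"
    unfolding Psi_tgt_def
  proof (rule the_equality)
    show "t \<in> Hom C (E i j) (on_ob P j) \<and> (\<forall>f\<in>Hom A i j. t \<cdot> sec f = on_ar P f)"
      using t ts by (auto simp: in_Hom_iff)
    fix r assume r: "r \<in> Hom C (E i j) (on_ob P j) \<and> (\<forall>f\<in>Hom A i j. r \<cdot> sec f = on_ar P f)"
    show "r = t"
    proof (rule Psi_local_eq [OF ij, of "Ide C (E i j)"])
      fix f e y assume f: "f \<in> Arr A" "Dom A f = i" "Cod A f = j" and y: "y \<in> Arr C" "Cod C y = on_ob P i"
        "e \<in> Arr C" "Cod C e = Dom C (Ide C (E i j))" "Ide C (E i j) \<cdot> e = sec f \<cdot> y"
      then have e: "e = sec f \<cdot> y" using ij by simp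
      have "r \<cdot> (sec f \<cdot> y) = on_ar P f \<cdot> y" "t \<cdot> (sec f \<cdot> y) = on_ar P f \<cdot> y"
        using r t ts f y by (auto simp: in_Hom_iff intro!: comp_reduce)
      then show "r \<cdot> e = t \<cdot> e" unfolding e by simp
    qed (use r t ij in \<open>auto simp: in_Hom_iff\<close>)
  qed
  then show "\<tau> i j \<in> Arr C" "Dom C (\<tau> i j) = E i j"
    "Cod C (\<tau> i j) = on_ob P j" "total C (\<tau> i j)"
    "f \<in> Arr A \<Longrightarrow> Dom A f = i \<Longrightarrow> Cod A f = j \<Longrightarrow> \<tau> i j \<cdot> sec f = on_ar P f"
    using t ts by (auto simp: total_def in_Hom_iff)
qed

lemma tgt_sec_comp:
  assumes "f \<in> Arr A" "Dom A f = i" "Cod A f = j" "y \<in> Arr C" "Cod C y = on_ob P i"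
  shows "\<tau> i j \<cdot> (sec f \<cdot> y) = on_ar P f \<cdot> y"
  using assms by (auto intro!: comp_reduce tgt_sec)

text \<open>First a is put on a sheet f, then b on a sheet g over a refined domain. The two elements
  have the same domain because source and target maps are total.\<close>

lemma Psi_local_eq2:
  assumes "i \<in> Ob A" "j \<in> Ob A" "k \<in> Ob A" "a \<in> Arr C" "Cod C a = E i j" "b \<in> Arr C" "Cod C b = E j k"
    "Dom C b = Dom C a" "\<sigma> j k \<cdot> b = \<tau> i j \<cdot> a"
    "u \<in> Arr C" "v \<in> Arr C" "Dom C u = Dom C a" "Dom C v = Dom C a" "Cod C u = Cod C v"
    "u \<cdot> Rst C a = u" "v \<cdot> Rst C a = v"
    and loc: "\<And>f g e y. f \<in> Arr A \<Longrightarrow> Dom A f = i \<Longrightarrow> Cod A f = j \<Longrightarrow> g \<in> Arr A \<Longrightarrow> Dom A g = j \<Longrightarrow> Cod A g = k \<Longrightarrow>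
      e \<in> Arr C \<Longrightarrow> Dom C e = Dom C a \<Longrightarrow> Cod C e = Dom C a \<Longrightarrow> Rst C e = e \<Longrightarrow> Rst C a \<cdot> e = e \<Longrightarrow>
      y \<in> Arr C \<Longrightarrow> Dom C y = Dom C a \<Longrightarrow> Cod C y = on_ob P i \<Longrightarrow> Rst C (on_ar P f) \<cdot> y = y \<Longrightarrow>
      Rst C (on_ar P g) \<cdot> (on_ar P f \<cdot> y) = on_ar P f \<cdot> y \<Longrightarrow>
      Rst C y = e \<Longrightarrow> a \<cdot> e = sec f \<cdot> y \<Longrightarrow> b \<cdot> e = sec g \<cdot> (on_ar P f \<cdot> y) \<Longrightarrow> u \<cdot> e = v \<cdot> e"
  shows "u = v"
proof (rule Psi_local_eq [OF assms(1,2,4,5,10-16)])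
  have rab: "Rst C b = Rst C a" using assms by (intro rst_cone [of "\<sigma> j k" "\<tau> i j"]) auto
  fix f e y assume f: "f \<in> Arr A" "Dom A f = i" "Cod A f = j"
    and e: "e \<in> Arr C" "Dom C e = Dom C a" "Cod C e = Dom C a" "Rst C e = e" "Rst C a \<cdot> e = e"
    and y: "y \<in> Arr C" "Dom C y = Dom C a" "Cod C y = on_ob P i" "Rst C (on_ar P f) \<cdot> y = y" "Rst C y = e"
    and ae: "a \<cdot> e = sec f \<cdot> y"
  have rbe: "Rst C (b \<cdot> e) = e" using rst_comp_idem [of b e] e assms rab by (simp add: rst_idems_iff)
  show "u \<cdot> e = v \<cdot> e"
  proof (rule Psi_local_eq [OF assms(2,3), of "b \<cdot> e"])
    fix g d z assume g: "g \<in> Arr A" "Dom A g = j" "Cod A g = k"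
      and d: "d \<in> Arr C" "Dom C d = Dom C (b \<cdot> e)" "Cod C d = Dom C (b \<cdot> e)" "Rst C d = d" "Rst C (b \<cdot> e) \<cdot> d = d"
      and z: "z \<in> Arr C" "Dom C z = Dom C (b \<cdot> e)" "Cod C z = on_ob P j" "Rst C (on_ar P g) \<cdot> z = z" "Rst C z = d"
      and be: "b \<cdot> e \<cdot> d = sec g \<cdot> z"
    have dd: "d \<in> Arr C" "Dom C d = Dom C a" "Cod C d = Dom C a" "Rst C d = d" using d e assms by auto
    have ed: "e \<cdot> d = d" using d(5) unfolding rbe .
    have "a \<cdot> e \<cdot> d = sec f \<cdot> y \<cdot> d" using ae by simp
    then have aed: "a \<cdot> d = sec f \<cdot> (y \<cdot> d)" using assms e(1-4) dd y f ed by simp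
    have bd: "b \<cdot> d = sec g \<cdot> z" using be ed assms(6,8) e(1-3) dd by simp
    \<comment> \<open>The base point of b is its source, hence the target of a, hence the image of
      the base point of a under P f.\<close>
    have "z = \<sigma> j k \<cdot> (b \<cdot> d)"
      unfolding bd using g z assms by (subst src_sec_comp) auto
    also have "\<dots> = \<tau> i j \<cdot> (a \<cdot> d)"
      using assms dd by (intro comp_reduce2) auto
    also have "\<dots> = on_ar P f \<cdot> (y \<cdot> d)"
      unfolding aed using f y dd by (intro tgt_sec_comp) auto
    finally have zz: "z = on_ar P f \<cdot> (y \<cdot> d)" .
    have yd: "Rst C (on_ar P f) \<cdot> (y \<cdot> d) = y \<cdot> d" using comp_reduce [OF y(4), of d] f y dd by simp
    have "Rst C (y \<cdot> d) = d" using rst_comp_idem [of y d] dd y ed by (simp add: rst_idems_iff)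
    moreover have "Rst C a \<cdot> d = d" using comp_reduce [OF e(5), of d] dd e assms ed by simp
    ultimately have "u \<cdot> d = v \<cdot> d"
      using f g dd y yd z(4) aed bd by (intro loc [of f g d "y \<cdot> d"]) (auto simp: zz)
    then show "u \<cdot> e \<cdot> d = v \<cdot> e \<cdot> d" using assms e(1-4) dd ed by simp
  next
    show "u \<cdot> e \<cdot> Rst C (b \<cdot> e) = u \<cdot> e" "v \<cdot> e \<cdot> Rst C (b \<cdot> e) = v \<cdot> e"
      unfolding rbe using e assms comp_rst' [of e] by simp_all
  qed (use assms e in auto)
qed

text \<open>The atlas pulled back along g is indexed by the same small hom-set, so it has a glueing,
  which is the required pullback.\<close>

lemma src_has_pb:
  assumes "i \<in> Ob A" "j \<in> Ob A" "g \<in> Arr C" "Cod C g = on_ob P i" "total C g"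
  shows "has_pb C (\<sigma> i j) g"
proof -
  interpret G: glued C "on_ob P i" "Hom A i j" \<phi> "\<sigma> i j"
    "fst (snd (Psi_glueing C A P i j))" sec by (rule Psi_glued [OF assms(1,2)])
  have "small K (Hom A i j)" using small_A assms by (simp add: locally_small_def)
  then obtain p q s where "glueing C (Dom C g) (Hom A i j) (\<lambda>f f'. Rst C (\<phi> f f' \<cdot> g)) p q s"
    using small_glueing [OF local_glueings _ _ local_atlas_pullback [OF agree_atlas [OF assms(1,2)] assms(3,4)]]
      assms by auto
  then have "glued C (Dom C g) (Hom A i j) (\<lambda>f f'. Rst C (\<phi> f f' \<cdot> g)) p q s"
    by unfold_locales
  then show ?thesis
    using assms agree_idem by (intro G.pullback) (auto simp: in_Hom_iff)
qed

lemma tgt_has_pb [simp]: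
  "i \<in> Ob A \<Longrightarrow> j \<in> Ob A \<Longrightarrow> k \<in> Ob A \<Longrightarrow> has_pb C (\<sigma> j k) (\<tau> i j)"
  by (rule src_has_pb) auto

text \<open>Agreement of a map with itself is definedness, by \<open>agree_refl\<close>; this is
  \<open>agree_comp\<close> with equal pairs.\<close>

lemma rst_P_comp:
  assumes "f \<in> Arr A" "g \<in> Arr A" "Dom A g = Cod A f" "y \<in> Arr C" "Cod C y = on_ob P (Dom A f)"
    "Rst C (on_ar P f) \<cdot> y = y" "Rst C (on_ar P g) \<cdot> (on_ar P f \<cdot> y) = on_ar P f \<cdot> y"
  shows "Rst C (on_ar P (g \<bullet> f)) \<cdot> y = y"
  using agree_comp [of f f g g y] assms by (simp add: agree_refl)

text \<open>\<open>Psi_mul\<close> is specified through sections pulled back along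
  \<open>\<tau>\<close>; at y these become pairs, the form on which \<open>mult\<close> acts. The
  cut-off vanishes because y lies where both sections are defined.\<close>

lemma sec_pairing:
  assumes "f \<in> Arr A" "Dom A f = i" "Cod A f = j" "g \<in> Arr A" "Dom A g = j" "Cod A g = k"
    "y \<in> Arr C" "Cod C y = on_ob P i"
    "Rst C (on_ar P f) \<cdot> y = y" "Rst C (on_ar P g) \<cdot> (on_ar P f \<cdot> y) = on_ar P f \<cdot> y"
  shows "pb_section C (\<sigma> j k) (\<tau> i j) (sec g) \<cdot> sec f \<cdot> y =
    pairing C (\<sigma> j k) (\<tau> i j) (sec g \<cdot> (on_ar P f \<cdot> y)) (sec f \<cdot> y)"
proof -
  have ob: "i \<in> Ob A" "j \<in> Ob A" "k \<in> Ob A" using assms by auto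
  have S: "sec g \<in> partial_sections C (\<sigma> j k)"
    unfolding in_partial_sections using assms src_sec [of g] rst_sec [of g] by auto
  have fy: "\<tau> i j \<cdot> (sec f \<cdot> y) = on_ar P f \<cdot> y" using assms by (intro tgt_sec_comp) auto
  have r: "Rst C (sec g \<cdot> (on_ar P f \<cdot> y)) = Rst C y"
    using assms rst_sec_comp [of g "on_ar P f \<cdot> y"] rst_rst_comp [of y "on_ar P f"] by simp
  have "pb_section C (\<sigma> j k) (\<tau> i j) (sec g) \<cdot> (sec f \<cdot> y) =
    pairing C (\<sigma> j k) (\<tau> i j) (sec g \<cdot> (on_ar P f \<cdot> y)) (sec f \<cdot> y)"
    using pb_section_comp(4) [OF tgt_has_pb [OF ob] S, of "sec f \<cdot> y"] assms ob
    unfolding fy r by simp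
  then show ?thesis
    using assms ob pb_section_comp(1-3) [OF tgt_has_pb [OF ob] S, of "sec f"] by simp
qed

text \<open>The pullback is covered by parts indexed by pairs of sheets (f, g), and on each the
  value is prescribed on the sheet of the composite. \<open>agree_comp\<close> makes the
  prescriptions consistent; uniqueness comes from \<open>Psi_local_eq2\<close>.\<close>

lemma
  assumes idx: "i \<in> Ob A" "j \<in> Ob A" "k \<in> Ob A"
  shows mul_arr [simp]: "Psi_mul C A P i j k \<in> Arr C"
    and dom_mul [simp]: "Dom C (Psi_mul C A P i j k) = pb_ob C (\<sigma> j k) (\<tau> i j)"
    and cod_mul [simp]: "Cod C (Psi_mul C A P i j k) = E i k"
    and mul_sec: "f \<in> Arr A \<Longrightarrow> Dom A f = i \<Longrightarrow> Cod A f = j \<Longrightarrow> g \<in> Arr A \<Longrightarrow> Dom A g = j \<Longrightarrow> Cod A g = k \<Longrightarrow>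
      y \<in> Arr C \<Longrightarrow> Cod C y = on_ob P i \<Longrightarrow> Rst C (on_ar P f) \<cdot> y = y \<Longrightarrow>
      Rst C (on_ar P g) \<cdot> (on_ar P f \<cdot> y) = on_ar P f \<cdot> y \<Longrightarrow>
      Psi_mul C A P i j k \<cdot> pairing C (\<sigma> j k) (\<tau> i j)
        (sec g \<cdot> (on_ar P f \<cdot> y)) (sec f \<cdot> y) = sec (g \<bullet> f) \<cdot> y"
proof -
  interpret G: glued C "on_ob P i" "Hom A i j" \<phi> "\<sigma> i j"
    "fst (snd (Psi_glueing C A P i j))" sec using idx by (intro Psi_glued)
  interpret H: glued C "on_ob P j" "Hom A j k" \<phi> "\<sigma> j k"
    "fst (snd (Psi_glueing C A P j k))" sec using idx by (intro Psi_glued)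
  let ?S = sec
  let ?\<sigma> = "\<sigma> i j" and ?\<tau> = "\<tau> i j" and ?\<rho> = "\<sigma> j k"
  let ?q = "fst (snd (Psi_glueing C A P i j))" and ?r = "fst (snd (Psi_glueing C A P j k))"
  let ?M = "pb_ob C ?\<rho> ?\<tau>" and ?p1 = "proj1 C ?\<rho> ?\<tau>" and ?p2 = "proj2 C ?\<rho> ?\<tau>"
  have pb [simp]: "has_pb C ?\<rho> ?\<tau>" using idx by simp
  have tot: "total C ?p1" "total C ?p2" using idx by auto
  let ?I = "Hom A i j \<times> Hom A j k"
  let ?e1 = "\<lambda>f. Rst C (?q f \<cdot> ?p2)" and ?e2 = "\<lambda>g. Rst C (?r g \<cdot> ?p1)"
  \<comment> \<open>The part of the pullback on which the second projection lies on sheet f and the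
    first on sheet g, as \<open>on\<close> confirms.\<close>
  define e where "e = (\<lambda>(f, g). ?e1 f \<cdot> ?e2 g)"
  define h where "h = (\<lambda>(f, g). ?S (g \<bullet> f) \<cdot> (?\<sigma> \<cdot> ?p2))"
  have e1: "?e1 f \<in> rst_idems C ?M" if "f \<in> Hom A i j" for f using that idx by (simp add: rst_in_idems)
  have e2: "?e2 g \<in> rst_idems C ?M" if "g \<in> Hom A j k" for g using that idx by (simp add: rst_in_idems)
  have eM: "e n \<in> rst_idems C ?M" if "n \<in> ?I" for n
    using that e1 e2 idem_comp by (auto simp: e_def)
  have on: "e (f, g) \<cdot> c = c \<longleftrightarrow> ?S f \<cdot> (?\<sigma> \<cdot> (?p2 \<cdot> c)) = ?p2 \<cdot> c \<and> ?S g \<cdot> (?\<rho> \<cdot> (?p1 \<cdot> c)) = ?p1 \<cdot> c"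
    if fg: "f \<in> Hom A i j" "g \<in> Hom A j k" and c: "c \<in> Arr C" "Cod C c = ?M" for f g c
  proof -
    have ty: "?e1 f \<in> Arr C" "Dom C (?e1 f) = ?M" "Cod C (?e1 f) = ?M" "?e2 g \<in> Arr C" "Dom C (?e2 g) = ?M" "Cod C (?e2 g) = ?M"
      using e1 [OF fg(1)] e2 [OF fg(2)] by (auto simp: rst_idems_iff)
    have cm: "?e1 f \<cdot> ?e2 g = ?e2 g \<cdot> ?e1 f" using idem_commute [OF e1 [OF fg(1)] e2 [OF fg(2)]] .
    have "e (f, g) \<cdot> c = c \<longleftrightarrow> ?e1 f \<cdot> c = c \<and> ?e2 g \<cdot> c = c"
    proof
      assume ec: "e (f, g) \<cdot> c = c"
      then have 1: "?e1 f \<cdot> (?e2 g \<cdot> c) = c" using ty c by (simp add: e_def)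
      have 2: "?e2 g \<cdot> (?e1 f \<cdot> c) = c" using ec ty c unfolding e_def prod.case cm by simp
      have "?e1 f \<cdot> (?e1 f \<cdot> (?e2 g \<cdot> c)) = ?e1 f \<cdot> (?e2 g \<cdot> c)"
        using comp_reduce [OF idem_idem [OF e1 [OF fg(1)]], of "?e2 g \<cdot> c"] ty c by simp
      moreover have "?e2 g \<cdot> (?e2 g \<cdot> (?e1 f \<cdot> c)) = ?e2 g \<cdot> (?e1 f \<cdot> c)"
        using comp_reduce [OF idem_idem [OF e2 [OF fg(2)]], of "?e1 f \<cdot> c"] ty c by simp
      ultimately show "?e1 f \<cdot> c = c \<and> ?e2 g \<cdot> c = c" unfolding 1 2 by simp
    next
      assume "?e1 f \<cdot> c = c \<and> ?e2 g \<cdot> c = c"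
      then show "e (f, g) \<cdot> c = c" using ty c by (simp add: e_def)
    qed
    also have "?e1 f \<cdot> c = c \<longleftrightarrow> ?S f \<cdot> (?\<sigma> \<cdot> (?p2 \<cdot> c)) = ?p2 \<cdot> c"
      using fg c idx tot by (intro G.sheet_domain_iff) (auto simp: total_def)
    also have "?e2 g \<cdot> c = c \<longleftrightarrow> ?S g \<cdot> (?\<rho> \<cdot> (?p1 \<cdot> c)) = ?p1 \<cdot> c"
      using fg c idx tot by (intro H.sheet_domain_iff) (auto simp: total_def)
    finally show ?thesis .
  qed
  have sq: "?\<rho> \<cdot> (?p1 \<cdot> c) = ?\<tau> \<cdot> (?p2 \<cdot> c)" if "c \<in> Arr C" "Cod C c = ?M" for c
    using that idx pb_square [OF pb] by (intro comp_reduce2) auto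
  have hI: "h n \<in> Hom C ?M (E i k)" if "n \<in> ?I" for n
    using that idx by (auto simp: h_def in_Hom_iff)
  \<comment> \<open>Where the pairs (f, g) and (f', g') both apply, f and f' agree at the base point
    and g and g' agree at its image, so the composites agree at the base point.\<close>
  have ag: "\<phi> (g \<bullet> f) (g' \<bullet> f') \<cdot> (?\<sigma> \<cdot> (?p2 \<cdot> c)) = ?\<sigma> \<cdot> (?p2 \<cdot> c)"
    if fg: "f \<in> Hom A i j" "g \<in> Hom A j k" "f' \<in> Hom A i j" "g' \<in> Hom A j k"
      and c: "c \<in> Arr C" "Cod C c = ?M" "e (f, g) \<cdot> c = c" "e (f', g') \<cdot> c = c" for f g f' g' c
  proof -
    have s1: "?S f \<cdot> (?\<sigma> \<cdot> (?p2 \<cdot> c)) = ?p2 \<cdot> c" "?S g \<cdot> (?\<rho> \<cdot> (?p1 \<cdot> c)) = ?p1 \<cdot> c"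
      "?S f' \<cdot> (?\<sigma> \<cdot> (?p2 \<cdot> c)) = ?p2 \<cdot> c" "?S g' \<cdot> (?\<rho> \<cdot> (?p1 \<cdot> c)) = ?p1 \<cdot> c"
      using on [OF fg(1,2) c(1,2)] on [OF fg(3,4) c(1,2)] c(3,4) by auto
    have ft: "f \<in> Arr A" "Dom A f = i" "Cod A f = j" "f' \<in> Arr A" "Dom A f' = i" "Cod A f' = j"
      "g \<in> Arr A" "Dom A g = j" "Cod A g = k" "g' \<in> Arr A" "Dom A g' = j" "Cod A g' = k"
      using fg by (auto simp: in_Hom_iff)
    have "?\<rho> \<cdot> (?p1 \<cdot> c) = on_ar P f \<cdot> (?\<sigma> \<cdot> (?p2 \<cdot> c))"
      unfolding sq [OF c(1,2)] using tgt_sec_comp [OF ft(1-3), of "?\<sigma> \<cdot> (?p2 \<cdot> c)"] s1 c idx by simp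
    moreover have "\<phi> f f' \<cdot> (?\<sigma> \<cdot> (?p2 \<cdot> c)) = ?\<sigma> \<cdot> (?p2 \<cdot> c)"
      using fg c s1 idx by (intro G.sheets_phi) auto
    moreover have "\<phi> g g' \<cdot> (?\<rho> \<cdot> (?p1 \<cdot> c)) = ?\<rho> \<cdot> (?p1 \<cdot> c)"
      using fg c s1 idx by (intro H.sheets_phi) auto
    ultimately show ?thesis using ft c idx by (intro agree_comp) auto
  qed
  have ty: "e n \<in> Arr C" "Dom C (e n) = ?M" "Cod C (e n) = ?M" "Rst C (e n) = e n" if "n \<in> ?I" for n
    using eM [OF that] by (auto simp: rst_idems_iff)
  have compat: "h m \<cdot> (e m \<cdot> e n) = h n \<cdot> (e m \<cdot> e n)" if mn: "m \<in> ?I" "n \<in> ?I" for m n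
  proof -
    obtain f g f' g' where fg: "m = (f, g)" "n = (f', g')" "f \<in> Hom A i j" "g \<in> Hom A j k" "f' \<in> Hom A i j" "g' \<in> Hom A j k"
      using mn by auto
    have ft: "f \<in> Arr A" "Dom A f = i" "Cod A f = j" "f' \<in> Arr A" "Dom A f' = i" "Cod A f' = j"
      "g \<in> Arr A" "Dom A g = j" "Cod A g = k" "g' \<in> Arr A" "Dom A g' = j" "Cod A g' = k"
      using fg by (auto simp: in_Hom_iff)
    let ?c = "e m \<cdot> e n"
    have c: "?c \<in> Arr C" "Cod C ?c = ?M" using ty mn by auto
    have cm: "?c = e n \<cdot> e m" using idem_commute eM mn by blast
    have "e m \<cdot> ?c = ?c" using comp_reduce [OF idem_idem [OF eM [OF mn(1)]], of "e n"] ty mn by simp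
    moreover have "e n \<cdot> ?c = ?c" unfolding cm using comp_reduce [OF idem_idem [OF eM [OF mn(2)]], of "e m"] ty mn by simp
    ultimately have "\<phi> (g \<bullet> f) (g' \<bullet> f') \<cdot> (?\<sigma> \<cdot> (?p2 \<cdot> ?c)) = ?\<sigma> \<cdot> (?p2 \<cdot> ?c)"
      using fg c by (intro ag) auto
    then have "?S (g \<bullet> f) \<cdot> (?\<sigma> \<cdot> (?p2 \<cdot> ?c)) = ?S (g' \<bullet> f') \<cdot> (?\<sigma> \<cdot> (?p2 \<cdot> ?c))"
      using ft c idx by (intro sec_eq) auto
    then show ?thesis unfolding h_def fg prod.case using ft c idx by (simp add: fg(1,2))
  qed
  have Mob: "?M \<in> Ob C" "E i k \<in> Ob C" using idx by auto
  obtain m where m: "m \<in> Hom C ?M (E i k)"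
    "\<And>n. n \<in> ?I \<Longrightarrow> Rst C (h n) \<cdot> e n = e n \<Longrightarrow> m \<cdot> e n = h n \<cdot> e n"
    using join_glue [of ?I h ?M "E i k" e, OF hI eM compat Mob] by blast
  have mt: "m \<in> Arr C" "Dom C m = ?M" "Cod C m = E i k" using m(1) by (auto simp: in_Hom_iff)
  have mfg: "m \<cdot> pairing C ?\<rho> ?\<tau> (?S g \<cdot> (on_ar P f \<cdot> y)) (?S f \<cdot> y) = ?S (g \<bullet> f) \<cdot> y"
    if f: "f \<in> Arr A" "Dom A f = i" "Cod A f = j" and g: "g \<in> Arr A" "Dom A g = j" "Cod A g = k"
      and y: "y \<in> Arr C" "Cod C y = on_ob P i" "Rst C (on_ar P f) \<cdot> y = y"
        "Rst C (on_ar P g) \<cdot> (on_ar P f \<cdot> y) = on_ar P f \<cdot> y" for f g y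
  proof -
    have sq1: "?\<rho> \<cdot> (?S g \<cdot> (on_ar P f \<cdot> y)) = ?\<tau> \<cdot> (?S f \<cdot> y)"
      using f g y by (simp add: src_sec_comp tgt_sec_comp)
    let ?w = "pairing C ?\<rho> ?\<tau> (?S g \<cdot> (on_ar P f \<cdot> y)) (?S f \<cdot> y)"
    have w: "?w \<in> Arr C" "Cod C ?w = ?M" "?p1 \<cdot> ?w = ?S g \<cdot> (on_ar P f \<cdot> y)" "?p2 \<cdot> ?w = ?S f \<cdot> y"
      using f g y idx sq1 by auto
    have fg: "f \<in> Hom A i j" "g \<in> Hom A j k" using f g by (auto simp: in_Hom_iff)
    then have n: "(f, g) \<in> ?I" by simp
    have ew: "e (f, g) \<cdot> ?w = ?w"
      using f g y by (simp add: on [OF fg w(1,2)] w(3,4) src_sec_comp)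
    \<comment> \<open>\<open>ag\<close> with two equal pairs says that the base point lies in the
      domain of the section of the composite, so \<open>h\<close> is defined on the whole
      part.\<close>
    have "Rst C (h (f, g)) \<cdot> e (f, g) = e (f, g)"
    proof -
      let ?e = "e (f, g)"
      note tye = ty [OF n]
      have "?e \<cdot> ?e = ?e" using idem_idem [OF eM [OF n]] .
      then have "\<phi> (g \<bullet> f) (g \<bullet> f) \<cdot> (?\<sigma> \<cdot> (?p2 \<cdot> ?e)) = ?\<sigma> \<cdot> (?p2 \<cdot> ?e)"
        using fg tye by (intro ag) auto
      then have 1: "Rst C (?S (g \<bullet> f)) \<cdot> (?\<sigma> \<cdot> (?p2 \<cdot> ?e)) = ?\<sigma> \<cdot> (?p2 \<cdot> ?e)"
        using f g by (simp add: agree_refl rst_sec)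
      have "Rst C (h (f, g)) \<cdot> ?e = Rst C (h (f, g) \<cdot> ?e)"
        using rst_comp_idem [of "h (f, g)" ?e] hI [OF n] eM [OF n] by (simp add: in_Hom_iff)
      also have "\<dots> = Rst C (Rst C (?S (g \<bullet> f)) \<cdot> (?\<sigma> \<cdot> (?p2 \<cdot> ?e)))"
        using f g tye idx by (simp add: h_def)
      also have "\<dots> = ?e" unfolding 1 using tye idx tot by simp
      finally show ?thesis .
    qed
    then have me: "m \<cdot> e (f, g) = h (f, g) \<cdot> e (f, g)" using m(2) n by blast
    have "m \<cdot> (e (f, g) \<cdot> ?w) = h (f, g) \<cdot> (e (f, g) \<cdot> ?w)"
      using hI [OF n] ty [OF n] mt w(1,2) by (intro comp_reduce2 [OF me]) (auto simp: in_Hom_iff)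
    then have "m \<cdot> ?w = h (f, g) \<cdot> ?w" unfolding ew .
    also have "\<dots> = ?S (g \<bullet> f) \<cdot> y"
      using f g y idx w by (simp add: h_def src_sec_comp)
    finally show ?thesis .
  qed
  have "Psi_mul C A P i j k = m"
    unfolding Psi_mul_def
  proof (rule the_equality)
    show "m \<in> Hom C ?M (E i k) \<and> (\<forall>f\<in>Hom A i j. \<forall>g\<in>Hom A j k.
        m \<cdot> pb_section C ?\<rho> ?\<tau> (?S g) \<cdot> ?S f = ?S (g \<bullet> f))"
    proof (intro conjI m(1) ballI)
      fix f g assume fg: "f \<in> Hom A i j" "g \<in> Hom A j k"
      then have f: "f \<in> Arr A" "Dom A f = i" "Cod A f = j" and g: "g \<in> Arr A" "Dom A g = j" "Cod A g = k"
        by (auto simp: in_Hom_iff)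
      have Sg: "?S g \<in> partial_sections C ?\<rho>"
        unfolding in_partial_sections using g src_sec [of g] rst_sec [of g] by auto
      \<comment> \<open>The domain of P (g f) satisfies both conditions on y in \<open>mfg\<close>,
        and both sides absorb it; thus the element equation yields the defining equation of
        \<open>Psi_mul\<close>.\<close>
      let ?b = "?S g \<cdot> on_ar P f" and ?y = "Rst C (on_ar P (g \<bullet> f))"
      have r: "Rst C ?b = ?y" using f g rst_rst_comp [of "on_ar P f" "?S g"] by (simp add: rst_sec P_comp)
      have 1: "pb_section C ?\<rho> ?\<tau> (?S g) \<cdot> ?S f = pairing C ?\<rho> ?\<tau> (?S g \<cdot> (on_ar P f \<cdot> ?y)) (?S f \<cdot> ?y)"
        using pb_section_comp(4) [OF pb Sg, of "?S f"] tgt_sec [OF idx(1,2) f] f g idx comp_rst' [of ?b]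
        unfolding r by (simp add: r)
      have y1: "Rst C (on_ar P f) \<cdot> ?y = ?y" using f g rst_comp_absorb' [of "on_ar P f" "on_ar P g"] by (simp add: P_comp)
      have y2: "Rst C (on_ar P g) \<cdot> (on_ar P f \<cdot> ?y) = on_ar P f \<cdot> ?y"
        using comp_reduce [OF rst_comp' [of "on_ar P f" "on_ar P g"], of ?y] f g by (simp add: P_comp)
      have "m \<cdot> (pb_section C ?\<rho> ?\<tau> (?S g) \<cdot> ?S f) = ?S (g \<bullet> f) \<cdot> ?y"
        unfolding 1 using f g y1 y2 by (intro mfg) auto
      also have "\<dots> = ?S (g \<bullet> f)" using comp_rst' [of "?S (g \<bullet> f)"] rst_sec [of "g \<bullet> f"] f g by simp
      finally show "m \<cdot> pb_section C ?\<rho> ?\<tau> (?S g) \<cdot> ?S f = ?S (g \<bullet> f)"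
        using mt f g idx pb_section_comp(1-3) [OF pb Sg, of "?S f"] by simp
    qed
    fix m' assume m': "m' \<in> Hom C ?M (E i k) \<and> (\<forall>f\<in>Hom A i j. \<forall>g\<in>Hom A j k.
        m' \<cdot> pb_section C ?\<rho> ?\<tau> (?S g) \<cdot> ?S f = ?S (g \<bullet> f))"
    then have mt': "m' \<in> Arr C" "Dom C m' = ?M" "Cod C m' = E i k" by (auto simp: in_Hom_iff)
    show "m' = m"
    \<comment> \<open>The two projections are the generic composable pair; on each of its parts the
      inclusion c is a pair of sheets, where both maps have the prescribed value.\<close>
    proof (rule Psi_local_eq2 [OF idx, of ?p2 ?p1])
      fix f g c y
      assume f: "f \<in> Arr A" "Dom A f = i" "Cod A f = j" and g: "g \<in> Arr A" "Dom A g = j" "Cod A g = k"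
        and c: "c \<in> Arr C" "Dom C c = Dom C ?p2" "Cod C c = Dom C ?p2"
        and y: "y \<in> Arr C" "Dom C y = Dom C ?p2" "Cod C y = on_ob P i" "Rst C (on_ar P f) \<cdot> y = y"
          "Rst C (on_ar P g) \<cdot> (on_ar P f \<cdot> y) = on_ar P f \<cdot> y"
        and pc: "?p2 \<cdot> c = ?S f \<cdot> y" "?p1 \<cdot> c = ?S g \<cdot> (on_ar P f \<cdot> y)"
      let ?w = "pairing C ?\<rho> ?\<tau> (?S g \<cdot> (on_ar P f \<cdot> y)) (?S f \<cdot> y)"
      have sq1: "?\<rho> \<cdot> (?S g \<cdot> (on_ar P f \<cdot> y)) = ?\<tau> \<cdot> (?S f \<cdot> y)"
        using f g y by (simp add: src_sec_comp tgt_sec_comp)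
      have cw: "c = ?w"
        by (rule pb_eqI [OF pb]) (use f g y c pc sq1 idx in auto)
      have Sg: "?S g \<in> partial_sections C ?\<rho>"
        unfolding in_partial_sections using g src_sec [of g] rst_sec [of g] by auto
      have wp: "?w = pb_section C ?\<rho> ?\<tau> (?S g) \<cdot> ?S f \<cdot> y"
        using f g y by (intro sec_pairing [symmetric]) auto
      have "m' \<cdot> pb_section C ?\<rho> ?\<tau> (?S g) \<cdot> ?S f \<cdot> y = ?S (g \<bullet> f) \<cdot> y"
        using m' f g by (auto simp: in_Hom_iff)
      then have "m' \<cdot> ?w = ?S (g \<bullet> f) \<cdot> y"
        unfolding wp using mt' f g y idx pb_section_comp(1-3) [OF pb Sg, of "?S f"] by simp
      then show "m' \<cdot> c = m \<cdot> c" unfolding cw using mfg [OF f g y(1,3-5)] by simp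
    qed (use idx mt mt' tot pb_square [OF pb] in \<open>auto simp: total_def\<close>)
  qed
  then show "Psi_mul C A P i j k \<in> Arr C" "Dom C (Psi_mul C A P i j k) = ?M" "Cod C (Psi_mul C A P i j k) = E i k"
    "f \<in> Arr A \<Longrightarrow> Dom A f = i \<Longrightarrow> Cod A f = j \<Longrightarrow> g \<in> Arr A \<Longrightarrow> Dom A g = j \<Longrightarrow> Cod A g = k \<Longrightarrow>
      y \<in> Arr C \<Longrightarrow> Cod C y = on_ob P i \<Longrightarrow> Rst C (on_ar P f) \<cdot> y = y \<Longrightarrow>
      Rst C (on_ar P g) \<cdot> (on_ar P f \<cdot> y) = on_ar P f \<cdot> y \<Longrightarrow>
      Psi_mul C A P i j k \<cdot> pairing C ?\<rho> ?\<tau> (?S g \<cdot> (on_ar P f \<cdot> y)) (?S f \<cdot> y) = ?S (g \<bullet> f) \<cdot> y"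
    using mt mfg by auto
qed

section \<open>The internal category axioms for \<Psi> P\<close>

abbreviation Psi :: "('a, 'o, 'm) partite" where
  "Psi \<equiv> Psi_ob C (A, P)"

lemma Psi_simps [simp]:
  "Idx Psi = Ob A" "Vtx Psi = on_ob P" "Edg Psi i j = E i j" "Src Psi = \<sigma>"
  "Tgt Psi = \<tau>" "Unt Psi i = sec (Ide A i)" "Mul Psi = Psi_mul C A P"
  by (simp_all add: Psi_ob_def)

lemma mult_sec:
  assumes "f \<in> Arr A" "Dom A f = i" "Cod A f = j" "g \<in> Arr A" "Dom A g = j" "Cod A g = k"
    "y \<in> Arr C" "Cod C y = on_ob P i" "Rst C (on_ar P f) \<cdot> y = y"
    "Rst C (on_ar P g) \<cdot> (on_ar P f \<cdot> y) = on_ar P f \<cdot> y"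
  shows "mult C Psi i j k (sec g \<cdot> (on_ar P f \<cdot> y)) (sec f \<cdot> y)
    = sec (g \<bullet> f) \<cdot> y"
  unfolding mult_def Psi_simps using assms by (intro mul_sec) auto

text \<open>These rules are needed before \<Psi> P is known to be an internal category. On sheets
  the product is \<open>sec (g \<bullet> f) \<cdot> y\<close>, whose source is y and whose target is
  the image of y under P (g f).\<close>

lemma
  assumes idx: "i \<in> Ob A" "j \<in> Ob A" "k \<in> Ob A" and "a \<in> Arr C" "b \<in> Arr C"
    "Cod C a = E i j" "Cod C b = E j k" "Dom C b = Dom C a" "\<sigma> j k \<cdot> b = \<tau> i j \<cdot> a"
  shows Psi_mult_arr: "mult C Psi i j k b a \<in> Arr C" "Dom C (mult C Psi i j k b a) = Dom C a"
      "Cod C (mult C Psi i j k b a) = E i k"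
    and Psi_mult_comp: "x \<in> Arr C \<Longrightarrow> Cod C x = Dom C a \<Longrightarrow>
      mult C Psi i j k b a \<cdot> x = mult C Psi i j k (b \<cdot> x) (a \<cdot> x)"
    and Psi_mult_src: "\<sigma> i k \<cdot> mult C Psi i j k b a = \<sigma> i j \<cdot> a"
    and Psi_mult_tgt: "\<tau> i k \<cdot> mult C Psi i j k b a = \<tau> j k \<cdot> b"
    and Psi_mult_rst: "mult C Psi i j k b a \<cdot> Rst C a = mult C Psi i j k b a"
proof -
  let ?m = "mult C Psi i j k b a"
  show m: "?m \<in> Arr C" "Dom C ?m = Dom C a" "Cod C ?m = E i k"
    using assms by (auto simp: mult_def)
  show comp: "?m \<cdot> x = mult C Psi i j k (b \<cdot> x) (a \<cdot> x)" if "x \<in> Arr C" "Cod C x = Dom C a" for x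
    unfolding mult_def using that assms pairing_comp [of "\<sigma> j k" "\<tau> i j" b a x] by simp
  have r: "Rst C b = Rst C a" using assms by (intro rst_cone [of "\<sigma> j k" "\<tau> i j"]) auto
  have "b \<cdot> Rst C a = b" unfolding r [symmetric] using assms by simp
  then show mr: "?m \<cdot> Rst C a = ?m" using comp [of "Rst C a"] assms by simp
  have key: "\<sigma> i k \<cdot> (?m \<cdot> e) = \<sigma> i j \<cdot> (a \<cdot> e) \<and>
      \<tau> i k \<cdot> (?m \<cdot> e) = \<tau> j k \<cdot> (b \<cdot> e)"
    if "f \<in> Arr A" "Dom A f = i" "Cod A f = j" "g \<in> Arr A" "Dom A g = j" "Cod A g = k"
      "e \<in> Arr C" "Cod C e = Dom C a"
      "y \<in> Arr C" "Cod C y = on_ob P i" "Rst C (on_ar P f) \<cdot> y = y"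
      "Rst C (on_ar P g) \<cdot> (on_ar P f \<cdot> y) = on_ar P f \<cdot> y"
      "a \<cdot> e = sec f \<cdot> y" "b \<cdot> e = sec g \<cdot> (on_ar P f \<cdot> y)" for f g e y
  proof -
    have "?m \<cdot> e = sec (g \<bullet> f) \<cdot> y"
      using that by (simp add: comp mult_sec)
    then show ?thesis using that rst_P_comp [of f g y] by (simp add: src_sec_comp tgt_sec_comp P_comp)
  qed
  show "\<sigma> i k \<cdot> ?m = \<sigma> i j \<cdot> a"
  proof (rule Psi_local_eq2 [OF idx, of a b])
    show "\<sigma> i k \<cdot> ?m \<cdot> e = \<sigma> i j \<cdot> a \<cdot> e"
      if "f \<in> Arr A" "Dom A f = i" "Cod A f = j" "g \<in> Arr A" "Dom A g = j" "Cod A g = k"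
        "e \<in> Arr C" "Cod C e = Dom C a"
        "y \<in> Arr C" "Cod C y = on_ob P i" "Rst C (on_ar P f) \<cdot> y = y"
        "Rst C (on_ar P g) \<cdot> (on_ar P f \<cdot> y) = on_ar P f \<cdot> y"
        "a \<cdot> e = sec f \<cdot> y" "b \<cdot> e = sec g \<cdot> (on_ar P f \<cdot> y)" for f g e y
      using key [OF that] that(7,8) m assms by simp
  qed (use assms m mr in auto)
  show "\<tau> i k \<cdot> ?m = \<tau> j k \<cdot> b"
  proof (rule Psi_local_eq2 [OF idx, of a b])
    show "\<tau> i k \<cdot> ?m \<cdot> e = \<tau> j k \<cdot> b \<cdot> e"
      if "f \<in> Arr A" "Dom A f = i" "Cod A f = j" "g \<in> Arr A" "Dom A g = j" "Cod A g = k"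
        "e \<in> Arr C" "Cod C e = Dom C a"
        "y \<in> Arr C" "Cod C y = on_ob P i" "Rst C (on_ar P f) \<cdot> y = y"
        "Rst C (on_ar P g) \<cdot> (on_ar P f \<cdot> y) = on_ar P f \<cdot> y"
        "a \<cdot> e = sec f \<cdot> y" "b \<cdot> e = sec g \<cdot> (on_ar P f \<cdot> y)" for f g e y
      using key [OF that] that(7,8) m assms by simp
  qed (use assms m mr \<open>b \<cdot> Rst C a = b\<close> in auto)
qed

lemma P_ide [simp]: "i \<in> Ob A \<Longrightarrow> on_ar P (Ide A i) = Ide C (on_ob P i)"
  by (rule P)

text \<open>On sheets the unit and associativity laws are those of A. A composable triple is refined
  on its first two members by \<open>Psi_local_eq2\<close> and once more on the third by
  \<open>Psi_local_eq\<close>.\<close>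

lemma Psi_partite: "partite C Psi"
proof -
  have "partite_internal_category C Psi"
  proof (rule partite_internal_categoryI; unfold Psi_simps)
    fix i assume i: "i \<in> Ob A"
    show "on_ob P i \<in> Ob C" using i by simp
    have ide: "Ide A i \<in> Arr A" "Dom A (Ide A i) = i" "Cod A (Ide A i) = i" using i by auto
    show "sec (Ide A i) \<in> Hom C (on_ob P i) (E i i)"
      using ide by (auto simp: in_Hom_iff)
    show "\<sigma> i i \<cdot> sec (Ide A i) = Ide C (on_ob P i)"
      using src_sec [OF ide(1)] i by simp
    show "\<tau> i i \<cdot> sec (Ide A i) = Ide C (on_ob P i)"
      using tgt_sec [OF i i ide] i by simp
    fix j assume j: "j \<in> Ob A"
    show "\<sigma> i j \<in> Hom C (E i j) (on_ob P i)" "total C (\<sigma> i j)"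
      "\<tau> i j \<in> Hom C (E i j) (on_ob P j)" "total C (\<tau> i j)"
      using i j by (auto simp: in_Hom_iff)
    show "has_pb C (\<sigma> i j) g" if "g \<in> Arr C" "Cod C g = on_ob P i" "total C g" for g
      using i j that by (rule src_has_pb)
    fix k assume k: "k \<in> Ob A"
    show "Psi_mul C A P i j k \<in> Hom C (pb_ob C (\<sigma> j k) (\<tau> i j)) (E i k)"
      using i j k by (simp add: in_Hom_iff)
    let ?p1 = "proj1 C (\<sigma> j k) (\<tau> i j)" and ?p2 = "proj2 C (\<sigma> j k) (\<tau> i j)"
    have pb: "has_pb C (\<sigma> j k) (\<tau> i j)" using i j k by simp
    have m: "mult C Psi i j k ?p1 ?p2 = Psi_mul C A P i j k"
      unfolding mult_def using i j k by (simp add: pairing_proj)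
    show "\<sigma> i k \<cdot> Psi_mul C A P i j k = \<sigma> i j \<cdot> ?p2"
      using Psi_mult_src [OF i j k, of ?p2 ?p1] pb pb_square [OF pb] i j k unfolding m by simp
    show "\<tau> i k \<cdot> Psi_mul C A P i j k = \<tau> j k \<cdot> ?p1"
      using Psi_mult_tgt [OF i j k, of ?p2 ?p1] pb pb_square [OF pb] i j k unfolding m by simp
  next
    fix i j a assume ij: "i \<in> Ob A" "j \<in> Ob A" and a: "a \<in> Arr C" "Cod C a = E i j"
    have ide: "Ide A i \<in> Arr A" "Dom A (Ide A i) = i" "Cod A (Ide A i) = i"
      "Ide A j \<in> Arr A" "Dom A (Ide A j) = j" "Cod A (Ide A j) = j" using ij by auto
    let ?ls = "sec (Ide A i) \<cdot> (\<sigma> i j \<cdot> a)"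
    have sq: "\<sigma> i j \<cdot> a = \<tau> i i \<cdot> ?ls"
      using ij a ide tgt_sec_comp [OF ide(1-3), of "\<sigma> i j \<cdot> a"] by simp
    have r: "Rst C ?ls = Rst C a"
      using rst_sec_comp [OF ide(1), of "\<sigma> i j \<cdot> a"] ide ij a by simp
    note m = Psi_mult_arr [OF ij(1,1,2) _ _ _ _ _ sq] Psi_mult_rst [OF ij(1,1,2) _ _ _ _ _ sq]
    show "mult C Psi i i j a ?ls = a"
    proof (rule Psi_local_eq [OF ij a])
      fix f e y assume f: "f \<in> Arr A" "Dom A f = i" "Cod A f = j"
        and e: "e \<in> Arr C" "Cod C e = Dom C a"
        and y: "y \<in> Arr C" "Cod C y = on_ob P i" "Rst C (on_ar P f) \<cdot> y = y" "a \<cdot> e = sec f \<cdot> y"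
      have "mult C Psi i i j a ?ls \<cdot> e = mult C Psi i i j (sec f \<cdot> y) (sec (Ide A i) \<cdot> y)"
        using f e y ij a ide src_sec_comp [OF f y(1-3)]
        by (subst Psi_mult_comp [OF ij(1,1,2) _ _ _ _ _ sq]) auto
      also have "\<dots> = sec f \<cdot> y"
        using mult_sec [OF ide(1-3) f, of y] f y ij by simp
      finally show "mult C Psi i i j a ?ls \<cdot> e = a \<cdot> e" using y by simp
    qed (use ij a ide m r in auto)
    let ?lt = "sec (Ide A j) \<cdot> (\<tau> i j \<cdot> a)"
    have sq: "\<sigma> j j \<cdot> ?lt = \<tau> i j \<cdot> a"
      using ij a ide by (intro src_sec_comp) auto
    note m = Psi_mult_arr [OF ij(1,2,2) _ _ _ _ _ sq] Psi_mult_rst [OF ij(1,2,2) _ _ _ _ _ sq]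
    show "mult C Psi i j j ?lt a = a"
    proof (rule Psi_local_eq [OF ij a])
      fix f e y assume f: "f \<in> Arr A" "Dom A f = i" "Cod A f = j"
        and e: "e \<in> Arr C" "Cod C e = Dom C a"
        and y: "y \<in> Arr C" "Cod C y = on_ob P i" "Rst C (on_ar P f) \<cdot> y = y" "a \<cdot> e = sec f \<cdot> y"
      have "mult C Psi i j j ?lt a \<cdot> e = mult C Psi i j j (sec (Ide A j) \<cdot> (on_ar P f \<cdot> y)) (sec f \<cdot> y)"
        using f e y ij a ide tgt_sec_comp [OF f y(1,2)]
        by (subst Psi_mult_comp [OF ij(1,2,2) _ _ _ _ _ sq]) auto
      also have "\<dots> = sec f \<cdot> y"
        using mult_sec [OF f ide(4-6), of y] f y ij by simp
      finally show "mult C Psi i j j ?lt a \<cdot> e = a \<cdot> e" using y by simp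
    qed (use ij a ide m in auto)
  next
    fix i j k l a b c assume idx: "i \<in> Ob A" "j \<in> Ob A" "k \<in> Ob A" "l \<in> Ob A"
      and abc: "a \<in> Arr C" "b \<in> Arr C" "c \<in> Arr C" "Cod C a = E i j" "Cod C b = E j k" "Cod C c = E k l"
        "Dom C b = Dom C a" "Dom C c = Dom C a"
      and sq: "\<sigma> j k \<cdot> b = \<tau> i j \<cdot> a" "\<sigma> k l \<cdot> c = \<tau> j k \<cdot> b"
    note ba = Psi_mult_arr [OF idx(1-3) abc(1,2,4,5,7) sq(1)] Psi_mult_rst [OF idx(1-3) abc(1,2,4,5,7) sq(1)]
      and ba_comp = Psi_mult_comp [OF idx(1-3) abc(1,2,4,5,7) sq(1)]
    have dcb: "Dom C c = Dom C b" using abc by simp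
    note cb = Psi_mult_arr [OF idx(2-4) abc(2,3,5,6) dcb sq(2)]
      and cb_comp = Psi_mult_comp [OF idx(2-4) abc(2,3,5,6) dcb sq(2)]
    have s1: "\<sigma> k l \<cdot> c = \<tau> i k \<cdot> mult C Psi i j k b a"
      using Psi_mult_tgt [OF idx(1-3) abc(1,2,4,5,7) sq(1)] sq by simp
    have s2: "\<sigma> j l \<cdot> mult C Psi j k l c b = \<tau> i j \<cdot> a"
      using Psi_mult_src [OF idx(2-4) abc(2,3,5,6) dcb sq(2)] sq by simp
    let ?L = "mult C Psi i k l c (mult C Psi i j k b a)" and ?R = "mult C Psi i j l (mult C Psi j k l c b) a"
    have tyL: "?L \<in> Arr C" "Dom C ?L = Dom C a" "Cod C ?L = E i l"
      using Psi_mult_arr [OF idx(1,3,4) _ _ _ _ _ s1] ba abc by auto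
    have tyR: "?R \<in> Arr C" "Dom C ?R = Dom C a" "Cod C ?R = E i l" "?R \<cdot> Rst C a = ?R"
      using Psi_mult_arr [OF idx(1,2,4) _ _ _ _ _ s2] Psi_mult_rst [OF idx(1,2,4) _ _ _ _ _ s2] cb abc by auto
    have Lx: "?L \<cdot> x = mult C Psi i k l (c \<cdot> x) (mult C Psi i j k (b \<cdot> x) (a \<cdot> x))"
      and Rx: "?R \<cdot> x = mult C Psi i j l (mult C Psi j k l (c \<cdot> x) (b \<cdot> x)) (a \<cdot> x)"
      if "x \<in> Arr C" "Cod C x = Dom C a" for x
      using Psi_mult_comp [OF idx(1,3,4) _ _ _ _ _ s1, of x] Psi_mult_comp [OF idx(1,2,4) _ _ _ _ _ s2, of x]
        ba cb abc that by (simp_all add: ba_comp cb_comp)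
    have ra: "Rst C b = Rst C a" "Rst C c = Rst C b"
      using abc idx sq rst_cone [of "\<sigma> j k" "\<tau> i j" b a]
        rst_cone [of "\<sigma> k l" "\<tau> j k" c b] by auto
    have La: "?L \<cdot> Rst C a = ?L"
    proof -
      have "c \<cdot> Rst C a = c" "b \<cdot> Rst C a = b" "a \<cdot> Rst C a = a"
        using abc comp_rst' [of c] comp_rst' [of b] ra by auto
      then show ?thesis using Lx [of "Rst C a"] abc by simp
    qed
    show "?L = ?R"
    proof (rule Psi_local_eq2 [OF idx(1-3) abc(1,4,2,5,7) sq(1)])
      fix f g e y
      assume f: "f \<in> Arr A" "Dom A f = i" "Cod A f = j" and g: "g \<in> Arr A" "Dom A g = j" "Cod A g = k"
        and e: "e \<in> Arr C" "Dom C e = Dom C a" "Cod C e = Dom C a" "Rst C e = e" "Rst C a \<cdot> e = e"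
        and y: "y \<in> Arr C" "Dom C y = Dom C a" "Cod C y = on_ob P i" "Rst C (on_ar P f) \<cdot> y = y"
          "Rst C (on_ar P g) \<cdot> (on_ar P f \<cdot> y) = on_ar P f \<cdot> y"
        and ae: "a \<cdot> e = sec f \<cdot> y" and be: "b \<cdot> e = sec g \<cdot> (on_ar P f \<cdot> y)"
      have rce: "Rst C (c \<cdot> e) = e" using rst_comp_idem [of c e] e abc ra by (simp add: rst_idems_iff)
      show "?L \<cdot> e = ?R \<cdot> e"
      proof (rule Psi_local_eq [OF idx(3,4), of "c \<cdot> e"])
        fix h d z assume h: "h \<in> Arr A" "Dom A h = k" "Cod A h = l"
          and d: "d \<in> Arr C" "Dom C d = Dom C (c \<cdot> e)" "Cod C d = Dom C (c \<cdot> e)"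
          and z: "z \<in> Arr C" "Cod C z = on_ob P k" "Rst C (on_ar P h) \<cdot> z = z"
          and ce: "c \<cdot> e \<cdot> d = sec h \<cdot> z"
        let ?x = "e \<cdot> d" and ?y = "y \<cdot> d"
        have x: "?x \<in> Arr C" "Cod C ?x = Dom C a" using d e abc by auto
        have yd: "?y \<in> Arr C" "Cod C ?y = on_ob P i" using y d e abc by auto
        have y1: "Rst C (on_ar P f) \<cdot> ?y = ?y" using comp_reduce [OF y(4), of d] f y(1-3) d e(1-3) abc by simp
        have "Rst C (on_ar P g) \<cdot> (on_ar P f \<cdot> y) \<cdot> d = on_ar P f \<cdot> y \<cdot> d" using y(5) by simp
        then have y2: "Rst C (on_ar P g) \<cdot> (on_ar P f \<cdot> ?y) = on_ar P f \<cdot> ?y"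
          using f g y(1-3) d e(1-3) abc by simp
        have "a \<cdot> e \<cdot> d = sec f \<cdot> y \<cdot> d" "b \<cdot> e \<cdot> d = sec g \<cdot> (on_ar P f \<cdot> y) \<cdot> d"
          using ae be by auto
        then have ax: "a \<cdot> ?x = sec f \<cdot> ?y" and bx: "b \<cdot> ?x = sec g \<cdot> (on_ar P f \<cdot> ?y)"
          using f g y(1-3) d e(1-3) abc by auto
        have cx0: "c \<cdot> ?x = sec h \<cdot> z" using ce d e(1-3) abc by simp
        \<comment> \<open>Composability forces the base point of c to be the target of b, so all
          three elements are expressed through the single point \<open>?y\<close>.\<close>
        have "z = \<sigma> k l \<cdot> (c \<cdot> ?x)"
          unfolding cx0 using h z by (subst src_sec_comp) auto
        also have "\<dots> = \<tau> j k \<cdot> (b \<cdot> ?x)"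
          using x abc idx sq by (intro comp_reduce2) auto
        also have "\<dots> = on_ar P g \<cdot> (on_ar P f \<cdot> ?y)"
          unfolding bx using f g yd by (intro tgt_sec_comp) auto
        finally have zz: "z = on_ar P g \<cdot> (on_ar P f \<cdot> ?y)" .
        have cx: "c \<cdot> ?x = sec h \<cdot> (on_ar P g \<cdot> (on_ar P f \<cdot> ?y))" using cx0 zz by simp
        have z3: "Rst C (on_ar P h) \<cdot> (on_ar P g \<cdot> (on_ar P f \<cdot> ?y)) = on_ar P g \<cdot> (on_ar P f \<cdot> ?y)"
          using z(3) unfolding zz .
        have gf: "g \<bullet> f \<in> Arr A" "Dom A (g \<bullet> f) = i" "Cod A (g \<bullet> f) = k"
          and hg: "h \<bullet> g \<in> Arr A" "Dom A (h \<bullet> g) = j" "Cod A (h \<bullet> g) = l"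
          using f g h by auto
        have gfy: "Rst C (on_ar P (g \<bullet> f)) \<cdot> ?y = ?y" using f g yd y1 y2 by (intro rst_P_comp) auto
        have hgy: "Rst C (on_ar P (h \<bullet> g)) \<cdot> (on_ar P f \<cdot> ?y) = on_ar P f \<cdot> ?y"
          using f g h yd y2 z3 by (intro rst_P_comp) auto
        have Pgf: "on_ar P g \<cdot> (on_ar P f \<cdot> ?y) = on_ar P (g \<bullet> f) \<cdot> ?y"
          using f g yd by (simp add: P_comp)
        have "?L \<cdot> ?x = mult C Psi i k l (sec h \<cdot> (on_ar P (g \<bullet> f) \<cdot> ?y)) (sec (g \<bullet> f) \<cdot> ?y)"
          unfolding Lx [OF x] ax bx cx mult_sec [OF f g yd y1 y2] Pgf ..
        also have "\<dots> = sec (h \<bullet> (g \<bullet> f)) \<cdot> ?y"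
          using z3 unfolding Pgf by (intro mult_sec [OF gf h yd gfy])
        also have "h \<bullet> (g \<bullet> f) = h \<bullet> g \<bullet> f" using f g h by simp
        also have "sec (h \<bullet> g \<bullet> f) \<cdot> ?y =
            mult C Psi i j l (sec (h \<bullet> g) \<cdot> (on_ar P f \<cdot> ?y)) (sec f \<cdot> ?y)"
          by (rule mult_sec [OF f hg yd y1 hgy, symmetric])
        also have "sec (h \<bullet> g) \<cdot> (on_ar P f \<cdot> ?y) = mult C Psi j k l (c \<cdot> ?x) (b \<cdot> ?x)"
          unfolding cx bx using f yd y2 z3 by (intro mult_sec [OF g h, symmetric]) auto
        also have "mult C Psi i j l (mult C Psi j k l (c \<cdot> ?x) (b \<cdot> ?x)) (sec f \<cdot> ?y) = ?R \<cdot> ?x"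
          unfolding Rx [OF x] ax ..
        finally show "?L \<cdot> e \<cdot> d = ?R \<cdot> e \<cdot> d" using tyL tyR e d abc by simp
      next
        show "?L \<cdot> e \<cdot> Rst C (c \<cdot> e) = ?L \<cdot> e" "?R \<cdot> e \<cdot> Rst C (c \<cdot> e) = ?R \<cdot> e"
          unfolding rce using comp_rst' [of e] e tyL tyR by simp_all
      qed (use abc e tyL tyR in auto)
    qed (use abc idx tyL tyR La in auto)
  qed
  then show ?thesis by (simp add: partite_iff)
qed

section \<open>The unit\<close>

lemma sec_section: "f \<in> Arr A \<Longrightarrow> sec f \<in> partial_sections C (\<sigma> (Dom A f) (Cod A f))"
  unfolding in_partial_sections using src_sec rst_sec by auto

text \<open>The cut-off in \<open>sec_comp\<close> is here the domain \<open>?y\<close> of P (g f),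
  over which both sections are defined and \<open>mult_sec\<close> applies.\<close>

lemma sec_comp_sec:
  assumes f: "f \<in> Arr A" "Dom A f = i" "Cod A f = j" and g: "g \<in> Arr A" "Dom A g = j" "Cod A g = k"
  shows "sec_comp C Psi i j k (sec g) (sec f) = sec (g \<bullet> f)"
proof -
  have idx: "i \<in> Ob A" "j \<in> Ob A" "k \<in> Ob A" using f g by auto
  let ?b = "sec g \<cdot> on_ar P f" and ?y = "Rst C (on_ar P (g \<bullet> f))"
  have r: "Rst C ?b = ?y" using f g rst_rst_comp [of "on_ar P f" "sec g"] by (simp add: rst_sec P_comp)
  have y1: "Rst C (on_ar P f) \<cdot> ?y = ?y" using f g rst_comp_absorb' [of "on_ar P f" "on_ar P g"] by (simp add: P_comp)
  have y2: "Rst C (on_ar P g) \<cdot> (on_ar P f \<cdot> ?y) = on_ar P f \<cdot> ?y"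
    using comp_reduce [OF rst_comp' [of "on_ar P f" "on_ar P g"], of ?y] f g by (simp add: P_comp)
  have b: "sec g \<cdot> (on_ar P f \<cdot> ?y) = ?b"
    using comp_rst' [of ?b] f g unfolding r by simp
  have "sec_comp C Psi i j k (sec g) (sec f) =
      mult C Psi i j k (sec g \<cdot> (on_ar P f \<cdot> ?y)) (sec f \<cdot> ?y)"
    unfolding sec_comp_def Psi_simps tgt_sec [OF idx(1,2) f] r b ..
  also have "\<dots> = sec (g \<bullet> f) \<cdot> ?y"
    using f g y1 y2 by (intro mult_sec) auto
  also have "\<dots> = sec (g \<bullet> f)"
    using comp_rst' [of "sec (g \<bullet> f)"] rst_sec [of "g \<bullet> f"] f g by simp
  finally show ?thesis .
qed

text \<open>The idempotent \<open>Rst A f\<close> witnesses its own agreement with the identity, so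
  the two sheets coincide over the domain of P f.\<close>

lemma sec_rst:
  assumes "f \<in> Arr A"
  shows "sec (Rst A f) = sec (Ide A (Dom A f)) \<cdot> Rst C (on_ar P f)"
proof -
  have "agrees_on (Rst A f) (Ide A (Dom A f)) (Rst A f)" using assms by (simp add: agrees_on_def)
  then have "\<phi> (Rst A f) (Ide A (Dom A f)) \<cdot> Rst C (on_ar P f) = Rst C (on_ar P f)"
    using assms P_rst [of f] by (intro agreeI [of _ _ "Rst A f"]) auto
  then have "sec (Rst A f) \<cdot> Rst C (on_ar P f) = sec (Ide A (Dom A f)) \<cdot> Rst C (on_ar P f)"
    using assms by (intro sec_eq) auto
  moreover have "sec (Rst A f) \<cdot> Rst C (on_ar P f) = sec (Rst A f)"
    using comp_rst' [of "sec (Rst A f)"] rst_sec [of "Rst A f"] P_rst [of f] assms by simp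
  ultimately show ?thesis by simp
qed

lemma eta_simps [simp]:
  "i \<in> Ob A \<Longrightarrow> on_ob (eta_functor C (A, P)) i = i"
  "f \<in> Arr A \<Longrightarrow> on_ar (eta_functor C (A, P)) f = (Dom A f, sec f, Cod A f)"
  by (auto simp: eta_functor_def)

text \<open>As the target of \<open>sec f\<close> is \<open>on_ar P f\<close>, the functor commutes
  strictly with the projections to C, so identities serve as the natural transformation.\<close>

lemma eta_over: "over_map C (A, P) (Phi_ob C Psi) (eta_map C (A, P))"
proof -
  interpret Q: partite C Psi by (rule Psi_partite)
  let ?\<eta> = "eta_functor C (A, P)"
  have f: "is_functor A (Phi_cat C Psi) ?\<eta>"
  proof (rule is_functorI)
    show "on_ob ?\<eta> \<in> extensional (Ob A)" "on_ar ?\<eta> \<in> extensional (Arr A)" by (auto simp: eta_functor_def)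
    fix f g assume f: "f \<in> Arr A" and g: "g \<in> Arr A" "Dom A g = Cod A f"
    show "on_ar ?\<eta> (g \<bullet> f) = on_ar ?\<eta> g \<cdot>\<^bsub>Phi_cat C Psi\<^esub> on_ar ?\<eta> f"
      using f g sec_section [of f] sec_section [of g] by (simp add: sec_comp_sec)
  qed (auto simp: A.category_axioms Q.Phi_category sec_section)
  have "restriction_functor A (Phi_cat C Psi) ?\<eta>"
    unfolding restriction_functor_def
    using f by (auto simp: A.restriction_category_axioms Q.Phi_restriction_category sec_rst rst_sec)
  moreover have "functor_comp A (Phi_proj C Psi) ?\<eta> = P"
    by (rule is_functor_eqI [OF functor_comp_functor [OF f restriction_functorD(3) [OF Q.Phi_proj_restriction_functor]]
        restriction_functorD(3) [OF P_functor]])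
      (auto simp: sec_section tgt_sec)
  moreover have "nat_trans A C P P (\<lambda>i\<in>Ob A. Ide C (on_ob P i))"
    using restriction_functorD(3) [OF P_functor] by (intro nat_transI) auto
  ultimately show ?thesis
    by (simp add: eta_map_def Phi_ob_def over_map_iff)
qed

end

section \<open>The universal property\<close>

locale over_map_to_Phi = over_join C A P K + B: partite C B
  for C :: "('o, 'm) rcategory" (structure) and A :: "('a, 'b) rcategory"
    and P :: "('a, 'b, 'o, 'm) functor_data" and K :: "'k itself" and B :: "('j, 'o, 'm) partite" +
  fixes G :: "('a, 'b, 'j, 'j \<times> 'm \<times> 'j) functor_data" and \<gamma> :: "'a \<Rightarrow> 'm"
  assumes over: "over_map C (A, P) (Phi_ob C B) (G, \<gamma>)"
begin

lemma G_restriction: "restriction_functor A (Phi_cat C B) G"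
  and \<gamma>_nat: "nat_trans A C (functor_comp A (Phi_proj C B) G) P \<gamma>"
  and \<gamma>_total [simp]: "i \<in> Ob A \<Longrightarrow> total C (\<gamma> i)"
  using over by (auto simp: Phi_ob_def over_map_iff)

lemmas G = is_functorD [OF restriction_functorD(3) [OF G_restriction]]

definition t :: "'b \<Rightarrow> 'm" where
  "t f = fst (snd (on_ar G f))"

lemma G_ob [simp]: "i \<in> Ob A \<Longrightarrow> on_ob G i \<in> Idx B"
  using G(5) by simp

lemma G_ar: "f \<in> Arr A \<Longrightarrow> on_ar G f = (on_ob G (Dom A f), t f, on_ob G (Cod A f))"
  using G(7) [of f] G(8) [of f] by (cases "on_ar G f") (auto simp: t_def)

lemma t_section: "f \<in> Arr A \<Longrightarrow> t f \<in> partial_sections C (Src B (on_ob G (Dom A f)) (on_ob G (Cod A f)))"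
  using G(6) [of f] by (simp add: G_ar)

lemma
  assumes "f \<in> Arr A"
  shows t_arr [simp]: "t f \<in> Arr C" and dom_t [simp]: "Dom C (t f) = Vtx B (on_ob G (Dom A f))"
    and cod_t [simp]: "Cod C (t f) = Edg B (on_ob G (Dom A f)) (on_ob G (Cod A f))"
    and src_t: "Src B (on_ob G (Dom A f)) (on_ob G (Cod A f)) \<cdot> t f = Rst C (t f)"
  using B.sec [OF _ _ t_section [OF assms]] assms by auto

lemma
  assumes "i \<in> Ob A"
  shows \<gamma>_arr [simp]: "\<gamma> i \<in> Arr C" and dom_\<gamma> [simp]: "Dom C (\<gamma> i) = Vtx B (on_ob G i)"
    and cod_\<gamma> [simp]: "Cod C (\<gamma> i) = on_ob P i"
  using nat_transD(4-6) [OF \<gamma>_nat assms] assms by auto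

lemma \<gamma>_t:
  assumes "f \<in> Arr A" "Dom A f = i" "Cod A f = j"
  shows "on_ar P f \<cdot> \<gamma> i = \<gamma> j \<cdot> (Tgt B (on_ob G i) (on_ob G j) \<cdot> t f)"
  using nat_transD(7) [OF \<gamma>_nat assms(1)] assms t_section [OF assms(1)] by (auto simp: G_ar)

lemma t_ide: "i \<in> Ob A \<Longrightarrow> t (Ide A i) = Unt B (on_ob G i)"
  using G(9) [of i] by (simp add: t_def)

lemma t_comp:
  assumes "f \<in> Arr A" "Dom A f = i" "Cod A f = j" "g \<in> Arr A" "Dom A g = j" "Cod A g = k"
  shows "t (g \<bullet> f) = sec_comp C B (on_ob G i) (on_ob G j) (on_ob G k) (t g) (t f)"
  using G(10) [of f g] assms t_section [of f] t_section [of g] by (auto simp: G_ar)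

lemma t_rst: "f \<in> Arr A \<Longrightarrow> t (Rst A f) = Unt B (on_ob G (Dom A f)) \<cdot> Rst C (t f)"
  using restriction_functorD(4) [OF G_restriction, of f] by (simp add: G_ar)

text \<open>Naturality writes P f after \<gamma> as total maps after \<open>t f\<close>, and total
  maps leave the domain unchanged.\<close>

lemma rst_t:
  assumes "f \<in> Arr A"
  shows "Rst C (t f) = Rst C (on_ar P f \<cdot> \<gamma> (Dom A f))"
  using assms by (simp add: \<gamma>_t)

lemma t_defined:
  assumes "f \<in> Arr A" "Dom A f = i" "x \<in> Arr C" "Cod C x = Vtx B (on_ob G i)"
    "Rst C (on_ar P f) \<cdot> (\<gamma> i \<cdot> x) = \<gamma> i \<cdot> x"
  shows "Rst C (t f) \<cdot> x = x" "Rst C (t f \<cdot> x) = Rst C x"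
proof -
  have i: "i \<in> Ob A" using assms by auto
  have "Rst C (t f) \<cdot> x = x \<cdot> Rst C (on_ar P f \<cdot> (\<gamma> i \<cdot> x))"
    using rst_comp' [of x "on_ar P f \<cdot> \<gamma> i"] assms i rst_t [OF assms(1)] by simp
  also have "Rst C (on_ar P f \<cdot> (\<gamma> i \<cdot> x)) = Rst C (Rst C (on_ar P f) \<cdot> (\<gamma> i \<cdot> x))"
    using assms(1-4) i by simp
  also have "\<dots> = Rst C x" unfolding assms(5) using assms(1-4) i by simp
  finally show 1: "Rst C (t f) \<cdot> x = x" using assms by simp
  show "Rst C (t f \<cdot> x) = Rst C x"
    using rst_rst_comp [of x "t f"] assms(1-4) unfolding 1 by simp
qed

text \<open>G preserves restrictions, so it sends a witness e to the unit over
  \<open>Rst C (t e)\<close>; composing with it restricts, and f e = g e makes \<open>t f\<close>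
  and \<open>t g\<close> agree there. Definedness transfers from P to t along \<gamma>, so such
  parts cover x.\<close>

lemma t_agree:
  assumes f: "f \<in> Arr A" "Dom A f = i" "Cod A f = j" and g: "g \<in> Arr A" "Dom A g = i" "Cod A g = j"
    and x: "x \<in> Arr C" "Cod C x = Vtx B (on_ob G i)" "\<phi> f g \<cdot> (\<gamma> i \<cdot> x) = \<gamma> i \<cdot> x"
  shows "t f \<cdot> x = t g \<cdot> x"
proof (rule agreeE [of f g "\<gamma> i \<cdot> x"])
  have i: "i \<in> Ob A" using f by auto
  fix e d assume e: "agrees_on f g e" and d: "d \<in> Arr C" "Dom C d = Dom C (\<gamma> i \<cdot> x)" "Cod C d = Dom C (\<gamma> i \<cdot> x)"
    "on_ar P e \<cdot> (\<gamma> i \<cdot> x \<cdot> d) = \<gamma> i \<cdot> x \<cdot> d"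
  have et: "e \<in> Arr A" "Dom A e = i" "Cod A e = i" "Rst A e = e" "f \<bullet> e = g \<bullet> e"
    using e f by (auto simp: agrees_on_def)
  have dd: "d \<in> Arr C" "Cod C d = Dom C x" using d x i by auto
  have Pe: "Rst C (on_ar P e) = on_ar P e" using P_rst [OF et(1)] et(4) by simp
  have te: "t e = Unt B (on_ob G i) \<cdot> Rst C (t e)" using t_rst [OF et(1)] et by simp
  have tfe: "t (h \<bullet> e) = t h \<cdot> Rst C (t e)" if h: "h \<in> Arr A" "Dom A h = i" "Cod A h = j" for h
  proof -
    have "t (h \<bullet> e) = sec_comp C B (on_ob G i) (on_ob G i) (on_ob G j) (t h) (Unt B (on_ob G i) \<cdot> Rst C (t e))"
      using t_comp [OF et(1-3) h] te by simp
    also have "\<dots> = t h \<cdot> Rst C (t e)"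
      using h et i t_section [OF h(1)] by (intro B.sec_comp_unt) (auto simp: rst_in_idems)
    finally show ?thesis .
  qed
  have tt: "t f \<cdot> Rst C (t e) = t g \<cdot> Rst C (t e)" using tfe [OF f] tfe [OF g] et(5) by simp
  have re: "Rst C (t e) \<cdot> (x \<cdot> d) = x \<cdot> d"
    using t_defined(1) [OF et(1,2), of "x \<cdot> d"] d dd x(1,2) i by (simp add: Pe)
  have "t f \<cdot> (Rst C (t e) \<cdot> (x \<cdot> d)) = t g \<cdot> (Rst C (t e) \<cdot> (x \<cdot> d))"
    using tt f g et dd x(1,2) by (intro comp_reduce2) auto
  then show "t f \<cdot> x \<cdot> d = t g \<cdot> x \<cdot> d" unfolding re using f g dd x(1,2) by simp
qed (use f g x in auto)

text \<open>This constructs the edge map of the cofunctor: where the first projection lies on the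
  sheet of f, the value is \<open>t f\<close> at the second projection, and \<open>t_agree\<close>
  settles overlaps. The property is kept for arbitrary elements c, the form in which the cofunctor
  laws use it.\<close>

lemma edge_map:
  assumes ij: "i \<in> Ob A" "j \<in> Ob A"
  defines "p1 \<equiv> proj1 C (\<sigma> i j) (\<gamma> i)" and "p2 \<equiv> proj2 C (\<sigma> i j) (\<gamma> i)"
  obtains u where "u \<in> Hom C (pb_ob C (\<sigma> i j) (\<gamma> i)) (Edg B (on_ob G i) (on_ob G j))"
    "\<And>f c. f \<in> Arr A \<Longrightarrow> Dom A f = i \<Longrightarrow> Cod A f = j \<Longrightarrow> c \<in> Arr C \<Longrightarrow>
      Cod C c = pb_ob C (\<sigma> i j) (\<gamma> i) \<Longrightarrow> Rst C (on_ar P f) \<cdot> (\<gamma> i \<cdot> (p2 \<cdot> c)) = \<gamma> i \<cdot> (p2 \<cdot> c) \<Longrightarrow>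
      p1 \<cdot> c = sec f \<cdot> (\<gamma> i \<cdot> (p2 \<cdot> c)) \<Longrightarrow> u \<cdot> c = t f \<cdot> (p2 \<cdot> c)"
proof -
  interpret H: glued C "on_ob P i" "Hom A i j" \<phi> "\<sigma> i j"
    "fst (snd (Psi_glueing C A P i j))" sec using ij by (intro Psi_glued)
  let ?\<sigma> = "\<sigma> i j" and ?D = "pb_ob C (\<sigma> i j) (\<gamma> i)"
  have pb: "has_pb C ?\<sigma> (\<gamma> i)" using ij by (intro src_has_pb) auto
  have p: "p1 \<in> Arr C" "Dom C p1 = ?D" "Cod C p1 = E i j" "total C p1"
    "p2 \<in> Arr C" "Dom C p2 = ?D" "Cod C p2 = Vtx B (on_ob G i)" "total C p2"
    using pb ij by (auto simp: p1_def p2_def)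
  have rp: "Rst C p1 = Ide C ?D" "?D \<in> Ob C" using p(2,4) pb by (auto simp: total_def)
  have sq: "?\<sigma> \<cdot> (p1 \<cdot> c) = \<gamma> i \<cdot> (p2 \<cdot> c)" if "c \<in> Arr C" "Cod C c = ?D" for c
    using that p ij pb_square [OF pb, folded p1_def p2_def] by (intro comp_reduce2) auto
  show thesis
  proof (rule H.glue_ex [OF p(1,3), of "Edg B (on_ob G i) (on_ob G j)" "\<lambda>f. t f \<cdot> p2"])
    fix f g e assume fg: "f \<in> Hom A i j" "g \<in> Hom A i j" and e: "e \<in> Arr C" "Dom C e = Dom C p1" "Cod C e = Dom C p1"
      "sec f \<cdot> (?\<sigma> \<cdot> (p1 \<cdot> e)) = p1 \<cdot> e" "sec g \<cdot> (?\<sigma> \<cdot> (p1 \<cdot> e)) = p1 \<cdot> e"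
    have ft: "f \<in> Arr A" "Dom A f = i" "Cod A f = j" "g \<in> Arr A" "Dom A g = i" "Cod A g = j"
      using fg by (auto simp: in_Hom_iff)
    have "\<phi> f g \<cdot> (?\<sigma> \<cdot> (p1 \<cdot> e)) = ?\<sigma> \<cdot> (p1 \<cdot> e)" using fg e p by (intro H.sheets_phi) auto
    then have "\<phi> f g \<cdot> (\<gamma> i \<cdot> (p2 \<cdot> e)) = \<gamma> i \<cdot> (p2 \<cdot> e)" using sq e p by simp
    then have "t f \<cdot> (p2 \<cdot> e) = t g \<cdot> (p2 \<cdot> e)" using ft e p by (intro t_agree) auto
    then show "t f \<cdot> p2 \<cdot> e = t g \<cdot> p2 \<cdot> e" using ft e p by simp
  next
    fix f e assume f: "f \<in> Hom A i j" and e: "e \<in> Arr C" "Dom C e = Dom C p1" "Cod C e = Dom C p1" "Rst C e = e"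
      "sec f \<cdot> (?\<sigma> \<cdot> (p1 \<cdot> e)) = p1 \<cdot> e"
    have ft: "f \<in> Arr A" "Dom A f = i" "Cod A f = j" using f by (auto simp: in_Hom_iff)
    have "\<phi> f f \<cdot> (?\<sigma> \<cdot> (p1 \<cdot> e)) = ?\<sigma> \<cdot> (p1 \<cdot> e)" using f e p by (intro H.sheets_phi) auto
    then have "Rst C (on_ar P f) \<cdot> (\<gamma> i \<cdot> (p2 \<cdot> e)) = \<gamma> i \<cdot> (p2 \<cdot> e)" using sq e p ft agree_refl by simp
    then have "Rst C (t f \<cdot> (p2 \<cdot> e)) = Rst C (p2 \<cdot> e)" using ft e p by (intro t_defined) auto
    then show "Rst C (t f \<cdot> p2 \<cdot> e) = e" using ft e p by simp
  next
    fix u assume u: "u \<in> Arr C" "Dom C u = Dom C p1" "Cod C u = Edg B (on_ob G i) (on_ob G j)" "Rst C u = Rst C p1"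
      "\<And>f c. f \<in> Hom A i j \<Longrightarrow> c \<in> Arr C \<Longrightarrow> Cod C c = Dom C p1 \<Longrightarrow> Rst C p1 \<cdot> c = c \<Longrightarrow>
        sec f \<cdot> (?\<sigma> \<cdot> (p1 \<cdot> c)) = p1 \<cdot> c \<Longrightarrow> u \<cdot> c = t f \<cdot> p2 \<cdot> c"
    show thesis
    proof (rule that [of u])
      fix f c assume f: "f \<in> Arr A" "Dom A f = i" "Cod A f = j" and c: "c \<in> Arr C" "Cod C c = ?D"
        "p1 \<cdot> c = sec f \<cdot> (\<gamma> i \<cdot> (p2 \<cdot> c))"
      have "sec f \<cdot> (?\<sigma> \<cdot> (p1 \<cdot> c)) = p1 \<cdot> c" using sq [OF c(1,2)] c(3) by simp
      then have "u \<cdot> c = t f \<cdot> p2 \<cdot> c" using f c(1,2) p rp by (intro u(5)) (auto simp: in_Hom_iff)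
      then show "u \<cdot> c = t f \<cdot> (p2 \<cdot> c)" using f c p by simp
    qed (use u p rp in \<open>auto simp: in_Hom_iff\<close>)
  qed (use p in \<open>auto simp: in_Hom_iff ij\<close>)
qed

text \<open>All data is extensional and the tags of an arrow of \<open>Phi_cat\<close> are fixed by
  the object part, so an equation of maps over C splits into indices, vertex maps and underlying
  sections.\<close>

lemma factorization_iff:
  assumes "cofunctor C Psi B F"
  shows "over_comp C A (Phi_map C Psi F) (eta_map C (A, P)) = (G, \<gamma>) \<longleftrightarrow>
    (\<forall>i\<in>Ob A. cf_idx F i = on_ob G i) \<and> (\<forall>i\<in>Ob A. cf_vtx F i = \<gamma> i) \<and>
    (\<forall>f\<in>Arr A. sec_map C Psi F (Dom A f) (Cod A f) (sec f) = t f)"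
proof -
  interpret F: cofunctor C Psi B F by fact
  let ?\<Phi> = "fst (Phi_map C Psi F)" and ?\<eta> = "eta_functor C (A, P)"
  have \<Phi>: "is_functor (Phi_cat C Psi) (Phi_cat C B) ?\<Phi>"
    using F.Phi_map_over by (auto simp: Phi_ob_def Phi_map_def over_map_iff restriction_functor_def)
  have \<eta>: "is_functor A (Phi_cat C Psi) ?\<eta>"
    using eta_over by (auto simp: Phi_ob_def eta_map_def over_map_iff restriction_functor_def)
  have ob: "on_ob (functor_comp A ?\<Phi> ?\<eta>) i = cf_idx F i" if "i \<in> Ob A" for i
    using that by (simp add: Phi_map_def)
  have ar: "on_ar (functor_comp A ?\<Phi> ?\<eta>) f =
      (cf_idx F (Dom A f), sec_map C Psi F (Dom A f) (Cod A f) (sec f), cf_idx F (Cod A f))" if "f \<in> Arr A" for f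
    using that sec_section [OF that] F.sec_map_eq [of "Dom A f" "Cod A f" "sec f"] by (simp add: Phi_map_def)
  have vt: "Ide C (on_ob P i) \<cdot> cf_vtx F i = cf_vtx F i" if "i \<in> Ob A" for i using that by simp
  have eq: "over_comp C A (Phi_map C Psi F) (eta_map C (A, P)) =
      (functor_comp A ?\<Phi> ?\<eta>, \<lambda>i\<in>Ob A. cf_vtx F i)"
    using vt by (simp add: eta_map_def Phi_map_def over_comp_simp cong: restrict_cong)
  have ext: "\<gamma> \<in> extensional (Ob A)" using nat_transD(3) [OF \<gamma>_nat] .
  show ?thesis
  proof
    assume "over_comp C A (Phi_map C Psi F) (eta_map C (A, P)) = (G, \<gamma>)"
    then have 1: "functor_comp A ?\<Phi> ?\<eta> = G" "(\<lambda>i\<in>Ob A. cf_vtx F i) = \<gamma>" using eq by auto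
    have "cf_vtx F i = \<gamma> i" if "i \<in> Ob A" for i using fun_cong [OF 1(2), of i] that by simp
    then show "(\<forall>i\<in>Ob A. cf_idx F i = on_ob G i) \<and> (\<forall>i\<in>Ob A. cf_vtx F i = \<gamma> i) \<and>
        (\<forall>f\<in>Arr A. sec_map C Psi F (Dom A f) (Cod A f) (sec f) = t f)"
      using ob ar unfolding 1 by (simp add: G_ar)
  next
    assume *: "(\<forall>i\<in>Ob A. cf_idx F i = on_ob G i) \<and> (\<forall>i\<in>Ob A. cf_vtx F i = \<gamma> i) \<and>
        (\<forall>f\<in>Arr A. sec_map C Psi F (Dom A f) (Cod A f) (sec f) = t f)"
    have "functor_comp A ?\<Phi> ?\<eta> = G"
      by (rule is_functor_eqI [OF functor_comp_functor [OF \<eta> \<Phi>] restriction_functorD(3) [OF G_restriction]])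
        (use * in \<open>simp_all add: ob ar G_ar del: functor_comp_simps\<close>)
    moreover have "(\<lambda>i\<in>Ob A. cf_vtx F i) = \<gamma>"
      by (rule extensionalityI [OF _ ext]) (use * in auto)
    ultimately show "over_comp C A (Phi_map C Psi F) (eta_map C (A, P)) = (G, \<gamma>)" using eq by simp
  qed
qed

lemma factorization_unique:
  assumes "cofunctor C Psi B F" "cofunctor C Psi B F'"
    "over_comp C A (Phi_map C Psi F) (eta_map C (A, P)) = (G, \<gamma>)"
    "over_comp C A (Phi_map C Psi F') (eta_map C (A, P)) = (G, \<gamma>)"
  shows "F = F'"
proof (rule cofunctor_eqI [OF assms(1,2)])
  \<comment> \<open>At an x over which \<open>sec f\<close> is defined, the cut-off in
    \<open>sec_map\<close> vanishes, and the equation for the image of \<open>sec f\<close>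
    determines the lift.\<close>
  have act: "act C Psi F i j (sec f \<cdot> (\<gamma> i \<cdot> x)) x = t f \<cdot> x"
    if F: "cofunctor C Psi B F" "over_comp C A (Phi_map C Psi F) (eta_map C (A, P)) = (G, \<gamma>)"
      and f: "f \<in> Arr A" "Dom A f = i" "Cod A f = j" "x \<in> Arr C" "Cod C x = Vtx B (on_ob G i)"
        "Rst C (on_ar P f) \<cdot> (\<gamma> i \<cdot> x) = \<gamma> i \<cdot> x" for F f i j x
  proof -
    interpret F: cofunctor C Psi B F by (rule F)
    have i: "i \<in> Ob A" "j \<in> Ob A" using f by auto
    have FF: "cf_idx F i = on_ob G i" "cf_vtx F i = \<gamma> i" "sec_map C Psi F i j (sec f) = t f"
      using F(2) unfolding factorization_iff [OF F(1)] using f i by auto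
    have r: "Rst C (sec f \<cdot> (\<gamma> i \<cdot> x)) = Rst C x"
      using rst_sec_comp [of f "\<gamma> i \<cdot> x"] f i by simp
    show ?thesis
      using F.sec_map_comp [of i j "sec f" x] sec_section [of f] f i r by (simp add: FF)
  qed
  interpret F: cofunctor C Psi B F by (rule assms)
  interpret F': cofunctor C Psi B F' by (rule assms)
  have F: "cf_idx F i = on_ob G i" "cf_vtx F i = \<gamma> i" "cf_idx F' i = on_ob G i" "cf_vtx F' i = \<gamma> i" if "i \<in> Ob A" for i
    using assms(3,4) unfolding factorization_iff [OF assms(1)] factorization_iff [OF assms(2)] using that by auto
  show "cf_idx F i = cf_idx F' i" "cf_vtx F i = cf_vtx F' i" if "i \<in> Idx Psi" for i
    using that F by auto
  fix i j a x assume a: "i \<in> Idx Psi" "j \<in> Idx Psi" "a \<in> Arr C" "x \<in> Arr C" "Cod C a = Edg Psi i j"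
    "Cod C x = Vtx B (cf_idx F i)" "Dom C a = Dom C x" and sq: "Src Psi i j \<cdot> a = cf_vtx F i \<cdot> x"
  have i: "i \<in> Ob A" "j \<in> Ob A" using a by auto
  have r: "Rst C a = Rst C x" using a sq F i by (intro rst_cone [of "Src Psi i j" "cf_vtx F i"]) auto
  have xr: "x \<cdot> Rst C a = x" "a \<cdot> Rst C a = a" using comp_rst' [of x] comp_rst' [of a] a by (auto simp: r)
  have aF: "act C Psi F i j a x \<cdot> z = act C Psi F i j (a \<cdot> z) (x \<cdot> z)"
    "act C Psi F' i j a x \<cdot> z = act C Psi F' i j (a \<cdot> z) (x \<cdot> z)" if "z \<in> Arr C" "Cod C z = Dom C x" for z
    using F.act_comp [of i j a x z] F'.act_comp [of i j a x z] a sq that F i by auto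
  show "act C Psi F i j a x = act C Psi F' i j a x"
  proof (rule Psi_local_eq [OF i, of a])
    fix f e y assume f: "f \<in> Arr A" "Dom A f = i" "Cod A f = j" and e: "e \<in> Arr C" "Dom C e = Dom C a" "Cod C e = Dom C a"
      and y: "y \<in> Arr C" "Dom C y = Dom C a" "Cod C y = on_ob P i" "Rst C (on_ar P f) \<cdot> y = y" and ae: "a \<cdot> e = sec f \<cdot> y"
    \<comment> \<open>The base point of a is the image of x under \<gamma>, so each part of a has
      exactly the form covered by \<open>act\<close>.\<close>
    have "y = \<sigma> i j \<cdot> (a \<cdot> e)" unfolding ae using f y by (subst src_sec_comp) auto
    also have "\<dots> = \<gamma> i \<cdot> (x \<cdot> e)" using sq a e i F by (intro comp_reduce2) auto
    finally have yy: "y = \<gamma> i \<cdot> (x \<cdot> e)" .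
    have ae': "a \<cdot> e = sec f \<cdot> (\<gamma> i \<cdot> (x \<cdot> e))" using ae yy by simp
    have xe: "x \<cdot> e \<in> Arr C" "Cod C (x \<cdot> e) = Vtx B (on_ob G i)" using a e F i by auto
    show "act C Psi F i j a x \<cdot> e = act C Psi F' i j a x \<cdot> e"
      using aF [of e] act [OF assms(1,3) f xe] act [OF assms(2,4) f xe] y(4) e a unfolding ae' yy by simp
  next
    show "act C Psi F i j a x \<cdot> Rst C a = act C Psi F i j a x" "act C Psi F' i j a x \<cdot> Rst C a = act C Psi F' i j a x"
      using aF [of "Rst C a"] a xr by simp_all
  qed (use a sq F i in auto)
qed

lemma factorization_exists:
  "\<exists>F. cofunctor C Psi B F \<and> over_comp C A (Phi_map C Psi F) (eta_map C (A, P)) = (G, \<gamma>)"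
proof -
  let ?p1 = "\<lambda>i j. proj1 C (\<sigma> i j) (\<gamma> i)" and ?p2 = "\<lambda>i j. proj2 C (\<sigma> i j) (\<gamma> i)"
  let ?D = "\<lambda>i j. pb_ob C (\<sigma> i j) (\<gamma> i)"
  interpret Q: partite C Psi by (rule Psi_partite)
  \<comment> \<open>The property supplied by \<open>edge_map\<close>, closed over f and c, so that
    one edge map can be chosen for each (i, j).\<close>
  let ?Q = "\<lambda>i j u. u \<in> Hom C (?D i j) (Edg B (on_ob G i) (on_ob G j)) \<and>
    (\<forall>f c. f \<in> Arr A \<longrightarrow> Dom A f = i \<longrightarrow> Cod A f = j \<longrightarrow> c \<in> Arr C \<longrightarrow> Cod C c = ?D i j \<longrightarrow>
      Rst C (on_ar P f) \<cdot> (\<gamma> i \<cdot> (?p2 i j \<cdot> c)) = \<gamma> i \<cdot> (?p2 i j \<cdot> c) \<longrightarrow>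
      ?p1 i j \<cdot> c = sec f \<cdot> (\<gamma> i \<cdot> (?p2 i j \<cdot> c)) \<longrightarrow> u \<cdot> c = t f \<cdot> (?p2 i j \<cdot> c))"
  have "\<forall>i\<in>Ob A. \<forall>j\<in>Ob A. \<exists>u. ?Q i j u"
    by (intro ballI, rule edge_map, assumption, assumption) blast
  then obtain u where U: "\<forall>i\<in>Ob A. \<forall>j\<in>Ob A. ?Q i j (u i j)"
    unfolding bchoice_iff by (rule exE)
  have u: "u i j \<in> Hom C (?D i j) (Edg B (on_ob G i) (on_ob G j))" if "i \<in> Ob A" "j \<in> Ob A" for i j
    using U that by blast
  have uc: "u i j \<cdot> c = t f \<cdot> (?p2 i j \<cdot> c)"
    if "i \<in> Ob A" "j \<in> Ob A" "f \<in> Arr A" "Dom A f = i" "Cod A f = j" "c \<in> Arr C" "Cod C c = ?D i j"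
      "Rst C (on_ar P f) \<cdot> (\<gamma> i \<cdot> (?p2 i j \<cdot> c)) = \<gamma> i \<cdot> (?p2 i j \<cdot> c)"
      "?p1 i j \<cdot> c = sec f \<cdot> (\<gamma> i \<cdot> (?p2 i j \<cdot> c))" for i j f c
    using U that by blast
  define F :: "('a, 'j, 'm) cofunctor_data" where
    "F = \<lparr>cf_idx = (\<lambda>i\<in>Ob A. on_ob G i), cf_vtx = \<gamma>, cf_edg = (\<lambda>i\<in>Ob A. \<lambda>j\<in>Ob A. u i j)\<rparr>"
  have [simp]: "cf_idx F i = on_ob G i" "cf_vtx F i = \<gamma> i" if "i \<in> Ob A" for i
    using that by (auto simp: F_def)
  have [simp]: "cf_edg F i j = u i j" if "i \<in> Ob A" "j \<in> Ob A" for i j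
    using that by (auto simp: F_def)
  have pb: "has_pb C (\<sigma> i j) (\<gamma> i)" if "i \<in> Ob A" "j \<in> Ob A" for i j
    using that by (intro src_has_pb) auto
  \<comment> \<open>Maps out of the pullback are compared where its first projection lies on a
    sheet; there \<open>u i j\<close> has the value \<open>t f\<close>. The source and target
    equations of F are verified in this way.\<close>
  have loc: "v = w"
    if ij: "i \<in> Ob A" "j \<in> Ob A" and v: "v \<in> Arr C" "w \<in> Arr C" "Dom C v = ?D i j" "Dom C w = ?D i j" "Cod C v = Cod C w"
      and eq: "\<And>f e. f \<in> Arr A \<Longrightarrow> Dom A f = i \<Longrightarrow> Cod A f = j \<Longrightarrow> e \<in> Arr C \<Longrightarrow> Cod C e = ?D i j \<Longrightarrow>
        Rst C (on_ar P f) \<cdot> (\<gamma> i \<cdot> (?p2 i j \<cdot> e)) = \<gamma> i \<cdot> (?p2 i j \<cdot> e) \<Longrightarrow>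
        ?p1 i j \<cdot> e = sec f \<cdot> (\<gamma> i \<cdot> (?p2 i j \<cdot> e)) \<Longrightarrow> u i j \<cdot> e = t f \<cdot> (?p2 i j \<cdot> e) \<Longrightarrow>
        v \<cdot> e = w \<cdot> e"
    for i j v w
  proof (rule Psi_local_eq [OF ij, of "?p1 i j"])
    note pb = pb [OF ij]
    have t1: "total C (?p1 i j)" using ij pb by auto
    then have r1: "Rst C (?p1 i j) = Ide C (?D i j)" using pb by (simp add: total_def)
    show "v \<cdot> Rst C (?p1 i j) = v" "w \<cdot> Rst C (?p1 i j) = w" unfolding r1 using v by simp_all
    fix f e y assume f: "f \<in> Arr A" "Dom A f = i" "Cod A f = j"
      and e: "e \<in> Arr C" "Cod C e = Dom C (?p1 i j)"
      and y: "y \<in> Arr C" "Cod C y = on_ob P i" "Rst C (on_ar P f) \<cdot> y = y" and pe: "?p1 i j \<cdot> e = sec f \<cdot> y"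
    have "y = \<sigma> i j \<cdot> (?p1 i j \<cdot> e)" unfolding pe using f y by (subst src_sec_comp) auto
    also have "\<dots> = \<gamma> i \<cdot> (?p2 i j \<cdot> e)"
      using pb_square [OF pb] pb ij e by (intro comp_reduce2) auto
    finally have yy: "y = \<gamma> i \<cdot> (?p2 i j \<cdot> e)" .
    have e': "Cod C e = ?D i j" using e pb by simp
    note a = f e(1) e' y(3) [unfolded yy] pe [unfolded yy]
    show "v \<cdot> e = w \<cdot> e" by (rule eq [OF a uc [OF ij a]])
  qed (use v pb [OF ij] ij in auto)
  interpret F: precofunctor C Psi B F
  proof
    fix i j assume "i \<in> Idx Psi" "j \<in> Idx Psi"
    then have ij: "i \<in> Ob A" "j \<in> Ob A" by auto
    have ut: "u i j \<in> Arr C" "Dom C (u i j) = ?D i j" "Cod C (u i j) = Edg B (on_ob G i) (on_ob G j)"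
      using u [OF ij] by (auto simp: in_Hom_iff)
    show "Src B (cf_idx F i) (cf_idx F j) \<cdot> cf_edg F i j = proj2 C (Src Psi i j) (cf_vtx F i)"
    proof -
      have "Src B (on_ob G i) (on_ob G j) \<cdot> u i j = ?p2 i j"
      proof (rule loc [OF ij])
        fix f e assume f: "f \<in> Arr A" "Dom A f = i" "Cod A f = j" and e: "e \<in> Arr C" "Cod C e = ?D i j"
          "Rst C (on_ar P f) \<cdot> (\<gamma> i \<cdot> (?p2 i j \<cdot> e)) = \<gamma> i \<cdot> (?p2 i j \<cdot> e)" "u i j \<cdot> e = t f \<cdot> (?p2 i j \<cdot> e)"
        have "Src B (on_ob G i) (on_ob G j) \<cdot> (t f \<cdot> (?p2 i j \<cdot> e)) = Rst C (t f) \<cdot> (?p2 i j \<cdot> e)"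
          using f e(1,2) pb [OF ij] ij src_t [OF f(1)] by (intro comp_reduce) auto
        also have "\<dots> = ?p2 i j \<cdot> e" using f e pb [OF ij] ij by (intro t_defined) auto
        finally show "Src B (on_ob G i) (on_ob G j) \<cdot> u i j \<cdot> e = ?p2 i j \<cdot> e" using ut e ij by simp
      qed (use ut ij pb [OF ij] in auto)
      then show ?thesis using ij by simp
    qed
    show "cf_vtx F j \<cdot> Tgt B (cf_idx F i) (cf_idx F j) \<cdot> cf_edg F i j = Tgt Psi i j \<cdot> proj1 C (Src Psi i j) (cf_vtx F i)"
    proof -
      have "\<gamma> j \<cdot> (Tgt B (on_ob G i) (on_ob G j) \<cdot> u i j) = \<tau> i j \<cdot> ?p1 i j"
      proof (rule loc [OF ij])
        fix f e assume f: "f \<in> Arr A" "Dom A f = i" "Cod A f = j" and e: "e \<in> Arr C" "Cod C e = ?D i j"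
          "?p1 i j \<cdot> e = sec f \<cdot> (\<gamma> i \<cdot> (?p2 i j \<cdot> e))" "u i j \<cdot> e = t f \<cdot> (?p2 i j \<cdot> e)"
        have "\<gamma> j \<cdot> (Tgt B (on_ob G i) (on_ob G j) \<cdot> (t f \<cdot> (?p2 i j \<cdot> e))) = on_ar P f \<cdot> (\<gamma> i \<cdot> (?p2 i j \<cdot> e))"
          using comp_reduce [OF \<gamma>_t [OF f], of "?p2 i j \<cdot> e"] f e(1,2) pb [OF ij] ij by simp
        also have "\<dots> = \<tau> i j \<cdot> (?p1 i j \<cdot> e)"
          unfolding e(3) using f e(1,2) pb [OF ij] ij by (subst tgt_sec_comp) auto
        finally show "\<gamma> j \<cdot> (Tgt B (on_ob G i) (on_ob G j) \<cdot> u i j) \<cdot> e = \<tau> i j \<cdot> ?p1 i j \<cdot> e"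
          using ut e(1,2,4) ij pb [OF ij] by simp
      qed (use ut ij pb [OF ij] in auto)
      then show ?thesis using ij ut by simp
    qed
    show "cf_edg F i j \<in> Hom C (pb_ob C (Src Psi i j) (cf_vtx F i)) (Edg B (cf_idx F i) (cf_idx F j))"
      using u [OF ij] ij by simp
  qed (auto simp: in_Hom_iff)
  \<comment> \<open>The element of the pullback given by \<open>?a\<close> and x has its first
    component on the sheet of f, so the characterisation of \<open>u i j\<close> applies.\<close>
  have act: "act C Psi F i j (sec f \<cdot> (\<gamma> i \<cdot> x)) x = t f \<cdot> x"
    if f: "f \<in> Arr A" "Dom A f = i" "Cod A f = j" "x \<in> Arr C" "Cod C x = Vtx B (on_ob G i)"
        "Rst C (on_ar P f) \<cdot> (\<gamma> i \<cdot> x) = \<gamma> i \<cdot> x" for f i j x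
  proof -
    have ij: "i \<in> Ob A" "j \<in> Ob A" using f by auto
    let ?a = "sec f \<cdot> (\<gamma> i \<cdot> x)"
    have sq: "\<sigma> i j \<cdot> ?a = \<gamma> i \<cdot> x" using f ij by (intro src_sec_comp) auto
    let ?w = "pairing C (\<sigma> i j) (\<gamma> i) ?a x"
    have w: "?w \<in> Arr C" "Cod C ?w = ?D i j" "?p1 i j \<cdot> ?w = ?a" "?p2 i j \<cdot> ?w = x"
      using pb [OF ij] f(1-5) ij sq by auto
    show ?thesis using uc [OF ij f(1-3) w(1,2)] w f ij by (simp add: act_def)
  qed
  have "partite_cofunctor C Psi B F"
  proof (rule F.partite_cofunctorI)
    show "cf_idx F \<in> extensional (Idx Psi)" "cf_edg F \<in> Idx Psi \<rightarrow>\<^sub>E extensional (Idx Psi)"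
      by (auto simp: F_def)
    show "cf_vtx F \<in> extensional (Idx Psi)" using nat_transD(3) [OF \<gamma>_nat] by (simp add: F_def)
    show "act C Psi F i i (Unt Psi i \<cdot> cf_vtx F i) (Ide C (Vtx B (cf_idx F i))) = Unt B (cf_idx F i)"
      if "i \<in> Idx Psi" for i
      using act [of "Ide A i" i i "Ide C (Vtx B (on_ob G i))"] that t_ide [of i] by simp
  next
    fix i j k a b x assume "i \<in> Idx Psi" "j \<in> Idx Psi" "k \<in> Idx Psi" and a: "a \<in> Arr C" and b: "b \<in> Arr C" and x: "x \<in> Arr C"
      and ca: "Cod C a = Edg Psi i j" and cb: "Cod C b = Edg Psi j k" and cx: "Cod C x = Vtx B (cf_idx F i)"
      and dax: "Dom C a = Dom C x" and dbx: "Dom C b = Dom C x"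
      and sa: "Src Psi i j \<cdot> a = cf_vtx F i \<cdot> x" and sb: "Src Psi j k \<cdot> b = Tgt Psi i j \<cdot> a"
    then have idx: "i \<in> Ob A" "j \<in> Ob A" "k \<in> Ob A" by auto
    note ty = a b x ca [unfolded Psi_simps] cb [unfolded Psi_simps] dax dbx
    have cx': "Cod C x = Vtx B (on_ob G i)" using cx idx by simp
    have sa': "\<sigma> i j \<cdot> a = \<gamma> i \<cdot> x" and sb': "\<sigma> j k \<cdot> b = \<tau> i j \<cdot> a"
      using sa sb idx by auto
    have dba: "Dom C b = Dom C a" using dax dbx by simp
    let ?m = "mult C Psi i j k b a"
    let ?ax = "act C Psi F i j a x"
    let ?y = "Tgt B (on_ob G i) (on_ob G j) \<cdot> ?ax"
    let ?by = "act C Psi F j k b ?y"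
    let ?L = "act C Psi F i k ?m x"
    let ?R = "mult C B (on_ob G i) (on_ob G j) (on_ob G k) ?by ?ax"
    have m: "?m \<in> Arr C" "Dom C ?m = Dom C x" "Cod C ?m = E i k" "\<sigma> i k \<cdot> ?m = \<gamma> i \<cdot> x"
      using Psi_mult_arr [OF idx ty(1,2,4,5) dba sb'] Psi_mult_src [OF idx ty(1,2,4,5) dba sb'] sa' dax by auto
    have ax: "?ax \<in> Arr C" "Dom C ?ax = Dom C x" "Cod C ?ax = Edg B (on_ob G i) (on_ob G j)"
      "\<gamma> j \<cdot> ?y = \<tau> i j \<cdot> a" "Rst C ?ax = Rst C x"
      using F.act_arr [of i j a x] F.dom_act [of i j a x] F.cod_act [of i j a x] F.tgt_act [of i j a x]
        F.rst_act [of i j a x] idx ty cx' sa' by auto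
    have byt: "?by \<in> Arr C" "Dom C ?by = Dom C x" "Cod C ?by = Edg B (on_ob G j) (on_ob G k)"
      "Src B (on_ob G j) (on_ob G k) \<cdot> ?by = ?y"
      using F.act_arr [of j k b ?y] F.dom_act [of j k b ?y] F.cod_act [of j k b ?y] F.src_act [of j k b ?y]
        idx ty ax sb' by auto
    have L: "?L \<in> Arr C" "Dom C ?L = Dom C x" "Cod C ?L = Edg B (on_ob G i) (on_ob G k)" "Rst C ?L = Rst C x"
      using F.act_arr [of i k ?m x] F.dom_act [of i k ?m x] F.cod_act [of i k ?m x] F.rst_act [of i k ?m x]
        idx m x cx' by auto
    have R: "?R \<in> Arr C" "Dom C ?R = Dom C x" "Cod C ?R = Edg B (on_ob G i) (on_ob G k)" "Rst C ?R = Rst C x"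
      using idx ax byt by (auto simp: B.rst_mult)
    have ra: "Rst C a = Rst C x" using idx ty cx' sa' by (intro rst_cone [of "\<sigma> i j" "\<gamma> i"]) auto
    have "?L = ?R"
    \<comment> \<open>On sheets the left side is \<open>t (g \<bullet> f)\<close> at x, and the
      right side lifts along f and then along g at the resulting target; \<open>t_comp\<close>
      identifies the two.\<close>
    proof (rule Psi_local_eq2 [OF idx ty(1,4,2,5) dba sb'])
      show "?L \<cdot> Rst C a = ?L" "?R \<cdot> Rst C a = ?R"
        unfolding ra using L R comp_rst' [of ?L] comp_rst' [of ?R] by auto
      fix f g e y
      assume f: "f \<in> Arr A" "Dom A f = i" "Cod A f = j" and g: "g \<in> Arr A" "Dom A g = j" "Cod A g = k"
        and e: "e \<in> Arr C" "Dom C e = Dom C a" "Cod C e = Dom C a"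
        and y: "y \<in> Arr C" "Dom C y = Dom C a" "Cod C y = on_ob P i" "Rst C (on_ar P f) \<cdot> y = y"
          "Rst C (on_ar P g) \<cdot> (on_ar P f \<cdot> y) = on_ar P f \<cdot> y"
        and ae: "a \<cdot> e = sec f \<cdot> y" and be: "b \<cdot> e = sec g \<cdot> (on_ar P f \<cdot> y)"
      let ?x = "x \<cdot> e"
      have xe: "?x \<in> Arr C" "Cod C ?x = Vtx B (on_ob G i)" "Dom C ?x = Dom C x" using ty cx' e by auto
      have "y = \<sigma> i j \<cdot> (a \<cdot> e)" unfolding ae using f y by (subst src_sec_comp) auto
      also have "\<dots> = \<gamma> i \<cdot> ?x" using sa' ty cx' e idx by (intro comp_reduce2) auto
      finally have yy: "y = \<gamma> i \<cdot> ?x" .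
      note y1 = y(4) [unfolded yy] and y2 = y(5) [unfolded yy]
      have gf: "g \<bullet> f \<in> Arr A" "Dom A (g \<bullet> f) = i" "Cod A (g \<bullet> f) = k" using f g by auto
      have gfy: "Rst C (on_ar P (g \<bullet> f)) \<cdot> (\<gamma> i \<cdot> ?x) = \<gamma> i \<cdot> ?x"
        using f g xe idx y1 y2 by (intro rst_P_comp) auto
      have me: "?m \<cdot> e = sec (g \<bullet> f) \<cdot> (\<gamma> i \<cdot> ?x)"
        using Psi_mult_comp [OF idx ty(1,2,4,5) dba sb' e(1,3)] mult_sec [OF f g y(1,3-5)] unfolding ae be yy by simp
      have Le: "?L \<cdot> e = t (g \<bullet> f) \<cdot> ?x"
        using F.act_comp [of i k ?m x e] idx m x cx' e dax act [OF gf xe(1,2) gfy] by (simp add: me)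
      have axe: "?ax \<cdot> e = t f \<cdot> ?x"
        using F.act_comp [of i j a x e] idx ty cx' sa' e act [OF f xe(1,2) y1] by (simp add: ae yy)
      let ?z = "Tgt B (on_ob G i) (on_ob G j) \<cdot> (t f \<cdot> ?x)"
      have z: "?z \<in> Arr C" "Cod C ?z = Vtx B (on_ob G j)" using f xe idx by auto
      have gz: "\<gamma> j \<cdot> ?z = on_ar P f \<cdot> (\<gamma> i \<cdot> ?x)"
        using comp_reduce [OF \<gamma>_t [OF f], of ?x] f xe idx by simp
      have y2': "Rst C (on_ar P g) \<cdot> (\<gamma> j \<cdot> ?z) = \<gamma> j \<cdot> ?z" unfolding gz by (rule y2)
      have ye: "?y \<cdot> e = ?z" using axe ax e dax idx by simp
      have bye: "?by \<cdot> e = t g \<cdot> ?z"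
      proof -
        have "?by \<cdot> e = act C Psi F j k (b \<cdot> e) (?y \<cdot> e)"
          using F.act_comp [of j k b ?y e] idx ty ax sb' e by simp
        also have "b \<cdot> e = sec g \<cdot> (\<gamma> j \<cdot> ?z)" unfolding gz be yy ..
        finally show ?thesis unfolding ye using act [OF g z y2'] by simp
      qed
      have Re: "?R \<cdot> e = mult C B (on_ob G i) (on_ob G j) (on_ob G k) (t g \<cdot> ?z) (t f \<cdot> ?x)"
        using idx ax byt e dax by (subst B.mult_comp) (auto simp: axe bye)
      \<comment> \<open>The restriction of \<open>?s\<close> is the cut-off of \<open>t f\<close> in
        \<open>sec_comp\<close>; \<open>?x\<close> lies inside it, so the cut-off
        disappears.\<close>
      let ?s = "t g \<cdot> (Tgt B (on_ob G i) (on_ob G j) \<cdot> t f)"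
      have sx: "?s \<cdot> ?x = t g \<cdot> ?z" using f g idx xe by simp
      have tf: "Rst C (t f \<cdot> ?x) = Rst C ?x" using t_defined(2) [OF f(1,2) xe(1,2) y1] .
      have "Rst C ?s \<cdot> ?x = ?x \<cdot> Rst C (t g \<cdot> ?z)"
        using rst_comp' [of ?x ?s] f g idx xe by simp
      also have "Rst C (t g \<cdot> ?z) = Rst C ?z" using t_defined(2) [OF g(1,2) z y2'] .
      also have "\<dots> = Rst C ?x" using f idx xe tf by simp
      finally have sr: "Rst C ?s \<cdot> ?x = ?x" using xe by simp
      have "t (g \<bullet> f) \<cdot> ?x = sec_comp C B (on_ob G i) (on_ob G j) (on_ob G k) (t g) (t f) \<cdot> ?x"
        using t_comp [OF f g] by simp
      also have "\<dots> = mult C B (on_ob G i) (on_ob G j) (on_ob G k) (?s \<cdot> ?x) (t f \<cdot> (Rst C ?s \<cdot> ?x))"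
        unfolding sec_comp_def
        using f g idx xe B.sec_comp_square [of "on_ob G i" "on_ob G j" "on_ob G k" "t f" "t g"] t_section [of f] t_section [of g]
        by (subst B.mult_comp) auto
      finally show "?L \<cdot> e = ?R \<cdot> e" unfolding Le Re sx sr by simp
    qed (use L R dax in auto)
    then show "act C Psi F i k (mult C Psi i j k b a) x = mult C B (cf_idx F i) (cf_idx F j) (cf_idx F k)
        (act C Psi F j k b (Tgt B (cf_idx F i) (cf_idx F j) \<cdot> act C Psi F i j a x)) (act C Psi F i j a x)"
      using idx by simp
  qed
  then have F: "cofunctor C Psi B F" by (simp add: cofunctor_iff)
  moreover have "over_comp C A (Phi_map C Psi F) (eta_map C (A, P)) = (G, \<gamma>)"
    unfolding factorization_iff [OF F]
  proof (intro conjI ballI)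
    fix f assume f: "f \<in> Arr A"
    let ?i = "Dom A f"
    \<comment> \<open>The idempotent at which to evaluate \<open>act\<close>: it lies over the
      domain of P f, and by \<open>rst_t\<close> it is the domain of \<open>t f\<close>, so nothing
      of \<open>t f\<close> is lost.\<close>
    let ?x = "Rst C (sec f \<cdot> \<gamma> ?i)"
    have x: "?x \<in> Arr C" "Cod C ?x = Vtx B (on_ob G ?i)" using f by auto
    have r: "?x = Rst C (on_ar P f \<cdot> \<gamma> ?i)"
      using rst_rst_comp [of "\<gamma> ?i" "sec f"] rst_rst_comp [of "\<gamma> ?i" "on_ar P f"] f by (simp add: rst_sec)
    have "Rst C (on_ar P f) \<cdot> \<gamma> ?i = \<gamma> ?i \<cdot> ?x" unfolding r using f by (intro rst_comp') auto
    moreover have "Rst C (on_ar P f) \<cdot> (Rst C (on_ar P f) \<cdot> \<gamma> ?i) = Rst C (on_ar P f) \<cdot> \<gamma> ?i"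
      using comp_reduce [OF rst_idem [of "on_ar P f"], of "\<gamma> ?i"] f by simp
    ultimately have gx: "Rst C (on_ar P f) \<cdot> (\<gamma> ?i \<cdot> ?x) = \<gamma> ?i \<cdot> ?x" by simp
    have "sec f \<cdot> \<gamma> ?i = sec f \<cdot> (\<gamma> ?i \<cdot> ?x)" using f by simp
    then have "sec_map C Psi F ?i (Cod A f) (sec f) = t f \<cdot> ?x"
      using act [OF f refl refl x gx] f by (simp add: sec_map_def)
    also have "\<dots> = t f" unfolding r using rst_t [OF f] f comp_rst' [of "t f"] by simp
    finally show "sec_map C Psi F (Dom A f) (Cod A f) (sec f) = t f" .
  qed auto
  ultimately show ?thesis by blast
qed

end

section \<open>The adjunction\<close>

text \<open>L on f is the factorization of \<eta> after f, and \<epsilon> the factorization of an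
  identity. Equations between maps of E out of \<open>Lo d\<close> are checked after applying R and
  precomposing with the unit, by \<open>lift_eq\<close>.\<close>

lemma universal_arrows_adjunction:
  assumes R: "is_functor E D R"
    and Lo: "\<And>d. d \<in> Ob D \<Longrightarrow> Lo d \<in> Ob E"
    and \<eta>_ext: "\<eta> \<in> extensional (Ob D)"
    and \<eta>: "\<And>d. d \<in> Ob D \<Longrightarrow> \<eta> d \<in> Hom D d (on_ob R (Lo d))"
    and univ: "\<And>d e f. d \<in> Ob D \<Longrightarrow> e \<in> Ob E \<Longrightarrow> f \<in> Hom D d (on_ob R e) \<Longrightarrow>
      \<exists>!g. g \<in> Hom E (Lo d) e \<and> on_ar R g \<cdot>\<^bsub>D\<^esub> \<eta> d = f"
  shows "\<exists>L \<epsilon>. (\<forall>d\<in>Ob D. on_ob L d = Lo d) \<and> adjunction D E L R \<eta> \<epsilon>"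
proof -
  note Rf = is_functorD [OF R]
  interpret E: category E by (rule Rf)
  interpret D: category D by (rule Rf)
  define lift where "lift d e f = (THE g. g \<in> Hom E (Lo d) e \<and> on_ar R g \<cdot>\<^bsub>D\<^esub> \<eta> d = f)" for d e f
  have \<eta>' [simp]: "\<eta> d \<in> Arr D" "Dom D (\<eta> d) = d" "Cod D (\<eta> d) = on_ob R (Lo d)" if "d \<in> Ob D" for d
    using \<eta> [OF that] by (auto simp: in_Hom_iff)
  have lift: "lift d e f \<in> Arr E" "Dom E (lift d e f) = Lo d" "Cod E (lift d e f) = e"
      "on_ar R (lift d e f) \<cdot>\<^bsub>D\<^esub> \<eta> d = f"
    if "d \<in> Ob D" "e \<in> Ob E" "f \<in> Arr D" "Dom D f = d" "Cod D f = on_ob R e" for d e f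
    using theI' [OF univ [of d e f]] that unfolding lift_def by (auto simp: in_Hom_iff)
  have lift_eq: "g = h"
    if "d \<in> Ob D" "g \<in> Arr E" "Dom E g = Lo d" "h \<in> Arr E" "Dom E h = Lo d" "Cod E h = Cod E g"
      "on_ar R g \<cdot>\<^bsub>D\<^esub> \<eta> d = on_ar R h \<cdot>\<^bsub>D\<^esub> \<eta> d" for d g h
  proof -
    have "on_ar R g \<cdot>\<^bsub>D\<^esub> \<eta> d \<in> Hom D d (on_ob R (Cod E g))"
      using that Rf by (simp add: in_Hom_iff)
    from univ [OF that(1) _ this] that show ?thesis by (auto simp: in_Hom_iff)
  qed
  define L where "L = \<lparr>on_ob = (\<lambda>d\<in>Ob D. Lo d),
    on_ar = (\<lambda>f\<in>Arr D. lift (Dom D f) (Lo (Cod D f)) (\<eta> (Cod D f) \<cdot>\<^bsub>D\<^esub> f))\<rparr>"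
  have Lob [simp]: "on_ob L d = Lo d" if "d \<in> Ob D" for d using that by (simp add: L_def)
  have Lar: "on_ar L f \<in> Arr E" "Dom E (on_ar L f) = Lo (Dom D f)" "Cod E (on_ar L f) = Lo (Cod D f)"
      "on_ar R (on_ar L f) \<cdot>\<^bsub>D\<^esub> \<eta> (Dom D f) = \<eta> (Cod D f) \<cdot>\<^bsub>D\<^esub> f" if "f \<in> Arr D" for f
    using lift [of "Dom D f" "Lo (Cod D f)" "\<eta> (Cod D f) \<cdot>\<^bsub>D\<^esub> f"] that Lo by (auto simp: L_def)
  define \<epsilon> where "\<epsilon> = (\<lambda>e\<in>Ob E. lift (on_ob R e) e (Ide D (on_ob R e)))"
  have \<epsilon>: "\<epsilon> e \<in> Arr E" "Dom E (\<epsilon> e) = Lo (on_ob R e)" "Cod E (\<epsilon> e) = e"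
      "on_ar R (\<epsilon> e) \<cdot>\<^bsub>D\<^esub> \<eta> (on_ob R e) = Ide D (on_ob R e)" if "e \<in> Ob E" for e
    using lift [of "on_ob R e" e "Ide D (on_ob R e)"] that Rf by (auto simp: \<epsilon>_def)
  have L: "is_functor D E L"
  proof (rule is_functorI)
    show "on_ob L \<in> extensional (Ob D)" "on_ar L \<in> extensional (Arr D)" by (auto simp: L_def)
    show "on_ar L (Ide D d) = Ide E (on_ob L d)" if "d \<in> Ob D" for d
      by (rule lift_eq [of d]) (use that Lo Lar [of "Ide D d"] Rf in auto)
    show "on_ar L (g \<cdot>\<^bsub>D\<^esub> f) = on_ar L g \<cdot>\<^bsub>E\<^esub> on_ar L f"
      if f: "f \<in> Arr D" and g: "g \<in> Arr D" "Dom D g = Cod D f" for f g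
    proof (rule lift_eq [of "Dom D f"])
      have gf: "g \<cdot>\<^bsub>D\<^esub> f \<in> Arr D" using f g by simp
      note 1 = Lar [OF f] and 2 = Lar [OF g(1)] and 3 = Lar [OF gf]
      have "on_ar R (on_ar L g) \<cdot>\<^bsub>D\<^esub> (\<eta> (Cod D f) \<cdot>\<^bsub>D\<^esub> f) = \<eta> (Cod D g) \<cdot>\<^bsub>D\<^esub> g \<cdot>\<^bsub>D\<^esub> f"
        using 2(4) g f Rf 2(1-3) Lo by (intro D.comp_reduce) auto
      then show "on_ar R (on_ar L (g \<cdot>\<^bsub>D\<^esub> f)) \<cdot>\<^bsub>D\<^esub> \<eta> (Dom D f) = on_ar R (on_ar L g \<cdot>\<^bsub>E\<^esub> on_ar L f) \<cdot>\<^bsub>D\<^esub> \<eta> (Dom D f)"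
        using 1 2 3 f g Rf Lo by simp
    qed (use f g Lar [OF f] Lar [OF g(1)] Lar [of "g \<cdot>\<^bsub>D\<^esub> f"] in auto)
  qed (use Lar Lo E.category_axioms D.category_axioms in auto)
  have "nat_trans D D (functor_id D) (functor_comp D R L) \<eta>"
    by (rule nat_transI)
      (use functor_id_functor [OF D.category_axioms] functor_comp_functor [OF L R] \<eta>_ext Lar(4) in
        \<open>auto simp: functor_id_def\<close>)
  moreover have "nat_trans E E (functor_comp E L R) (functor_id E) \<epsilon>"
  proof (rule nat_transI)
    fix f assume f: "f \<in> Arr E"
    have Rr: "on_ar R f \<in> Arr D" using f Rf by simp
    have dc: "Dom E f \<in> Ob E" "Cod E f \<in> Ob E" using f by auto
    have ob: "on_ob R (Dom E f) \<in> Ob D" "on_ob R (Cod E f) \<in> Ob D" using dc Rf by auto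
    note 1 = \<epsilon> [OF dc(1)] and 2 = \<epsilon> [OF dc(2)] and 3 = Lar [OF Rr]
    have tyR: "Dom D (on_ar R f) = on_ob R (Dom E f)" "Cod D (on_ar R f) = on_ob R (Cod E f)" using f Rf by auto
    have "f \<cdot>\<^bsub>E\<^esub> \<epsilon> (Dom E f) = \<epsilon> (Cod E f) \<cdot>\<^bsub>E\<^esub> on_ar L (on_ar R f)"
    proof (rule lift_eq [of "on_ob R (Dom E f)"])
      have "on_ar R (f \<cdot>\<^bsub>E\<^esub> \<epsilon> (Dom E f)) \<cdot>\<^bsub>D\<^esub> \<eta> (on_ob R (Dom E f)) = on_ar R f"
        using f 1 dc ob Rf tyR Rr by simp
      moreover have "on_ar R (\<epsilon> (Cod E f) \<cdot>\<^bsub>E\<^esub> on_ar L (on_ar R f)) \<cdot>\<^bsub>D\<^esub> \<eta> (on_ob R (Dom E f)) = on_ar R f"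
      proof -
        have "on_ar R (\<epsilon> (Cod E f)) \<cdot>\<^bsub>D\<^esub> (\<eta> (on_ob R (Cod E f)) \<cdot>\<^bsub>D\<^esub> on_ar R f) = Ide D (on_ob R (Cod E f)) \<cdot>\<^bsub>D\<^esub> on_ar R f"
          using 2 ob Rf tyR Rr dc Lo by (intro D.comp_reduce) auto
        then show ?thesis using f 2 3 dc ob Rf(5-8) Rf(10) tyR Rr Lo by simp
      qed
      ultimately show "on_ar R (f \<cdot>\<^bsub>E\<^esub> \<epsilon> (Dom E f)) \<cdot>\<^bsub>D\<^esub> \<eta> (on_ob R (Dom E f))
          = on_ar R (\<epsilon> (Cod E f) \<cdot>\<^bsub>E\<^esub> on_ar L (on_ar R f)) \<cdot>\<^bsub>D\<^esub> \<eta> (on_ob R (Dom E f))" by simp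
    qed (use f 1 2 3 ob tyR in auto)
    then show "on_ar (functor_id E) f \<cdot>\<^bsub>E\<^esub> \<epsilon> (Dom E f) = \<epsilon> (Cod E f) \<cdot>\<^bsub>E\<^esub> on_ar (functor_comp E L R) f"
      using f by (simp add: functor_id_def)
  qed (use functor_id_functor [OF E.category_axioms] functor_comp_functor [OF R L] \<epsilon> Rf in
      \<open>auto simp: functor_id_def \<epsilon>_def\<close>)
  moreover have "\<epsilon> (on_ob L d) \<cdot>\<^bsub>E\<^esub> on_ar L (\<eta> d) = Ide E (on_ob L d)" if d: "d \<in> Ob D" for d
  proof (rule lift_eq [of d])
    note 1 = \<epsilon> [OF Lo [OF d]] and 2 = Lar [OF \<eta>'(1) [OF d]]
    have RL: "on_ob R (Lo d) \<in> Ob D" using Lo [OF d] Rf by simp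
    have "on_ar R (\<epsilon> (Lo d)) \<cdot>\<^bsub>D\<^esub> (\<eta> (on_ob R (Lo d)) \<cdot>\<^bsub>D\<^esub> \<eta> d) = Ide D (on_ob R (Lo d)) \<cdot>\<^bsub>D\<^esub> \<eta> d"
      using 1 d RL Rf(5-8) Lo by (intro D.comp_reduce) auto
    then show "on_ar R (\<epsilon> (on_ob L d) \<cdot>\<^bsub>E\<^esub> on_ar L (\<eta> d)) \<cdot>\<^bsub>D\<^esub> \<eta> d = on_ar R (Ide E (on_ob L d)) \<cdot>\<^bsub>D\<^esub> \<eta> d"
      using 1 2 d RL Rf(5-10) Lo by simp
  qed (use d \<epsilon> [OF Lo [OF d]] Lar [OF \<eta>'(1) [OF d]] Lo in auto)
  moreover have "on_ar R (\<epsilon> e) \<cdot>\<^bsub>D\<^esub> \<eta> (on_ob R e) = Ide D (on_ob R e)" if "e \<in> Ob E" for e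
    using \<epsilon>(4) [OF that] .
  ultimately have "adjunction D E L R \<eta> \<epsilon>"
    using L R unfolding adjunction_def by blast
  then show ?thesis using Lob by blast
qed

text \<open>The universal property is stated at independent index and arrow types. An adjunction
  relates two fixed categories; since \<Phi> turns the index type \<open>'i\<close> into the arrow
  type \<open>'i \<times> 'm \<times> 'i\<close>, it is formed at these types.\<close>

theorem theorem5p14:
  fixes C :: "('o, 'm) rcategory"
  assumes "join_restriction_category C"
    and "locally_small TYPE('k) C"
    and "has_local_glueings TYPE('k) C"
  shows "(\<forall>(A :: ('a, 'b) rcategory) P. over_ob TYPE('k) C (A, P) \<longrightarrow>
           partite_internal_category C (Psi_ob C (A, P)) \<and>
           over_ob TYPE('k) C (Phi_ob C (Psi_ob C (A, P))) \<and>
           over_map C (A, P) (Phi_ob C (Psi_ob C (A, P))) (eta_map C (A, P)) \<and>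
           (\<forall>(B :: ('j, 'o, 'm) partite) G \<gamma>.
              partite_internal_category C B \<longrightarrow> over_map C (A, P) (Phi_ob C B) (G, \<gamma>) \<longrightarrow>
              (\<exists>!F. partite_cofunctor C (Psi_ob C (A, P)) B F \<and>
                 over_comp C A (Phi_map C (Psi_ob C (A, P)) F) (eta_map C (A, P)) = (G, \<gamma>)))) \<and>
         (\<exists>Psi \<epsilon>.
           (\<forall>X \<in> Ob (rCat_over TYPE('k) C). on_ob Psi X = Psi_ob C X) \<and>
           adjunction
             (rCat_over TYPE('k) C
               :: (('i, 'i \<times> 'm \<times> 'i, 'o, 'm) over, ('i, 'i \<times> 'm \<times> 'i, 'o, 'm) over_arrow) category)
             (pCat C)
             Psi (Phi C)
             (\<lambda>X \<in> Ob (rCat_over TYPE('k) C). (X, eta_map C X, Phi_ob C (Psi_ob C X)))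
             \<epsilon>)"
proof -
  interpret join_restriction_category C by (rule assms(1))
  have over_join: "over_join C A P TYPE('k)" if "over_ob TYPE('k) C (A, P)"
    for A :: "('c, 'd) rcategory" and P
  proof -
    have A: "restriction_functor A C P" "locally_small TYPE('k) A" using that by (auto simp: over_ob_def)
    interpret A: restriction_category A by (rule restriction_functorD [OF A(1)])
    show ?thesis by unfold_locales (use A assms(3) in auto)
  qed
  have obj: "partite C (Psi_ob C (A, P))" "over_map C (A, P) (Phi_ob C (Psi_ob C (A, P))) (eta_map C (A, P))"
    "over_ob TYPE('k) C (Phi_ob C (Psi_ob C (A, P)))"
    if "over_ob TYPE('k) C (A, P)" for A :: "('c, 'd) rcategory" and P
  proof -
    interpret over_join C A P "TYPE('k)" by (rule over_join [OF that])
    show "partite C Psi" "over_map C (A, P) (Phi_ob C Psi) (eta_map C (A, P))" "over_ob TYPE('k) C (Phi_ob C Psi)"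
      using Psi_partite eta_over Phi_ob_over [OF Psi_partite assms(2)] by auto
  qed
  have univ: "\<exists>!F. cofunctor C (Psi_ob C (A, P)) B F \<and>
      over_comp C A (Phi_map C (Psi_ob C (A, P)) F) (eta_map C (A, P)) = (G, \<gamma>)"
    if "over_ob TYPE('k) C (A, P)" "partite C B" "over_map C (A, P) (Phi_ob C B) (G, \<gamma>)"
    for A :: "('c, 'd) rcategory" and P and B :: "('e, 'o, 'm) partite" and G \<gamma>
  proof -
    interpret over_join C A P "TYPE('k)" by (rule over_join [OF that(1)])
    interpret B: partite C B by (rule that(2))
    interpret over_map_to_Phi C A P "TYPE('k)" B G \<gamma> by unfold_locales (rule that(3))
    show ?thesis using factorization_exists factorization_unique by blast
  qed
  show ?thesis
  proof (intro conjI)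
    show "\<forall>(A :: ('a, 'b) rcategory) P. over_ob TYPE('k) C (A, P) \<longrightarrow>
           partite_internal_category C (Psi_ob C (A, P)) \<and>
           over_ob TYPE('k) C (Phi_ob C (Psi_ob C (A, P))) \<and>
           over_map C (A, P) (Phi_ob C (Psi_ob C (A, P))) (eta_map C (A, P)) \<and>
           (\<forall>(B :: ('j, 'o, 'm) partite) G \<gamma>.
              partite_internal_category C B \<longrightarrow> over_map C (A, P) (Phi_ob C B) (G, \<gamma>) \<longrightarrow>
              (\<exists>!F. partite_cofunctor C (Psi_ob C (A, P)) B F \<and>
                 over_comp C A (Phi_map C (Psi_ob C (A, P)) F) (eta_map C (A, P)) = (G, \<gamma>)))"
      using obj univ unfolding partite_iff cofunctor_iff by blast
    let ?D = "rCat_over TYPE('k) C :: (('i, 'i \<times> 'm \<times> 'i, 'o, 'm) over, ('i, 'i \<times> 'm \<times> 'i, 'o, 'm) over_arrow) category"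
    let ?E = "pCat C :: (('i, 'o, 'm) partite, ('i, 'o, 'm) partite_arrow) category"
    let ?\<eta> = "\<lambda>X \<in> Ob ?D. (X, eta_map C X, Phi_ob C (Psi_ob C X))"
    have Phi_ob: "on_ob (Phi C) B = Phi_ob C B" if "partite C B" for B :: "('i, 'o, 'm) partite"
      using that by (simp add: Phi_def)
    have Phi_ar: "on_ar (Phi C) (B, F, B') = (Phi_ob C B, Phi_map C B F, Phi_ob C B')" if "cofunctor C B B' F"
      for B B' :: "('i, 'o, 'm) partite" and F
      using that by (simp add: Phi_def)
    show "\<exists>Psi \<epsilon>. (\<forall>X \<in> Ob ?D. on_ob Psi X = Psi_ob C X) \<and> adjunction ?D ?E Psi (Phi C) ?\<eta> \<epsilon>"
    proof (rule universal_arrows_adjunction)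
      show "is_functor ?E ?D (Phi C)" by (rule Phi_functor [OF assms(2)])
      fix X assume X: "X \<in> Ob ?D"
      then obtain A P where AP: "X = (A, P)" "over_ob TYPE('k) C (A, P)" by (cases X) simp
      note Psi = obj [OF AP(2), folded AP(1)]
      show "Psi_ob C X \<in> Ob ?E" using Psi by simp
      show "?\<eta> X \<in> Hom ?D X (on_ob (Phi C) (Psi_ob C X))"
        using X Psi by (simp add: in_Hom_iff Phi_ob)
      fix B f assume B: "B \<in> Ob ?E" and f: "f \<in> Hom ?D X (on_ob (Phi C) B)"
      have B': "partite C B" using B by simp
      obtain G \<gamma> where G: "f = (X, (G, \<gamma>), Phi_ob C B)" "over_map C (A, P) (Phi_ob C B) (G, \<gamma>)"
        using f by (auto simp: in_Hom_rCat_over Phi_ob [OF B'] AP(1))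
      \<comment> \<open>Arrows of \<open>rCat_over\<close> carry their end objects, which match
        already; the content of the equation is its middle component.\<close>
      have eq: "on_ar (Phi C) (Psi_ob C X, F, B) \<cdot>\<^bsub>?D\<^esub> ?\<eta> X = f \<longleftrightarrow>
          over_comp C A (Phi_map C (Psi_ob C (A, P)) F) (eta_map C (A, P)) = (G, \<gamma>)"
        if "cofunctor C (Psi_ob C X) B F" for F
        using X that by (simp add: Phi_ar G(1)) (simp add: AP(1))
      obtain F where F: "cofunctor C (Psi_ob C X) B F"
          "over_comp C A (Phi_map C (Psi_ob C (A, P)) F) (eta_map C (A, P)) = (G, \<gamma>)"
        and F_unique: "\<And>F'. cofunctor C (Psi_ob C X) B F' \<Longrightarrow>
          over_comp C A (Phi_map C (Psi_ob C (A, P)) F') (eta_map C (A, P)) = (G, \<gamma>) \<Longrightarrow> F' = F"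
        using univ [OF AP(2) B' G(2)] unfolding AP(1) by blast
      show "\<exists>!g. g \<in> Hom ?E (Psi_ob C X) B \<and> on_ar (Phi C) g \<cdot>\<^bsub>?D\<^esub> ?\<eta> X = f"
      proof (rule ex1I [of _ "(Psi_ob C X, F, B)"])
        show "(Psi_ob C X, F, B) \<in> Hom ?E (Psi_ob C X) B \<and> on_ar (Phi C) (Psi_ob C X, F, B) \<cdot>\<^bsub>?D\<^esub> ?\<eta> X = f"
          using F eq [OF F(1)] by (simp add: in_Hom_pCat)
        show "g = (Psi_ob C X, F, B)" if "g \<in> Hom ?E (Psi_ob C X) B \<and> on_ar (Phi C) g \<cdot>\<^bsub>?D\<^esub> ?\<eta> X = f" for g
          using that eq F_unique unfolding in_Hom_pCat by blast
      qed
    qed auto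
  qed
qed

end
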